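(* Let $n\ge2$. The isomorphism classes of Lie algebras $\mathfrak g_A$ with $A\in M(2n-1,\mathbb R)$ non-nilpotent which admit a symplectic structure are the isomorphism classes of $\mathfrak g_M$ for $M\in M(2n-1,\mathbb R)$ of one of the following forms: (1) $M=M(0)\oplus Q$ with $m_0\ge1$ odd, $\Lambda(M(0))\in\bigwedge^s_{m_0}$, $Q\in\mathfrak{sp}(2n-m_0-1,\mathbb R)$, $0\notin\mathrm{spec}(Q)=\{\mu_1,\ldots,\mu_s\}$ and $1=|\mu_1|\ge\cdots\ge|\mu_s|>0$; (2) $M=M(1)\oplus Q$ where $m_1=1$, $Q\in\mathfrak{sp}(2n-2,\mathbb R)$ and $1\notin\mathrm{spec}(Q)$; (3) $M=M(1)\oplus M(-1)$ where $m_1=m_{-1}+1$ and $(\Lambda(M(-1)),\Lambda(M(1)))\in\Sigma_{n,1}$; (4) $M=M(1)\oplus M(-1)\oplus Q$, where $(\Lambda(M(-1)),\Lambda(M(1)))\in\Sigma_{m_1,1}$ and $Q\in\mathfrak{sp}(2r,\mathbb R)$ with $2r=2n-2-2m_{-1}$ ($r\ge 1$) and $\{1,-1\}\not\subset\mathrm{spec}(Q)$. The isomorphism classes of $\mathfrak g_M$ for $M$ as in (1), (2), (3), (4) are parametrized (via $M\mapsto(\Lambda(M(0)),[Q])$, $M\mapsto[Q]$, $M\mapsto(\Lambda(M(-1)),\Lambda(M(1)))$, $M\mapsto((\Lambda(M(-1)),\Lambda(M(1))),[Q])$), respectively, by $$(1)\ \bigcup_{k=1}^{n-1}\Big(\bigwedge{}^s_{2k-1}\times\mathcal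 S^0_{n-k}\Big),\qquad(2)\ \mathcal S^1_{n-1},\qquad(3)\ \Sigma_{n,1},\qquad(4)\ \bigcup_{k=2}^{n-1}\Big(\Sigma_{k,1}\times\mathcal S^1_{n-k}\Big).$$
   Context: For $A\in M(d,\mathbb R)$, $\mathfrak g_A=\mathbb R e_0\ltimes_A\mathbb R^d$ denotes the $(d+1)$-dimensional real Lie algebra $\mathbb R e_0\oplus\mathbb R^d$ with $[e_0,v]=Av$ and $[v,w]=0$ for $v,w\in\mathbb R^d$. A symplectic structure on a real Lie algebra $\mathfrak g$ is a non-degenerate 2-form $\omega$ on $\mathfrak g$ that is closed: $\omega([x,y],z)+\omega([y,z],x)+\omega([z,x],y)=0$ for all $x,y,z\in\mathfrak g$. $\mathrm{spec}(C)$ is the set of distinct complex eigenvalues of $C$; $\oplus$ is block-diagonal sum, $N^{\oplus p}$ the block-diagonal sum of $p$ copies of $N$. For a real eigenvalue $\lambda$ of $M$, $M(\lambda)\in M(m_\lambda,\mathbb R)$ denotes the direct sum of all Jordan blocks of $M$ with eigenvalue $\lambda$ (so $m_\lambda\geq 1$ is the algebraic multiplicity of $\lambda$). $\mathfrak{sp}(2r,\mathbb R)=\{D\in M(2r,\mathbb R):D^TJ_r+J_rD=0\}$ with $J_r=\begin{pmatrix}0&-I_r\\ I_r&0\end{pmatrix}$. $\mathcal J_n(b)$ ($n\ge2$) is the $n\times n$ Jordan block with $b$ on the diagonal, ones on the subdiagonal and zeros elsewhere. $\bigwedge_m$ is the set consisting of the symbol $(m)$ and all tuples of integers $(n_1,\ldots,n_k;p_1,\ldots,p_k;t)$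 with $k\ge1$, $n_1>\cdots>n_k\ge2$, all $p_i>0$, $t\ge0$ and $\sum_i n_ip_i+t=m$. For $A\in M(m,\mathbb R)$ whose only eigenvalue is $b\in\mathbb R$: $\Lambda(A)=(m)$ if $A=bI_m$, and $\Lambda(A)=(n_1,\ldots,n_k;p_1,\ldots,p_k;t)$ if $A$ is conjugate to $\mathcal J_{n_1}(b)^{\oplus p_1}\oplus\cdots\oplus\mathcal J_{n_k}(b)^{\oplus p_k}\oplus bI_t$. For odd $m$, $\bigwedge^s_m\subset\bigwedge_m$ consists of $(m)$ together with all tuples $(n_1,\ldots,n_k;p_1,\ldots,p_k;t)\in\bigwedge_m$ satisfying one of: (i) $t$ is odd and $p_i$ is even for all $i$ with $n_i$ odd; (ii) $t$ is even and there is a unique $\ell\in\{1,\dots,k\}$ with $n_\ell$ and $p_\ell$ both odd. For $n\ge2$ and $c\ne0$, $\Sigma_{n,c}\subset\bigwedge_{n-1}\times\bigwedge_n$ is the set of pairs $(\tau,\sigma)$ such that either $\tau=(n-1)$ and $\sigma\in\{(n),(2;1;n-2)\}$, or $\tau=(n_1,\ldots,n_k;p_1,\ldots,p_k;t)$ and $\sigma$ is one of the following: (i) $(n_1,\ldots,n_k;p_1,\ldots,p_k;t+1)$; (ii) for some $d\in\{1,\ldots,k\}$: $(n_1,\ldots,n_{d-1},n_d,\ldots,n_k;p_1,\ldots,p_{d-1}+1,p_d-1,\ldots,p_k;t)$ if $n_{d-1}=n_d+1$, or $(n_1,\ldots,n_{d-1},n_d+1,n_d,\ldots,n_k;p_1,\ldots,p_{d-1},1,p_d-1,\ldots,p_k;t)$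 if $n_{d-1}>n_d+1$; (iii) when $t\ge1$: $(n_1,\ldots,n_k,2;p_1,\ldots,p_k,1;t-1)$ if $n_k>2$, or $(n_1,\ldots,n_k;p_1,\ldots,p_k+1;t-1)$ if $n_k=2$. Conventions in (ii): for $d=1$ one puts $n_0=+\infty$ (second alternative), and if $p_d-1=0$ then the entry $n_d$ and its multiplicity $p_d-1$ are deleted. $\mathcal S^1_r$ is the set of $GL(2r,\mathbb R)$-conjugacy classes of matrices $Q\in\mathfrak{sp}(2r,\mathbb R)$ with $1\notin\mathrm{spec}(Q)$ (two such matrices are identified if they are conjugate in $GL(2r,\mathbb R)$). $\mathcal S^0_r$ is the quotient of the set of $Q\in\mathfrak{sp}(2r,\mathbb R)$ with $0\notin\mathrm{spec}(Q)=\{\mu_1,\ldots,\mu_s\}$ and $1=|\mu_1|\ge\cdots\ge|\mu_s|>0$ by the relation: $Q_1\sim Q_2$ if and only if $Q_1$ is $GL(2r,\mathbb R)$-conjugate to $Q_2$ or to $-Q_2$. *)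

theory Defs
  imports "Jordan_Normal_Form.Spectral_Radius"
begin

record 'v lie_algebra = "(real, 'v) module" +
  lie_bracket :: "'v \<Rightarrow> 'v \<Rightarrow> 'v"

locale real_lie_algebra = vectorspace "class_ring :: real ring" L
  for L :: "'v lie_algebra" +
  assumes bracket_closed:
      "\<lbrakk>x \<in> carrier L; y \<in> carrier L\<rbrakk> \<Longrightarrow> lie_bracket L x y \<in> carrier L"
    and bracket_add_left:
      "\<lbrakk>x \<in> carrier L; y \<in> carrier L; z \<in> carrier L\<rbrakk> \<Longrightarrow>
        lie_bracket L (x \<oplus>\<^bsub>L\<^esub> y) z = lie_bracket L x z \<oplus>\<^bsub>L\<^esub> lie_bracket L y z"
    and bracket_add_right:
      "\<lbrakk>x \<in> carrier L; y \<in> carrier L; z \<in> carrier L\<rbrakk> \<Longrightarrow>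
        lie_bracket L x (y \<oplus>\<^bsub>L\<^esub> z) = lie_bracket L x y \<oplus>\<^bsub>L\<^esub> lie_bracket L x z"
    and bracket_smult_left:
      "\<lbrakk>x \<in> carrier L; y \<in> carrier L\<rbrakk> \<Longrightarrow>
        lie_bracket L (a \<odot>\<^bsub>L\<^esub> x) y = a \<odot>\<^bsub>L\<^esub> lie_bracket L x y"
    and bracket_smult_right:
      "\<lbrakk>x \<in> carrier L; y \<in> carrier L\<rbrakk> \<Longrightarrow>
        lie_bracket L x (a \<odot>\<^bsub>L\<^esub> y) = a \<odot>\<^bsub>L\<^esub> lie_bracket L x y"
    and bracket_self: "x \<in> carrier L \<Longrightarrow> lie_bracket L x x = \<zero>\<^bsub>L\<^esub>"
    and jacobi:
      "\<lbrakk>x \<in> carrier L; y \<in> carrier L; z \<in> carrier L\<rbrakk> \<Longrightarrow>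
        lie_bracket L x (lie_bracket L y z) \<oplus>\<^bsub>L\<^esub> lie_bracket L y (lie_bracket L z x)
          \<oplus>\<^bsub>L\<^esub> lie_bracket L z (lie_bracket L x y) = \<zero>\<^bsub>L\<^esub>"

definition lie_iso :: "'v lie_algebra \<Rightarrow> 'v lie_algebra \<Rightarrow> bool" where
  "lie_iso L L' \<longleftrightarrow> (\<exists>f. bij_betw f (carrier L) (carrier L')
     \<and> (\<forall>x\<in>carrier L. \<forall>y\<in>carrier L. f (x \<oplus>\<^bsub>L\<^esub> y) = f x \<oplus>\<^bsub>L'\<^esub> f y)
     \<and> (\<forall>a. \<forall>x\<in>carrier L. f (a \<odot>\<^bsub>L\<^esub> x) = a \<odot>\<^bsub>L'\<^esub> f x)
     \<and> (\<forall>x\<in>carrier L. \<forall>y\<in>carrier L.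
          f (lie_bracket L x y) = lie_bracket L' (f x) (f y)))"

definition iso_class :: "'v lie_algebra \<Rightarrow> 'v lie_algebra set" where
  "iso_class L = {L'. real_lie_algebra L' \<and> lie_iso L L'}"

definition two_form :: "'v lie_algebra \<Rightarrow> ('v \<Rightarrow> 'v \<Rightarrow> real) \<Rightarrow> bool" where
  "two_form L \<omega> \<longleftrightarrow>
     (\<forall>x\<in>carrier L. \<forall>y\<in>carrier L. \<forall>z\<in>carrier L.
        \<omega> (x \<oplus>\<^bsub>L\<^esub> y) z = \<omega> x z + \<omega> y z \<and> \<omega> x (y \<oplus>\<^bsub>L\<^esub> z) = \<omega> x y + \<omega> x z)
     \<and> (\<forall>a. \<forall>x\<in>carrier L. \<forall>y\<in>carrier L.
        \<omega> (a \<odot>\<^bsub>L\<^esub> x) y = a * \<omega> x y \<and> \<omega> x (a \<odot>\<^bsub>L\<^esub> y) = a * \<omega> x y)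
     \<and> (\<forall>x\<in>carrier L. \<omega> x x = 0)"

definition symplectic_structure :: "'v lie_algebra \<Rightarrow> ('v \<Rightarrow> 'v \<Rightarrow> real) \<Rightarrow> bool" where
  "symplectic_structure L \<omega> \<longleftrightarrow> two_form L \<omega>
     \<and> (\<forall>x\<in>carrier L. (\<forall>y\<in>carrier L. \<omega> x y = 0) \<longrightarrow> x = \<zero>\<^bsub>L\<^esub>)
     \<and> (\<forall>x\<in>carrier L. \<forall>y\<in>carrier L. \<forall>z\<in>carrier L.
          \<omega> (lie_bracket L x y) z + \<omega> (lie_bracket L y z) x + \<omega> (lie_bracket L z x) y = 0)"

text \<open>The Lie algebra \<open>\<real> e\<^sub>0 \<ltimes>\<^sub>A \<real>\<^sup>d\<close> for a square matrix \<open>A\<close> of size \<open>d\<close>; the pair \<open>(s, v)\<close>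
  stands for \<open>s e\<^sub>0 + v\<close>.\<close>

definition almost_abelian :: "real mat \<Rightarrow> (real \<times> real vec) lie_algebra" where
  "almost_abelian A = \<lparr>
     carrier = UNIV \<times> carrier_vec (dim_row A),
     mult = undefined,
     one = undefined,
     zero = (0, 0\<^sub>v (dim_row A)),
     add = (\<lambda>(s, v) (t, w). (s + t, v + w)),
     smult = (\<lambda>a (s, v). (a * s, a \<cdot>\<^sub>v v)),
     lie_bracket = (\<lambda>(s, v) (t, w). (0, s \<cdot>\<^sub>v (A *\<^sub>v w) - t \<cdot>\<^sub>v (A *\<^sub>v v))) \<rparr>"

lemma real_lie_algebra_almost_abelian:
  assumes A: "A \<in> carrier_mat d d"
  shows "real_lie_algebra (almost_abelian A)"
proof -
  have vs: "vectorspace (class_ring :: real ring) (almost_abelian A)"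
    unfolding vectorspace_def
  proof (intro conjI)
    show "Module.module (class_ring :: real ring) (almost_abelian A)"
      using A
      by (intro moduleI abelian_groupI)
        (auto simp: almost_abelian_def add_smult_distrib_vec smult_add_distrib_vec algebra_simps
          comm_add_vec class_ring_simps smult_smult_assoc
          intro!: class_cring.is_cring  exI[of _ "- _"] bexI[of _ "- _"])
    show "field (class_ring :: real ring)" by (rule class_field.field_axioms)
  qed
  show ?thesis using A
    by (intro real_lie_algebra.intro vs real_lie_algebra_axioms.intro)
      (auto simp: almost_abelian_def algebra_simps intro!: eq_vecI)
qed

definition nilpotent_mat :: "real mat \<Rightarrow> bool" where
  "nilpotent_mat A \<longleftrightarrow> (\<exists>k. A ^\<^sub>m k = 0\<^sub>m (dim_row A) (dim_row A))"

definition spec :: "real mat \<Rightarrow> complex set" where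
  "spec A = spectrum (map_mat complex_of_real A)"

definition alg_mult :: "real mat \<Rightarrow> real \<Rightarrow> nat" where
  "alg_mult M b = Polynomial.order b (char_poly M)"

definition J_mat :: "nat \<Rightarrow> real mat" where
  "J_mat r = four_block_mat (0\<^sub>m r r) (- 1\<^sub>m r) (1\<^sub>m r) (0\<^sub>m r r)"

text \<open>\<open>sp r\<close> is \<open>sp(2r, \<real>)\<close>: the index is half the size of the matrices.\<close>

definition sp :: "nat \<Rightarrow> real mat set" where
  "sp r = {D \<in> carrier_mat (2 * r) (2 * r).
     transpose_mat D * J_mat r + J_mat r * D = 0\<^sub>m (2 * r) (2 * r)}"

text \<open>The ones of the library's \<^const>\<open>jordan_block\<close> are on the superdiagonal; here they are on
  the subdiagonal.\<close>

definition lower_jordan_block :: "nat \<Rightarrow> real \<Rightarrow> real mat" where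
  "lower_jordan_block n b = transpose_mat (jordan_block n b)"

text \<open>\<open>is_jordan_part M b N\<close>: \<open>N\<close> is the direct sum \<open>M(b)\<close> of all Jordan blocks of \<open>M\<close> with real
  eigenvalue \<open>b\<close>. No order of the blocks is fixed, so \<open>N\<close> is determined by \<open>M\<close> and \<open>b\<close> up to
  a permutation of the blocks.\<close>

definition is_jordan_part :: "real mat \<Rightarrow> real \<Rightarrow> real mat \<Rightarrow> bool" where
  "is_jordan_part M b N \<longleftrightarrow> eigenvalue M b \<and>
     (\<exists>ns R. (\<forall>k\<in>set ns. k \<ge> 1)
        \<and> N = diag_block_mat (map (\<lambda>k. lower_jordan_block k b) ns)
        \<and> square_mat R \<and> complex_of_real b \<notin> spec R
        \<and> similar_mat M (diag_block_mat [N, R]))"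

text \<open>\<open>Scalar_type m\<close> is the symbol \<open>(m)\<close>, and
  \<open>Block_type [(n\<^sub>1, p\<^sub>1), \<dots>, (n\<^sub>k, p\<^sub>k)] t\<close> is the tuple \<open>(n\<^sub>1, \<dots>, n\<^sub>k; p\<^sub>1, \<dots>, p\<^sub>k; t)\<close>.\<close>

datatype jordan_type = Scalar_type nat | Block_type "(nat \<times> nat) list" nat

definition types :: "nat \<Rightarrow> jordan_type set" where
  "types m = {Scalar_type m} \<union> {Block_type xs t | xs t. xs \<noteq> []
     \<and> sorted_wrt (\<lambda>x y. fst x > fst y) xs
     \<and> (\<forall>(n, p)\<in>set xs. n \<ge> 2 \<and> p > 0)
     \<and> (\<Sum>(n, p)\<leftarrow>xs. n * p) + t = m}"

definition has_type :: "real mat \<Rightarrow> jordan_type \<Rightarrow> bool" where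
  "has_type A \<tau> \<longleftrightarrow> \<tau> \<in> types (dim_row A) \<and> (\<exists>b. case \<tau> of
       Scalar_type m \<Rightarrow> A = b \<cdot>\<^sub>m 1\<^sub>m m
     | Block_type xs t \<Rightarrow> similar_mat A (diag_block_mat
         (concat (map (\<lambda>(n, p). replicate p (lower_jordan_block n b)) xs) @ [b \<cdot>\<^sub>m 1\<^sub>m t])))"

definition jtype :: "real mat \<Rightarrow> jordan_type" where
  "jtype A = (THE \<tau>. has_type A \<tau>)"

text \<open>\<open>\<And>\<^sup>s\<^sub>m\<close>, used for odd \<open>m\<close> only.\<close>

definition types_s :: "nat \<Rightarrow> jordan_type set" where
  "types_s m = {Scalar_type m} \<union> {Block_type xs t | xs t. Block_type xs t \<in> types m
     \<and> (odd t \<and> (\<forall>(n, p)\<in>set xs. odd n \<longrightarrow> even p)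
        \<or> even t \<and> (\<exists>!l. l < length xs \<and> odd (fst (xs ! l)) \<and> odd (snd (xs ! l))))}"

text \<open>\<open>add_box \<tau> \<sigma>\<close> states that \<open>\<sigma>\<close> is one of the tuples (i), (ii), (iii) obtained from the tuple
  \<open>\<tau>\<close>. In \<open>enlarge\<close> and \<open>enlarge_new\<close>, which are the two alternatives of (ii), the distinguished
  entry \<open>(n\<^sub>d, p\<^sub>d)\<close> is \<open>(a, p)\<close> and \<open>reduce\<close> implements the deletion of the entry if
  \<open>p\<^sub>d - 1 = 0\<close>; the convention \<open>n\<^sub>0 = \<infinity>\<close> is the case \<open>xs = []\<close> of \<open>enlarge_new\<close>.\<close>

definition reduce :: "nat \<Rightarrow> nat \<Rightarrow> (nat \<times> nat) list" where
  "reduce a p = (if p - 1 = 0 then [] else [(a, p - 1)])"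

inductive add_box :: "jordan_type \<Rightarrow> jordan_type \<Rightarrow> bool" where
  new_scalar: "add_box (Block_type xs t) (Block_type xs (t + 1))"
| enlarge: "add_box (Block_type (xs @ [(a + 1, q)] @ [(a, p)] @ ys) t)
     (Block_type (xs @ [(a + 1, q + 1)] @ reduce a p @ ys) t)"
| enlarge_new: "xs = [] \<or> fst (last xs) > a + 1 \<Longrightarrow>
     add_box (Block_type (xs @ [(a, p)] @ ys) t)
       (Block_type (xs @ [(a + 1, 1)] @ reduce a p @ ys) t)"
| scalar_new: "t \<ge> 1 \<Longrightarrow> fst (last xs) > 2 \<Longrightarrow>
     add_box (Block_type xs t) (Block_type (xs @ [(2, 1)]) (t - 1))"
| scalar_two: "t \<ge> 1 \<Longrightarrow>
     add_box (Block_type (xs @ [(2, p)]) t) (Block_type (xs @ [(2, p + 1)]) (t - 1))"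

text \<open>\<open>\<Sigma>\<^sub>n\<^sub>,\<^sub>c\<close> for \<open>n \<ge> 2\<close> and \<open>c \<noteq> 0\<close>; as a set it does not depend on the label \<open>c\<close>.\<close>

definition Sigma_set :: "nat \<Rightarrow> real \<Rightarrow> (jordan_type \<times> jordan_type) set" where
  "Sigma_set n c = {(\<tau>, \<sigma>). \<tau> \<in> types (n - 1) \<and> \<sigma> \<in> types n
     \<and> (\<tau> = Scalar_type (n - 1) \<and> \<sigma> \<in> {Scalar_type n, Block_type [(2, 1)] (n - 2)}
        \<or> add_box \<tau> \<sigma>)}"

definition S1_set :: "nat \<Rightarrow> real mat set" where
  "S1_set r = {Q \<in> sp r. 1 \<notin> spec Q}"

definition S1_rel :: "nat \<Rightarrow> (real mat \<times> real mat) set" where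
  "S1_rel r = {(Q1, Q2). Q1 \<in> S1_set r \<and> Q2 \<in> S1_set r \<and> similar_mat Q1 Q2}"

definition S1 :: "nat \<Rightarrow> real mat set set" where
  "S1 r = S1_set r // S1_rel r"

definition S1_class :: "real mat \<Rightarrow> real mat set" where
  "S1_class Q = S1_rel (dim_row Q div 2) `` {Q}"

definition normalized_spec :: "real mat \<Rightarrow> bool" where
  "normalized_spec Q \<longleftrightarrow> 0 \<notin> spec Q \<and> (\<exists>\<mu>s. distinct \<mu>s \<and> set \<mu>s = spec Q \<and> \<mu>s \<noteq> []
     \<and> cmod (hd \<mu>s) = 1 \<and> sorted_wrt (\<lambda>x y. cmod x \<ge> cmod y) \<mu>s \<and> cmod (last \<mu>s) > 0)"

definition S0_set :: "nat \<Rightarrow> real mat set" where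
  "S0_set r = {Q \<in> sp r. normalized_spec Q}"

definition S0_rel :: "nat \<Rightarrow> (real mat \<times> real mat) set" where
  "S0_rel r = {(Q1, Q2). Q1 \<in> S0_set r \<and> Q2 \<in> S0_set r
     \<and> (similar_mat Q1 Q2 \<or> similar_mat Q1 (- Q2))}"

definition S0 :: "nat \<Rightarrow> real mat set set" where
  "S0 r = S0_set r // S0_rel r"

definition S0_class :: "real mat \<Rightarrow> real mat set" where
  "S0_class Q = S0_rel (dim_row Q div 2) `` {Q}"

text \<open>The summands of the decomposition of \<open>M\<close> are arguments, e.g. in \<open>form4 n M M1 N1 Q\<close> one has
  \<open>M1 = M(1)\<close> and \<open>N1 = M(-1)\<close>.\<close>

definition form1 :: "nat \<Rightarrow> real mat \<Rightarrow> real mat \<Rightarrow> real mat \<Rightarrow> bool" where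
  "form1 n M M0 Q \<longleftrightarrow> M \<in> carrier_mat (2 * n - 1) (2 * n - 1)
     \<and> M = diag_block_mat [M0, Q] \<and> is_jordan_part M 0 M0
     \<and> alg_mult M 0 \<ge> 1 \<and> odd (alg_mult M 0) \<and> jtype M0 \<in> types_s (alg_mult M 0)
     \<and> (\<exists>r. 2 * r = 2 * n - alg_mult M 0 - 1 \<and> Q \<in> sp r)
     \<and> normalized_spec Q"

definition form2 :: "nat \<Rightarrow> real mat \<Rightarrow> real mat \<Rightarrow> real mat \<Rightarrow> bool" where
  "form2 n M M1 Q \<longleftrightarrow> M \<in> carrier_mat (2 * n - 1) (2 * n - 1)
     \<and> M = diag_block_mat [M1, Q] \<and> is_jordan_part M 1 M1
     \<and> alg_mult M 1 = 1 \<and> Q \<in> sp (n - 1) \<and> 1 \<notin> spec Q"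

definition form3 :: "nat \<Rightarrow> real mat \<Rightarrow> real mat \<Rightarrow> real mat \<Rightarrow> bool" where
  "form3 n M M1 N1 \<longleftrightarrow> M \<in> carrier_mat (2 * n - 1) (2 * n - 1)
     \<and> M = diag_block_mat [M1, N1] \<and> is_jordan_part M 1 M1 \<and> is_jordan_part M (- 1) N1
     \<and> alg_mult M 1 = alg_mult M (- 1) + 1 \<and> (jtype N1, jtype M1) \<in> Sigma_set n 1"

definition form4 :: "nat \<Rightarrow> real mat \<Rightarrow> real mat \<Rightarrow> real mat \<Rightarrow> real mat \<Rightarrow> bool" where
  "form4 n M M1 N1 Q \<longleftrightarrow> M \<in> carrier_mat (2 * n - 1) (2 * n - 1)
     \<and> M = diag_block_mat [M1, N1, Q] \<and> is_jordan_part M 1 M1 \<and> is_jordan_part M (- 1) N1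
     \<and> (jtype N1, jtype M1) \<in> Sigma_set (alg_mult M 1) 1
     \<and> (\<exists>r\<ge>1. 2 * r = 2 * n - 2 - 2 * alg_mult M (- 1) \<and> Q \<in> sp r)
     \<and> \<not> {1, - 1} \<subseteq> spec Q"

end

theory Submission
  imports Defs "Jordan_Normal_Form.Jordan_Normal_Form_Uniqueness" "Jordan_Normal_Form.DL_Rank"
begin

text \<open>
  Restricting a symplectic form to the abelian ideal \<open>\<real>\<^bsup>2n-1\<^esup>\<close> gives a form for which \<open>A\<close> is
  skew. Its radical is an \<open>A\<close>-invariant line, on which \<open>A\<close> acts as a scalar \<open>l\<close>, and \<open>A\<close> induces a
  Hamiltonian matrix \<open>D\<close> on the quotient, so \<open>A\<close> is an arbitrary one-dimensional extension of \<open>D\<close>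
  by the eigenvalue \<open>l\<close>. Such an extension enlarges one Jordan block of \<open>D\<close> with eigenvalue \<open>l\<close>
  (possibly an empty one) by one and changes nothing else. If \<open>l = 0\<close>, the nilpotent part of \<open>D\<close> is
  Hamiltonian, so its blocks of odd size come in pairs, and enlarging one block leaves exactly one
  odd size with odd multiplicity. If \<open>l \<noteq> 0\<close>, one rescales to \<open>l = 1\<close>; the blocks of \<open>D\<close> for \<open>1\<close> and
  \<open>-1\<close> correspond to each other. Finally \<open>\<gg>\<^sub>A\<close> and \<open>\<gg>\<^sub>B\<close> are isomorphic if and only if \<open>A\<close> is
  similar to a non-zero multiple of \<open>B\<close>, and the Jordan blocks of one eigenvalue can be cancelled
  from a similarity.
\<close>

subsection \<open>Similarity and block matrices\<close>

text \<open>The radical is a line for two reasons: if its dimension were two or more, it would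
  contain a non-zero vector that also pairs to zero with \<open>e_0\<close>, against non-degeneracy;
  and the ideal has odd dimension. Conversely, pairing \<open>e_0\<close> with the radical line
  makes every extension of a Hamiltonian matrix symplectic, so what has to be classified are the
  extensions. The obstacle is that a real matrix need not have a Jordan form over the reals. Only
  the part of one real eigenvalue \<open>b\<close> is ever brought to Jordan form; the complement
  stays an arbitrary matrix \<open>B\<close> without that eigenvalue. Two facts separate them, both
  because \<open>A - b\<close> is nilpotent on one side and \<open>B - b\<close> is invertible on
  the other: intertwiners vanish, and Sylvester equations are solvable. Jordan types are compared as
  multisets of block sizes. There the tuples of \<open>Sigma_set\<close> become the covering
  relation of Young's lattice, and the clauses of \<open>types_s\<close> become a single parity
  condition.\<close>

lemma det_nonzero_inverse:
  fixes A :: "'a :: field mat"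
  assumes A: "A \<in> carrier_mat n n" and "det A \<noteq> 0"
  obtains B where "B \<in> carrier_mat n n" "A * B = 1\<^sub>m n" "B * A = 1\<^sub>m n"
  using det_non_zero_imp_unit[OF assms, of "()"] by (auto simp: Units_def ring_mat_def)

lemma inverse_det_nonzero:
  fixes A :: "'a :: field mat"
  assumes "A \<in> carrier_mat n n" "B \<in> carrier_mat n n" "A * B = 1\<^sub>m n"
  shows "det A \<noteq> 0"
  using det_mult[OF assms(1,2)] assms(3) by auto

text \<open>The equation \<open>A * P = P * B\<close> is linear in \<open>P\<close>, so it can be
  compared block by block, while the inverse survives only as \<open>det P \<noteq> 0\<close>. The
  cancellation of summands relies on this form.\<close>

lemma similar_mat_iff:
  fixes A B :: "'a :: field mat"
  assumes A: "A \<in> carrier_mat n n" and B: "B \<in> carrier_mat n n"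
  shows "similar_mat A B \<longleftrightarrow> (\<exists>P\<in>carrier_mat n n. det P \<noteq> 0 \<and> A * P = P * B)"
proof
  assume "similar_mat A B"
  then obtain P Q where w: "similar_mat_wit A B P Q" by (auto simp: similar_mat_def)
  note w = similar_mat_witD2[OF A w]
  have "A * P = P * B * (Q * P)" using w by (simp add: assoc_mult_mat[of _ n n _ n _ n])
  then have "A * P = P * B" using w by simp
  with inverse_det_nonzero[OF w(6,7,1)] w show "\<exists>P\<in>carrier_mat n n. det P \<noteq> 0 \<and> A * P = P * B"
    by auto
next
  assume "\<exists>P\<in>carrier_mat n n. det P \<noteq> 0 \<and> A * P = P * B"
  then obtain P where P: "P \<in> carrier_mat n n" "det P \<noteq> 0" "A * P = P * B" by auto
  obtain Q where Q: "Q \<in> carrier_mat n n" "P * Q = 1\<^sub>m n" "Q * P = 1\<^sub>m n"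
    using det_nonzero_inverse[OF P(1,2)] .
  have "A = A * (P * Q)" using A Q by simp
  also have "\<dots> = A * P * Q" by (rule assoc_mult_mat[OF A P(1) Q(1), symmetric])
  also have "\<dots> = P * B * Q" by (simp only: P)
  finally show "similar_mat A B" using A B P Q by (intro similar_matI[of A B P Q n]) auto
qed

lemma similar_mat_carrier:
  assumes "similar_mat A B"
  shows "B \<in> carrier_mat n n \<longleftrightarrow> A \<in> carrier_mat n n"
proof -
  obtain m where "A \<in> carrier_mat m m" "B \<in> carrier_mat m m"
    using similar_matD[OF assms] by auto
  then show ?thesis by auto
qed

lemma similar_matE:
  fixes A :: "'a :: field mat"
  assumes "similar_mat A B" "A \<in> carrier_mat n n"
  obtains P Q where "P \<in> carrier_mat n n" "Q \<in> carrier_mat n n" "P * Q = 1\<^sub>m n" "Q * P = 1\<^sub>m n"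
    "A = P * B * Q" "B \<in> carrier_mat n n" "A * P = P * B" "Q * A = B * Q"
proof -
  obtain P Q where w: "similar_mat_wit A B P Q" using assms(1) by (auto simp: similar_mat_def)
  note w = similar_mat_witD2[OF assms(2) w]
  have "A * P = P * B * (Q * P)" using w by (simp add: assoc_mult_mat[of _ n n _ n _ n])
  then have "A * P = P * B" using w by simp
  moreover have "Q * A = Q * P * (B * Q)"
    unfolding w(3) using w(4-) by (simp add: assoc_mult_mat[of _ n n _ n _ n])
  then have "Q * A = B * Q" using w(2,5,7) by simp
  ultimately show ?thesis using w that[of P Q] by blast
qed

lemma uminus_mat_smult: "- A = (- 1 :: 'a :: comm_ring_1) \<cdot>\<^sub>m A"
  by (rule eq_matI) auto

lemma similar_mat_uminus:
  fixes A :: "'a :: comm_ring_1 mat"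
  assumes "similar_mat A B"
  shows "similar_mat (- A) (- B)"
  unfolding uminus_mat_smult by (rule similar_mat_smult[OF assms])

text \<open>Binary form of \<open>diag_block_mat\<close>. Associativity and the empty unit hold as
  equations, so summands can be regrouped by rewriting instead of by similarity.\<close>

definition dsum :: "'a :: zero mat \<Rightarrow> 'a mat \<Rightarrow> 'a mat" (infixr \<open>\<oplus>\<^sub>d\<close> 65) where
  "A \<oplus>\<^sub>d B = four_block_mat A (0\<^sub>m (dim_row A) (dim_col B)) (0\<^sub>m (dim_row B) (dim_col A)) B"

lemma diag_block_mat_dsum: "diag_block_mat (A # As) = A \<oplus>\<^sub>d diag_block_mat As"
  by (simp add: dsum_def Let_def)

lemma diag_block_mat_append_dsum: "diag_block_mat (As @ Bs) = diag_block_mat As \<oplus>\<^sub>d diag_block_mat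
  Bs"
  by (simp add: dsum_def Let_def diag_block_mat_append)

lemma dsum_carrier [simp]:
  "A \<in> carrier_mat n n \<Longrightarrow> B \<in> carrier_mat m m \<Longrightarrow> A \<oplus>\<^sub>d B \<in> carrier_mat (n + m) (n + m)"
  by (simp add: dsum_def)

lemma dsum_four_block:
  "A \<in> carrier_mat n n \<Longrightarrow> B \<in> carrier_mat m m \<Longrightarrow>
    A \<oplus>\<^sub>d B = four_block_mat A (0\<^sub>m n m) (0\<^sub>m m n) B"
  by (simp add: dsum_def)

lemma dsum_dim [simp]: "dim_row (A \<oplus>\<^sub>d B) = dim_row A + dim_row B"
  "dim_col (A \<oplus>\<^sub>d B) = dim_col A + dim_col B"
  by (auto simp: dsum_def)

lemma dsum_assoc: "(A \<oplus>\<^sub>d B) \<oplus>\<^sub>d C = A \<oplus>\<^sub>d (B \<oplus>\<^sub>d C)"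
  using assoc_four_block_mat[of A B C] by (simp add: dsum_def)

lemma dsum_empty [simp]: "A \<oplus>\<^sub>d 0\<^sub>m 0 0 = A" "0\<^sub>m 0 0 \<oplus>\<^sub>d A = A"
  by (auto simp: dsum_def intro!: eq_matI)

lemma dsum_empty' [simp]: "B \<in> carrier_mat 0 0 \<Longrightarrow> A \<oplus>\<^sub>d B = A" "B \<in> carrier_mat 0 0 \<Longrightarrow> B \<oplus>\<^sub>d A = A"
  by (auto simp: dsum_def intro!: eq_matI)

lemma dsum_mult:
  fixes A :: "'a :: comm_ring_1 mat"
  assumes "A \<in> carrier_mat n n" "B \<in> carrier_mat m m" "C \<in> carrier_mat n n" "D \<in> carrier_mat m m"
  shows "(A \<oplus>\<^sub>d B) * (C \<oplus>\<^sub>d D) = (A * C) \<oplus>\<^sub>d (B * D)"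
  using assms by (simp add: dsum_four_block mult_four_block_mat[of _ n n _ m _ m _ _ n _ m])
   (auto simp: dsum_def)

lemma dsum_transpose:
  "A \<in> carrier_mat n n \<Longrightarrow> B \<in> carrier_mat m m \<Longrightarrow>
    transpose_mat (A \<oplus>\<^sub>d B) = transpose_mat A \<oplus>\<^sub>d transpose_mat B"
  by (simp add: dsum_four_block transpose_four_block_mat[of _ n n _ m _ m])

lemma dsum_smult:
  fixes A :: "'a :: comm_ring_1 mat"
  shows "A \<in> carrier_mat n n \<Longrightarrow> B \<in> carrier_mat m m \<Longrightarrow>
    c \<cdot>\<^sub>m (A \<oplus>\<^sub>d B) = (c \<cdot>\<^sub>m A) \<oplus>\<^sub>d (c \<cdot>\<^sub>m B)"
  by (auto simp: dsum_def intro!: eq_matI)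

lemma dsum_uminus:
  fixes A :: "'a :: comm_ring_1 mat"
  shows "A \<in> carrier_mat n n \<Longrightarrow> B \<in> carrier_mat m m \<Longrightarrow> - (A \<oplus>\<^sub>d B) = (- A) \<oplus>\<^sub>d (- B)"
  by (auto simp: dsum_def intro!: eq_matI)

lemma dsum_zero [simp]: "0\<^sub>m n n \<oplus>\<^sub>d 0\<^sub>m m m = 0\<^sub>m (n + m) (n + m)"
  by (auto simp: dsum_def)

lemma similar_mat_dsum:
  assumes "similar_mat A B" "similar_mat C D"
  shows "similar_mat (A \<oplus>\<^sub>d C) (B \<oplus>\<^sub>d D)"
proof -
  obtain n where n: "A \<in> carrier_mat n n" "B \<in> carrier_mat n n" using similar_matD[OF assms(1)]
    by auto
  obtain m where m: "C \<in> carrier_mat m m" "D \<in> carrier_mat m m" using similar_matD[OF assms(2)]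
    by auto
  show ?thesis using similar_mat_four_block_0_0[OF assms n(1) m(1)] n m
    by (simp add: dsum_four_block)
qed

lemma det_dsum:
  fixes A :: "'a :: idom mat"
  assumes "A \<in> carrier_mat n n" "B \<in> carrier_mat m m"
  shows "det (A \<oplus>\<^sub>d B) = det A * det B"
  using assms by (simp add: dsum_four_block) (rule det_four_block_mat_lower_left_zero, auto)

text \<open>The characteristic matrix is again block triangular, with the constant entries of
  \<open>- U\<close> off the diagonal, so its determinant is the product of the two diagonal
  determinants.\<close>

lemma char_poly_block_upper:
  fixes A :: "'a :: idom mat"
  assumes A: "A \<in> carrier_mat n n" and B: "B \<in> carrier_mat m m" and U: "U \<in> carrier_mat n m"
  shows "char_poly (four_block_mat A U (0\<^sub>m m n) B) = char_poly A * char_poly B"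
proof -
  have "char_poly_matrix (four_block_mat A U (0\<^sub>m m n) B) =
     four_block_mat (char_poly_matrix A) (map_mat (\<lambda>a. [:- a:]) U) (0\<^sub>m m n) (char_poly_matrix B)"
    using assms by (auto simp: char_poly_matrix_def intro!: eq_matI)
  then show ?thesis unfolding char_poly_def
    using assms by (simp, subst det_four_block_mat_lower_left_zero[of _ n _ m]) auto
qed

lemma char_poly_dsum:
  fixes A :: "'a :: idom mat"
  assumes "A \<in> carrier_mat n n" "B \<in> carrier_mat m m"
  shows "char_poly (A \<oplus>\<^sub>d B) = char_poly A * char_poly B"
  using assms char_poly_block_upper[of A n B m "0\<^sub>m n m"] by (simp add: dsum_four_block)

lemma similar_mat_dsum_commute:
  fixes A :: "'a :: field mat"
  assumes A: "A \<in> carrier_mat n n" and B: "B \<in> carrier_mat m m"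
  shows "similar_mat (A \<oplus>\<^sub>d B) (B \<oplus>\<^sub>d A)"
proof -
  \<comment> \<open>\<open>?P\<close> is the block permutation that exchanges the two summands, and
    \<open>?Q\<close> is its inverse; the zero blocks differ in shape because \<open>n\<close> and
    \<open>m\<close> may differ.\<close>
  let ?P = "four_block_mat (0\<^sub>m n m) (1\<^sub>m n) (1\<^sub>m m) (0\<^sub>m m n) :: 'a mat"
  let ?Q = "four_block_mat (0\<^sub>m m n) (1\<^sub>m m) (1\<^sub>m n) (0\<^sub>m n m) :: 'a mat"
  have PQ: "?P * ?Q = 1\<^sub>m (n + m)"
    by (subst mult_four_block_mat[of _ n m _ n _ m]) (auto simp flip: four_block_one_mat)
  have QP: "?Q * ?P = 1\<^sub>m (m + n)"
    by (subst mult_four_block_mat[of _ m n _ m _ n]) (auto simp flip: four_block_one_mat)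
  have "?P * (B \<oplus>\<^sub>d A) = four_block_mat (0\<^sub>m n m) A B (0\<^sub>m m n)"
    using A B by (simp add: dsum_four_block) (subst mult_four_block_mat[of _ n m _ n _ m], auto)
  then have "?P * (B \<oplus>\<^sub>d A) * ?Q = A \<oplus>\<^sub>d B"
    using A B by (simp add: dsum_four_block) (subst mult_four_block_mat[of _ n m _ n _ m], auto)
  moreover have "?P \<in> carrier_mat (n + m) (m + n)" "?Q \<in> carrier_mat (m + n) (n + m)" by auto
  ultimately show ?thesis using A B PQ QP
    by (intro similar_matI[of _ _ ?P ?Q "n + m"]) (auto simp: add.commute)
qed

text \<open>Conjugating the diagonal blocks changes the corner \<open>U\<close> to some
  \<open>V\<close>. Later arguments use only the triangular shape, so \<open>V\<close> is left
  unspecified.\<close>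

lemma block_upper_similar:
  fixes A :: "'a :: field mat"
  assumes "similar_mat A1 B1" "similar_mat A2 B2" "A1 \<in> carrier_mat n n" "A2 \<in> carrier_mat m m"
    "U \<in> carrier_mat n m"
  obtains V where "V \<in> carrier_mat n m"
    "similar_mat (four_block_mat A1 U (0\<^sub>m m n) A2) (four_block_mat B1 V (0\<^sub>m m n) B2)"
  using similar_mat_four_block_0_ex[OF assms(1,2,5,3,4)] by auto

lemma four_block_cases:
  assumes "A \<in> carrier_mat (n + m) (n + m)"
  obtains B C D E where "A = four_block_mat B C D E" "B \<in> carrier_mat n n" "C \<in> carrier_mat n m"
    "D \<in> carrier_mat m n" "E \<in> carrier_mat m m"
proof -
  obtain B C D E where "split_block A n n = (B, C, D, E)" by (metis prod_cases4)
  from split_block[OF this, of m m] assms that show ?thesis by auto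
qed

lemma four_block_eq_iff:
  assumes "A \<in> carrier_mat n p" "B \<in> carrier_mat n q" "C \<in> carrier_mat m p" "D \<in> carrier_mat m q"
    "A' \<in> carrier_mat n p" "B' \<in> carrier_mat n q" "C' \<in> carrier_mat m p" "D' \<in> carrier_mat m q"
  shows "four_block_mat A B C D = four_block_mat A' B' C' D' \<longleftrightarrow> A = A' \<and> B = B' \<and> C = C' \<and> D = D'"
proof
  assume eq: "four_block_mat A B C D = four_block_mat A' B' C' D'"
  have e: "four_block_mat A B C D $$ (i, j) = four_block_mat A' B' C' D' $$ (i, j)" for i j
    using eq by simp
  show "A = A' \<and> B = B' \<and> C = C' \<and> D = D'"
  proof (intro conjI eq_matI)
    fix i j assume "i < dim_row A'" "j < dim_col A'" then show "A $$ (i, j) = A' $$ (i, j)"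
      using e[of i j] assms by auto
  next
    fix i j assume "i < dim_row B'" "j < dim_col B'" then show "B $$ (i, j) = B' $$ (i, j)"
      using e[of i "p + j"] assms by auto
  next
    fix i j assume "i < dim_row C'" "j < dim_col C'" then show "C $$ (i, j) = C' $$ (i, j)"
      using e[of "n + i" j] assms by auto
  next
    fix i j assume "i < dim_row D'" "j < dim_col D'" then show "D $$ (i, j) = D' $$ (i, j)"
      using e[of "n + i" "p + j"] assms by auto
  qed (use assms in auto)
qed auto

subsection \<open>Sums of Jordan blocks with one eigenvalue\<close>

definition lower_jordan :: "nat list \<Rightarrow> real \<Rightarrow> real mat" where
  "lower_jordan ns b = diag_block_mat (map (\<lambda>k. lower_jordan_block k b) ns)"

lemma lower_jordan_block_carrier [simp]: "lower_jordan_block k b \<in> carrier_mat k k"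
  by (simp add: lower_jordan_block_def)

lemma lower_jordan_Nil [simp]: "lower_jordan [] b = 0\<^sub>m 0 0"
  by (simp add: lower_jordan_def)

lemma lower_jordan_Cons: "lower_jordan (k # ns) b = lower_jordan_block k b \<oplus>\<^sub>d lower_jordan ns b"
  by (simp add: lower_jordan_def diag_block_mat_dsum del: diag_block_mat.simps)

lemma lower_jordan_append: "lower_jordan (ns @ ms) b = lower_jordan ns b \<oplus>\<^sub>d lower_jordan ms b"
  by (simp add: lower_jordan_def diag_block_mat_append_dsum)

lemma lower_jordan_carrier [simp]: "lower_jordan ns b \<in> carrier_mat (sum_list ns) (sum_list ns)"
  by (induction ns) (auto simp: lower_jordan_Cons)

lemma lower_jordan_dim [simp]: "dim_row (lower_jordan ns b) = sum_list ns"
  "dim_col (lower_jordan ns b) = sum_list ns"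
  using lower_jordan_carrier[of ns b] by (blast intro: carrier_matD)+

text \<open>Reversing the order of the basis turns the subdiagonal into the superdiagonal;
  \<open>P\<close> is the antidiagonal permutation matrix, an involution.\<close>

lemma lower_jordan_block_similar: "similar_mat (lower_jordan_block k b) (jordan_block k b)"
proof -
  let ?L = "lower_jordan_block k b" and ?J = "jordan_block k b :: real mat"
  define P :: "real mat" where "P = mat k k (\<lambda>(i, j). if i + j + 1 = k then 1 else 0)"
  have P: "P \<in> carrier_mat k k" by (simp add: P_def)
  have row: "(P * A) $$ (i, j) = A $$ (k - 1 - i, j)"
    if "A \<in> carrier_mat k k" "i < k" "j < k" for A i j
  proof -
    have "(P * A) $$ (i, j) = (\<Sum>l\<in>{0..<k}. P $$ (i, l) * A $$ (l, j))"
      using that P by (simp add: scalar_prod_def)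
    also have "\<dots> = (\<Sum>l\<in>{0..<k}. if l = k - 1 - i then A $$ (l, j) else 0)"
      using that by (intro sum.cong) (auto simp: P_def)
    also have "\<dots> = A $$ (k - 1 - i, j)" using that by simp
    finally show ?thesis .
  qed
  have col: "(A * P) $$ (i, j) = A $$ (i, k - 1 - j)"
    if "A \<in> carrier_mat k k" "i < k" "j < k" for A i j
  proof -
    have "(A * P) $$ (i, j) = (\<Sum>l\<in>{0..<k}. A $$ (i, l) * P $$ (l, j))"
      using that P by (simp add: scalar_prod_def)
    also have "\<dots> = (\<Sum>l\<in>{0..<k}. if l = k - 1 - j then A $$ (i, l) else 0)"
      using that by (intro sum.cong) (auto simp: P_def)
    also have "\<dots> = A $$ (i, k - 1 - j)" using that by simp
    finally show ?thesis .
  qed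
  have PP: "P * P = 1\<^sub>m k"
  proof (rule eq_matI)
    fix i j assume "i < dim_row (1\<^sub>m k :: real mat)" "j < dim_col (1\<^sub>m k :: real mat)"
    then show "(P * P) $$ (i, j) = 1\<^sub>m k $$ (i, j)"
      using row[OF P, of i j] by (auto simp: P_def)
  qed (auto simp: P_def)
  have "?L * P = P * ?J"
  proof (rule eq_matI)
    fix i j assume "i < dim_row (P * ?J)" "j < dim_col (P * ?J)"
    then have ij: "i < k" "j < k" by (auto simp: P_def)
    show "(?L * P) $$ (i, j) = (P * ?J) $$ (i, j)"
      unfolding row[OF jordan_block_carrier ij] col[OF lower_jordan_block_carrier ij]
      using ij by (auto simp: lower_jordan_block_def)
  qed (auto simp: P_def lower_jordan_block_def)
  with P inverse_det_nonzero[OF P P PP] show ?thesis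
    by (subst similar_mat_iff[of _ k]) auto
qed

lemma lower_jordan_similar_jordan_matrix:
  "similar_mat (lower_jordan ns b) (jordan_matrix (map (\<lambda>k. (k, b)) ns))"
proof (induction ns)
  case Nil
  then show ?case by (auto simp: jordan_matrix_def intro: similar_mat_refl[of _ 0])
next
  case (Cons k ns)
  have "jordan_matrix (map (\<lambda>k. (k, b)) (k # ns)) =
    jordan_block k b \<oplus>\<^sub>d jordan_matrix (map (\<lambda>k. (k, b)) ns)"
    by (simp add: jordan_matrix_def diag_block_mat_dsum o_def del: diag_block_mat.simps)
  with similar_mat_dsum[OF lower_jordan_block_similar Cons] show ?case
    by (simp add: lower_jordan_Cons)
qed

lemma jordan_nf_lower_jordan:
  "0 \<notin> set ns \<Longrightarrow> jordan_nf (lower_jordan ns b) (map (\<lambda>k. (k, b)) ns)"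
  using lower_jordan_similar_jordan_matrix by (auto simp: jordan_nf_def)

text \<open>The head of \<open>ns\<close> occurs somewhere in \<open>ms\<close>; it is moved past
  the blocks in front of it by commuting two direct summands, and the induction handles the
  rest.\<close>

lemma lower_jordan_similar_mset:
  "mset ns = mset ms \<Longrightarrow> similar_mat (lower_jordan ns b) (lower_jordan ms b)"
proof (induction ns arbitrary: ms)
  case Nil
  then show ?case by (auto intro: similar_mat_refl[of _ 0])
next
  case (Cons k ns)
  then obtain xs ys where ms: "ms = xs @ k # ys"
    by (metis list.set_intros(1) mset_eq_setD split_list)
  let ?B = "lower_jordan_block k b"
  have "similar_mat (lower_jordan ns b) (lower_jordan xs b \<oplus>\<^sub>d lower_jordan ys b)"
    using Cons by (simp add: ms flip: lower_jordan_append)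
  then have "similar_mat (?B \<oplus>\<^sub>d lower_jordan ns b) ((?B \<oplus>\<^sub>d lower_jordan xs b) \<oplus>\<^sub>d lower_jordan ys b)"
    unfolding dsum_assoc by (intro similar_mat_dsum similar_mat_refl[of ?B k]) auto
  moreover have "similar_mat ((?B \<oplus>\<^sub>d lower_jordan xs b) \<oplus>\<^sub>d lower_jordan ys b)
      ((lower_jordan xs b \<oplus>\<^sub>d ?B) \<oplus>\<^sub>d lower_jordan ys b)"
    by (intro similar_mat_dsum similar_mat_dsum_commute[of _ k _ "sum_list xs"]
        similar_mat_refl[of _ "sum_list ys"]) auto
  ultimately show ?case
    unfolding dsum_assoc
      by (simp add: ms lower_jordan_Cons lower_jordan_append) (rule similar_mat_trans)
qed

lemma count_jordan_blocks:
  fixes A :: "real mat"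
  assumes "jordan_nf A (map (\<lambda>k. (k, b)) ns)" "k \<noteq> 0"
  shows "count (mset ns) k = compute_nr_of_jordan_blocks A b k"
  unfolding compute_nr_of_jordan_blocks[OF assms] by (induction ns) auto

lemma jordan_nf_similar: "similar_mat A B \<Longrightarrow> jordan_nf B xs \<Longrightarrow> jordan_nf A xs"
  by (auto simp: jordan_nf_def intro: similar_mat_trans)

text \<open>The number of blocks of a given positive size is computed from the matrix by
  \<open>compute_nr_of_jordan_blocks\<close>, hence is a similarity invariant. Blocks of size 0
  escape this count.\<close>

lemma lower_jordan_similar_mset_iff:
  assumes "0 \<notin> set ns" "0 \<notin> set ms"
  shows "similar_mat (lower_jordan ns b) (lower_jordan ms b) \<longleftrightarrow> mset ns = mset ms"
proof
  assume "similar_mat (lower_jordan ns b) (lower_jordan ms b)"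
  then have j: "jordan_nf (lower_jordan ns b) (map (\<lambda>k. (k, b)) ms)"
    using jordan_nf_lower_jordan[OF assms(2)] by (rule jordan_nf_similar)
  have z: "count (mset ns) 0 = 0" "count (mset ms) 0 = 0"
    using assms by (metis count_eq_zero_iff set_mset_mset)+
  show "mset ns = mset ms"
  proof (rule multiset_eqI)
    fix k show "count (mset ns) k = count (mset ms) k"
      using count_jordan_blocks[OF j, of k]
        count_jordan_blocks[OF jordan_nf_lower_jordan[OF assms(1)], of k b]
        z by (cases "k = 0") metis+
  qed
qed (rule lower_jordan_similar_mset)

text \<open>Needed because \<open>has_type\<close> quantifies existentially over the eigenvalue: a
  second label has to be identified with the first before block sizes can be compared.\<close>

lemma lower_jordan_similar_eigenvalue:
  assumes "0 \<notin> set ns" "0 \<notin> set ms" "ns \<noteq> []" "similar_mat (lower_jordan ns b) (lower_jordan ms c)"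
  shows "b = c"
proof -
  have "jordan_nf (lower_jordan ns b) (map (\<lambda>k. (k, c)) ms)"
    using assms(4) jordan_nf_lower_jordan[OF assms(2)] by (rule jordan_nf_similar)
  from jordan_nf_unique[OF jordan_nf_lower_jordan[OF assms(1)] this]
  show ?thesis using assms(3) by (cases ns) auto
qed

lemma lower_jordan_smult:
  assumes "c \<noteq> 0"
  shows "similar_mat (c \<cdot>\<^sub>m lower_jordan ns b) (lower_jordan ns (c * b))"
proof (rule similar_mat_trans[OF similar_mat_smult[OF lower_jordan_similar_jordan_matrix]])
  have "map (\<lambda>(n, a). (n, c * a)) (map (\<lambda>k. (k, b)) ns) = map (\<lambda>k. (k, c * b)) ns" by simp
  then show "similar_mat (c \<cdot>\<^sub>m jordan_matrix (map (\<lambda>k. (k, b)) ns)) (lower_jordan ns (c * b))"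
    using similar_mat_jordan_matrix_smult[OF assms, of "map (\<lambda>k. (k, b)) ns"]
      lower_jordan_similar_jordan_matrix[of ns "c * b"]
    by (metis similar_mat_trans similar_mat_sym)
qed

lemma lower_jordan_transpose: "similar_mat (transpose_mat (lower_jordan ns b)) (lower_jordan ns b)"
proof (induction ns)
  case Nil
  then show ?case by (auto intro: similar_mat_refl[of _ 0])
next
  case (Cons k ns)
  have "similar_mat (transpose_mat (lower_jordan_block k b)) (lower_jordan_block k b)"
    using similar_mat_sym[OF lower_jordan_block_similar] by (simp add: lower_jordan_block_def)
  then show ?case
    using similar_mat_dsum[OF _ Cons]
      by (simp add: lower_jordan_Cons dsum_transpose[of _ k _ "sum_list ns"])
qed

lemma char_poly_lower_jordan: "char_poly (lower_jordan ns b) = [:- b, 1:] ^ sum_list ns"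
proof (induction ns)
  case Nil
  have "char_poly (0\<^sub>m 0 0 :: real mat) = 1"
    by (simp add: char_poly_def det_dim_zero[of "char_poly_matrix (0\<^sub>m 0 0)"] char_poly_matrix_def)
  then show ?case by simp
next
  case (Cons k ns)
  have "char_poly (lower_jordan_block k b) = [:- b, 1:] ^ k"
    by (simp add: char_poly_similar[OF lower_jordan_block_similar] jordan_block_char_poly)
  with Cons show ?case
    by (simp add: lower_jordan_Cons char_poly_dsum[of _ k _ "sum_list ns"] power_add)
qed

lemma similar_char_matrix_pow_zero:
  fixes A :: "'a :: field mat"
  assumes "similar_mat A B" "A \<in> carrier_mat n n" "char_matrix B b ^\<^sub>m k = 0\<^sub>m n n"
  shows "char_matrix A b ^\<^sub>m k = 0\<^sub>m n n"
proof -
  obtain P Q where w: "similar_mat_wit A B P Q" using assms(1) by (auto simp: similar_mat_def)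
  note w' = similar_mat_witD2[OF assms(2) w]
  show ?thesis
    using similar_mat_wit_pow_id[OF similar_mat_wit_char_matrix[OF w], of b k] assms(3) w' by simp
qed

lemma char_matrix_dsum:
  "A \<in> carrier_mat n n \<Longrightarrow> B \<in> carrier_mat m m \<Longrightarrow>
    char_matrix (A \<oplus>\<^sub>d B) b = char_matrix A b \<oplus>\<^sub>d char_matrix B b"
  by (auto simp: char_matrix_def dsum_def intro!: eq_matI)

lemma dsum_pow:
  fixes A :: "'a :: comm_ring_1 mat"
  assumes "A \<in> carrier_mat n n" "B \<in> carrier_mat m m"
  shows "(A \<oplus>\<^sub>d B) ^\<^sub>m k = (A ^\<^sub>m k) \<oplus>\<^sub>d (B ^\<^sub>m k)"
  using pow_four_block_mat[OF assms, of k] assms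
  by (simp add: dsum_four_block[of _ n _ m])

text \<open>The largest block size would be the sharp exponent; the total size is a cruder bound
  that suffices wherever some annihilating power is wanted.\<close>

lemma lower_jordan_nilpotent:
  "sum_list ns \<le> k \<Longrightarrow> char_matrix (lower_jordan ns b) b ^\<^sub>m k = 0\<^sub>m (sum_list ns) (sum_list ns)"
proof (induction ns)
  case Nil
  show ?case by (rule eq_matI) (auto simp: char_matrix_def)
next
  case (Cons n ns)
  have "char_matrix (jordan_block n b) b ^\<^sub>m k = 0\<^sub>m n n"
    using Cons.prems by (auto simp: char_matrix_jordan_block jordan_block_zero_pow intro!: eq_matI)
  then have "char_matrix (lower_jordan_block n b) b ^\<^sub>m k = 0\<^sub>m n n"
    using similar_char_matrix_pow_zero[OF lower_jordan_block_similar] by auto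
  with Cons show ?case
    by (simp add: lower_jordan_Cons char_matrix_dsum[of _ n _ "sum_list ns"]
      dsum_pow[of _ n _ "sum_list ns"])
qed

text \<open>The characteristic polynomial splits, so a Jordan form exists over the reals. A block of
  positive size for another eigenvalue would need positive order there, but
  \<open>[:- b, 1:] ^ n\<close> has order 0 away from \<open>b\<close>.\<close>

lemma lower_jordan_exists:
  assumes A: "A \<in> carrier_mat n n" and cp: "char_poly A = [:- b, 1:] ^ n"
  obtains ns where "0 \<notin> set ns" "sum_list ns = n" "similar_mat A (lower_jordan ns b)"
proof -
  have "char_poly A = (\<Prod>a\<leftarrow>replicate n b. [:- a, 1:])" unfolding cp by (induction n) auto
  from jordan_nf_exists[OF A this] obtain xs where xs: "jordan_nf A xs" by auto
  have s: "snd x = b" if "x \<in> set xs" for x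
  proof -
    obtain k c where x: "x = (k, c)" by force
    have "k > 0" using xs that by (force simp: jordan_nf_def x)
    moreover have "k \<le> Polynomial.order c (char_poly A)"
      using jordan_nf_block_size_order_bound[OF xs, of k c] that by (simp add: x)
    ultimately show ?thesis by (auto simp: cp order_linear_power x split: if_splits)
  qed
  then have "map (\<lambda>k. (k, b)) (map fst xs) = xs" by (auto intro!: map_idI simp: o_def)
  with xs have "similar_mat A (jordan_matrix (map (\<lambda>k. (k, b)) (map fst xs)))"
    "0 \<notin> set (map fst xs)"
    by (simp_all add: jordan_nf_def)
  then have sim: "similar_mat A (lower_jordan (map fst xs) b)"
    using similar_mat_sym[OF lower_jordan_similar_jordan_matrix[of "map fst xs" b]]
    by (metis similar_mat_trans)
  moreover have "sum_list (map fst xs) = n"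
    using similar_mat_carrier[OF sim, of n] A by auto
  ultimately show ?thesis using that \<open>0 \<notin> set (map fst xs)\<close> by blast
qed

subsection \<open>Jordan types as multisets of block sizes\<close>

text \<open>A Jordan type read as a partition: a scalar entry is a Jordan block of size 1. The list
  version can be fed to \<open>lower_jordan\<close>, the multiset version \<open>parts\<close> is
  what similarity determines.\<close>

fun part_list :: "jordan_type \<Rightarrow> nat list" where
  "part_list (Scalar_type m) = replicate m 1"
| "part_list (Block_type xs t) = concat (map (\<lambda>(n, p). replicate p n) xs) @ replicate t 1"

definition parts :: "jordan_type \<Rightarrow> nat multiset" where
  "parts \<tau> = mset (part_list \<tau>)"

definition block_parts :: "(nat \<times> nat) list \<Rightarrow> nat multiset" where
  "block_parts xs = (\<Sum>(n, p)\<leftarrow>xs. replicate_mset p n)"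

definition valid_blocks :: "(nat \<times> nat) list \<Rightarrow> bool" where
  "valid_blocks xs \<longleftrightarrow> sorted_wrt (\<lambda>x y. fst x > fst y) xs \<and> (\<forall>(n, p)\<in>set xs. n \<ge> 2 \<and> p > 0)"

lemma block_parts_simps [simp]:
  "block_parts [] = {#}"
  "block_parts ((n, p) # xs) = replicate_mset p n + block_parts xs"
  "block_parts (xs @ ys) = block_parts xs + block_parts ys"
  by (simp_all add: block_parts_def)

lemma block_parts_reduce [simp]: "block_parts (reduce a p) = replicate_mset (p - 1) a"
  by (simp add: reduce_def)

lemma parts_simps [simp]:
  "parts (Scalar_type m) = replicate_mset m 1"
  "parts (Block_type xs t) = block_parts xs + replicate_mset t 1"
proof -
  have "mset (concat (map (\<lambda>(n, p). replicate p n) xs)) = block_parts xs" by (induction xs) auto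
  then show "parts (Block_type xs t) = block_parts xs + replicate_mset t 1" by (simp add: parts_def)
qed (simp add: parts_def)

lemma sum_parts: "sum_mset (parts (Block_type xs t)) = (\<Sum>(n, p)\<leftarrow>xs. n * p) + t"
proof -
  have "sum_mset (block_parts xs) = (\<Sum>(n, p)\<leftarrow>xs. n * p)"
    by (induction xs) (auto simp: sum_mset_replicate_mset)
  then show ?thesis by (simp add: sum_mset_replicate_mset)
qed

lemma Block_type_in_types:
  "Block_type xs t \<in> types m \<longleftrightarrow> xs \<noteq> [] \<and> valid_blocks xs \<and> sum_mset (parts (Block_type xs t)) = m"
  unfolding sum_parts by (auto simp: types_def valid_blocks_def)

lemma Scalar_type_in_types: "Scalar_type k \<in> types m \<longleftrightarrow> k = m"
  by (auto simp: types_def)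

lemma sum_mset_parts: "\<tau> \<in> types m \<Longrightarrow> sum_mset (parts \<tau>) = m"
  by (cases \<tau>) (auto simp: Block_type_in_types Scalar_type_in_types sum_mset_replicate_mset simp
    del: parts_simps(2))

lemma count_block_parts:
  assumes "valid_blocks xs"
  shows "count (block_parts xs) k = (case map_of xs k of None \<Rightarrow> 0 | Some p \<Rightarrow> p)"
  using assms
proof (induction xs)
  case (Cons x xs)
  obtain n p where x: "x = (n, p)" by force
  have "map_of xs n = None" using Cons.prems by (auto simp: valid_blocks_def x map_of_eq_None_iff)
  with Cons show ?case by (auto simp: x valid_blocks_def)
qed simp

lemma valid_blocks_distinct: "valid_blocks xs \<Longrightarrow> distinct (map fst xs)"
  by (induction xs) (auto simp: valid_blocks_def)

lemma valid_blocks_mem: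
  assumes "valid_blocks xs"
  shows "(n, p) \<in> set xs \<longleftrightarrow> p > 0 \<and> count (block_parts xs) n = p"
proof -
  have "(n, p) \<in> set xs \<Longrightarrow> p > 0" using assms by (auto simp: valid_blocks_def)
  then show ?thesis
    unfolding count_block_parts[OF assms] map_of_eq_Some_iff[OF valid_blocks_distinct[OF assms],
      symmetric]
    by (auto split: option.splits)
qed

lemma valid_blocks_count_small: "valid_blocks xs \<Longrightarrow> k < 2 \<Longrightarrow> count (block_parts xs) k = 0"
  by (auto simp: count_block_parts valid_blocks_def split: option.splits dest!: map_of_SomeD)

text \<open>Sizes decrease strictly, so the head is the entry of largest size. If the heads
  differed, each would lie in the tail of the other list and be the smaller of the two.\<close>

lemma valid_blocks_eqI:
  assumes "valid_blocks xs" "valid_blocks ys" "set xs = set ys"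
  shows "xs = ys"
  using assms
proof (induction xs arbitrary: ys)
  case (Cons x xs)
  then obtain y zs where ys: "ys = y # zs" by (cases ys) auto
  have xy: "x = y"
  proof (rule ccontr)
    assume "x \<noteq> y"
    then have "x \<in> set zs" "y \<in> set xs" using Cons.prems(3) ys by auto
    then have "fst y > fst x" "fst x > fst y" using Cons.prems ys by (auto simp: valid_blocks_def)
    then show False by simp
  qed
  have "x \<notin> set xs" "y \<notin> set zs" using Cons.prems ys by (auto simp: valid_blocks_def)
  then have "set xs = set zs" using Cons.prems(3) ys xy by (simp add: insert_ident)
  with xy show ?case using Cons ys by (simp add: valid_blocks_def)
qed auto

text \<open>For block types the multiplicity of 1 is \<open>t\<close>, and the other multiplicities
  determine the set of entries and with it the decreasing list. A scalar type cannot coincide with a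
  block type because of \<open>big\<close>.\<close>

lemma parts_inj:
  assumes "\<tau> \<in> types m" "\<sigma> \<in> types m'" "parts \<tau> = parts \<sigma>"
  shows "\<tau> = \<sigma>"
proof -
  have c: "count (parts (Block_type xs t)) k = count (block_parts xs) k +
    (if k = 1 then t else 0)" for xs t k
    by simp
  \<comment> \<open>The list of a block type is non-empty with sizes at least 2, so some part
    exceeds 1; this separates the two constructors.\<close>
  have big: "\<exists>k\<ge>2. count (parts (Block_type xs t)) k > 0" if h: "Block_type xs t \<in> types l"
    for xs t l
  proof -
    obtain n p where "(n, p) \<in> set xs" using h by (metis Block_type_in_types last_in_set surj_pair)
    then have "n \<ge> 2" "count (block_parts xs) n > 0"
      using h valid_blocks_mem[of xs n p] unfolding Block_type_in_types valid_blocks_def by auto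
    then show ?thesis unfolding c by (intro exI[of _ n]) simp
  qed
  show ?thesis
  proof (cases \<tau>; cases \<sigma>)
    fix k k' assume "\<tau> = Scalar_type k" "\<sigma> = Scalar_type k'"
    then have "size (parts (Scalar_type k)) = size (parts (Scalar_type k'))" using assms(3) by metis
    then show ?thesis using \<open>\<tau> = _\<close> \<open>\<sigma> = _\<close> by simp
  next
    fix k xs t assume "\<tau> = Scalar_type k" "\<sigma> = Block_type xs t"
    then have "Block_type xs t \<in> types m'" "parts (Block_type xs t) = replicate_mset k 1"
      using assms by (simp_all del: parts_simps(2))
    then show ?thesis using big[of xs t m'] by (auto simp del: parts_simps(2) split: if_splits)
  next
    fix k xs t assume "\<tau> = Block_type xs t" "\<sigma> = Scalar_type k"
    then have "Block_type xs t \<in> types m" "parts (Block_type xs t) = replicate_mset k 1"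
      using assms by (simp_all del: parts_simps(2))
    then show ?thesis using big[of xs t m] by (auto simp del: parts_simps(2) split: if_splits)
  next
    fix xs t ys s assume eq: "\<tau> = Block_type xs t" "\<sigma> = Block_type ys s"
    have v: "valid_blocks xs" "valid_blocks ys" using assms eq by (auto simp: Block_type_in_types)
    have e: "count (block_parts xs) k + (if k = 1 then t else 0) = count (block_parts ys) k +
      (if k = 1 then s else 0)" for k
      using arg_cong[OF assms(3), of "\<lambda>M. count M k"] unfolding eq c .
    have "t = s"
      using e[of 1] valid_blocks_count_small[OF v(1), of 1] valid_blocks_count_small[OF v(2), of
      1] by simp
    moreover have "count (block_parts xs) k = count (block_parts ys) k" for k
      using e[of k] unfolding \<open>t = s\<close> by (rule add_right_imp_eq)
    then have "x \<in> set xs \<longleftrightarrow> x \<in> set ys" for x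
      using valid_blocks_mem[OF v(1), of "fst x" "snd x"] valid_blocks_mem[OF v(2), of "fst x"
        "snd x"] by simp
    then have "set xs = set ys" by blast
    ultimately show ?thesis using eq valid_blocks_eqI[OF v] by simp
  qed
qed

lemma zero_notin_parts: "\<tau> \<in> types m \<Longrightarrow> 0 \<notin># parts \<tau>"
  using valid_blocks_count_small[of _ 0]
  by (cases \<tau>) (auto simp: Block_type_in_types in_replicate_mset not_in_iff simp
    del: count_greater_zero_iff)

text \<open>If all parts are 1, which includes the empty multiset, the scalar type is the preimage.
  Otherwise the sizes at least 2, listed in decreasing order with their multiplicities, form the
  list, and the multiplicity of 1 becomes \<open>t\<close>.\<close>

lemma parts_surj:
  assumes "0 \<notin># M"
  obtains \<tau> where "\<tau> \<in> types (sum_mset M)" "parts \<tau> = M"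
proof (cases "\<forall>k\<in>#M. k = 1")
  case True
  then have M: "M = replicate_mset (size M) 1"
    by (metis set_mset_subset_singletonD singleton_iff subsetI)
  then have "parts (Scalar_type (size M)) = M" by simp
  moreover have "sum_mset M = size M" using arg_cong[OF M, of sum_mset]
    by (simp add: sum_mset_replicate_mset)
  ultimately show ?thesis using that[of "Scalar_type (size M)"] by (simp add: Scalar_type_in_types)
next
  case False
  define K where "K = {k \<in> set_mset M. k \<ge> 2}"
  have fin: "finite K" by (simp add: K_def)
  define xs where "xs = map (\<lambda>k. (k, count M k)) (rev (sorted_list_of_set K))"
  have "sorted_wrt (\<lambda>x y. fst x > fst y) xs"
    using strict_sorted_list_of_set[of K] by (simp add: xs_def sorted_wrt_map sorted_wrt_rev)
  then have v: "valid_blocks xs"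
    using fin by (auto simp: valid_blocks_def xs_def K_def)
  obtain k where "k \<in># M" "k \<noteq> 1" using False by auto
  moreover from this have "k \<noteq> 0" using assms by metis
  ultimately have "k \<in> K" by (simp add: K_def)
  then have ne: "xs \<noteq> []" using fin by (auto simp: xs_def)
  have mem: "(k, p) \<in> set xs \<longleftrightarrow> k \<in> K \<and> p = count M k" for k p
    using fin by (auto simp: xs_def)
  have p: "parts (Block_type xs (count M 1)) = M"
  proof (rule multiset_eqI)
    fix k :: nat
    consider "k = 0" | "k = 1" | "k \<ge> 2" by linarith
    then show "count (parts (Block_type xs (count M 1))) k = count M k"
    proof cases
      case 1
      then show ?thesis using valid_blocks_count_small[OF v, of 0] assms by (simp add: not_in_iff)
    next
      case 2
      then show ?thesis using valid_blocks_count_small[OF v, of 1] by simp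
    next
      case 3
      show ?thesis
      proof (cases "k \<in># M")
        case True
        then show ?thesis using 3 mem[of k "count M k"] valid_blocks_mem[OF v, of k "count M k"]
          by (simp add: K_def)
      next
        case False
        then have "count (block_parts xs) k = 0"
          using mem[of k "count (block_parts xs) k"] valid_blocks_mem[OF v, of k
            "count (block_parts xs) k"]
          unfolding K_def by (metis (no_types, lifting) mem_Collect_eq gr0I)
        with False 3 show ?thesis by (simp add: not_in_iff)
      qed
    qed
  qed
  then have "Block_type xs (count M 1) \<in> types (sum_mset M)" using v ne
    by (metis Block_type_in_types)
  then show ?thesis using that p by blast
qed

text \<open>The covering relation of Young's lattice: one part \<open>a\<close> is replaced by
  \<open>a + 1\<close>. Multisets of block sizes do not contain 0, so for \<open>a = 0\<close> the
  difference removes nothing and a new part 1 appears.\<close>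

definition grows :: "nat multiset \<Rightarrow> nat multiset \<Rightarrow> bool" where
  "grows M M' \<longleftrightarrow> (\<exists>a. (a = 0 \<or> a \<in># M) \<and> M' = add_mset (a + 1) (M - {#a#}))"

text \<open>Each rule enlarges one part: \<open>a = 0\<close> for \<open>new_scalar\<close>, the
  distinguished size \<open>a\<close> for the two alternatives of (ii), and \<open>a = 1\<close> for
  the two rules that consume a scalar entry.\<close>

lemma add_box_grows:
  assumes "add_box \<tau> \<sigma>" "\<tau> \<in> types m"
  shows "grows (parts \<tau>) (parts \<sigma>)"
  using assms
proof cases
  case (new_scalar xs t)
  have "0 \<notin># parts \<tau>" using assms(2) by (rule zero_notin_parts)
  then have "parts \<tau> - {#0#} = parts \<tau>" by (simp add: diff_single_trivial)
  then show ?thesis unfolding grows_def by (intro exI[of _ 0]) (simp add: new_scalar(1,2))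
next
  case (enlarge xs a q p ys t)
  then have "p > 0" using assms(2) by (auto simp: Block_type_in_types valid_blocks_def)
  then obtain p' where "p = Suc p'" by (cases p) auto
  then show ?thesis unfolding grows_def enlarge(1,2) \<open>p = _\<close> by (intro exI[of _ a]) simp
next
  case (enlarge_new xs a p ys t)
  then have "p > 0" using assms(2) by (auto simp: Block_type_in_types valid_blocks_def)
  then obtain p' where "p = Suc p'" by (cases p) auto
  then show ?thesis unfolding grows_def enlarge_new(1,2) \<open>p = _\<close> by (intro exI[of _ a]) simp
next
  case (scalar_new t xs)
  then obtain t' where "t = Suc t'" by (cases t) auto
  then show ?thesis unfolding grows_def
    scalar_new(1,2) \<open>t = _\<close> by (intro exI[of _ 1]) (simp add: numeral_2_eq_2)
next
  case (scalar_two t xs p)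
  then obtain t' where "t = Suc t'" by (cases t) auto
  then show ?thesis unfolding grows_def
    scalar_two(1,2) \<open>t = _\<close> by (intro exI[of _ 1]) (simp add: numeral_2_eq_2)
qed

text \<open>The enlarged part is 0, a scalar entry, or a listed size. In the last two cases the rule
  that applies depends on whether the size \<open>a + 1\<close> is already listed, in which case its
  multiplicity has to be raised instead of a new entry inserted.\<close>

lemma grows_add_box:
  assumes \<tau>: "Block_type xs t \<in> types m" and g: "grows (parts (Block_type xs t)) M"
  obtains \<sigma> where "add_box (Block_type xs t) \<sigma>" "\<sigma> \<in> types (m + 1)" "parts \<sigma> = M"
proof -
  have v: "valid_blocks xs" and ne: "xs \<noteq> []" using \<tau> by (auto simp: Block_type_in_types)
  from g obtain a where a: "a = 0 \<or> a \<in># parts (Block_type xs t)"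
    and M: "M = add_mset (a + 1) (parts (Block_type xs t) - {#a#})"
    unfolding grows_def by blast
  note result = that
  have "sum_mset M = m + 1"
  proof (cases "a \<in># parts (Block_type xs t)")
    case True
    then obtain N where "parts (Block_type xs t) = add_mset a N" by (metis multi_member_split)
    then show ?thesis using M sum_mset_parts[OF \<tau>] by simp
  next
    case False
    then show ?thesis using M a sum_mset_parts[OF \<tau>] by (simp add: diff_single_trivial)
  qed
  \<comment> \<open>The total size goes up by one in every case, so it is settled here; each case
    below only has to exhibit the new list and check its order and its parts.\<close>
  then have thI: thesis if "add_box (Block_type xs t) (Block_type ys s)" "valid_blocks ys" "ys \<noteq> []"
    "parts (Block_type ys s) = M" for ys s
    using result[of "Block_type ys s"] that by (simp add: Block_type_in_types del: parts_simps)
  consider "a = 0" | "a = 1" "t \<ge> 1" | p where "(a, p) \<in> set xs"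
  proof -
    assume *: "a = 0 \<Longrightarrow> thesis" "a = 1 \<Longrightarrow> t \<ge> 1 \<Longrightarrow> thesis" "\<And>p. (a, p) \<in> set xs \<Longrightarrow> thesis"
    show thesis
    proof (cases "a \<in># block_parts xs")
      case True
      then show ?thesis using *(3)[of "count (block_parts xs) a"] valid_blocks_mem[OF v] by simp
    next
      case False
      then show ?thesis using * a by (auto simp: in_replicate_mset split: if_splits)
    qed
  qed
  then show thesis
  proof cases
    case 1
    have "0 \<notin># parts (Block_type xs t)" using \<tau> by (rule zero_notin_parts)
    then have "parts (Block_type xs t) - {#0#} = parts (Block_type xs t)"
      by (simp add: diff_single_trivial)
    then show ?thesis using 1 M v ne by (intro thI[OF add_box.new_scalar]) auto
  next
    case 2
    then obtain t' where t': "t = Suc t'" by (cases t) auto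
    obtain ys l p where xs: "xs = ys @ [(l, p)]" using ne
      by (metis append_butlast_last_id surj_pair)
    \<comment> \<open>A scalar entry turns into a block of size 2, and \<open>l\<close> is the
      smallest listed size; whether \<open>l\<close> is already 2 decides between
      \<open>scalar_two\<close> and \<open>scalar_new\<close>.\<close>
    have "l \<ge> 2" using v xs by (auto simp: valid_blocks_def)
    show ?thesis
    proof (cases "l = 2")
      case True
      show ?thesis using 2 M v t' unfolding xs True
        by (intro thI[unfolded xs True, OF add_box.scalar_two]) (auto simp: valid_blocks_def
          sorted_wrt_append numeral_2_eq_2)
    next
      case False
      then show ?thesis using 2 M v t' \<open>l \<ge> 2\<close>
        by (intro thI[OF add_box.scalar_new])
          (auto simp: valid_blocks_def sorted_wrt_append numeral_2_eq_2 xs)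
    qed
  next
    case 3
    then obtain us ys where xs: "xs = us @ [(a, p)] @ ys"
      by (metis append_Cons append_Nil split_list)
    have "p > 0" using v xs by (auto simp: valid_blocks_def)
    then obtain p' where p': "p = Suc p'" by (cases p) auto
    show ?thesis
    proof (cases "us = [] \<or> fst (last us) > a + 1")
      case True
      \<comment> \<open>The last entry of \<open>us\<close> has the smallest size in
        \<open>us\<close>, so the condition on it bounds all of them and \<open>a + 1\<close> can be
        inserted without breaking the strict decrease.\<close>
      have "a + 1 < n" if "(n, q) \<in> set us" for n q
      proof -
        have ne: "us \<noteq> []" using that by auto
        then have us: "us = butlast us @ [last us]" by simp
        have "fst (last us) \<le> n"
          using that v unfolding xs
            by (subst (asm) (1 2) us) (auto simp: valid_blocks_def sorted_wrt_append)
        then show ?thesis using True ne by simp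
      qed
      then show ?thesis using M v p' True
        by (intro thI[unfolded xs, OF add_box.enlarge_new])
          (fastforce simp: valid_blocks_def sorted_wrt_append xs reduce_def)+
    next
      case False
      then obtain vs n q where us: "us = vs @ [(n, q)]" by (metis append_butlast_last_id surj_pair)
      \<comment> \<open>The size \<open>n\<close> in front of \<open>a\<close> is larger than
        \<open>a\<close> but not larger than \<open>a + 1\<close>.\<close>
      have n: "n = a + 1" using False v xs us by (auto simp: valid_blocks_def sorted_wrt_append)
      show ?thesis using M v p'
        by (intro thI[unfolded xs us n append_assoc, OF add_box.enlarge])
          (fastforce simp: valid_blocks_def sorted_wrt_append xs us n reduce_def)+
    qed
  qed
qed

text \<open>A scalar type has no list to modify, which is why its two successors are a separate
  clause of \<open>Sigma_set\<close>; on multisets they are the growth of 0 and of 1. Types are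
  recovered from their parts by \<open>parts_inj\<close>.\<close>

lemma Sigma_set_iff:
  assumes n: "n \<ge> 2" and \<tau>: "\<tau> \<in> types (n - 1)" and \<sigma>: "\<sigma> \<in> types n"
  shows "(\<tau>, \<sigma>) \<in> Sigma_set n c \<longleftrightarrow> grows (parts \<tau>) (parts \<sigma>)"
proof
  obtain n' where n': "n = Suc (Suc n')" using n by (metis add_2_eq_Suc le_Suc_ex)
  assume "(\<tau>, \<sigma>) \<in> Sigma_set n c"
  then consider "\<tau> = Scalar_type (n - 1)" "\<sigma> = Scalar_type n"
    | "\<tau> = Scalar_type (n - 1)" "\<sigma> = Block_type [(2, 1)] (n - 2)" | "add_box \<tau> \<sigma>"
    by (auto simp: Sigma_set_def)
  then show "grows (parts \<tau>) (parts \<sigma>)"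
  proof cases
    case 1
    then show ?thesis unfolding grows_def n' by (intro exI[of _ 0]) (auto simp: diff_single_trivial)
  next
    case 2
    then show ?thesis unfolding grows_def n' by (intro exI[of _ 1]) (auto simp: numeral_2_eq_2)
  next
    case 3
    then show ?thesis using add_box_grows \<tau> by blast
  qed
next
  obtain n' where n': "n = Suc (Suc n')" using n by (metis add_2_eq_Suc le_Suc_ex)
  assume g: "grows (parts \<tau>) (parts \<sigma>)"
  have inj: "\<sigma> = \<sigma>'" if "\<sigma>' \<in> types n" "parts \<sigma>' = parts \<sigma>" for \<sigma>'
    using parts_inj[OF that(1) \<sigma> that(2)] by simp
  show "(\<tau>, \<sigma>) \<in> Sigma_set n c"
  proof (cases \<tau>)
    case (Scalar_type k)
    then have k: "k = Suc n'" using \<tau> n' by (simp add: Scalar_type_in_types)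
    obtain a where a: "a = 0 \<or> a \<in># parts \<tau>" "parts \<sigma> = add_mset (a + 1) (parts \<tau> - {#a#})"
      using g unfolding grows_def by blast
    from a(1) have "a = 0 \<or> a = 1" using Scalar_type
      by (auto simp: in_replicate_mset split: if_splits)
    then show ?thesis
    proof
      assume "a = 0"
      then have "\<sigma> = Scalar_type n"
        using a Scalar_type n' k
          by (intro inj) (auto simp: Scalar_type_in_types diff_single_trivial)
      then show ?thesis using \<tau> \<sigma> Scalar_type by (auto simp: Sigma_set_def Scalar_type_in_types)
    next
      assume "a = 1"
      then have "\<sigma> = Block_type [(2, 1)] (n - 2)"
        using a Scalar_type n' k
        by (intro inj) (auto simp: Block_type_in_types valid_blocks_def numeral_2_eq_2
          sum_mset_replicate_mset)
      then show ?thesis using \<tau> \<sigma> Scalar_type by (auto simp: Sigma_set_def Scalar_type_in_types)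
    qed
  next
    case (Block_type xs t)
    obtain \<sigma>' where s: "add_box \<tau> \<sigma>'" "\<sigma>' \<in> types (n - 1 + 1)" "parts \<sigma>' = parts \<sigma>"
      using grows_add_box[of xs t "n - 1" "parts \<sigma>"] \<tau> g Block_type by metis
    then have "\<sigma> = \<sigma>'" using n by (intro inj) auto
    then show ?thesis using s \<tau> \<sigma> by (auto simp: Sigma_set_def)
  qed
qed

text \<open>The scalar part \<open>t\<close> is the multiplicity of size 1. Clause (i) is the case
  in which the exceptional odd size is 1, clause (ii) the case in which it is a listed size, and the
  symbol \<open>(m)\<close> has the exceptional size 1 because \<open>m\<close> is odd.\<close>

lemma types_s_iff:
  assumes \<tau>: "\<tau> \<in> types m" and m: "odd m"
  shows "\<tau> \<in> types_s m \<longleftrightarrow> (\<exists>!a. odd a \<and> odd (count (parts \<tau>) a))"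
proof (cases \<tau>)
  case (Scalar_type k)
  then show ?thesis using assms by (auto simp: types_s_def Scalar_type_in_types)
next
  case (Block_type xs t)
  have v: "valid_blocks xs" using \<tau> Block_type by (simp add: Block_type_in_types)
  let ?c = "\<lambda>a. count (parts \<tau>) a"
  have c1: "?c 1 = t" using valid_blocks_count_small[OF v, of 1] by (simp add: Block_type)
  have ck: "?c a = count (block_parts xs) a" if "a \<noteq> 1" for a using that by (simp add: Block_type)
  have mem: "odd a \<and> odd (?c a) \<longleftrightarrow> (\<exists>p. (a, p) \<in> set xs \<and> odd a \<and> odd p)" if "a \<noteq> 1" for a
    unfolding ck[OF that] valid_blocks_mem[OF v] by (metis odd_pos)
  have not1: "(1, p) \<notin> set xs" for p using v by (auto simp: valid_blocks_def)
  have n1: "(odd t \<and> (\<forall>(n, p)\<in>set xs. odd n \<longrightarrow> even p)) \<longleftrightarrow>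
    (odd (?c 1) \<and> (\<forall>a. a \<noteq> 1 \<longrightarrow> \<not> (odd a \<and> odd (?c a))))"
  proof -
    have "(\<forall>(n, p)\<in>set xs. odd n \<longrightarrow> even p) \<longleftrightarrow>
      (\<forall>a. a \<noteq> 1 \<longrightarrow> \<not> (\<exists>p. (a, p) \<in> set xs \<and> odd a \<and> odd p))"
    proof -
      have "(\<forall>(n, p)\<in>set xs. odd n \<longrightarrow> even p) \<longleftrightarrow> (\<forall>n p. (n, p) \<in> set xs \<longrightarrow> odd n \<longrightarrow> even p)"
        by auto
      then show ?thesis using not1 by metis
    qed
    then show ?thesis using mem unfolding c1 by simp
  qed
  have n2: "(\<exists>!l. l < length xs \<and> odd (fst (xs ! l)) \<and> odd (snd (xs ! l))) \<longleftrightarrow>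
    (\<exists>!a. a \<noteq> 1 \<and> odd a \<and> odd (?c a))" (is "(\<exists>!l. ?L l) \<longleftrightarrow> (\<exists>!a. ?A a)")
  proof -
    have d: "distinct (map fst xs)" using valid_blocks_distinct[OF v] .
    have L: "?A (fst (xs ! l))" if "?L l" for l
    proof -
      have "xs ! l \<in> set xs" using that by simp
      then have "(fst (xs ! l), snd (xs ! l)) \<in> set xs" by simp
      then show ?thesis using that mem not1 by metis
    qed
    have A: "\<exists>l. ?L l \<and> fst (xs ! l) = a" if a: "?A a" for a
    proof -
      obtain p where "(a, p) \<in> set xs" "odd p" using a mem by blast
      then show ?thesis using a by (metis fst_conv snd_conv in_set_conv_nth)
    qed
    have inj: "l = l'" if "?L l" "?L l'" "fst (xs ! l) = fst (xs ! l')" for l l'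
      using that nth_eq_iff_index_eq[OF d, of l l'] by simp
    show ?thesis
    proof
      assume "\<exists>!l. ?L l"
      then obtain l where l: "?L l" "\<And>l'. ?L l' \<Longrightarrow> l' = l" by blast
      show "\<exists>!a. ?A a"
      proof (rule ex1I)
        show "?A (fst (xs ! l))" using L[OF l(1)] .
        show "a = fst (xs ! l)" if "?A a" for a using A[OF that] l(2) by auto
      qed
    next
      assume "\<exists>!a. ?A a"
      then obtain a where a: "?A a" "\<And>a'. ?A a' \<Longrightarrow> a' = a" by blast
      obtain l where l: "?L l" "fst (xs ! l) = a" using A[OF a(1)] by auto
      show "\<exists>!l. ?L l"
      proof (rule ex1I)
        show "?L l" by (rule l(1))
        show "l' = l" if "?L l'" for l' using inj[OF that l(1)] a(2)[OF L[OF that]] l(2) by simp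
      qed
    qed
  qed
  \<comment> \<open>Unique existence is split according to whether the witness is 1; this mirrors
    the two clauses of \<open>types_s\<close>.\<close>
  have "P 1 \<and> (\<forall>a. a \<noteq> 1 \<longrightarrow> \<not> P a) \<or> \<not> P 1 \<and> (\<exists>!a. a \<noteq> 1 \<and> P a) \<longleftrightarrow> (\<exists>!a. P a)"
    for P :: "nat \<Rightarrow> bool"
  proof (cases "P 1")
    case True
    then have "(\<exists>!a. P a) \<longleftrightarrow> (\<forall>a. P a \<longrightarrow> a = 1)" by auto
    with True show ?thesis by auto
  next
    case False
    then have "a \<noteq> 1 \<and> P a \<longleftrightarrow> P a" for a by (cases "a = 1") auto
    with False show ?thesis by simp
  qed
  from this[of "\<lambda>a. odd a \<and> odd (?c a)"]
  have n3: "odd (?c 1) \<and> (\<forall>a. a \<noteq> 1 \<longrightarrow> \<not> (odd a \<and> odd (?c a))) \<or>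
    even (?c 1) \<and> (\<exists>!a. a \<noteq> 1 \<and> odd a \<and> odd (?c a)) \<longleftrightarrow> (\<exists>!a. odd a \<and> odd (?c a))"
    by simp
  have n4: "\<tau> \<in> types_s m \<longleftrightarrow> odd t \<and> (\<forall>(n, p)\<in>set xs. odd n \<longrightarrow> even p) \<or>
    even t \<and> (\<exists>!l. l < length xs \<and> odd (fst (xs ! l)) \<and> odd (snd (xs ! l)))"
    using \<tau> by (simp add: types_s_def Block_type)
  show ?thesis unfolding n4 n1 n2 using n3 unfolding c1 .
qed

lemma types_s_subset: "types_s m \<subseteq> types m"
  by (auto simp: types_s_def Scalar_type_in_types)

lemma lower_jordan_replicate_one: "lower_jordan (replicate t 1) b = b \<cdot>\<^sub>m 1\<^sub>m t"
proof (induction t)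
  case 0
  show ?case by (rule eq_matI) auto
next
  case (Suc t)
  then show ?case
    by (auto simp: lower_jordan_Cons dsum_def lower_jordan_block_def intro!: eq_matI)
qed

text \<open>Both alternatives of \<open>has_type\<close> amount to similarity with the
  \<open>lower_jordan\<close> of \<open>part_list\<close>, for some label \<open>c\<close>. Once
  \<open>c = b\<close> is known, uniqueness of block sizes applies.\<close>

lemma has_type_lower_jordan:
  assumes ns: "0 \<notin> set ns"
  shows "has_type (lower_jordan ns b) \<tau> \<longleftrightarrow> \<tau> \<in> types (sum_list ns) \<and> parts \<tau> = mset ns"
proof -
  have blk: "diag_block_mat (concat (map (\<lambda>(n, p). replicate p (lower_jordan_block n c)) xs) @
    [c \<cdot>\<^sub>m 1\<^sub>m t])
     = lower_jordan (part_list (Block_type xs t)) c" for xs t c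
  proof -
    have "diag_block_mat (concat (map (\<lambda>(n, p). replicate p (lower_jordan_block n c)) xs)) =
      lower_jordan (concat (map (\<lambda>(n, p). replicate p n) xs)) c"
      by (simp add: lower_jordan_def map_concat o_def case_prod_unfold map_replicate)
    then show ?thesis
      by (simp only: diag_block_mat_append_dsum diag_block_mat_singleton lower_jordan_append
          part_list.simps lower_jordan_replicate_one)
  qed
  show ?thesis
  proof
    assume h: "has_type (lower_jordan ns b) \<tau>"
    then have \<tau>: "\<tau> \<in> types (sum_list ns)" by (simp add: has_type_def)
    have z: "0 \<notin> set (part_list \<tau>)" using zero_notin_parts[OF \<tau>] by (simp add: parts_def)
    obtain c where sim: "similar_mat (lower_jordan ns b) (lower_jordan (part_list \<tau>) c)"
    proof (cases \<tau>)
      case (Scalar_type m)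
      then obtain c where "lower_jordan ns b = c \<cdot>\<^sub>m 1\<^sub>m m" using h by (auto simp: has_type_def)
      then have "lower_jordan ns b = lower_jordan (part_list \<tau>) c"
        unfolding Scalar_type part_list.simps lower_jordan_replicate_one by simp
      then show ?thesis using that[of c] similar_mat_refl[OF lower_jordan_carrier, of ns b] by simp
    next
      case (Block_type xs t)
      then show ?thesis using h that by (auto simp: has_type_def blk)
    qed
    show "\<tau> \<in> types (sum_list ns) \<and> parts \<tau> = mset ns"
    proof (cases "ns = []")
      \<comment> \<open>An empty matrix has no eigenvalue, so \<open>c\<close> cannot be compared
        with \<open>b\<close>; instead, total size 0 leaves only the empty partition.\<close>
      case True
      then have "sum_mset (parts \<tau>) = 0" using sum_mset_parts[OF \<tau>] by simp
      then have "parts \<tau> = {#}" using zero_notin_parts[OF \<tau>]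
        by (metis sum_mset_0_iff multiset_nonemptyE)
      then show ?thesis using \<tau> True by simp
    next
      case False
      then show ?thesis
        using lower_jordan_similar_eigenvalue[OF ns z _ sim] lower_jordan_similar_mset_iff[OF ns
          z] sim \<tau>
        by (simp add: parts_def)
    qed
  next
    assume t: "\<tau> \<in> types (sum_list ns) \<and> parts \<tau> = mset ns"
    show "has_type (lower_jordan ns b) \<tau>"
    proof (cases \<tau>)
      case (Scalar_type m)
      then have "mset ns = replicate_mset m 1" using t by simp
      then have "ns = replicate m 1"
        by (metis mset_eq_length mset_replicate length_replicate mset_eq_setD replicate_eqI
          in_set_replicate)
      then show ?thesis using t Scalar_type lower_jordan_replicate_one[of m b]
        by (auto simp: has_type_def sum_list_replicate)
    next
      case (Block_type xs t')
      have "similar_mat (lower_jordan ns b) (lower_jordan (part_list \<tau>) b)"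
        using t by (intro lower_jordan_similar_mset) (simp add: parts_def)
      then show ?thesis using t Block_type by (auto simp: has_type_def blk)
    qed
  qed
qed

text \<open>The definite description in \<open>jtype\<close> is meaningful here:
  \<open>parts_surj\<close> supplies a type and \<open>parts_inj\<close> shows that there is only
  one.\<close>

lemma jtype_lower_jordan:
  assumes "0 \<notin> set ns"
  shows "jtype (lower_jordan ns b) \<in> types (sum_list ns)"
    "parts (jtype (lower_jordan ns b)) = mset ns"
proof -
  obtain \<tau> where \<tau>: "\<tau> \<in> types (sum_list ns)" "parts \<tau> = mset ns"
    using parts_surj[of "mset ns"] assms by (auto simp: sum_mset_sum_list)
  have "jtype (lower_jordan ns b) = \<tau>"
    unfolding jtype_def has_type_lower_jordan[OF assms]
    using \<tau> parts_inj by (intro the_equality) auto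
  with \<tau> show "jtype (lower_jordan ns b) \<in> types (sum_list ns)"
    "parts (jtype (lower_jordan ns b)) = mset ns"
    by auto
qed

lemma jtype_eq_iff:
  assumes "0 \<notin> set ns"
  shows "jtype (lower_jordan ns b) = \<tau> \<longleftrightarrow> \<tau> \<in> types (sum_list ns) \<and> parts \<tau> = mset ns"
  using jtype_lower_jordan[OF assms, of b] parts_inj by metis

subsection \<open>Splitting off the part of one eigenvalue\<close>

lemma eigenvalue_similar:
  fixes A :: "'a :: field mat"
  assumes "similar_mat A B"
  shows "eigenvalue A b \<longleftrightarrow> eigenvalue B b"
proof -
  obtain n where n: "A \<in> carrier_mat n n" "B \<in> carrier_mat n n" using similar_matD[OF assms] by auto
  show ?thesis
    unfolding eigenvalue_root_char_poly[OF n(1)] eigenvalue_root_char_poly[OF n(2)]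
      char_poly_similar[OF assms] ..
qed

lemma eigenvalue_dsum:
  fixes A :: "'a :: field mat"
  assumes "A \<in> carrier_mat n n" "B \<in> carrier_mat m m"
  shows "eigenvalue (A \<oplus>\<^sub>d B) b \<longleftrightarrow> eigenvalue A b \<or> eigenvalue B b"
  unfolding eigenvalue_root_char_poly[OF assms(1)] eigenvalue_root_char_poly[OF assms(2)]
    eigenvalue_root_char_poly[OF dsum_carrier[OF assms]] char_poly_dsum[OF assms] by simp

lemma eigenvalue_transpose:
  fixes A :: "'a :: field mat"
  assumes "A \<in> carrier_mat n n"
  shows "eigenvalue (transpose_mat A) b \<longleftrightarrow> eigenvalue A b"
  using assms eigenvalue_root_char_poly[of A n] eigenvalue_root_char_poly[of "transpose_mat A" n]
    by simp

lemma eigenvalue_smult: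
  fixes A :: "'a :: field mat"
  assumes A: "A \<in> carrier_mat n n" and c: "c \<noteq> 0"
  shows "eigenvalue (c \<cdot>\<^sub>m A) (c * b) \<longleftrightarrow> eigenvalue A b"
proof -
  have "char_matrix (c \<cdot>\<^sub>m A) (c * b) = c \<cdot>\<^sub>m char_matrix A b"
    using A by (auto simp: char_matrix_def algebra_simps intro!: eq_matI)
  then show ?thesis
    using A c eigenvalue_det[of A n] eigenvalue_det[of "c \<cdot>\<^sub>m A" n] by simp
qed

lemma eigenvalue_uminus:
  fixes A :: "'a :: field mat"
  assumes "A \<in> carrier_mat n n"
  shows "eigenvalue (- A) b \<longleftrightarrow> eigenvalue A (- b)"
  using eigenvalue_smult[OF assms, of "- 1" "- b"] by (simp add: uminus_mat_smult)

lemma eigenvalue_lower_jordan: "eigenvalue (lower_jordan ns b) c \<longleftrightarrow> c = b \<and> sum_list ns \<noteq> 0"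
  by (subst eigenvalue_root_char_poly[OF lower_jordan_carrier]) (auto simp: char_poly_lower_jordan
    poly_power simp del: sum_list_eq_0_iff)

section \<open>Intertwiners and Sylvester equations\<close>

lemma intertwine_char_matrix:
  fixes A :: "'a :: field mat"
  assumes "A \<in> carrier_mat n n" "B \<in> carrier_mat m m" "X \<in> carrier_mat n m" "A * X = X * B"
  shows "char_matrix A b * X = X * char_matrix B b"
proof -
  have "char_matrix A b * X = A * X + (- b) \<cdot>\<^sub>m X"
    using assms(1-3)
      by (simp add: char_matrix_def add_mult_distrib_mat[of _ n n] mult_smult_assoc_mat[of _ n n _
      m])
  also have "A * X + (- b) \<cdot>\<^sub>m X = X * B + (- b) \<cdot>\<^sub>m X" by (simp only: assms(4))
  also have "X * B + (- b) \<cdot>\<^sub>m X = X * char_matrix B b"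
    using assms(1-3)
      by (simp add: char_matrix_def mult_add_distrib_mat[of _ n m _ m] mult_smult_distrib[of _ n m
      _ m])
  finally show ?thesis .
qed

lemma intertwine_pow:
  fixes A :: "'a :: comm_ring_1 mat"
  assumes A: "A \<in> carrier_mat n n" and B: "B \<in> carrier_mat m m" and X: "X \<in> carrier_mat n m"
    and eq: "A * X = X * B"
  shows "A ^\<^sub>m k * X = X * B ^\<^sub>m k"
proof (induction k)
  case 0
  then show ?case using assms by simp
next
  case (Suc k)
  have c: "A ^\<^sub>m k \<in> carrier_mat n n" "B ^\<^sub>m k \<in> carrier_mat m m" using A B
    by (auto intro: pow_carrier_mat)
  have "A ^\<^sub>m Suc k * X = A ^\<^sub>m k * (A * X)" using assoc_mult_mat[OF c(1) A X] by simp
  also have "\<dots> = A ^\<^sub>m k * X * B" unfolding eq by (rule assoc_mult_mat[OF c(1) X B, symmetric])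
  also have "\<dots> = X * B ^\<^sub>m Suc k" unfolding Suc using assoc_mult_mat[OF X c(2) B] by simp
  finally show ?case .
qed

lemma det_pow_mat:
  fixes A :: "'a :: comm_ring_1 mat"
  assumes "A \<in> carrier_mat n n"
  shows "det (A ^\<^sub>m k) = det A ^ k"
  by (induction k) (use assms in \<open>simp_all add: det_mult[of _ n] pow_carrier_mat mult.commute\<close>)

lemma mult_invertible_zero:
  fixes X :: "'a :: field mat"
  assumes "X \<in> carrier_mat n m" "G \<in> carrier_mat m m" "det G \<noteq> 0" "X * G = 0\<^sub>m n m"
  shows "X = 0\<^sub>m n m"
proof -
  obtain H where H: "H \<in> carrier_mat m m" "G * H = 1\<^sub>m m" using det_nonzero_inverse[OF assms(2,3)]
    by metis
  have "X = X * (G * H)" using assms H by simp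
  also have "\<dots> = X * G * H" using assms(1,2) H(1) by (rule assoc_mult_mat[symmetric])
  also have "\<dots> = 0\<^sub>m n m" unfolding assms(4) using H by simp
  finally show ?thesis .
qed

text \<open>Shifting by \<open>b\<close> and taking powers gives
  \<open>0 = (A - b)^k X = X (B - b)^k\<close>, and the last factor is invertible since
  \<open>b\<close> is not an eigenvalue of \<open>B\<close>.\<close>

lemma intertwine_zero:
  fixes A :: "'a :: field mat"
  assumes A: "A \<in> carrier_mat n n" and B: "B \<in> carrier_mat m m" and X: "X \<in> carrier_mat n m"
    and eq: "A * X = X * B" and nil: "char_matrix A b ^\<^sub>m k = 0\<^sub>m n n" and ev: "\<not> eigenvalue B b"
  shows "X = 0\<^sub>m n m"
proof (rule mult_invertible_zero[OF X])
  show "char_matrix B b ^\<^sub>m k \<in> carrier_mat m m" using B by (auto intro: pow_carrier_mat)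
  show "det (char_matrix B b ^\<^sub>m k) \<noteq> 0"
    using ev B by (subst det_pow_mat[of _ m]) (auto simp: eigenvalue_det)
  show "X * char_matrix B b ^\<^sub>m k = 0\<^sub>m n m"
    using intertwine_pow[OF _ _ X intertwine_char_matrix[OF A B X eq], of b k] A B X nil by simp
qed

lemma char_matrix_transpose:
  "A \<in> carrier_mat n n \<Longrightarrow> char_matrix (transpose_mat A) b = transpose_mat (char_matrix A b)"
  by (auto simp: char_matrix_def intro!: eq_matI)

lemma transpose_pow_mat:
  fixes A :: "'a :: comm_ring_1 mat"
  assumes A: "A \<in> carrier_mat n n"
  shows "transpose_mat (A ^\<^sub>m k) = transpose_mat A ^\<^sub>m k"
proof (induction k)
  case 0
  then show ?case using A by simp
next
  case (Suc k)
  have c: "A ^\<^sub>m k \<in> carrier_mat n n" using A by (auto intro: pow_carrier_mat)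
  have "transpose_mat A * transpose_mat A ^\<^sub>m k = transpose_mat A ^\<^sub>m k * transpose_mat A"
    using intertwine_pow[of "transpose_mat A" n "transpose_mat A" n "transpose_mat A" k] A by simp
  then show ?case using transpose_mult[OF c A] Suc by simp
qed

text \<open>The transposed situation, with the nilpotent factor on the right.\<close>

lemma intertwine_zero':
  fixes A :: "'a :: field mat"
  assumes A: "A \<in> carrier_mat n n" and B: "B \<in> carrier_mat m m" and X: "X \<in> carrier_mat m n"
    and eq: "B * X = X * A" and nil: "char_matrix A b ^\<^sub>m k = 0\<^sub>m n n" and ev: "\<not> eigenvalue B b"
  shows "X = 0\<^sub>m m n"
proof -
  have "transpose_mat X = 0\<^sub>m n m"
  proof (rule intertwine_zero)
    show "transpose_mat A * transpose_mat X = transpose_mat X * transpose_mat B"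
      using arg_cong[OF eq, of transpose_mat]
        by (simp add: transpose_mult[OF B X] transpose_mult[OF X A])
    show "char_matrix (transpose_mat A) b ^\<^sub>m k = 0\<^sub>m n n"
      using nil A by (simp add: char_matrix_transpose flip: transpose_pow_mat[of _ n])
    show "\<not> eigenvalue (transpose_mat B) b" using ev B by (simp add: eigenvalue_transpose)
  qed (use A B X in auto)
  then have "transpose_mat (transpose_mat X) = 0\<^sub>m m n" by simp
  then show ?thesis by simp
qed

text \<open>With \<open>N = A - b\<close> nilpotent and \<open>H\<close> inverse to
  \<open>B - b\<close>, the finite sum of the terms \<open>N^i C H^(i+1)\<close> solves the shifted
  equation. The induction on an exponent that annihilates \<open>C\<close> builds this sum term by
  term.\<close>

lemma sylvester_solution:
  fixes A :: "'a :: field mat"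
  assumes A: "A \<in> carrier_mat n n" and B: "B \<in> carrier_mat m m" and C: "C \<in> carrier_mat n m"
    and nil: "char_matrix A b ^\<^sub>m k = 0\<^sub>m n n" and ev: "\<not> eigenvalue B b"
  obtains X where "X \<in> carrier_mat n m" "A * X + C = X * B"
proof -
  define N G where "N = char_matrix A b" "G = char_matrix B b"
  have N: "N \<in> carrier_mat n n" and G: "G \<in> carrier_mat m m" using A B by (auto simp: N_G_def)
  have "det G \<noteq> 0" using ev B by (simp add: N_G_def eigenvalue_det)
  then obtain H where H: "H \<in> carrier_mat m m" "H * G = 1\<^sub>m m" using det_nonzero_inverse[OF G]
    by metis
  have "\<exists>X\<in>carrier_mat n m. N * X + C = X * G" if "C \<in> carrier_mat n m" "N ^\<^sub>m k * C = 0\<^sub>m n m"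
    for C k
    using that
  proof (induction k arbitrary: C)
    case 0
    then have "C = 0\<^sub>m n m" using N by simp
    then show ?case using N G by (intro bexI[of _ "0\<^sub>m n m"]) auto
  next
    case (Suc k)
    have Nk: "N ^\<^sub>m k \<in> carrier_mat n n" using N by (auto intro: pow_carrier_mat)
    have c: "C * H \<in> carrier_mat n m" "N * (C * H) \<in> carrier_mat n m" using N Suc.prems H by auto
    have "N ^\<^sub>m k * (N * (C * H)) = N ^\<^sub>m Suc k * C * H"
      using N Nk Suc.prems(1) H
        by (simp add: assoc_mult_mat[of _ n n _ n _ m] assoc_mult_mat[of _ n n _ m _ m])
    also have "\<dots> = 0\<^sub>m n m" unfolding Suc.prems(2) using H by simp
    finally obtain Y where Y: "Y \<in> carrier_mat n m" "N * Y + N * (C * H) = Y * G"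
      using Suc.IH[OF c(2)] by auto
    \<comment> \<open>The first term \<open>C * H\<close> absorbs \<open>C\<close> and leaves the
      error \<open>N * (C * H)\<close>, which is annihilated by one power of \<open>N\<close> less;
      \<open>Y\<close> corrects that error.\<close>
    have "C * H * G = C" using Suc.prems(1) H G by (simp add: assoc_mult_mat[of _ n m _ m _ m])
    then have "(Y + C * H) * G = Y * G + C" using Y c G
      by (simp add: add_mult_distrib_mat[of _ n m])
    also have "Y * G + C = N * (Y + C * H) + C"
      unfolding Y(2)[symmetric] using N Y c by (simp add: mult_add_distrib_mat[of _ n n _ m])
    finally show ?case using Y c by (intro bexI[of _ "Y + C * H"]) auto
  qed
  from this[OF C, of k] obtain X where X: "X \<in> carrier_mat n m" "N * X + C = X * G"
    using nil C by (auto simp: N_G_def)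
  have "N * X = A * X + (- b) \<cdot>\<^sub>m X"
    using A X
      by (simp add: N_G_def char_matrix_def add_mult_distrib_mat[of _ n n]
      mult_smult_assoc_mat[of _ n n _ m])
  moreover have "X * G = X * B + (- b) \<cdot>\<^sub>m X"
    using B X
      by (simp add: N_G_def char_matrix_def mult_add_distrib_mat[of _ n m _ m]
      mult_smult_distrib[of _ n m _ m])
  ultimately have e: "A * X + (- b) \<cdot>\<^sub>m X + C = X * B + (- b) \<cdot>\<^sub>m X" using X by simp
  have "A * X + C = X * B"
  proof (rule eq_matI)
    fix i j assume ij: "i < dim_row (X * B)" "j < dim_col (X * B)"
    then have ij': "i < n" "j < m" using X B by auto
    show "(A * X + C) $$ (i, j) = (X * B) $$ (i, j)"
      using arg_cong[OF e, of "\<lambda>M. M $$ (i, j)"] ij' A B C X by (simp del: index_mult_mat(1))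
  qed (use A B C X in auto)
  with X show ?thesis using that by blast
qed

text \<open>Conjugation by the unipotent matrix with corner \<open>X\<close> changes the corner
  \<open>U\<close> by a Sylvester expression, which a suitable \<open>X\<close> makes
  vanish.\<close>

lemma block_upper_similar_dsum:
  fixes A :: "'a :: field mat"
  assumes A: "A \<in> carrier_mat n n" and B: "B \<in> carrier_mat m m" and U: "U \<in> carrier_mat n m"
    and nil: "char_matrix A b ^\<^sub>m k = 0\<^sub>m n n" and ev: "\<not> eigenvalue B b"
  shows "similar_mat (four_block_mat A U (0\<^sub>m m n) B) (A \<oplus>\<^sub>d B)"
proof -
  obtain X where X: "X \<in> carrier_mat n m" "A * X + U = X * B"
    using sylvester_solution[OF A B U nil ev] .
  let ?T = "four_block_mat (1\<^sub>m n) X (0\<^sub>m m n) (1\<^sub>m m)"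
  have "four_block_mat A U (0\<^sub>m m n) B * ?T = four_block_mat A (A * X + U) (0\<^sub>m m n) B"
    using A B U X by (subst mult_four_block_mat[of _ n n _ m _ m _ _ n _ m]) auto
  moreover have "?T * (A \<oplus>\<^sub>d B) = four_block_mat A (X * B) (0\<^sub>m m n) B"
    unfolding dsum_four_block[OF A B]
    using A B U X by (subst mult_four_block_mat[of _ n n _ m _ m _ _ n _ m]) auto
  moreover have "det ?T \<noteq> 0"
    using X by (subst det_four_block_mat_lower_left_zero[of _ n _ m]) auto
  ultimately show ?thesis using A B X
    by (subst similar_mat_iff[of _ "n + m"]) (auto intro!: bexI[of _ ?T])
qed

lemma extend_to_invertible:
  fixes v :: "'a :: field vec"
  assumes v: "v \<in> carrier_vec n" "v \<noteq> 0\<^sub>v n"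
  obtains W where "W \<in> carrier_mat n n" "det W \<noteq> 0" "col W 0 = v" "n > 0"
proof -
  interpret vec_space "TYPE('a)" n .
  note b = basis_completion[OF v]
  define W where "W = mat_of_cols n (basis_completion v)"
  have W: "W \<in> carrier_mat n n" unfolding W_def by (metis b(6) mat_of_cols_carrier(1))
  have c: "cols W = basis_completion v" using b(2) by (simp add: W_def cols_mat_of_cols)
  have "rank W = n" using b(4,5) by (intro lin_indpt_full_rank[OF W]) (simp_all add: c)
  then have "det W \<noteq> 0" by (simp add: det_rank_iff[OF W])
  moreover have n: "n > 0" using v by (cases n) auto
  moreover have "col W 0 = v"
  proof -
    have "basis_completion v ! 0 = v" using b(6,7) n by (cases "basis_completion v") auto
    moreover have "v \<in> carrier_vec n" by (rule v(1))
    ultimately show ?thesis using b(6) n by (simp add: W_def)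
  qed
  ultimately show ?thesis using that W by blast
qed

text \<open>Deflation: an eigenvector is completed to a basis as its first vector, so the first
  column becomes \<open>b\<close> times the first unit vector.\<close>

lemma eigenvalue_block:
  fixes A :: "'a :: field mat"
  assumes A: "A \<in> carrier_mat n n" and ev: "eigenvalue A b"
  obtains m w A' where "n = Suc m" "w \<in> carrier_mat 1 m" "A' \<in> carrier_mat m m"
    "similar_mat A (four_block_mat (b \<cdot>\<^sub>m 1\<^sub>m 1) w (0\<^sub>m m 1) A')"
proof -
  obtain v where v: "v \<in> carrier_vec n" "v \<noteq> 0\<^sub>v n" "A *\<^sub>v v = b \<cdot>\<^sub>v v"
    using ev A by (auto simp: eigenvalue_def eigenvector_def)
  obtain W where W: "W \<in> carrier_mat n n" "det W \<noteq> 0" "col W 0 = v" "n > 0"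
    using extend_to_invertible[OF v(1,2)] .
  obtain V where V: "V \<in> carrier_mat n n" "W * V = 1\<^sub>m n" "V * W = 1\<^sub>m n"
    using det_nonzero_inverse[OF W(1,2)] .
  obtain m where m: "n = Suc m" using W(4) by (cases n) auto
  define B where "B = V * A * W"
  have B: "B \<in> carrier_mat n n" using A V W by (simp add: B_def)
  have "W * B = W * V * (A * W)"
    using A V(1) W(1) by (simp add: B_def assoc_mult_mat[of _ n n _ n _ n])
  then have "W * B = A * W" using A V W by simp
  then have sim: "similar_mat A B" using A B W by (subst similar_mat_iff[of _ n]) auto
  have "col B 0 = V * A *\<^sub>v col W 0"
    unfolding B_def by (rule col_mult2[OF mult_carrier_mat[OF V(1) A] W(1,4)])
  also have "\<dots> = V *\<^sub>v (A *\<^sub>v col W 0)"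
    by (rule assoc_mult_mat_vec[OF V(1) A]) (use W(3) v(1) in simp)
  also have "\<dots> = b \<cdot>\<^sub>v (V *\<^sub>v col W 0)" unfolding W(3) v(3) using V v
    by (simp add: mult_mat_vec[of _ n n])
  also have "V *\<^sub>v col W 0 = col (V * W) 0" using col_mult2[OF V(1) W(1,4)] by simp
  also have "\<dots> = col (1\<^sub>m n) 0" by (simp only: V(3))
  finally have col: "col B 0 = b \<cdot>\<^sub>v unit_vec n 0" using W(4) by simp
  have Bij: "B $$ (i, 0) = (if i = 0 then b else 0)" if "i < n" for i
    using arg_cong[OF col, of "\<lambda>x. x $ i"] that B W(4) by simp
  have B': "B \<in> carrier_mat (1 + m) (1 + m)" using B m by simp
  obtain P w z A' where Bd: "B = four_block_mat P w z A'" "P \<in> carrier_mat 1 1"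
    "w \<in> carrier_mat 1 m"
    "z \<in> carrier_mat m 1" "A' \<in> carrier_mat m m"
    using four_block_cases[OF B'] .
  have "P = b \<cdot>\<^sub>m 1\<^sub>m 1" using Bij[of 0] W(4) Bd by (auto intro!: eq_matI)
  moreover have "z = 0\<^sub>m m 1"
  proof (rule eq_matI)
    fix i j assume "i < dim_row (0\<^sub>m m 1 :: 'a mat)" "j < dim_col (0\<^sub>m m 1 :: 'a mat)"
    then show "z $$ (i, j) = 0\<^sub>m m 1 $$ (i, j)"
      using Bij[of "Suc i"] Bd m by auto
  qed (use Bd in auto)
  ultimately show ?thesis using that[OF m] Bd sim by auto
qed

text \<open>The sizes \<open>1 + (k + m)\<close> are rebracketed as \<open>(1 + k) + m\<close>. The
  entries of \<open>w\<close> above \<open>A\<close> stay in the corner block; those above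
  \<open>B\<close> become the first row of \<open>U\<close>, whose other rows are zero.\<close>

lemma block_upper_regroup:
  fixes A :: "'a :: field mat"
  assumes "w \<in> carrier_mat 1 (k + m)" "A \<in> carrier_mat k k" "B \<in> carrier_mat m m"
    "a \<in> carrier_mat 1 1"
  obtains w1 U where "w1 \<in> carrier_mat 1 k" "U \<in> carrier_mat (1 + k) m"
    "four_block_mat a w (0\<^sub>m (k + m) 1) (A \<oplus>\<^sub>d B) =
      four_block_mat (four_block_mat a w1 (0\<^sub>m k 1) A) U (0\<^sub>m m (1 + k)) B"
proof -
  define w1 where "w1 = mat 1 k (\<lambda>(i, j). w $$ (0, j))"
  define U where "U = mat (1 + k) m (\<lambda>(i, j). if i = 0 then w $$ (0, k + j) else 0)"
  have "four_block_mat a w (0\<^sub>m (k + m) 1) (A \<oplus>\<^sub>d B) =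
      four_block_mat (four_block_mat a w1 (0\<^sub>m k 1) A) U (0\<^sub>m m (1 + k)) B"
    (is "?F = ?G")
  proof (rule eq_matI)
    fix i j assume "i < dim_row ?G" "j < dim_col ?G"
    then have ij: "i < 1 + k + m" "j < 1 + k + m" using assms by auto
    have "i = 0 \<or> 0 < i \<and> i < 1 + k \<or> 1 + k \<le> i" "j = 0 \<or> 0 < j \<and> j < 1 + k \<or> 1 + k \<le> j"
      by linarith+
    then show "?F $$ (i, j) = ?G $$ (i, j)"
      using ij assms
        by (elim disjE conjE; simp add: w1_def U_def dsum_def; (intro conjI impI; linarith)?)
  qed (use assms in auto)
  then show ?thesis by (intro that[of w1 U]) (auto simp: w1_def U_def)
qed

text \<open>Eigenvectors for \<open>b\<close> are split off one at a time, so no factorisation of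
  the characteristic polynomial is needed and the rest \<open>B\<close> may have arbitrary non-real
  spectrum.\<close>

lemma jordan_splitting:
  assumes "A \<in> carrier_mat n n"
  obtains ns B k where "0 \<notin> set ns" "B \<in> carrier_mat k k" "sum_list ns + k = n" "\<not> eigenvalue B b"
    "similar_mat A (lower_jordan ns b \<oplus>\<^sub>d B)"
proof -
  have "\<exists>ns B k. 0 \<notin> set ns \<and> B \<in> carrier_mat k k \<and> sum_list ns + k = n \<and> \<not> eigenvalue B b \<and>
    similar_mat A (lower_jordan ns b \<oplus>\<^sub>d B)"
    using assms
  proof (induction n arbitrary: A rule: less_induct)
    case (less n)
    note A = less.prems
    show ?case
    proof (cases "eigenvalue A b")
      case False
      with A show ?thesis
        by (intro exI[of _ "[]"] exI[of _ A] exI[of _ n]) (simp add: similar_mat_refl)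
    next
      case True
      obtain m w A' where m: "n = Suc m" and w: "w \<in> carrier_mat 1 m" and A': "A' \<in> carrier_mat m m"
        and sim: "similar_mat A (four_block_mat (b \<cdot>\<^sub>m 1\<^sub>m 1) w (0\<^sub>m m 1) A')"
        using eigenvalue_block[OF A True] .
      obtain ns B k where IH: "0 \<notin> set ns" "B \<in> carrier_mat k k" "sum_list ns + k = m"
        "\<not> eigenvalue B b"
        "similar_mat A' (lower_jordan ns b \<oplus>\<^sub>d B)"
        using less.IH[of m A'] m A' by auto
      let ?s = "sum_list ns" and ?b = "b \<cdot>\<^sub>m 1\<^sub>m 1 :: real mat"
      have b1: "?b \<in> carrier_mat 1 1" by simp
      obtain v where v: "v \<in> carrier_mat 1 m"
        "similar_mat (four_block_mat ?b w (0\<^sub>m m 1) A') (four_block_mat ?b v (0\<^sub>m m 1)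
          (lower_jordan ns b \<oplus>\<^sub>d B))"
        using block_upper_similar[OF similar_mat_refl[OF b1] IH(5) b1 A' w] .
      obtain w1 U where U: "w1 \<in> carrier_mat 1 ?s" "U \<in> carrier_mat (1 + ?s) k"
        "four_block_mat ?b v (0\<^sub>m m 1) (lower_jordan ns b \<oplus>\<^sub>d B) =
          four_block_mat (four_block_mat ?b w1 (0\<^sub>m ?s 1) (lower_jordan ns b)) U (0\<^sub>m k (1 + ?s)) B"
        using block_upper_regroup[of v ?s k "lower_jordan ns b" B ?b] v IH(2,3) by auto
      let ?P = "four_block_mat ?b w1 (0\<^sub>m ?s 1) (lower_jordan ns b)"
      have P: "?P \<in> carrier_mat (1 + ?s) (1 + ?s)" by (intro four_block_carrier_mat) auto
      have "char_poly ?b = [:- b, 1:]"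
        using char_poly_lower_jordan[of "replicate 1 1" b] unfolding lower_jordan_replicate_one
          by simp
      \<comment> \<open>\<open>?P\<close> joins the eigenvector with the \<open>b\<close>-part of
        the quotient. Its only eigenvalue is \<open>b\<close>, so it has a Jordan form over the
        reals and is annihilated by a power of \<open>?P - b\<close>; the Sylvester argument then
        removes \<open>U\<close>.\<close>
      then have "char_poly ?P = [:- b, 1:] ^ (1 + ?s)"
        using char_poly_block_upper[OF b1 lower_jordan_carrier U(1), of b]
          by (simp add: char_poly_lower_jordan)
      then obtain ms where ms: "0 \<notin> set ms" "sum_list ms = 1 + ?s"
        "similar_mat ?P (lower_jordan ms b)"
        using lower_jordan_exists[OF P] by blast
      have "char_matrix ?P b ^\<^sub>m (1 + ?s) = 0\<^sub>m (1 + ?s) (1 + ?s)"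
        using ms(2) lower_jordan_nilpotent[of ms "1 + ?s" b]
        by (intro similar_char_matrix_pow_zero[OF ms(3) P]) simp
      then have "similar_mat (four_block_mat ?P U (0\<^sub>m k (1 + ?s)) B) (?P \<oplus>\<^sub>d B)"
        using block_upper_similar_dsum[OF P IH(2) U(2) _ IH(4)] by blast
      moreover have "similar_mat (?P \<oplus>\<^sub>d B) (lower_jordan ms b \<oplus>\<^sub>d B)"
        using IH(2) by (intro similar_mat_dsum[OF ms(3)] similar_mat_refl)
      ultimately have "similar_mat A (lower_jordan ms b \<oplus>\<^sub>d B)"
        using sim v(2) unfolding U(3) by (metis similar_mat_trans)
      then show ?thesis using ms IH m
        by (intro exI[of _ ms] exI[of _ B] exI[of _ k]) auto
    qed
  qed
  then show ?thesis using that by blast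
qed

lemma order_char_poly_zero:
  fixes A :: "'a :: field mat"
  assumes "A \<in> carrier_mat n n" "\<not> eigenvalue A b"
  shows "Polynomial.order b (char_poly A) = 0"
  using assms eigenvalue_root_char_poly[OF assms(1)] by (simp add: order_0I)

lemma alg_mult_lower_jordan_dsum:
  assumes "B \<in> carrier_mat k k" "\<not> eigenvalue B b"
  shows "alg_mult (lower_jordan ns b \<oplus>\<^sub>d B) b = sum_list ns"
proof -
  have "char_poly B \<noteq> 0" using degree_monic_char_poly[OF assms(1)] by auto
  then have "[:- b, 1:] ^ sum_list ns * char_poly B \<noteq> 0" by simp
  then show ?thesis
    by (simp add: alg_mult_def char_poly_dsum[OF lower_jordan_carrier assms(1)]
      char_poly_lower_jordan
        order_mult order_linear_power order_char_poly_zero[OF assms])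
qed

lemma alg_mult_similar:
  "similar_mat A B \<Longrightarrow> alg_mult A b = alg_mult B b"
  by (simp add: alg_mult_def char_poly_similar)

lemma dsum_intertwine_iff:
  fixes A :: "'a :: comm_ring_1 mat"
  assumes "A \<in> carrier_mat n n" "B \<in> carrier_mat m m" "C \<in> carrier_mat n n" "D \<in> carrier_mat m m"
    "P1 \<in> carrier_mat n n" "P2 \<in> carrier_mat n m" "P3 \<in> carrier_mat m n" "P4 \<in> carrier_mat m m"
  shows "(A \<oplus>\<^sub>d B) * four_block_mat P1 P2 P3 P4 = four_block_mat P1 P2 P3 P4 * (C \<oplus>\<^sub>d D) \<longleftrightarrow>
    A * P1 = P1 * C \<and> A * P2 = P2 * D \<and> B * P3 = P3 * C \<and> B * P4 = P4 * D"
proof -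
  have "(A \<oplus>\<^sub>d B) * four_block_mat P1 P2 P3 P4 = four_block_mat (A * P1) (A * P2) (B * P3) (B * P4)"
    unfolding dsum_four_block[OF assms(1,2)] using assms
    by (subst mult_four_block_mat[of _ n n _ m _ m]) auto
  moreover have "four_block_mat P1 P2 P3 P4 * (C \<oplus>\<^sub>d D) = four_block_mat (P1 * C) (P2 * D) (P3 * C)
    (P4 * D)"
    unfolding dsum_four_block[OF assms(3,4)] using assms
    by (subst mult_four_block_mat[of _ n n _ m _ m]) auto
  ultimately show ?thesis
    using assms four_block_eq_iff[of "A * P1" n n "A * P2" m "B * P3" m "B * P4" "P1 * C" "P2 * D"
      "P3 * C" "P4 * D"]
    by simp
qed

text \<open>The off-diagonal blocks of the conjugating matrix intertwine a matrix that is nilpotent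
  up to the shift by \<open>b\<close> with one without the eigenvalue \<open>b\<close>, hence
  vanish. So the conjugation is block diagonal and restricts to both summands.\<close>

lemma jordan_cancel:
  assumes ns: "0 \<notin> set ns" "0 \<notin> set ms" and B: "B \<in> carrier_mat k k" and C: "C \<in> carrier_mat l l"
    and ev: "\<not> eigenvalue B b" "\<not> eigenvalue C b"
    and sim: "similar_mat (lower_jordan ns b \<oplus>\<^sub>d B) (lower_jordan ms b \<oplus>\<^sub>d C)"
  shows "mset ns = mset ms" "similar_mat B C" "k = l"
proof -
  let ?s = "sum_list ns" and ?L = "lower_jordan ns b" and ?M = "lower_jordan ms b"
  \<comment> \<open>The algebraic multiplicity of \<open>b\<close> is the total size of its blocks;
    equality of these sizes is needed before the conjugating matrix can be cut into matching
    blocks.\<close>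
  have s: "sum_list ms = ?s"
    using alg_mult_similar[OF sim, of b]
      by (simp add: alg_mult_lower_jordan_dsum[OF B] alg_mult_lower_jordan_dsum[OF C] ev)
  have "?L \<oplus>\<^sub>d B \<in> carrier_mat (?s + k) (?s + k)" using B by simp
  moreover have "?M \<oplus>\<^sub>d C \<in> carrier_mat (?s + l) (?s + l)"
    using C s dsum_carrier[OF lower_jordan_carrier C] by metis
  ultimately show kl: "k = l" using similar_mat_carrier[OF sim, of "?s + k"]
    by (metis add_left_cancel carrier_matD(1))
  have M: "?M \<in> carrier_mat ?s ?s" using lower_jordan_carrier[of ms b] s by simp
  note C = C[folded kl]
  obtain P where P: "P \<in> carrier_mat (?s + k) (?s + k)" "det P \<noteq> 0"
    "(?L \<oplus>\<^sub>d B) * P = P * (?M \<oplus>\<^sub>d C)"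
    using sim similar_mat_iff[OF dsum_carrier[OF lower_jordan_carrier B] dsum_carrier[OF M C]]
      by auto
  obtain P1 P2 P3 P4 where Pd: "P = four_block_mat P1 P2 P3 P4" "P1 \<in> carrier_mat ?s ?s"
    "P2 \<in> carrier_mat ?s k"
    "P3 \<in> carrier_mat k ?s" "P4 \<in> carrier_mat k k"
    using four_block_cases[OF P(1)] .
  note eq = P(3)[unfolded Pd(1) dsum_intertwine_iff[OF lower_jordan_carrier B M C Pd(2-)]]
  have "P2 = 0\<^sub>m ?s k"
    using intertwine_zero[OF lower_jordan_carrier C Pd(3) _ lower_jordan_nilpotent[OF order_refl]
      ev(2)] eq by blast
  moreover have "P3 = 0\<^sub>m k ?s"
    using intertwine_zero'[OF M B Pd(4) _ _ ev(1)] lower_jordan_nilpotent[of ms ?s b] s eq by auto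
  ultimately have "det P = det P1 * det P4"
    unfolding Pd(1) using Pd by (subst det_four_block_mat_lower_left_zero[of _ ?s _ k]) auto
  then have d: "det P1 \<noteq> 0" "det P4 \<noteq> 0" using P(2) by auto
  have "similar_mat ?L ?M" using eq Pd d M by (subst similar_mat_iff[of _ ?s]) auto
  then show "mset ns = mset ms" using lower_jordan_similar_mset_iff[OF ns] by simp
  show "similar_mat B C" using eq Pd d B C by (subst similar_mat_iff[of _ k]) auto
qed

lemma spec_carrier:
  assumes "A \<in> carrier_mat n n"
  shows "spec A = {x. poly (map_poly complex_of_real (char_poly A)) x = 0}"
  using spectrum_root_char_poly[of "map_mat complex_of_real A" n] assms
  by (simp add: spec_def of_real_hom.char_poly_hom[OF assms])

lemma spec_of_real_iff:
  assumes "A \<in> carrier_mat n n"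
  shows "complex_of_real b \<in> spec A \<longleftrightarrow> eigenvalue A b"
  unfolding spec_carrier[OF assms] eigenvalue_root_char_poly[OF assms] by simp

subsection \<open>Skew-symmetric forms and Hamiltonian matrices\<close>

lemma mat_add_eq_zero_iff:
  fixes A :: "'a :: ab_group_add mat"
  assumes "A \<in> carrier_mat n m" "B \<in> carrier_mat n m"
  shows "A + B = 0\<^sub>m n m \<longleftrightarrow> A = - B"
proof
  assume h: "A + B = 0\<^sub>m n m"
  show "A = - B"
  proof (rule eq_matI)
    fix i j assume "i < dim_row (- B)" "j < dim_col (- B)"
    then show "A $$ (i, j) = (- B) $$ (i, j)"
      using arg_cong[OF h, of "\<lambda>M. M $$ (i, j)"] assms by (simp add: eq_neg_iff_add_eq_0)
  qed (use assms in auto)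
qed (use assms in \<open>auto intro!: eq_matI\<close>)

lemma dsum_eq_iff:
  assumes "A \<in> carrier_mat n n" "B \<in> carrier_mat m m" "C \<in> carrier_mat n n" "D \<in> carrier_mat m m"
  shows "A \<oplus>\<^sub>d B = C \<oplus>\<^sub>d D \<longleftrightarrow> A = C \<and> B = D"
  using assms four_block_eq_iff[of A n n "0\<^sub>m n m" m "0\<^sub>m m n" m B C "0\<^sub>m n m" "0\<^sub>m m n" D]
  by (simp add: dsum_four_block)

section \<open>Congruence and the normal form of skew-symmetric matrices\<close>

definition congruent_mat :: "real mat \<Rightarrow> real mat \<Rightarrow> bool" where
  "congruent_mat A B \<longleftrightarrow> (\<exists>n. \<exists>P\<in>carrier_mat n n. A \<in> carrier_mat n n \<and> det P \<noteq> 0 \<and>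
     B = transpose_mat P * A * P)"

lemma congruent_matI:
  "A \<in> carrier_mat n n \<Longrightarrow> P \<in> carrier_mat n n \<Longrightarrow> det P \<noteq> 0 \<Longrightarrow> B = transpose_mat P * A * P \<Longrightarrow>
    congruent_mat A B"
  unfolding congruent_mat_def by blast

lemma congruent_matE:
  assumes "congruent_mat A B" "A \<in> carrier_mat n n"
  obtains P where "P \<in> carrier_mat n n" "det P \<noteq> 0" "B = transpose_mat P * A * P"
  using assms by (auto simp: congruent_mat_def)

lemma congruent_mat_refl: "A \<in> carrier_mat n n \<Longrightarrow> congruent_mat A A"
  by (rule congruent_matI[of A n "1\<^sub>m n"]) auto

lemma congruent_mat_trans:
  assumes "congruent_mat A B" "congruent_mat B C"
  shows "congruent_mat A C"
proof -
  obtain n P where P: "A \<in> carrier_mat n n" "P \<in> carrier_mat n n" "det P \<noteq> 0"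
    "B = transpose_mat P * A * P"
    using assms(1) by (auto simp: congruent_mat_def)
  then have B: "B \<in> carrier_mat n n" by simp
  obtain R where R: "R \<in> carrier_mat n n" "det R \<noteq> 0" "C = transpose_mat R * B * R"
    using congruent_matE[OF assms(2) B] .
  show ?thesis
  proof (rule congruent_matI[OF P(1)])
    show "P * R \<in> carrier_mat n n" using P R by simp
    show "det (P * R) \<noteq> 0" using P R by (simp add: det_mult[of _ n])
    show "C = transpose_mat (P * R) * A * (P * R)"
      unfolding R(3) P(4) transpose_mult[OF P(2) R(1)]
      using P(1,2) R(1) by (simp add: assoc_mult_mat[of _ n n _ n _ n])
  qed
qed

lemma congruent_mat_skew:
  assumes "congruent_mat A B" "transpose_mat A = - A"
  shows "transpose_mat B = - B"
proof -
  obtain n P where P: "A \<in> carrier_mat n n" "P \<in> carrier_mat n n" "B = transpose_mat P * A * P"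
    using assms(1) by (auto simp: congruent_mat_def)
  have "transpose_mat B = transpose_mat P * (transpose_mat A * P)"
    unfolding P(3) using P(1,2) transpose_mult[of "transpose_mat P * A" n n P n]
      transpose_mult[of "transpose_mat P" n n A n] by (simp del: assoc_mult_mat)
  also have "\<dots> = - B" unfolding assms(2) P(3) using P(1,2)
    by (simp add: assoc_mult_mat[of _ n n _ n _ n])
  finally show ?thesis .
qed

lemma congruent_mat_dsum:
  assumes "congruent_mat A B" "congruent_mat C D"
  shows "congruent_mat (A \<oplus>\<^sub>d C) (B \<oplus>\<^sub>d D)"
proof -
  obtain n P where P: "A \<in> carrier_mat n n" "P \<in> carrier_mat n n" "det P \<noteq> 0"
    "B = transpose_mat P * A * P"
    using assms(1) by (auto simp: congruent_mat_def)
  obtain m R where R: "C \<in> carrier_mat m m" "R \<in> carrier_mat m m" "det R \<noteq> 0"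
    "D = transpose_mat R * C * R"
    using assms(2) by (auto simp: congruent_mat_def)
  show ?thesis
  proof (rule congruent_matI)
    show "A \<oplus>\<^sub>d C \<in> carrier_mat (n + m) (n + m)" "P \<oplus>\<^sub>d R \<in> carrier_mat (n + m) (n + m)"
      using P R by auto
    show "det (P \<oplus>\<^sub>d R) \<noteq> 0" using P R by (simp add: det_dsum[of _ n _ m])
    show "B \<oplus>\<^sub>d D = transpose_mat (P \<oplus>\<^sub>d R) * (A \<oplus>\<^sub>d C) * (P \<oplus>\<^sub>d R)"
      using P R by (simp add: dsum_transpose[of _ n _ m] dsum_mult[of _ n _ m])
  qed
qed

text \<open>A simultaneous permutation of rows and columns is congruence by the permutation matrix
  \<open>P\<close>; injectivity of the reindexing gives
  \<open>transpose_mat P * P = 1\<close>.\<close>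

lemma congruent_mat_reindex:
  assumes A: "A \<in> carrier_mat n n" and inj: "inj_on \<sigma> {..<n}" and ran: "\<And>i. i < n \<Longrightarrow> \<sigma> i < n"
  shows "congruent_mat A (mat n n (\<lambda>(i, j). A $$ (\<sigma> i, \<sigma> j)))"
proof -
  define P :: "real mat" where "P = mat n n (\<lambda>(i, j). if i = \<sigma> j then 1 else 0)"
  have P: "P \<in> carrier_mat n n" by (simp add: P_def)
  have r: "(B * P) $$ (i, j) = B $$ (i, \<sigma> j)" if "B \<in> carrier_mat n n" "i < n" "j < n" for B i j
  proof -
    have "(B * P) $$ (i, j) = (\<Sum>l\<in>{0..<n}. B $$ (i, l) * P $$ (l, j))"
      using that P by (simp add: scalar_prod_def)
    also have "\<dots> = (\<Sum>l\<in>{0..<n}. if l = \<sigma> j then B $$ (i, l) else 0)"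
      using that by (intro sum.cong) (auto simp: P_def)
    also have "\<dots> = B $$ (i, \<sigma> j)" using that ran by simp
    finally show ?thesis .
  qed
  have l: "(transpose_mat P * B) $$ (i, j) = B $$ (\<sigma> i, j)" if "B \<in> carrier_mat n n" "i < n"
    "j < n" for B i j
  proof -
    have "(transpose_mat P * B) $$ (i, j) = (\<Sum>l\<in>{0..<n}. P $$ (l, i) * B $$ (l, j))"
      using that P by (simp add: scalar_prod_def)
    also have "\<dots> = (\<Sum>l\<in>{0..<n}. if l = \<sigma> i then B $$ (l, j) else 0)"
      using that by (intro sum.cong) (auto simp: P_def)
    also have "\<dots> = B $$ (\<sigma> i, j)" using that ran by simp
    finally show ?thesis .
  qed
  have "transpose_mat P * P = 1\<^sub>m n"
  proof (rule eq_matI)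
    fix i j assume "i < dim_row (1\<^sub>m n :: real mat)" "j < dim_col (1\<^sub>m n :: real mat)"
    then have ij: "i < n" "j < n" by auto
    show "(transpose_mat P * P) $$ (i, j) = 1\<^sub>m n $$ (i, j)"
      unfolding l[OF P ij] using ij ran inj by (auto simp: P_def inj_on_eq_iff)
  qed (auto simp: P_def)
  then have d: "det P \<noteq> 0" using det_mult[of "transpose_mat P" n P] P by auto
  show ?thesis
  proof (rule congruent_matI[OF A P d], rule eq_matI)
    fix i j assume "i < dim_row (transpose_mat P * A * P)" "j < dim_col (transpose_mat P * A * P)"
    then have ij: "i < n" "j < n" using P by auto
    have PA: "transpose_mat P * A \<in> carrier_mat n n" using P A by simp
    show "mat n n (\<lambda>(i, j). A $$ (\<sigma> i, \<sigma> j)) $$ (i, j) = (transpose_mat P * A * P) $$ (i, j)"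
      unfolding r[OF PA ij] using l[OF A ij(1), of "\<sigma> j"] ij ran by simp
  qed (auto simp: P_def)
qed

text \<open>Block elimination with the invertible corner \<open>G\<close>: the choice
  \<open>X = - (H * F)\<close>, with \<open>H\<close> inverse to \<open>G\<close>, clears the lower
  left block, and skewness clears the upper right one at the same time.\<close>

lemma schur_complement:
  assumes E: "E \<in> carrier_mat n n" and F: "F \<in> carrier_mat m n" and G: "G \<in> carrier_mat m m"
    and skew: "transpose_mat G = - G" and d: "det G \<noteq> 0"
  obtains E' where "E' \<in> carrier_mat n n"
    "congruent_mat (four_block_mat E (- transpose_mat F) F G) (E' \<oplus>\<^sub>d G)"
proof -
  obtain H where H: "H \<in> carrier_mat m m" "G * H = 1\<^sub>m m" "H * G = 1\<^sub>m m"
    using det_nonzero_inverse[OF G d] .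
  define X where "X = - (H * F)"
  have X: "X \<in> carrier_mat m n" using H F by (simp add: X_def)
  let ?T = "four_block_mat (1\<^sub>m n) (0\<^sub>m n m) X (1\<^sub>m m)"
  let ?S = "four_block_mat E (- transpose_mat F) F G"
  have S: "?S \<in> carrier_mat (n + m) (n + m)" using E G by simp
  have T: "?T \<in> carrier_mat (n + m) (n + m)" by simp
  have "G * X = - (G * (H * F))" using G H(1) F by (simp add: X_def)
  also have "G * (H * F) = G * H * F" by (rule assoc_mult_mat[OF G H(1) F, symmetric])
  also have "\<dots> = F" using H(2) F by simp
  finally have "G * X = - F" .
  then have GX: "F + G * X = 0\<^sub>m m n" using F by (simp add: mat_add_eq_zero_iff[of _ m n])
  \<comment> \<open>The transpose of the equation \<open>F + G * X = 0\<close>, rewritten with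
    \<open>transpose_mat G = - G\<close>, is the vanishing of the other off-diagonal block.\<close>
  have "transpose_mat (F + G * X) = transpose_mat F + transpose_mat X * transpose_mat G"
    using F G X by (simp add: transpose_add[of _ m n] transpose_mult[of _ m m])
  then have XG: "- transpose_mat F + transpose_mat X * G = 0\<^sub>m n m"
  proof -
    assume a: "transpose_mat (F + G * X) = transpose_mat F + transpose_mat X * transpose_mat G"
    have "transpose_mat F + - (transpose_mat X * G) = 0\<^sub>m n m"
      using a X G unfolding GX skew by simp
    then have "transpose_mat F = transpose_mat X * G"
      using F X G by (subst (asm) mat_add_eq_zero_iff[of _ n m]) auto
    then show ?thesis using F X G
      by (subst mat_add_eq_zero_iff[of _ n m]) auto
  qed
  define E' where "E' = E + - transpose_mat F * X"
  have "?S * ?T = four_block_mat E' (- transpose_mat F) (F + G * X) G"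
    unfolding E'_def using E F G X by (subst mult_four_block_mat[of _ n n _ m _ m]) auto
  also have "\<dots> = four_block_mat E' (- transpose_mat F) (0\<^sub>m m n) G" unfolding GX ..
  finally have ST: "?S * ?T = four_block_mat E' (- transpose_mat F) (0\<^sub>m m n) G" .
  have E': "E' \<in> carrier_mat n n" using E F X by (simp add: E'_def)
  have "transpose_mat ?T = four_block_mat (1\<^sub>m n) (transpose_mat X) (0\<^sub>m m n) (1\<^sub>m m)"
    using X by (simp add: transpose_four_block_mat[of _ n n _ m _ m])
  note tT = this
  have "transpose_mat ?T * (?S * ?T) =
    four_block_mat E' (- transpose_mat F + transpose_mat X * G) (0\<^sub>m m n) G"
    unfolding ST tT using E' F G X by (subst mult_four_block_mat[of _ n n _ m _ m]) auto
  also have "\<dots> = E' \<oplus>\<^sub>d G" unfolding XG dsum_four_block[OF E' G] ..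
  finally have eq: "E' \<oplus>\<^sub>d G = transpose_mat ?T * ?S * ?T"
    using S T by (simp add: assoc_mult_mat[of _ "n + m" "n + m" _ "n + m" _ "n + m"])
  have "det ?T \<noteq> 0" using X by (subst det_four_block_mat_upper_right_zero[of _ n _ m]) auto
  then show ?thesis using that[OF E'] congruent_matI[OF S T _ eq] by blast
qed

lemma J_mat_carrier [simp]: "J_mat r \<in> carrier_mat (2 * r) (2 * r)"
  by (simp add: J_mat_def mult_2)

lemma J_mat_dim [simp]: "dim_row (J_mat r) = 2 * r" "dim_col (J_mat r) = 2 * r"
  by (rule carrier_matD[OF J_mat_carrier])+

lemma J_mat_entry:
  "i < 2 * r \<Longrightarrow> j < 2 * r \<Longrightarrow> J_mat r $$ (i, j) = (if j = i + r then - 1 else if i =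
    j + r then 1 else 0)"
  by (auto simp: J_mat_def)

lemma J_mat_skew: "transpose_mat (J_mat r) = - J_mat r"
  by (auto simp: J_mat_entry intro!: eq_matI)

lemma J_mat_det: "det (J_mat r) \<noteq> 0"
proof -
  let ?K = "four_block_mat (0\<^sub>m r r) (1\<^sub>m r) (- 1\<^sub>m r) (0\<^sub>m r r) :: real mat"
  have "J_mat r * ?K = four_block_mat (1\<^sub>m r) (0\<^sub>m r r) (0\<^sub>m r r) (1\<^sub>m r)"
    unfolding J_mat_def
    by (subst mult_four_block_mat[of _ r r _ r _ r]) (auto intro!: cong_four_block_mat eq_matI)
  then have "J_mat r * ?K = 1\<^sub>m (2 * r)" by (simp add: mult_2)
  moreover have "?K \<in> carrier_mat (2 * r) (2 * r)" by (simp add: mult_2)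
  ultimately show ?thesis by (intro inverse_det_nonzero[of _ "2 * r" ?K]) auto
qed

lemma J_mat_Suc: "congruent_mat (J_mat r \<oplus>\<^sub>d J_mat 1) (J_mat (Suc r))"
proof -
  \<comment> \<open>The coordinates of \<open>J_mat r\<close>, \<open>J_mat 1\<close> are ordered as
    r positions, r momenta, position, momentum. \<open>J_mat (Suc r)\<close> wants the new position,
    index \<open>2 * r\<close>, right after the first r positions, so the r momenta move up by
    one.\<close>
  define \<sigma>
    where "\<sigma> i = (if i < r then i else if i = r then 2 * r else if i < 2 * r + 1 then i - 1 else
    i)" for i
  have c: "J_mat r \<oplus>\<^sub>d J_mat 1 \<in> carrier_mat (2 * Suc r) (2 * Suc r)"
    using dsum_carrier[OF J_mat_carrier[of r] J_mat_carrier[of 1]] by simp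
  have "inj_on \<sigma> {..<2 * Suc r}" by (auto simp: inj_on_def \<sigma>_def split: if_splits)
  moreover have "\<sigma> i < 2 * Suc r" if "i < 2 * Suc r" for i using that by (auto simp: \<sigma>_def)
  ultimately have "congruent_mat (J_mat r \<oplus>\<^sub>d J_mat 1)
    (mat (2 * Suc r) (2 * Suc r) (\<lambda>(i, j). (J_mat r \<oplus>\<^sub>d J_mat 1) $$ (\<sigma> i, \<sigma> j)))"
    by (rule congruent_mat_reindex[OF c])
  also have "mat (2 * Suc r) (2 * Suc r) (\<lambda>(i, j). (J_mat r \<oplus>\<^sub>d J_mat 1) $$ (\<sigma> i, \<sigma> j)) =
    J_mat (Suc r)"
  proof (rule eq_matI)
    fix i j assume "i < dim_row (J_mat (Suc r))" "j < dim_col (J_mat (Suc r))"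
    then have ij: "i < 2 * Suc r" "j < 2 * Suc r" using J_mat_carrier[of "Suc r"] by auto
    have "i < r \<or> i = r \<or> r < i \<and> i < 2 * r + 1 \<or> i = 2 * r + 1"
      "j < r \<or> j = r \<or> r < j \<and> j < 2 * r + 1 \<or> j = 2 * r + 1"
      using ij by auto
    then show "mat (2 * Suc r) (2 * Suc r) (\<lambda>(i, j). (J_mat r \<oplus>\<^sub>d J_mat 1) $$ (\<sigma> i, \<sigma> j)) $$ (i, j)
      = J_mat (Suc r) $$ (i, j)"
      using ij by (elim disjE conjE) (auto simp: J_mat_entry \<sigma>_def dsum_def)
  qed (use J_mat_carrier[of "Suc r"] in auto)
  finally show ?thesis .
qed

text \<open>Symplectic Gram-Schmidt: a non-zero entry singles out a hyperbolic plane, which is moved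
  to the last two indices, normalised to \<open>J_mat 1\<close> and split off by the Schur
  complement; the complement is treated by induction.\<close>

lemma skew_normal_form:
  assumes "S \<in> carrier_mat n n" "transpose_mat S = - S"
  obtains q r where "n = q + 2 * r" "congruent_mat S (0\<^sub>m q q \<oplus>\<^sub>d J_mat r)"
proof -
  have "\<exists>q r. n = q + 2 * r \<and> congruent_mat S (0\<^sub>m q q \<oplus>\<^sub>d J_mat r)"
    using assms
  proof (induction n arbitrary: S rule: less_induct)
    case (less n)
    note S = less.prems(1)
    have sk: "S $$ (i, j) = - S $$ (j, i)" if "i < n" "j < n" for i j
      using arg_cong[OF less.prems(2), of "\<lambda>M. M $$ (j, i)"] that S by simp
    show ?case
    proof (cases "S = 0\<^sub>m n n")
      case True
      then show ?thesis using congruent_mat_refl[OF S]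
        by (intro exI[of _ n] exI[of _ 0])
          (auto simp: dsum_empty'(1)[OF J_mat_carrier[of 0, simplified]])
    next
      case False
      then obtain i j where ij: "i < n" "j < n" "S $$ (i, j) \<noteq> 0" using S
        by (metis carrier_matD eq_matI index_zero_mat)
      then have "i \<noteq> j" using sk[of i j] by auto
      with ij obtain m where m: "n = m + 2"
        by (metis Suc_lessI add_2_eq_Suc' less_antisym less_nat_zero_code not0_implies_Suc)
      \<comment> \<open>The aim is \<open>\<sigma> m = i\<close> and
        \<open>\<sigma> (m + 1) = j\<close>. After \<open>\<tau>\<close> has placed
        \<open>i\<close>, the index \<open>j\<close> may itself have moved, so the second
        transposition refers to \<open>\<tau> j\<close>.\<close>
      define \<tau> where "\<tau> = Transposition.transpose m i"
      define \<sigma> where "\<sigma> = \<tau> \<circ> Transposition.transpose (m + 1) (\<tau> j)"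
      have \<tau>: "\<tau> x < n" if "x < n" for x using that ij m
        by (auto simp: \<tau>_def Transposition.transpose_def)
      have \<sigma>n: "\<sigma> x < n" if "x < n" for x
        unfolding \<sigma>_def o_def using that ij m \<tau>
          by (intro \<tau>) (auto simp: Transposition.transpose_def)
      have \<sigma>inj: "inj_on \<sigma> {..<n}"
        by (rule inj_on_subset[of _ UNIV]) (auto simp: \<sigma>_def \<tau>_def intro!: inj_compose)
      have \<sigma>1: "\<sigma> (m + 1) = j" by (simp add: \<sigma>_def \<tau>_def)
      have \<sigma>0: "\<sigma> m = i"
        using \<open>i \<noteq> j\<close> by (auto simp: \<sigma>_def \<tau>_def Transposition.transpose_def)
      define S' where "S' = mat n n (\<lambda>(i, j). S $$ (\<sigma> i, \<sigma> j))"
      have cS: "congruent_mat S S'" unfolding S'_def by (rule congruent_mat_reindex[OF S \<sigma>inj \<sigma>n])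
      have S': "S' \<in> carrier_mat (m + 2) (m + 2)" by (simp add: S'_def m)
      obtain E F' F G where b: "S' = four_block_mat E F' F G" "E \<in> carrier_mat m m"
        "F' \<in> carrier_mat m 2"
        "F \<in> carrier_mat 2 m" "G \<in> carrier_mat 2 2"
        using four_block_cases[OF S'] .
      have "transpose_mat S' = - S'" using congruent_mat_skew[OF cS less.prems(2)] .
      then have "four_block_mat (transpose_mat E) (transpose_mat F) (transpose_mat F')
        (transpose_mat G) =
        four_block_mat (- E) (- F') (- F) (- G)"
        unfolding b(1) using b(2-)
          by (simp add: transpose_four_block_mat[of _ m m _ 2 _ 2]) (auto intro!: eq_matI)
      then have t: "transpose_mat F = - F'" "transpose_mat G = - G"
        using b(2-) by (subst (asm) four_block_eq_iff[of _ m m _ 2 _ 2]; simp)+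
      then have F': "F' = - transpose_mat F" by simp
      have G: "G $$ (0, 1) = S $$ (i, j)" "G $$ (1, 0) = S $$ (j, i)" "G $$ (0, 0) = 0"
        "G $$ (1, 1) = 0"
      proof -
        have e: "G $$ (a, c) = S $$ (\<sigma> (m + a), \<sigma> (m + c))" if "a < 2" "c < 2" for a c
          using arg_cong[OF b(1), of "\<lambda>M. M $$ (m + a, m + c)"] that b(2-) m by (simp add: S'_def)
        show "G $$ (0, 1) = S $$ (i, j)" "G $$ (1, 0) = S $$ (j, i)" "G $$ (0, 0) = 0"
          "G $$ (1, 1) = 0"
          using e[of 0 1] e[of 1 0] e[of 0 0] e[of 1 1] \<sigma>0 \<sigma>1 sk[of i i] sk[of j j] ij by auto
      qed
      define s where "s = S $$ (i, j)"
      have s: "s \<noteq> 0" "S $$ (j, i) = - s" using ij sk[of j i] by (auto simp: s_def)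
      \<comment> \<open>The plane has upper right entry \<open>s\<close>; rescaling the first of its
        two vectors by \<open>- 1 / s\<close> makes that entry \<open>-1\<close>, as in
        \<open>J_mat 1\<close>.\<close>
      define R where "R = mat 2 2 (\<lambda>(a, c). if a = c then if a = 0 then - 1 / s else 1 else 0
        :: real)"
      have R: "R \<in> carrier_mat 2 2" by (simp add: R_def)
      have less2: "(x < 2) = (x = 0 \<or> x = Suc 0)" for x by auto
      have sum2: "(\<Sum>x\<in>{0..<2}. f x) = f 0 + f 1" for f :: "nat \<Rightarrow> real"
        by (simp add: numeral_2_eq_2)
      have "det R = prod_list (diag_mat R)"
        by (rule det_upper_triangular[OF _ R]) (auto simp: R_def)
      then have "det R \<noteq> 0" using s by (auto simp: diag_mat_def R_def)
      moreover have "J_mat 1 = transpose_mat R * G * R"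
        using b(5) R s G
        by (auto simp: J_mat_entry less2 scalar_prod_def R_def s_def[symmetric] sum2
          intro!: eq_matI)
      ultimately have cG: "congruent_mat G (J_mat 1)" using b(5) R
        by (intro congruent_matI[of G 2 R])
      have "det G \<noteq> 0" 
      proof
        assume "det G = 0"
        then have "det (J_mat 1) = 0" using \<open>J_mat 1 = _\<close> b(5) R by (simp add: det_mult[of _ 2])
        then show False using J_mat_det by blast
      qed
      then obtain E' where E': "E' \<in> carrier_mat m m" "congruent_mat S' (E' \<oplus>\<^sub>d G)"
        unfolding b(1) F' using schur_complement[OF b(2,4,5) t(2)] by blast
      have "transpose_mat (E' \<oplus>\<^sub>d G) = - (E' \<oplus>\<^sub>d G)"
        using congruent_mat_skew[OF E'(2) \<open>transpose_mat S' = _\<close>] .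
      then have "transpose_mat E' = - E'"
        using E'(1) b(5)
        by (simp add: dsum_transpose[of _ m _ 2] dsum_uminus[of _ m _ 2] dsum_eq_iff[of _ m _ 2])
      then obtain q r where qr: "m = q + 2 * r" "congruent_mat E' (0\<^sub>m q q \<oplus>\<^sub>d J_mat r)"
        using less.IH[of m E'] m E'(1) by auto
      have "congruent_mat (E' \<oplus>\<^sub>d G) ((0\<^sub>m q q \<oplus>\<^sub>d J_mat r) \<oplus>\<^sub>d J_mat 1)"
        by (rule congruent_mat_dsum[OF qr(2) cG])
      moreover have "congruent_mat ((0\<^sub>m q q \<oplus>\<^sub>d J_mat r) \<oplus>\<^sub>d J_mat 1) (0\<^sub>m q q \<oplus>\<^sub>d J_mat (Suc r))"
        unfolding dsum_assoc by (intro congruent_mat_dsum J_mat_Suc congruent_mat_refl[of _ q]) auto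
      ultimately have "congruent_mat S (0\<^sub>m q q \<oplus>\<^sub>d J_mat (Suc r))"
        using cS E'(2) by (metis congruent_mat_trans)
      then show ?thesis using qr(1) m by (intro exI[of _ q] exI[of _ "Suc r"]) auto
    qed
  qed
  then show ?thesis using that by blast
qed


section \<open>Hamiltonian matrices with respect to an arbitrary symplectic form\<close>

definition hamiltonian :: "real mat \<Rightarrow> bool" where
  "hamiltonian D \<longleftrightarrow> (\<exists>n. D \<in> carrier_mat n n \<and> (\<exists>W\<in>carrier_mat n n. transpose_mat W = - W \<and>
     det W \<noteq> 0 \<and> transpose_mat D * W = - (W * D)))"

lemma hamiltonianI:
  "D \<in> carrier_mat n n \<Longrightarrow> W \<in> carrier_mat n n \<Longrightarrow> transpose_mat W = - W \<Longrightarrow> det W \<noteq> 0 \<Longrightarrow>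
    transpose_mat D * W = - (W * D) \<Longrightarrow> hamiltonian D"
  unfolding hamiltonian_def by blast

lemma hamiltonianE:
  assumes "hamiltonian D" "D \<in> carrier_mat n n"
  obtains W where "W \<in> carrier_mat n n" "transpose_mat W = - W" "det W \<noteq> 0"
    "transpose_mat D * W = - (W * D)"
  using assms by (auto simp: hamiltonian_def)

lemma sp_iff:
  "D \<in> sp r \<longleftrightarrow> D \<in> carrier_mat (2 * r) (2 * r) \<and> transpose_mat D * J_mat r = - (J_mat r * D)"
proof (cases "D \<in> carrier_mat (2 * r) (2 * r)")
  case True
  then have "transpose_mat D * J_mat r \<in> carrier_mat (2 * r) (2 * r)"
    "J_mat r * D \<in> carrier_mat (2 * r) (2 * r)"
    by (auto intro!: mult_carrier_mat[of _ "2 * r" "2 * r"])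
  with True show ?thesis
    using mat_add_eq_zero_iff[of "transpose_mat D * J_mat r" "2 * r" "2 * r" "J_mat r * D"]
    by (simp add: sp_def)
qed (simp add: sp_def)

lemma sp_hamiltonian: "D \<in> sp r \<Longrightarrow> hamiltonian D"
  unfolding sp_iff by (intro hamiltonianI[of D "2 * r" "J_mat r"] J_mat_skew J_mat_det) auto

text \<open>The form is transported by congruence while the operator is transported by similarity.
  Stated for every form \<open>W\<close>: it is applied to symplectic forms and also to the
  degenerate restriction of a symplectic structure to the ideal.\<close>

lemma skew_adjoint_change_basis:
  fixes D :: "'a :: comm_ring_1 mat"
  assumes D: "D \<in> carrier_mat n n" and W: "W \<in> carrier_mat n n" and P: "P \<in> carrier_mat n n"
    and Q: "Q \<in> carrier_mat n n" and PQ: "P * Q = 1\<^sub>m n" and eq: "transpose_mat D * W = - (W * D)"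
  shows "transpose_mat (Q * D * P) * (transpose_mat P * W * P) =
    - ((transpose_mat P * W * P) * (Q * D * P))"
proof -
  let ?t = transpose_mat
  have c: "?t P \<in> carrier_mat n n" "?t Q \<in> carrier_mat n n" "?t D \<in> carrier_mat n n"
    "W * P \<in> carrier_mat n n"
    using D P Q W by auto
  have tq: "?t Q * ?t P = 1\<^sub>m n" unfolding transpose_mult[OF P Q, symmetric] PQ by simp
  have "?t (Q * D * P) = ?t P * (?t D * ?t Q)"
    using D P Q transpose_mult[of "Q * D" n n P n] transpose_mult[of Q n n D n]
      by (simp del: assoc_mult_mat)
  then have "?t (Q * D * P) * (?t P * W * P) = ?t P * (?t D * (?t Q * ?t P) * (W * P))"
    using D P Q W by (simp add: assoc_mult_mat[of _ n n _ n _ n])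
  also have "\<dots> = ?t P * (?t D * W * P)"
    unfolding tq using c W P by (simp add: assoc_mult_mat[of _ n n _ n _ n])
  also have "?t D * W * P = - (W * D * P)" unfolding eq using W D P by simp
  also have "?t P * - (W * D * P) = - (?t P * (W * (D * P)))" using c W D P by simp
  also have "D * P = P * Q * (D * P)" unfolding PQ using D P by simp
  also have "- (?t P * (W * (P * Q * (D * P)))) = - ((?t P * W * P) * (Q * D * P))"
    using D P Q W by (simp add: assoc_mult_mat[of _ n n _ n _ n])
  finally show ?thesis .
qed

text \<open>This invariance is the reason for leaving the form existential in
  \<open>hamiltonian\<close>: conjugation carries the form along, whereas membership in
  \<open>sp\<close> with its fixed \<open>J_mat\<close> is not preserved.\<close>

lemma hamiltonian_similar:
  assumes "similar_mat D E" "hamiltonian D"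
  shows "hamiltonian E"
proof -
  obtain n where D: "D \<in> carrier_mat n n" using similar_matD[OF assms(1)] by auto
  obtain P Q where P: "P \<in> carrier_mat n n" "Q \<in> carrier_mat n n" "P * Q = 1\<^sub>m n" "Q * P = 1\<^sub>m n"
    "E \<in> carrier_mat n n" "Q * D = E * Q" using similar_matE[OF assms(1) D] by metis
  obtain W where W: "W \<in> carrier_mat n n" "transpose_mat W = - W" "det W \<noteq> 0"
    "transpose_mat D * W = - (W * D)" using hamiltonianE[OF assms(2) D] .
  have "Q * D * P = E * (Q * P)" unfolding P(6) using P by (intro assoc_mult_mat) auto
  then have QDP: "Q * D * P = E" using P by simp
  have dP: "det P \<noteq> 0" using inverse_det_nonzero[OF P(1,2,3)] .
  have c: "congruent_mat W (transpose_mat P * W * P)" using congruent_matI[OF W(1) P(1) dP] by simp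
  show ?thesis
  proof (rule hamiltonianI[OF P(5)])
    show "transpose_mat (transpose_mat P * W * P) = - (transpose_mat P * W * P)"
      by (rule congruent_mat_skew[OF c W(2)])
    show "det (transpose_mat P * W * P) \<noteq> 0"
      using P W dP by (simp add: det_mult[of _ n] det_transpose)
    show "transpose_mat E * (transpose_mat P * W * P) = - (transpose_mat P * W * P * E)"
      using skew_adjoint_change_basis[OF D W(1) P(1,2,3) W(4)] unfolding QDP .
  qed (use P W in auto)
qed

text \<open>A basis in which the invariant form becomes \<open>J_mat r\<close> conjugates the matrix
  into \<open>sp r\<close>; in particular the size is even.\<close>

lemma hamiltonian_similar_sp:
  assumes "hamiltonian D"
  obtains r E where "E \<in> sp r" "similar_mat D E" "D \<in> carrier_mat (2 * r) (2 * r)"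
proof -
  obtain n where D: "D \<in> carrier_mat n n" using assms by (auto simp: hamiltonian_def)
  obtain W where W: "W \<in> carrier_mat n n" "transpose_mat W = - W" "det W \<noteq> 0"
    "transpose_mat D * W = - (W * D)" using hamiltonianE[OF assms D] .
  obtain q r where qr: "n = q + 2 * r" "congruent_mat W (0\<^sub>m q q \<oplus>\<^sub>d J_mat r)"
    using skew_normal_form[OF W(1,2)] .
  obtain P where P: "P \<in> carrier_mat n n" "det P \<noteq> 0" "0\<^sub>m q q \<oplus>\<^sub>d J_mat r = transpose_mat P * W * P"
    using congruent_matE[OF qr(2) W(1)] .
  have "det (0\<^sub>m q q \<oplus>\<^sub>d J_mat r) \<noteq> 0" unfolding P(3) using P(1,2) W
    by (simp add: det_mult[of _ n] det_transpose)
  \<comment> \<open>An invertible form leaves no zero block, since a zero matrix of positive size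
    has determinant 0.\<close>
  then have "det (0\<^sub>m q q :: real mat) \<noteq> 0" by (simp add: det_dsum[of _ q _ "2 * r"])
  then have q: "q = 0" by (metis det_zero gr0I)
  then have n: "n = 2 * r" using qr(1) by simp
  obtain Q where Q: "Q \<in> carrier_mat n n" "P * Q = 1\<^sub>m n" "Q * P = 1\<^sub>m n"
    using det_nonzero_inverse[OF P(1,2)] .
  define E where "E = Q * D * P"
  have E: "E \<in> carrier_mat n n" using P Q D by (simp add: E_def)
  have J: "J_mat r = transpose_mat P * W * P" using P(3) q by simp
  have "transpose_mat E * J_mat r = - (J_mat r * E)"
    unfolding J E_def by (rule skew_adjoint_change_basis[OF D W(1) P(1) Q(1,2) W(4)])
  then have "E \<in> sp r" using E n by (simp add: sp_iff)
  moreover have "similar_mat D E"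
  proof -
    have "P * E = P * Q * (D * P)" using P(1) Q(1) D
      by (simp add: E_def assoc_mult_mat[of _ n n _ n _ n])
    then have "D * P = P * E" using D P Q by simp
    then show ?thesis using D E P by (subst similar_mat_iff[of _ n]) auto
  qed
  ultimately show ?thesis using that D n by blast
qed

text \<open>The invariant form itself is the conjugating matrix. All symmetry of the spectrum under
  \<open>b\<close> and \<open>- b\<close>, with multiplicities and block sizes, comes from
  here.\<close>

lemma hamiltonian_similar_uminus_transpose:
  assumes "hamiltonian D"
  shows "similar_mat D (- transpose_mat D)"
proof -
  obtain n where D: "D \<in> carrier_mat n n" using assms by (auto simp: hamiltonian_def)
  obtain W where W: "W \<in> carrier_mat n n" "det W \<noteq> 0" "transpose_mat D * W = - (W * D)"
    using hamiltonianE[OF assms D] .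
  have "(- transpose_mat D) * W = W * D" using D W by simp
  then have "similar_mat (- transpose_mat D) D" using D W by (subst similar_mat_iff[of _ n]) auto
  then show ?thesis by (rule similar_mat_sym)
qed

lemma hamiltonian_eigenvalue_uminus:
  assumes "hamiltonian D"
  shows "eigenvalue D (- b) \<longleftrightarrow> eigenvalue D b"
proof -
  obtain n where D: "D \<in> carrier_mat n n" using assms by (auto simp: hamiltonian_def)
  then show ?thesis
    using eigenvalue_similar[OF hamiltonian_similar_uminus_transpose[OF assms], of b]
    by (simp add: eigenvalue_uminus[of _ n] eigenvalue_transpose[of _ n])
qed

lemma hamiltonian_dsum:
  assumes "hamiltonian D" "hamiltonian E"
  shows "hamiltonian (D \<oplus>\<^sub>d E)"
proof -
  obtain n where D: "D \<in> carrier_mat n n" using assms by (auto simp: hamiltonian_def)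
  obtain m where E: "E \<in> carrier_mat m m" using assms by (auto simp: hamiltonian_def)
  obtain W where W: "W \<in> carrier_mat n n" "transpose_mat W = - W" "det W \<noteq> 0"
    "transpose_mat D * W = - (W * D)" using hamiltonianE[OF assms(1) D] .
  obtain V where V: "V \<in> carrier_mat m m" "transpose_mat V = - V" "det V \<noteq> 0"
    "transpose_mat E * V = - (V * E)" using hamiltonianE[OF assms(2) E] .
  show ?thesis
    using D E W V
    by (intro hamiltonianI[of "D \<oplus>\<^sub>d E" "n + m" "W \<oplus>\<^sub>d V"])
      (simp_all add: dsum_transpose[of _ n _ m] dsum_uminus[of _ n _ m] dsum_mult[of _ n _ m]
        det_dsum[of _ n _ m])
qed

lemma hamiltonian_smult:
  assumes "hamiltonian D"
  shows "hamiltonian (c \<cdot>\<^sub>m D)"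
proof -
  obtain n where D: "D \<in> carrier_mat n n" using assms by (auto simp: hamiltonian_def)
  obtain W where W: "W \<in> carrier_mat n n" "transpose_mat W = - W" "det W \<noteq> 0"
    "transpose_mat D * W = - (W * D)" using hamiltonianE[OF assms D] .
  have "transpose_mat (c \<cdot>\<^sub>m D) = c \<cdot>\<^sub>m transpose_mat D" by (rule eq_matI) auto
  moreover have "c \<cdot>\<^sub>m (- (W * D)) = - (c \<cdot>\<^sub>m (W * D))" by (rule eq_matI) auto
  ultimately show ?thesis
    using D W
      by (intro hamiltonianI[of _ n W]) (simp_all add: mult_smult_distrib[of _ n n _ n]
      mult_smult_assoc_mat[of _ n n _ n])
qed

text \<open>A linear map together with minus its dual acts on the sum of a space and its dual space,
  and preserves the canonical symplectic form infinitesimally.\<close>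

lemma hamiltonian_uminus_transpose:
  assumes A: "A \<in> carrier_mat n n"
  shows "hamiltonian (A \<oplus>\<^sub>d (- transpose_mat A))"
proof (rule hamiltonianI)
  let ?D = "A \<oplus>\<^sub>d (- transpose_mat A)"
  show "?D \<in> carrier_mat (2 * n) (2 * n)" using dsum_carrier[of A n "- transpose_mat A" n] A
    by (simp add: mult_2)
  show "transpose_mat (J_mat n) = - J_mat n" "det (J_mat n) \<noteq> 0" by (rule J_mat_skew J_mat_det)+
  have "transpose_mat ?D = transpose_mat A \<oplus>\<^sub>d (- A)"
    using A by (simp add: dsum_transpose[of _ n _ n] transpose_uminus)
  also have "\<dots> * J_mat n = four_block_mat (0\<^sub>m n n) (- transpose_mat A) (- A) (0\<^sub>m n n)"
    using A unfolding J_mat_def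
    by (simp add: dsum_four_block[of _ n _ n], subst mult_four_block_mat[of _ n n _ n _ n]) auto
  also have "\<dots> = - four_block_mat (0\<^sub>m n n) (transpose_mat A) A (0\<^sub>m n n)"
    using A by (auto intro!: eq_matI)
  also have "four_block_mat (0\<^sub>m n n) (transpose_mat A) A (0\<^sub>m n n) = J_mat n * ?D"
    using A unfolding J_mat_def
    by (simp add: dsum_four_block[of _ n _ n], subst mult_four_block_mat[of _ n n _ n _ n]) auto
  finally show "transpose_mat ?D * J_mat n = - (J_mat n * ?D)" .
qed simp

lemma lower_jordan_uminus_transpose:
  "similar_mat (- transpose_mat (lower_jordan ns b)) (lower_jordan ns (- b))"
  using similar_mat_trans[OF similar_mat_uminus[OF lower_jordan_transpose, of ns b]
      lower_jordan_smult[of "- 1" ns b, folded uminus_mat_smult]] by simp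

text \<open>Minus the transpose of the blocks for \<open>b\<close> is similar to the blocks for
  \<open>- b\<close> of the same sizes. The case \<open>b = 0\<close> gives two equal nilpotent
  blocks, which is what odd sizes require.\<close>

lemma hamiltonian_lower_jordan_pair: "hamiltonian (lower_jordan ns b \<oplus>\<^sub>d lower_jordan ns (- b))"
  by (rule hamiltonian_similar[OF similar_mat_dsum[OF similar_mat_refl[OF lower_jordan_carrier]
        lower_jordan_uminus_transpose] hamiltonian_uminus_transpose[OF lower_jordan_carrier]])

lemma lower_jordan_block_dim [simp]:
  "dim_row (lower_jordan_block k b) = k" "dim_col (lower_jordan_block k b) = k"
  by (simp_all add: lower_jordan_block_def)

lemma hamiltonian_even_block:
  assumes "even k"
  shows "hamiltonian (lower_jordan_block k 0)"
proof (rule hamiltonianI)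
  let ?L = "lower_jordan_block k 0"
  \<comment> \<open>The form pairs the basis vectors \<open>i\<close> and \<open>k - 1 - i\<close>.
    Skewness of the shift forces the sign to alternate with \<open>i\<close>, and since
    \<open>k\<close> is even the two partners have opposite parity, which makes the form
    skew-symmetric.\<close>
  define W :: "real mat" where "W = mat k k (\<lambda>(i, j). if j = k - 1 - i then (- 1) ^ i else 0)"
  show W: "W \<in> carrier_mat k k" by (simp add: W_def)
  have sgn: "(- 1 :: real) ^ (k - Suc i) = - ((- 1) ^ i)" if "i < k" for i
  proof -
    have "even (k - Suc i) \<longleftrightarrow> odd i" using assms that by presburger
    then show ?thesis by (cases "even i") auto
  qed
  have flip: "i < k \<Longrightarrow> j < k \<Longrightarrow> i = k - Suc j \<longleftrightarrow> j = k - Suc i" for i j by auto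
  show "transpose_mat W = - W"
    by (rule eq_matI) (auto simp: W_def flip sgn)
  have left: "(W * B) $$ (i, j) = (- 1) ^ i * B $$ (k - 1 - i, j)" if "B \<in> carrier_mat k k"
    "i < k" "j < k" for B i j
  proof -
    have "(W * B) $$ (i, j) = (\<Sum>l\<in>{0..<k}. W $$ (i, l) * B $$ (l, j))"
      using that W by (simp add: scalar_prod_def)
    also have "\<dots> = (\<Sum>l\<in>{0..<k}. if l = k - 1 - i then (- 1) ^ i * B $$ (l, j) else 0)"
      using that by (intro sum.cong) (auto simp: W_def)
    also have "\<dots> = (- 1) ^ i * B $$ (k - 1 - i, j)" using that by simp
    finally show ?thesis .
  qed
  have "W * (- W) = 1\<^sub>m k"
  proof (rule eq_matI)
    fix i j assume "i < dim_row (1\<^sub>m k :: real mat)" "j < dim_col (1\<^sub>m k :: real mat)"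
    then have ij: "i < k" "j < k" by auto
    have "- W \<in> carrier_mat k k" using W by simp
    then show "(W * - W) $$ (i, j) = 1\<^sub>m k $$ (i, j)"
      unfolding left[OF \<open>- W \<in> _\<close> ij] using ij sgn[of i]
      by (auto simp: W_def simp flip: power_mult_distrib)
  qed (use W in auto)
  then show "det W \<noteq> 0" using W by (intro inverse_det_nonzero[of W k "- W"]) auto
  have L: "?L $$ (i, j) = (if i = Suc j then 1 else 0)" if "i < k" "j < k" for i j
    using that by (auto simp: lower_jordan_block_def)
  show "transpose_mat ?L * W = - (W * ?L)"
  proof (rule eq_matI)
    fix i j assume "i < dim_row (- (W * ?L))" "j < dim_col (- (W * ?L))"
    then have ij: "i < k" "j < k" using W lower_jordan_block_carrier[of k 0] by auto
    have "(transpose_mat ?L * W) $$ (i, j) = (\<Sum>l\<in>{0..<k}. ?L $$ (l, i) * W $$ (l, j))"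
      using ij W lower_jordan_block_carrier[of k 0] by (simp add: scalar_prod_def)
    also have "\<dots> = (\<Sum>l\<in>{0..<k}. if l = Suc i then W $$ (l, j) else 0)"
      using ij by (intro sum.cong) (auto simp: L)
    also have "\<dots> = (if Suc i < k then W $$ (Suc i, j) else 0)" by simp
    also have "\<dots> = - ((- 1) ^ i * ?L $$ (k - 1 - i, j))"
      using ij by (auto simp: L W_def)
    also have "\<dots> = (- (W * ?L)) $$ (i, j)"
      using left[OF lower_jordan_block_carrier ij] ij W lower_jordan_block_carrier[of k 0] by simp
    finally show "(transpose_mat ?L * W) $$ (i, j) = (- (W * ?L)) $$ (i, j)" .
  qed (use W lower_jordan_block_carrier[of k 0] in auto)
qed simp

text \<open>Single even blocks and pairs of equal odd blocks are Hamiltonian; the list is exhausted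
  by removing one of these at a time, which preserves the parity condition.\<close>

lemma hamiltonian_nilpotent_jordan:
  assumes "\<And>k. odd k \<Longrightarrow> even (count (mset ns) k)"
  shows "hamiltonian (lower_jordan ns 0)"
  using assms
proof (induction "length ns" arbitrary: ns rule: less_induct)
  case less
  consider "ns = []" | k where "k \<in> set ns" "even k" | k where "k \<in> set ns" "odd k"
    by (metis last_in_set)
  then show ?case
  proof cases
    case 1
    then show ?thesis by (intro hamiltonianI[of _ 0 "0\<^sub>m 0 0"]) auto
  next
    case 2
    then have m: "mset (k # remove1 k ns) = mset ns" by simp
    have "hamiltonian (lower_jordan (remove1 k ns) 0)"
    proof (rule less.hyps)
      show "length (remove1 k ns) < length ns" using 2(1) length_pos_if_in_set[OF 2(1)]
        by (simp add: length_remove1)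
      show "even (count (mset (remove1 k ns)) l)" if "odd l" for l
        using less.prems[OF that] that 2(2) by auto
    qed
    then have "hamiltonian (lower_jordan (k # remove1 k ns) 0)"
      unfolding lower_jordan_Cons by (intro hamiltonian_dsum hamiltonian_even_block 2)
    then show ?thesis using hamiltonian_similar[OF lower_jordan_similar_mset[OF m]] by blast
  next
    case 3
    have c: "count (mset ns) k > 0" "even (count (mset ns) k)" using 3 less.prems
      by (auto simp: count_greater_zero_iff)
    then have "count (mset ns) k > 1" by presburger
    then have "count (mset (remove1 k ns)) k > 0" by simp
    then have k2: "k \<in> set (remove1 k ns)" by (metis count_greater_zero_iff set_mset_mset)
    define ms where "ms = remove1 k (remove1 k ns)"
    have m: "mset ([k] @ [k] @ ms) = mset ns"
    proof -
      have r: "mset (k # remove1 k xs) = mset xs" if "k \<in> set xs" for xs using that by simp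
      have "mset (k # remove1 k (remove1 k ns)) = mset (remove1 k ns)" by (rule r[OF k2])
      moreover have "mset (k # remove1 k ns) = mset ns" by (rule r[OF 3(1)])
      ultimately show ?thesis unfolding ms_def by (metis append_Cons append_Nil mset.simps(2))
    qed
    have len: "length ms < length ns" using mset_eq_length[OF m] by simp
    have "hamiltonian (lower_jordan ms 0)"
    proof (rule less.hyps[OF len])
      show "even (count (mset ms) l)" if "odd l" for l
        using less.prems[OF that] unfolding m[symmetric] by (simp split: if_splits)
    qed
    then have "hamiltonian ((lower_jordan [k] 0 \<oplus>\<^sub>d lower_jordan [k] 0) \<oplus>\<^sub>d lower_jordan ms 0)"
      using hamiltonian_lower_jordan_pair[of "[k]" 0]
        by (intro hamiltonian_dsum[of "_ \<oplus>\<^sub>d _"]) simp_all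
    then have "hamiltonian (lower_jordan ([k] @ [k] @ ms) 0)"
      unfolding lower_jordan_append dsum_assoc .
    then show ?thesis using hamiltonian_similar[OF lower_jordan_similar_mset[OF m]] by blast
  qed
qed

text \<open>The condition \<open>z\<close> says that the off-diagonal block of every invariant form
  vanishes. The form is then block diagonal, and its diagonal blocks are skew, invertible and
  invariant for the two summands.\<close>

lemma hamiltonian_dsumD:
  assumes D: "D \<in> carrier_mat n n" and E: "E \<in> carrier_mat m m" and h: "hamiltonian (D \<oplus>\<^sub>d E)"
    and z: "\<And>X. X \<in> carrier_mat n m \<Longrightarrow> transpose_mat D * X = X * (- E) \<Longrightarrow> X = 0\<^sub>m n m"
  shows "hamiltonian D" "hamiltonian E"
proof -
  obtain W where W: "W \<in> carrier_mat (n + m) (n + m)" "transpose_mat W = - W" "det W \<noteq> 0"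
    "transpose_mat (D \<oplus>\<^sub>d E) * W = - (W * (D \<oplus>\<^sub>d E))" using hamiltonianE[OF h dsum_carrier[OF D E]] .
  obtain A X Y C where b: "W = four_block_mat A X Y C" "A \<in> carrier_mat n n" "X \<in> carrier_mat n m"
    "Y \<in> carrier_mat m n" "C \<in> carrier_mat m m" using four_block_cases[OF W(1)] .
  have "four_block_mat (transpose_mat A) (transpose_mat Y) (transpose_mat X) (transpose_mat C) =
    four_block_mat (- A) (- X) (- Y) (- C)"
    using W(2) b(2-) unfolding b(1) transpose_four_block_mat[OF b(2-5)] by (auto intro!: eq_matI)
  then have t: "transpose_mat A = - A" "transpose_mat Y = - X" "transpose_mat C = - C"
    using b(2-) by (subst (asm) four_block_eq_iff[of _ n n _ m _ m]; simp)+
  have "transpose_mat (D \<oplus>\<^sub>d E) * W = W * (- (D \<oplus>\<^sub>d E))"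
    unfolding W(4) using W(1) D E by simp
  then have "(transpose_mat D \<oplus>\<^sub>d transpose_mat E) * W = W * ((- D) \<oplus>\<^sub>d (- E))"
    by (simp add: dsum_transpose[OF D E] dsum_uminus[OF D E])
  then have eq: "transpose_mat D * A = A * (- D)" "transpose_mat D * X = X * (- E)"
    "transpose_mat E * C = C * (- E)"
    unfolding b(1) using D E b(2-) by (simp_all add: dsum_intertwine_iff[of _ n _ m])
  have X: "X = 0\<^sub>m n m" using z[OF b(3) eq(2)] .
  have "det W = det A * det C"
  proof -
    have "transpose_mat (transpose_mat Y) = 0\<^sub>m m n" unfolding t(2) X by (auto intro!: eq_matI)
    then have "Y = 0\<^sub>m m n" by simp
    then show ?thesis unfolding b(1) X using b
      by (simp add: det_four_block_mat_lower_left_zero[of _ n _ m])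
  qed
  then have d: "det A \<noteq> 0" "det C \<noteq> 0" using W(3) by auto
  show "hamiltonian D" using hamiltonianI[OF D b(2) t(1) d(1)] eq(1) b(2) D by simp
  show "hamiltonian E" using hamiltonianI[OF E b(5) t(3) d(2)] eq(3) b(5) E by simp
qed

text \<open>An off-diagonal block of the form intertwines the nilpotent transpose of the Jordan part
  with \<open>- Q\<close>, which does not have the eigenvalue 0.\<close>

lemma hamiltonian_split_zero:
  assumes Q: "Q \<in> carrier_mat m m" and ev: "\<not> eigenvalue Q 0"
    and h: "hamiltonian (lower_jordan ns 0 \<oplus>\<^sub>d Q)"
  shows "hamiltonian (lower_jordan ns 0)" "hamiltonian Q"
proof -
  let ?L = "lower_jordan ns 0"
  have z: "X = 0\<^sub>m (sum_list ns) m"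
    if "X \<in> carrier_mat (sum_list ns) m" "transpose_mat ?L * X = X * (- Q)" for X
  proof (rule intertwine_zero[OF _ _ that])
    show "char_matrix (transpose_mat ?L) 0 ^\<^sub>m sum_list ns = 0\<^sub>m (sum_list ns) (sum_list ns)"
      by (intro similar_char_matrix_pow_zero[OF lower_jordan_transpose] lower_jordan_nilpotent) auto
    show "\<not> eigenvalue (- Q) 0" using ev Q by (simp add: eigenvalue_uminus)
  qed (use Q in auto)
  show "hamiltonian ?L" "hamiltonian Q"
    using hamiltonian_dsumD[OF lower_jordan_carrier Q h] z by auto
qed

text \<open>The eigenspaces for \<open>b\<close> and \<open>- b\<close> are paired with each other
  by the form, so neither is Hamiltonian alone and they have to be split off together. The sizes are
  compared through similarity with minus the transpose.\<close>

lemma hamiltonian_split_pair: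
  assumes Q: "Q \<in> carrier_mat m m" and b: "b \<noteq> 0" and ev: "\<not> eigenvalue Q b" "\<not> eigenvalue Q (- b)"
    and ns: "0 \<notin> set ns" "0 \<notin> set ms"
    and h: "hamiltonian (lower_jordan ns b \<oplus>\<^sub>d lower_jordan ms (- b) \<oplus>\<^sub>d Q)"
  shows "mset ns = mset ms" "hamiltonian Q"
proof -
  let ?L = "lower_jordan ns b" and ?M = "lower_jordan ms (- b)"
  let ?s = "sum_list ns" and ?t = "sum_list ms"
  \<comment> \<open>Minus the transpose turns the sizes \<open>ns\<close> at \<open>b\<close> into
    sizes at \<open>- b\<close> and the sizes \<open>ms\<close> at \<open>- b\<close> into sizes at
    \<open>b\<close>. After reordering, cancelling at \<open>b\<close> compares \<open>ns\<close>
    with \<open>ms\<close>.\<close>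
  have "similar_mat (?L \<oplus>\<^sub>d ?M \<oplus>\<^sub>d Q) (- transpose_mat (?L \<oplus>\<^sub>d ?M \<oplus>\<^sub>d Q))"
    by (rule hamiltonian_similar_uminus_transpose[OF h])
  also have "- transpose_mat (?L \<oplus>\<^sub>d ?M \<oplus>\<^sub>d Q) =
      (- transpose_mat ?L) \<oplus>\<^sub>d (- transpose_mat ?M) \<oplus>\<^sub>d (- transpose_mat Q)"
    using Q dsum_carrier[OF lower_jordan_carrier[of ms "- b"] Q]
    by (simp add: dsum_transpose[of _ ?s _ "?t + m"] dsum_transpose[of _ ?t _ m]
        dsum_uminus[of _ ?s _ "?t + m"] dsum_uminus[of _ ?t _ m])
  finally have "similar_mat (?L \<oplus>\<^sub>d ?M \<oplus>\<^sub>d Q) ((- transpose_mat ?L) \<oplus>\<^sub>d (- transpose_mat ?M) \<oplus>\<^sub>d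
    (- transpose_mat Q))" .
  moreover have "similar_mat ((- transpose_mat ?L) \<oplus>\<^sub>d (- transpose_mat ?M) \<oplus>\<^sub>d (- transpose_mat Q))
      (lower_jordan ns (- b) \<oplus>\<^sub>d lower_jordan ms b \<oplus>\<^sub>d (- transpose_mat Q))"
    using lower_jordan_uminus_transpose[of ms "- b"] Q
    by (intro similar_mat_dsum lower_jordan_uminus_transpose similar_mat_refl[of _ m]) auto
  moreover have "similar_mat (lower_jordan ns (- b) \<oplus>\<^sub>d lower_jordan ms b \<oplus>\<^sub>d (- transpose_mat Q))
      (lower_jordan ms b \<oplus>\<^sub>d lower_jordan ns (- b) \<oplus>\<^sub>d (- transpose_mat Q))"
    unfolding dsum_assoc[symmetric] using Q
    by (intro similar_mat_dsum similar_mat_dsum_commute[of _ ?s _ ?t] similar_mat_refl[of _ m]) auto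
  ultimately have sim: "similar_mat (?L \<oplus>\<^sub>d ?M \<oplus>\<^sub>d Q)
      (lower_jordan ms b \<oplus>\<^sub>d lower_jordan ns (- b) \<oplus>\<^sub>d (- transpose_mat Q))"
    by (metis similar_mat_trans)
  show "mset ns = mset ms"
  proof (rule jordan_cancel(1)[OF ns _ _ _ _ sim])
    show "?M \<oplus>\<^sub>d Q \<in> carrier_mat (?t + m) (?t + m)" using Q by simp
    show "lower_jordan ns (- b) \<oplus>\<^sub>d (- transpose_mat Q) \<in> carrier_mat (?s + m) (?s + m)" using Q
      by simp
    show "\<not> eigenvalue (?M \<oplus>\<^sub>d Q) b"
      using ev b Q by (simp add: eigenvalue_dsum[of _ ?t _ m] eigenvalue_lower_jordan)
    show "\<not> eigenvalue (lower_jordan ns (- b) \<oplus>\<^sub>d (- transpose_mat Q)) b"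
      using ev b Q
        by (simp add: eigenvalue_dsum[of _ ?s _ m] eigenvalue_lower_jordan eigenvalue_uminus[of _ m]
          eigenvalue_transpose[of _ m])
  qed
  let ?E = "?L \<oplus>\<^sub>d ?M" and ?n = "?s + ?t"
  let ?F = "transpose_mat ?E"
  have E: "?E \<in> carrier_mat ?n ?n" by simp
  have F: "?F = transpose_mat ?L \<oplus>\<^sub>d transpose_mat ?M" by (simp add: dsum_transpose[of _ ?s _ ?t])
  have L: "char_matrix (transpose_mat ?L) b ^\<^sub>m ?s = 0\<^sub>m ?s ?s"
    "char_matrix (transpose_mat ?M) (- b) ^\<^sub>m ?t = 0\<^sub>m ?t ?t"
    by (intro similar_char_matrix_pow_zero[OF lower_jordan_transpose] lower_jordan_nilpotent; auto)+
  have c: "char_matrix (transpose_mat ?L) (- b) ^\<^sub>m ?t \<in> carrier_mat ?s ?s"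
    "char_matrix (transpose_mat ?M) b ^\<^sub>m ?s \<in> carrier_mat ?t ?t"
    by (intro pow_carrier_mat char_matrix_closed; simp)+
  \<comment> \<open>Two eigenvalues need a product of two powers: each factor annihilates one
    summand, and it does not matter what it does on the other.\<close>
  have nil: "char_matrix ?F (- b) ^\<^sub>m ?t * char_matrix ?F b ^\<^sub>m ?s = 0\<^sub>m ?n ?n"
    unfolding F using L
    by (simp add: char_matrix_dsum[of _ ?s _ ?t] dsum_pow[of _ ?s _ ?t] dsum_mult[of _ ?s _ ?t]
      pow_carrier_mat
        right_mult_zero_mat[OF c(1)] left_mult_zero_mat[OF c(2)])
  show "hamiltonian Q"
  proof (rule hamiltonian_dsumD(2)[OF E Q])
    show "hamiltonian (?E \<oplus>\<^sub>d Q)" using h unfolding dsum_assoc .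
    fix X assume X: "X \<in> carrier_mat ?n m" "?F * X = X * (- Q)"
    have F': "?F \<in> carrier_mat ?n ?n" using E by (rule transpose_carrier_mat[THEN iffD2])
    have Q': "- Q \<in> carrier_mat m m" using Q by simp
    have ch: "char_matrix ?F c \<in> carrier_mat ?n ?n" "char_matrix (- Q) c \<in> carrier_mat m m" for c
      using F' Q' by (auto intro: char_matrix_closed)
    have pw: "char_matrix ?F c ^\<^sub>m k * X = X * char_matrix (- Q) c ^\<^sub>m k" for c k
      using intertwine_pow[OF ch X(1) intertwine_char_matrix[OF F' Q' X]] .
    let ?A = "char_matrix ?F (- b) ^\<^sub>m ?t" and ?B = "char_matrix ?F b ^\<^sub>m ?s"
    let ?G = "char_matrix (- Q) (- b) ^\<^sub>m ?t" and ?H = "char_matrix (- Q) b ^\<^sub>m ?s"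
    have c: "?A \<in> carrier_mat ?n ?n" "?B \<in> carrier_mat ?n ?n" "?G \<in> carrier_mat m m"
      "?H \<in> carrier_mat m m"
      using ch by (auto intro: pow_carrier_mat)
    \<comment> \<open>The two powers are moved one after the other from the right of
      \<open>X\<close> to its left, where their product is zero; on the right their product is
      invertible.\<close>
    have "X * (?G * ?H) = X * ?G * ?H" by (rule assoc_mult_mat[OF X(1) c(3,4), symmetric])
    also have "\<dots> = ?A * X * ?H" unfolding pw ..
    also have "\<dots> = ?A * (X * ?H)" by (rule assoc_mult_mat[OF c(1) X(1) c(4)])
    also have "\<dots> = ?A * (?B * X)" unfolding pw ..
    also have "\<dots> = ?A * ?B * X" by (rule assoc_mult_mat[OF c(1,2) X(1), symmetric])
    also have "\<dots> = 0\<^sub>m ?n m" unfolding nil using X by simp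
    finally have z: "X * (?G * ?H) = 0\<^sub>m ?n m" .
    have "det ?G \<noteq> 0" "det ?H \<noteq> 0"
      using ev Q Q' ch
        by (auto simp: det_pow_mat[of _ m] eigenvalue_det[symmetric] eigenvalue_uminus)
    then have "det (?G * ?H) \<noteq> 0" using c by (simp add: det_mult[of _ m])
    then show "X = 0\<^sub>m ?n m" using mult_invertible_zero[OF X(1) _ _ z] c by simp
  qed
qed

subsection \<open>Isomorphisms and symplectic structures of almost abelian Lie algebras\<close>

lemma lie_iso_refl: "lie_iso L L"
  unfolding lie_iso_def by (intro exI[of _ "\<lambda>x. x"]) (auto simp: bij_betw_def)

lemma lie_iso_trans:
  assumes "lie_iso L L'" "lie_iso L' L''"
  shows "lie_iso L L''"
proof -
  obtain f g where f: "bij_betw f (carrier L) (carrier L')"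
    "\<forall>x\<in>carrier L. \<forall>y\<in>carrier L. f (x \<oplus>\<^bsub>L\<^esub> y) = f x \<oplus>\<^bsub>L'\<^esub> f y"
    "\<forall>a. \<forall>x\<in>carrier L. f (a \<odot>\<^bsub>L\<^esub> x) = a \<odot>\<^bsub>L'\<^esub> f x"
    "\<forall>x\<in>carrier L. \<forall>y\<in>carrier L. f (lie_bracket L x y) = lie_bracket L' (f x) (f y)"
    and g: "bij_betw g (carrier L') (carrier L'')"
    "\<forall>x\<in>carrier L'. \<forall>y\<in>carrier L'. g (x \<oplus>\<^bsub>L'\<^esub> y) = g x \<oplus>\<^bsub>L''\<^esub> g y"
    "\<forall>a. \<forall>x\<in>carrier L'. g (a \<odot>\<^bsub>L'\<^esub> x) = a \<odot>\<^bsub>L''\<^esub> g x"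
    "\<forall>x\<in>carrier L'. \<forall>y\<in>carrier L'. g (lie_bracket L' x y) = lie_bracket L'' (g x) (g y)"
    using assms unfolding lie_iso_def by blast
  show ?thesis unfolding lie_iso_def
  proof (intro exI[of _ "g \<circ> f"] conjI)
    show "bij_betw (g \<circ> f) (carrier L) (carrier L'')" using f(1) g(1) by (rule bij_betw_trans)
  qed (use f g bij_betwE[OF f(1)] in auto)
qed

lemma lie_iso_sym:
  assumes L: "real_lie_algebra L" and iso: "lie_iso L L'"
  shows "lie_iso L' L"
proof -
  interpret real_lie_algebra L by (rule L)
  obtain f where f: "bij_betw f (carrier L) (carrier L')"
    "\<And>x y. x \<in> carrier L \<Longrightarrow> y \<in> carrier L \<Longrightarrow> f (x \<oplus>\<^bsub>L\<^esub> y) = f x \<oplus>\<^bsub>L'\<^esub> f y"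
    "\<And>a x. x \<in> carrier L \<Longrightarrow> f (a \<odot>\<^bsub>L\<^esub> x) = a \<odot>\<^bsub>L'\<^esub> f x"
    "\<And>x y. x \<in> carrier L \<Longrightarrow> y \<in> carrier L \<Longrightarrow> f (lie_bracket L x y) = lie_bracket L' (f x) (f y)"
    using iso unfolding lie_iso_def by blast
  define g where "g = inv_into (carrier L) f"
  have g: "bij_betw g (carrier L') (carrier L)" unfolding g_def by (rule bij_betw_inv_into[OF f(1)])
  have gc: "y \<in> carrier L' \<Longrightarrow> g y \<in> carrier L" for y using g by (auto simp: bij_betw_def)
  have fg: "y \<in> carrier L' \<Longrightarrow> f (g y) = y" for y
    unfolding g_def using f(1) by (rule bij_betw_inv_into_right)
  have gf: "x \<in> carrier L \<Longrightarrow> g (f x) = x" for x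
    unfolding g_def using f(1) by (rule bij_betw_inv_into_left)
  have sc: "x \<in> carrier L \<Longrightarrow> a \<odot>\<^bsub>L\<^esub> x \<in> carrier L" for a x
    by (intro smult_closed) (simp_all add: class_ring_simps)
  show ?thesis unfolding lie_iso_def
  proof (intro exI[of _ g] conjI ballI allI)
    show "bij_betw g (carrier L') (carrier L)" by (rule g)
    fix x y assume xy: "x \<in> carrier L'" "y \<in> carrier L'"
    show "g (x \<oplus>\<^bsub>L'\<^esub> y) = g x \<oplus>\<^bsub>L\<^esub> g y"
      using f(2)[OF gc gc, OF xy] gf[of "g x \<oplus>\<^bsub>L\<^esub> g y"] gc fg xy by simp
    show "g (lie_bracket L' x y) = lie_bracket L (g x) (g y)"
      using f(4)[OF gc gc, OF xy] gf[of "lie_bracket L (g x) (g y)"] gc fg xy bracket_closed by simp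
  next
    fix a x assume x: "x \<in> carrier L'"
    show "g (a \<odot>\<^bsub>L'\<^esub> x) = a \<odot>\<^bsub>L\<^esub> g x"
      using f(3)[OF gc, OF x, of a] gf[OF sc[OF gc[OF x]], of a] fg x by simp
  qed
qed

lemma iso_class_eq_iff:
  assumes "real_lie_algebra L" "real_lie_algebra L'"
  shows "iso_class L = iso_class L' \<longleftrightarrow> lie_iso L L'"
proof
  assume "iso_class L = iso_class L'"
  moreover have "L' \<in> iso_class L'" using assms lie_iso_refl by (simp add: iso_class_def)
  ultimately show "lie_iso L L'" by (auto simp: iso_class_def)
next
  assume h: "lie_iso L L'"
  then have h': "lie_iso L' L" using assms(1) lie_iso_sym by blast
  show "iso_class L = iso_class L'"
    unfolding iso_class_def using h h' lie_iso_trans by blast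
qed

section \<open>Isomorphism of almost abelian Lie algebras as similarity up to a factor\<close>

lemma almost_abelian_simps [simp]:
  assumes "A \<in> carrier_mat n n"
  shows "carrier (almost_abelian A) = UNIV \<times> carrier_vec n"
    "\<zero>\<^bsub>almost_abelian A\<^esub> = (0, 0\<^sub>v n)"
    "(s, v) \<oplus>\<^bsub>almost_abelian A\<^esub> (t, w) = (s + t, v + w)"
    "a \<odot>\<^bsub>almost_abelian A\<^esub> (s, v) = (a * s, a \<cdot>\<^sub>v v)"
    "lie_bracket (almost_abelian A) (s, v) (t, w) = (0, s \<cdot>\<^sub>v (A *\<^sub>v w) - t \<cdot>\<^sub>v (A *\<^sub>v v))"
  using assms by (auto simp: almost_abelian_def)

text \<open>The truncations \<open>u k\<close> of \<open>v\<close> add one coordinate at a time,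
  which turns additivity for two summands into the full sum by induction on
  \<open>k\<close>.\<close>

lemma linear_functional_representation:
  fixes \<phi> :: "'a :: field vec \<Rightarrow> 'a"
  assumes add: "\<And>v w. v \<in> carrier_vec n \<Longrightarrow> w \<in> carrier_vec n \<Longrightarrow> \<phi> (v + w) = \<phi> v + \<phi> w"
    and smult: "\<And>a v. v \<in> carrier_vec n \<Longrightarrow> \<phi> (a \<cdot>\<^sub>v v) = a * \<phi> v"
    and v: "v \<in> carrier_vec n"
  shows "\<phi> v = (\<Sum>i<n. v $ i * \<phi> (unit_vec n i))"
proof -
  define u where "u k = vec n (\<lambda>i. if i < k then v $ i else 0)" for k
  have u: "u k \<in> carrier_vec n" for k by (simp add: u_def)
  have "\<phi> (u k) = (\<Sum>i<k. v $ i * \<phi> (unit_vec n i))" if "k \<le> n" for k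
    using that
  proof (induction k)
    case 0
    have "u 0 = 0 \<cdot>\<^sub>v u 0" by (auto simp: u_def intro!: eq_vecI)
    then have "\<phi> (u 0) = 0" using smult[OF u, of 0 0] by simp
    then show ?case by simp
  next
    case (Suc k)
    have "u (Suc k) = u k + v $ k \<cdot>\<^sub>v unit_vec n k"
      using Suc.prems by (auto simp: u_def less_Suc_eq intro!: eq_vecI)
    then show ?case using Suc u by (simp add: add smult)
  qed
  moreover have "u n = v" using v by (auto simp: u_def intro!: eq_vecI)
  ultimately show ?thesis by auto
qed

lemma linear_map_matrix:
  fixes p :: "'a :: field vec \<Rightarrow> 'a vec"
  assumes c: "\<And>v. v \<in> carrier_vec n \<Longrightarrow> p v \<in> carrier_vec m"
    and add: "\<And>v w. v \<in> carrier_vec n \<Longrightarrow> w \<in> carrier_vec n \<Longrightarrow> p (v + w) = p v + p w"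
    and smult: "\<And>a v. v \<in> carrier_vec n \<Longrightarrow> p (a \<cdot>\<^sub>v v) = a \<cdot>\<^sub>v p v"
  obtains P where "P \<in> carrier_mat m n" "\<And>v. v \<in> carrier_vec n \<Longrightarrow> P *\<^sub>v v = p v"
proof -
  define P where "P = mat m n (\<lambda>(i, j). p (unit_vec n j) $ i)"
  have "P *\<^sub>v v = p v" if v: "v \<in> carrier_vec n" for v
  proof (rule eq_vecI)
    fix i assume "i < dim_vec (p v)"
    then have i: "i < m" using c[OF v] by auto
    have "p v $ i = (\<Sum>j<n. v $ j * p (unit_vec n j) $ i)"
    proof (rule linear_functional_representation[OF _ _ v])
      show "p (v + w) $ i = p v $ i + p w $ i" if "v \<in> carrier_vec n" "w \<in> carrier_vec n" for v w
        using that add[OF that] c[OF that(1)] c[OF that(2)] i by simp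
      show "p (a \<cdot>\<^sub>v v) $ i = a * p v $ i" if "v \<in> carrier_vec n" for a v
        using smult[OF that] c[OF that] i by simp
    qed
    also have "\<dots> = (P *\<^sub>v v) $ i"
      using v i by (simp add: P_def scalar_prod_def mult.commute lessThan_atLeast0)
    finally show "(P *\<^sub>v v) $ i = p v $ i" ..
  qed (use c[OF v] in \<open>simp add: P_def\<close>)
  then show ?thesis using that[of P] by (simp add: P_def)
qed

lemma zero_smult_vec: "(v :: 'a :: semiring_0 vec) \<in> carrier_vec n \<Longrightarrow> 0 \<cdot>\<^sub>v v = 0\<^sub>v n"
  by (auto intro!: eq_vecI)

lemma smult_mat_mult_vec:
  fixes A :: "'a :: comm_ring_1 mat"
  shows "A \<in> carrier_mat n m \<Longrightarrow> v \<in> carrier_vec m \<Longrightarrow> (c \<cdot>\<^sub>m A) *\<^sub>v v = c \<cdot>\<^sub>v (A *\<^sub>v v)"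
  by (auto intro!: eq_vecI)

lemma mat_eq_mult_vecI:
  fixes A :: "'a :: comm_ring_1 mat"
  assumes "A \<in> carrier_mat n m" "B \<in> carrier_mat n m" "\<And>v. v \<in> carrier_vec m \<Longrightarrow> A *\<^sub>v v = B *\<^sub>v v"
  shows "A = B"
proof (rule eq_matI)
  fix i j assume ij: "i < dim_row B" "j < dim_col B"
  have "col C j = C *\<^sub>v unit_vec m j" if "C \<in> carrier_mat n m" for C :: "'a mat"
    using that ij assms(2) by (intro eq_vecI) auto
  then have "col A j = col B j" using assms by simp
  then show "A $$ (i, j) = B $$ (i, j)" using ij assms(1,2) by (metis carrier_matD index_col)
qed (use assms in auto)

text \<open>The ideal is mapped by the conjugating matrix and \<open>e_0\<close> is rescaled to
  \<open>c e_0\<close>; the rescaling absorbs the factor \<open>c\<close>.\<close>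

lemma lie_iso_almost_abelianI:
  assumes A: "A \<in> carrier_mat n n" and B: "B \<in> carrier_mat n n" and c: "c \<noteq> 0"
    and sim: "similar_mat A (c \<cdot>\<^sub>m B)"
  shows "lie_iso (almost_abelian A) (almost_abelian B)"
proof -
  obtain P Q where P: "P \<in> carrier_mat n n" "Q \<in> carrier_mat n n" "P * Q = 1\<^sub>m n" "Q * P = 1\<^sub>m n"
    "Q * A = c \<cdot>\<^sub>m B * Q" using similar_matE[OF sim A] by metis
  have PQv: "P *\<^sub>v (Q *\<^sub>v v) = v" "Q *\<^sub>v (P *\<^sub>v v) = v" if "v \<in> carrier_vec n" for v
    using that P by (simp_all flip: assoc_mult_mat_vec[of _ n n _ n])
  have QA: "Q *\<^sub>v (A *\<^sub>v v) = c \<cdot>\<^sub>v (B *\<^sub>v (Q *\<^sub>v v))" if "v \<in> carrier_vec n" for v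
  proof -
    have "Q *\<^sub>v (A *\<^sub>v v) = (Q * A) *\<^sub>v v" using assoc_mult_mat_vec[OF P(2) A that] by simp
    also have "\<dots> = (c \<cdot>\<^sub>m B) *\<^sub>v (Q *\<^sub>v v)" unfolding P(5) using that P B
      by (intro assoc_mult_mat_vec) auto
    finally show ?thesis using that P B by (simp add: smult_mat_mult_vec[of _ n n])
  qed
  let ?f = "\<lambda>(s, v). (c * s, Q *\<^sub>v v)"
  show ?thesis unfolding lie_iso_def
  proof (intro exI[of _ ?f] conjI ballI allI)
    show "bij_betw ?f (carrier (almost_abelian A)) (carrier (almost_abelian B))"
      by (rule bij_betw_byWitness[of _ "\<lambda>(s, v). (s / c, P *\<^sub>v v)"])
        (use A B P c PQv in \<open>auto simp: almost_abelian_simps(1)[of _ n]\<close>)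
  next
    fix x y assume "x \<in> carrier (almost_abelian A)" "y \<in> carrier (almost_abelian A)"
    then obtain s v t w where x: "x = (s, v)" "v \<in> carrier_vec n" "y = (t, w)" "w \<in> carrier_vec n"
      using A by (auto simp: almost_abelian_simps(1)[of _ n])
    then show "?f (x \<oplus>\<^bsub>almost_abelian A\<^esub> y) = ?f x \<oplus>\<^bsub>almost_abelian B\<^esub> ?f y"
      using A B P
        by (simp add: almost_abelian_simps(3)[of _ n] algebra_simps mult_add_distrib_mat_vec[of _
        n n])
    have "Q *\<^sub>v (s \<cdot>\<^sub>v (A *\<^sub>v w) - t \<cdot>\<^sub>v (A *\<^sub>v v)) = s \<cdot>\<^sub>v (Q *\<^sub>v (A *\<^sub>v w)) - t \<cdot>\<^sub>v (Q *\<^sub>v (A *\<^sub>v v))"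
      using A P x by (simp add: mult_minus_distrib_mat_vec[of _ n n] mult_mat_vec[of _ n n])
    then show "?f (lie_bracket (almost_abelian A) x y) = lie_bracket (almost_abelian B) (?f x)
      (?f y)"
      using x A B P by (simp add: almost_abelian_simps(5)[of _ n] QA smult_smult_assoc mult.commute)
  next
    fix a x assume "x \<in> carrier (almost_abelian A)"
    then obtain s v where x: "x = (s, v)" "v \<in> carrier_vec n"
      using A by (auto simp: almost_abelian_simps(1)[of _ n])
    then show "?f (a \<odot>\<^bsub>almost_abelian A\<^esub> x) = a \<odot>\<^bsub>almost_abelian B\<^esub> ?f x"
      using A B P by (simp add: almost_abelian_simps(4)[of _ n] mult_mat_vec[of _ n n])
  qed
qed

text \<open>An isomorphism respects the abelian ideal \<open>\<real>\<^sup>n\<close> because the elements of the ideal are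
  exactly those whose adjoint map squares to zero on the ideal, as long as \<open>B\<^sup>2 \<noteq> 0\<close>.\<close>

lemma lie_iso_almost_abelianD:
  assumes A: "A \<in> carrier_mat n n" and B: "B \<in> carrier_mat n n"
    and nil: "\<not> nilpotent_mat A" "\<not> nilpotent_mat B"
    and iso: "lie_iso (almost_abelian A) (almost_abelian B)"
  obtains c where "c \<noteq> 0" "similar_mat A (c \<cdot>\<^sub>m B)"
proof -
  note sA = almost_abelian_simps[OF A] and sB = almost_abelian_simps[OF B]
  obtain f where f': "bij_betw f (carrier (almost_abelian A)) (carrier (almost_abelian B))"
    "\<And>x y. x \<in> carrier (almost_abelian A) \<Longrightarrow> y \<in> carrier (almost_abelian A) \<Longrightarrow>
      f (x \<oplus>\<^bsub>almost_abelian A\<^esub> y) = f x \<oplus>\<^bsub>almost_abelian B\<^esub> f y"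
    "\<And>a x. x \<in> carrier (almost_abelian A) \<Longrightarrow> f (a \<odot>\<^bsub>almost_abelian A\<^esub> x) = a \<odot>\<^bsub>almost_abelian B\<^esub> f x"
    "\<And>x y. x \<in> carrier (almost_abelian A) \<Longrightarrow> y \<in> carrier (almost_abelian A) \<Longrightarrow>
      f (lie_bracket (almost_abelian A) x y) = lie_bracket (almost_abelian B) (f x) (f y)"
    using iso unfolding lie_iso_def by blast
  note f = f'(1)[unfolded sA(1) sB(1)] and f_add = f'(2)[unfolded sA(1)]
    and f_smult = f'(3)[unfolded sA(1)] and f_br = f'(4)[unfolded sA(1)]
  have fc: "snd (f x) \<in> carrier_vec n" if "x \<in> UNIV \<times> carrier_vec n" for x
    using bij_betw_apply[OF f that] by (simp add: mem_Times_iff)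
  have z: "(0, 0\<^sub>v n) \<in> UNIV \<times> carrier_vec n" by simp
  have f0: "f (0, 0\<^sub>v n) = (0, 0\<^sub>v n)"
  proof -
    obtain s v where sv: "f (0, 0\<^sub>v n) = (s, v)" "v \<in> carrier_vec n" using fc[OF z]
      by (metis prod.collapse)
    then show ?thesis using f_smult[OF z, of 0] by (simp add: sA(4) sB(4) zero_smult_vec[of _ n])
  qed
  have fst0: "fst (f (0, v)) = 0" if v: "v \<in> carrier_vec n" for v
  proof (rule ccontr)
    assume s0: "fst (f (0, v)) \<noteq> 0"
    obtain s u where su: "f (0, v) = (s, u)" "u \<in> carrier_vec n" using fc[of "(0, v)"] v
      by (metis SigmaI UNIV_I prod.collapse)
    have "B * B = 0\<^sub>m n n"
    proof (rule mat_eq_mult_vecI[of _ n n])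
      fix w :: "real vec" assume w: "w \<in> carrier_vec n"
      then obtain t a where ta: "f (t, a) = (0, w)" "a \<in> carrier_vec n"
      proof -
        have "(0, w) \<in> f ` (UNIV \<times> carrier_vec n)" using bij_betw_imp_surj_on[OF f] w by simp
        then show ?thesis using that by auto
      qed
      have "lie_bracket (almost_abelian A) (0, v) (lie_bracket (almost_abelian A) (0, v) (t, a)) =
        (0, 0\<^sub>v n)"
        using A v ta by (auto simp: sA(5) intro!: eq_vecI)
      then have "f (0, 0\<^sub>v n) = lie_bracket (almost_abelian B) (s, u)
        (lie_bracket (almost_abelian B) (s, u) (0, w))"
        using f_br[of "(0, v)" "lie_bracket (almost_abelian A) (0, v) (t, a)"] f_br[of "(0, v)"
          "(t, a)"] A v ta su
        by (simp add: sA(5))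
      then have "0\<^sub>v n = s \<cdot>\<^sub>v (B *\<^sub>v (s \<cdot>\<^sub>v (B *\<^sub>v w) - 0 \<cdot>\<^sub>v (B *\<^sub>v u))) - 0 \<cdot>\<^sub>v (B *\<^sub>v u)"
        unfolding f0 by (simp add: sB(5))
      also have "\<dots> = s * s \<cdot>\<^sub>v ((B * B) *\<^sub>v w)"
      proof -
        have "s \<cdot>\<^sub>v (B *\<^sub>v w) - 0 \<cdot>\<^sub>v (B *\<^sub>v u) = s \<cdot>\<^sub>v (B *\<^sub>v w)" using B w su by (auto intro!: eq_vecI)
        moreover have "x - 0 \<cdot>\<^sub>v (B *\<^sub>v u) = x" if "x \<in> carrier_vec n" for x using B su that
          by (auto intro!: eq_vecI)
        ultimately show ?thesis using B w
          by (simp add: mult_mat_vec[of _ n n] smult_smult_assoc assoc_mult_mat_vec[of _ n n _ n])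
      qed
      finally have e: "s * s \<cdot>\<^sub>v ((B * B) *\<^sub>v w) = 0\<^sub>v n" by simp
      show "(B * B) *\<^sub>v w = 0\<^sub>m n n *\<^sub>v w"
      proof (rule eq_vecI)
        fix i assume "i < dim_vec (0\<^sub>m n n *\<^sub>v w)"
        then show "((B * B) *\<^sub>v w) $ i = (0\<^sub>m n n *\<^sub>v w) $ i"
          using arg_cong[OF e, of "\<lambda>x. x $ i"] s0 su(1) B w by simp
      qed (use B in auto)
    qed (use B in auto)
    then have "nilpotent_mat B" unfolding nilpotent_mat_def using B
      by (intro exI[of _ 2]) (simp add: numeral_2_eq_2)
    then show False using nil(2) by simp
  qed
  define p where "p v = snd (f (0, v))" for v
  have fp: "f (0, v) = (0, p v)" "p v \<in> carrier_vec n" if "v \<in> carrier_vec n" for v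
    using fst0[OF that] fc[of "(0, v)"] that by (simp_all add: p_def prod_eq_iff)
  obtain P where P: "P \<in> carrier_mat n n" "\<And>v. v \<in> carrier_vec n \<Longrightarrow> P *\<^sub>v v = p v"
  proof (rule linear_map_matrix)
    show "p v \<in> carrier_vec n" if "v \<in> carrier_vec n" for v using fp that by simp
    show "p (v + w) = p v + p w" if "v \<in> carrier_vec n" "w \<in> carrier_vec n" for v w
      using f_add[of "(0, v)" "(0, w)"] that fp by (simp add: sA(3) sB(3))
    show "p (a \<cdot>\<^sub>v v) = a \<cdot>\<^sub>v p v" if "v \<in> carrier_vec n" for a v
      using f_smult[of "(0, v)" a] that fp by (simp add: sA(4) sB(4))
  qed auto
  have dP: "det P \<noteq> 0"
  proof
    assume "det P = 0"
    then obtain v where v: "v \<in> carrier_vec n" "v \<noteq> 0\<^sub>v n" "P *\<^sub>v v = 0\<^sub>v n"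
      using det_0_iff_vec_prod_zero_field[OF P(1)] by auto
    then have "f (0, v) = f (0, 0\<^sub>v n)" using fp P f0 by simp
    then show False using f v by (auto simp: bij_betw_def inj_on_eq_iff)
  qed
  \<comment> \<open>The scalar \<open>c\<close> is the \<open>e_0\<close>-component of the image of
    \<open>e_0\<close>. The component \<open>u\<close> in the ideal commutes with the ideal, so
    bracketing with the image of \<open>e_0\<close> acts there as \<open>c B\<close>. If
    \<open>c\<close> were 0, \<open>A\<close> would be zero, hence nilpotent.\<close>
  obtain c u where cu: "f (1, 0\<^sub>v n) = (c, u)" "u \<in> carrier_vec n" using fc[of "(1, 0\<^sub>v n)"]
    by (metis SigmaI UNIV_I prod.collapse zero_carrier_vec)
  have PA: "P * A = c \<cdot>\<^sub>m B * P"
  proof (rule mat_eq_mult_vecI[of _ n n])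
    fix v :: "real vec" assume v: "v \<in> carrier_vec n"
    have m0: "x - 0 \<cdot>\<^sub>v (C *\<^sub>v y) = x" if "x \<in> carrier_vec n" "y \<in> carrier_vec n"
      "C \<in> carrier_mat n n" for C and x y :: "real vec"
      using that by (auto intro!: eq_vecI)
    have "f (0, A *\<^sub>v v) = lie_bracket (almost_abelian B) (f (1, 0\<^sub>v n)) (f (0, v))"
      using f_br[of "(1, 0\<^sub>v n)" "(0, v)"] v A by (simp add: sA(5) m0)
    then have "p (A *\<^sub>v v) = c \<cdot>\<^sub>v (B *\<^sub>v p v)"
      using fp v A B cu by (simp add: sB(5) m0)
    then show "(P * A) *\<^sub>v v = (c \<cdot>\<^sub>m B * P) *\<^sub>v v"
      using P A B v fp(2)[OF v]
        by (simp add: assoc_mult_mat_vec[of _ n n _ n] smult_mat_mult_vec[of _ n n])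
  qed (use P A B in auto)
  then have "similar_mat (c \<cdot>\<^sub>m B) A"
    using P(1) A B dP by (subst similar_mat_iff[of _ n]) auto
  moreover have "c \<noteq> 0"
  proof
    assume c: "c = 0"
    have "similar_mat A (0\<^sub>m n n)"
    proof -
      have "0 \<cdot>\<^sub>m B = 0\<^sub>m n n" using B by (auto intro!: eq_matI)
      then show ?thesis using similar_mat_sym[OF \<open>similar_mat (c \<cdot>\<^sub>m B) A\<close>] unfolding c by simp
    qed
    then obtain R T where "A = R * 0\<^sub>m n n * T" "R \<in> carrier_mat n n" "T \<in> carrier_mat n n"
      using similar_matE[of A "0\<^sub>m n n" n] A by metis
    then have "A = 0\<^sub>m n n" by simp
    then have "nilpotent_mat A" unfolding nilpotent_mat_def by (intro exI[of _ 1]) simp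
    then show False using nil(1) by simp
  qed
  ultimately show ?thesis using that similar_mat_sym by blast
qed

section \<open>Symplectic structures on almost abelian Lie algebras\<close>

lemma symplectic_structure_lie_iso:
  assumes A: "A \<in> carrier_mat n n" and B: "B \<in> carrier_mat n n"
    and iso: "lie_iso (almost_abelian A) (almost_abelian B)"
      and \<omega>: "symplectic_structure (almost_abelian B) \<omega>"
  obtains \<omega>' where "symplectic_structure (almost_abelian A) \<omega>'"
proof -
  let ?L = "almost_abelian A" and ?M = "almost_abelian B"
  obtain f where f: "bij_betw f (carrier ?L) (carrier ?M)"
    "\<And>x y. x \<in> carrier ?L \<Longrightarrow> y \<in> carrier ?L \<Longrightarrow> f (x \<oplus>\<^bsub>?L\<^esub> y) = f x \<oplus>\<^bsub>?M\<^esub> f y"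
    "\<And>a x. x \<in> carrier ?L \<Longrightarrow> f (a \<odot>\<^bsub>?L\<^esub> x) = a \<odot>\<^bsub>?M\<^esub> f x"
    "\<And>x y. x \<in> carrier ?L \<Longrightarrow> y \<in> carrier ?L \<Longrightarrow> f (lie_bracket ?L x y) = lie_bracket ?M (f x) (f y)"
    using iso unfolding lie_iso_def by blast
  have fc: "x \<in> carrier ?L \<Longrightarrow> f x \<in> carrier ?M" for x using f(1) by (auto simp: bij_betw_def)
  have z: "\<zero>\<^bsub>?L\<^esub> \<in> carrier ?L" using A by (simp add: almost_abelian_simps(1,2)[OF A])
  have f0: "f \<zero>\<^bsub>?L\<^esub> = \<zero>\<^bsub>?M\<^esub>"
  proof -
    obtain s v where sv: "f \<zero>\<^bsub>?L\<^esub> = (s, v)" "v \<in> carrier_vec n" using fc[OF z]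
      by (auto simp: almost_abelian_simps[OF B])
    then show ?thesis using f(3)[OF z, of 0]
      by (simp add: almost_abelian_simps[OF A] almost_abelian_simps[OF B] zero_smult_vec[of _ n])
  qed
  have "symplectic_structure ?L (\<lambda>x y. \<omega> (f x) (f y))"
    unfolding symplectic_structure_def
  proof (intro conjI ballI impI)
    show "two_form ?L (\<lambda>x y. \<omega> (f x) (f y))"
      using \<omega> fc unfolding symplectic_structure_def two_form_def by (simp add: f(2,3))
  next
    fix x assume x: "x \<in> carrier ?L" "\<forall>y\<in>carrier ?L. \<omega> (f x) (f y) = 0"
    have "\<forall>y\<in>carrier ?M. \<omega> (f x) y = 0" using x(2) bij_betw_imp_surj_on[OF f(1)] by (metis imageE)
    then have "f x = f \<zero>\<^bsub>?L\<^esub>" unfolding f0 using \<omega> fc[OF x(1)] by (simp add: symplectic_structure_def)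
    then show "x = \<zero>\<^bsub>?L\<^esub>" using f(1) x(1) z by (auto simp: bij_betw_def inj_on_eq_iff)
  next
    fix x y w assume "x \<in> carrier ?L" "y \<in> carrier ?L" "w \<in> carrier ?L"
    then show "\<omega> (f (lie_bracket ?L x y)) (f w) + \<omega> (f (lie_bracket ?L y w)) (f x) + \<omega>
      (f (lie_bracket ?L w x)) (f y) = 0"
      using \<omega> fc by (simp add: f(4) symplectic_structure_def)
  qed
  then show ?thesis by (rule that)
qed


lemma bilinear_matrix:
  fixes B :: "real vec \<Rightarrow> real vec \<Rightarrow> real"
  assumes add_left: "\<And>u v w. u \<in> carrier_vec n \<Longrightarrow> v \<in> carrier_vec n \<Longrightarrow> w \<in> carrier_vec n \<Longrightarrow>
      B (u + v) w = B u w + B v w"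
    and add_right: "\<And>u v w. u \<in> carrier_vec n \<Longrightarrow> v \<in> carrier_vec n \<Longrightarrow> w \<in> carrier_vec n \<Longrightarrow>
      B u (v + w) = B u v + B u w"
    and smult_left: "\<And>a v w. v \<in> carrier_vec n \<Longrightarrow> w \<in> carrier_vec n \<Longrightarrow> B (a \<cdot>\<^sub>v v) w = a * B v w"
    and smult_right: "\<And>a v w. v \<in> carrier_vec n \<Longrightarrow> w \<in> carrier_vec n \<Longrightarrow> B v (a \<cdot>\<^sub>v w) = a * B v w"
  obtains S where "S \<in> carrier_mat n n"
    "\<And>v w. v \<in> carrier_vec n \<Longrightarrow> w \<in> carrier_vec n \<Longrightarrow> B v w = v \<bullet> (S *\<^sub>v w)"
proof -
  define p where "p w = vec n (\<lambda>i. B (unit_vec n i) w)" for w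
  obtain S where S: "S \<in> carrier_mat n n" "\<And>w. w \<in> carrier_vec n \<Longrightarrow> S *\<^sub>v w = p w"
    by (rule linear_map_matrix[of n p n]) (auto simp: p_def add_right smult_right intro!: eq_vecI)
  have "B v w = v \<bullet> (S *\<^sub>v w)" if v: "v \<in> carrier_vec n" and w: "w \<in> carrier_vec n" for v w
  proof -
    have "B v w = (\<Sum>i<n. v $ i * B (unit_vec n i) w)"
      by (rule linear_functional_representation[OF _ _ v]) (simp_all add: add_left smult_left w)
    then show ?thesis by (simp add: S(2)[OF w] p_def scalar_prod_def lessThan_atLeast0)
  qed
  then show ?thesis using that S(1) by blast
qed

lemma unit_vec_mult_mat: 
  fixes S :: "real mat"
  assumes "S \<in> carrier_mat n n" "i < n" "j < n"
  shows "unit_vec n i \<bullet> (S *\<^sub>v unit_vec n j) = S $$ (i, j)"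
  using assms by simp

lemma scalar_prod_mult_mat_vec:
  fixes A :: "real mat"
  assumes "A \<in> carrier_mat n n" "v \<in> carrier_vec n" "w \<in> carrier_vec n"
  shows "(A *\<^sub>v v) \<bullet> w = v \<bullet> (transpose_mat A *\<^sub>v w)"
  using transpose_vec_mult_scalar[of "transpose_mat A" n n w v] assms
  by (simp add: comm_scalar_prod[of _ n])

text \<open>The invariant form of \<open>D\<close> is pulled back to the ideal. Its radical is
  spanned by the first basis vector, an eigenvector of the block matrix, and the missing direction
  is supplied by pairing \<open>e_0\<close> with it.\<close>

lemma symplectic_structure_block:
  assumes w: "w \<in> carrier_mat 1 m" and D: "D \<in> carrier_mat m m" and ham: "hamiltonian D"
  obtains \<omega>
    where "symplectic_structure (almost_abelian (four_block_mat (l \<cdot>\<^sub>m 1\<^sub>m 1) w (0\<^sub>m m 1) D)) \<omega>"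
proof -
  let ?n = "1 + m" and ?l = "l \<cdot>\<^sub>m 1\<^sub>m 1 :: real mat"
  let ?A = "four_block_mat ?l w (0\<^sub>m m 1) D"
  obtain W where W: "W \<in> carrier_mat m m" "transpose_mat W = - W" "det W \<noteq> 0"
    "transpose_mat D * W = - (W * D)"
    using hamiltonianE[OF ham D] .
  define S where "S = 0\<^sub>m 1 1 \<oplus>\<^sub>d W"
  have A: "?A \<in> carrier_mat ?n ?n" using D by (intro four_block_carrier_mat) auto
  have S: "S \<in> carrier_mat ?n ?n" using dsum_carrier[of "0\<^sub>m 1 1" 1 W m] W by (simp add: S_def)
  have Sb: "S = four_block_mat (0\<^sub>m 1 1) (0\<^sub>m 1 m) (0\<^sub>m m 1) W"
    unfolding S_def using W by (simp add: dsum_four_block[of _ 1 _ m])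
  have skew: "transpose_mat S = - S"
    using W by (simp add: S_def dsum_transpose[of _ 1 _ m] dsum_uminus[of _ 1 _ m])
      (auto intro!: eq_matI arg_cong2[where f = dsum])
  have "transpose_mat ?A = four_block_mat ?l (0\<^sub>m 1 m) (transpose_mat w) (transpose_mat D)"
    using w D
      by (simp add: transpose_four_block_mat[of _ 1 1 _ m _ m])
      (auto intro!: eq_matI cong_four_block_mat)
  then have "transpose_mat ?A * S = four_block_mat (0\<^sub>m 1 1) (0\<^sub>m 1 m) (0\<^sub>m m 1) (transpose_mat D * W)"
    unfolding Sb using w D W by (simp, subst mult_four_block_mat[of _ 1 1 _ m _ m]) auto
  also have "\<dots> = - four_block_mat (0\<^sub>m 1 1) (0\<^sub>m 1 m) (0\<^sub>m m 1) (W * D)"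
    unfolding W(4) using W D by (auto intro!: eq_matI)
  also have "four_block_mat (0\<^sub>m 1 1) (0\<^sub>m 1 m) (0\<^sub>m m 1) (W * D) = S * ?A"
    unfolding Sb using w D W by (subst mult_four_block_mat[of _ 1 1 _ m _ m]) auto
  finally have AS: "transpose_mat ?A * S = - (S * ?A)" .
  define M where "M = ?A"
  note A = A[folded M_def] and AS = AS[folded M_def]
  define B where "B v u = v \<bullet> (S *\<^sub>v u)" for v u :: "real vec"
  have Badd: "B (u + v) x = B u x + B v x" "B x (u + v) = B x u + B x v"
    if "u \<in> carrier_vec ?n" "v \<in> carrier_vec ?n" "x \<in> carrier_vec ?n" for u v x
    using that S
      by (simp_all add: B_def add_scalar_prod_distrib[of _ ?n] mult_add_distrib_mat_vec[of _ ?n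
      ?n] scalar_prod_add_distrib[of _ ?n])
  have Bsm: "B (a \<cdot>\<^sub>v v) x = a * B v x" "B x (a \<cdot>\<^sub>v v) = a * B x v"
    if "v \<in> carrier_vec ?n" "x \<in> carrier_vec ?n" for a v x
    using that S by (simp_all add: B_def mult_mat_vec[of _ ?n ?n])
  have Bsw: "B v u = - B u v" if "v \<in> carrier_vec ?n" "u \<in> carrier_vec ?n" for u v
  proof -
    have "B u v = (S *\<^sub>v v) \<bullet> u" using that S by (simp add: B_def comm_scalar_prod[of _ ?n])
    also have "\<dots> = v \<bullet> (transpose_mat S *\<^sub>v u)" using scalar_prod_mult_mat_vec[OF S] that by blast
    also have "\<dots> = - B v u" unfolding skew B_def using S that by (simp add: uminus_mult_mat_vec)
    finally show ?thesis by simp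
  qed
  have BA: "B (M *\<^sub>v v) u = - B v (M *\<^sub>v u)" if "v \<in> carrier_vec ?n" "u \<in> carrier_vec ?n" for u v
  proof -
    have Su: "S *\<^sub>v u \<in> carrier_vec ?n" using S that by simp
    have "B (M *\<^sub>v v) u = v \<bullet> (transpose_mat M *\<^sub>v (S *\<^sub>v u))"
      unfolding B_def by (rule scalar_prod_mult_mat_vec[OF A that(1) Su])
    also have "transpose_mat M *\<^sub>v (S *\<^sub>v u) = (transpose_mat M * S) *\<^sub>v u"
      using A S that by (intro assoc_mult_mat_vec[symmetric, of _ ?n ?n _ ?n]) auto
    also have "\<dots> = - (S *\<^sub>v (M *\<^sub>v u))"
    proof -
      have "(S * M) *\<^sub>v u = S *\<^sub>v (M *\<^sub>v u)" using S A that(2) by (rule assoc_mult_mat_vec)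
      moreover have "dim_vec u = dim_col (S * M)" using A that by simp
      ultimately show ?thesis unfolding AS by (metis uminus_mult_mat_vec)
    qed
    finally show ?thesis using that A S by (simp add: B_def)
  qed
  \<comment> \<open>On the ideal the form is \<open>B\<close>; the two additional terms are the
    exterior product of the \<open>e_0\<close>-coordinate with the first coordinate of the
    ideal.\<close>
  define \<omega> where "\<omega> = (\<lambda>(s, v) (t, u). B v u + s * u $ 0 - t * v $ (0::nat))"
  note simps = almost_abelian_simps[OF A]
  have "symplectic_structure (almost_abelian M) \<omega>"
    unfolding symplectic_structure_def simps(1,2)
  proof (intro conjI ballI impI)
    have "B v v = 0" if "v \<in> carrier_vec ?n" for v using Bsw[OF that that] by simp
    then show "two_form (almost_abelian M) \<omega>"
      unfolding two_form_def simps(1)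
      by (auto simp: simps(3,4) \<omega>_def Badd Bsm algebra_simps simp del: index_mat_four_block)
  next
    fix x :: "real \<times> real vec" assume x: "x \<in> UNIV \<times> carrier_vec ?n"
      "\<forall>y\<in>UNIV \<times> carrier_vec ?n. \<omega> x y = 0"
    obtain s v where sv: "x = (s, v)" "v \<in> carrier_vec ?n" using x(1) by auto
    \<comment> \<open>Since \<open>S\<close> kills the first unit vector, pairing with it isolates
      \<open>s\<close>; pairing with \<open>e_0\<close> then isolates the first coordinate of
      \<open>v\<close>, and the remaining unit vectors test \<open>S v\<close>.\<close>
    have Se: "S *\<^sub>v unit_vec ?n 0 = 0\<^sub>v ?n"
      using S by (auto simp: Sb intro!: eq_vecI)
    have "\<omega> x (0, unit_vec ?n 0) = 0" using x(2) by simp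
    then have s: "s = 0" using sv Se by (simp add: \<omega>_def B_def)
    have "\<omega> x (1, 0\<^sub>v ?n) = 0" using x(2) by simp
    moreover have "B v (0\<^sub>v ?n) = 0" using Bsm(2)[of "0\<^sub>v ?n" v 0] sv
      by (simp add: zero_smult_vec[of _ ?n])
    ultimately have v0: "v $ 0 = 0" using sv s by (simp add: \<omega>_def)
    have Sv: "(S *\<^sub>v v) $ i = 0" if "i < ?n" for i
    proof -
      have "\<omega> x (0, unit_vec ?n i) = 0" using x(2) that by simp
      then have "B v (unit_vec ?n i) = 0" using sv s by (simp add: \<omega>_def)
      then have "B (unit_vec ?n i) v = 0" using Bsw[of v "unit_vec ?n i"] sv by simp
      then show ?thesis using that sv S unfolding B_def
        by (subst (asm) scalar_prod_left_unit[of _ ?n]) auto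
    qed
    \<comment> \<open>The conditions \<open>v $ 0 = 0\<close> and \<open>S v = 0\<close> together
      are one linear system, whose matrix \<open>1 + W\<close> (block sum) is invertible although
      \<open>S\<close> is not.\<close>
    have "(1\<^sub>m 1 \<oplus>\<^sub>d W) *\<^sub>v v = 0\<^sub>v ?n"
    proof (rule eq_vecI)
      fix i assume i: "i < dim_vec (0\<^sub>v ?n :: real vec)"
      have "row (1\<^sub>m 1 \<oplus>\<^sub>d W) i \<bullet> v = (if i = 0 then v $ 0 else 0) + row S i \<bullet> v"
      proof -
        have c: "(1\<^sub>m 1 \<oplus>\<^sub>d W) $$ (i, j) = (if i = 0 \<and> j = 0 then 1 else 0) + S $$ (i, j)"
          if "j < ?n" for j
          using that i W by (auto simp: S_def dsum_def)
        have "row (1\<^sub>m 1 \<oplus>\<^sub>d W) i \<bullet> v = (\<Sum>j\<in>{0..<?n}. (1\<^sub>m 1 \<oplus>\<^sub>d W) $$ (i, j) * v $ j)"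
          using i W sv by (auto simp: scalar_prod_def intro!: sum.cong)
        also have "\<dots> = (\<Sum>j\<in>{0..<?n}. (if j = 0 then if i = 0 then v $ 0 else 0 else 0) + S $$
          (i, j) * v $ j)"
        proof (rule sum.cong[OF refl])
          fix j assume "j \<in> {0..<?n}"
          then have "j < ?n" by simp
          show "(1\<^sub>m 1 \<oplus>\<^sub>d W) $$ (i, j) * v $ j = (if j = 0 then if i = 0 then v $ 0 else 0 else 0)
            + S $$ (i, j) * v $ j"
            unfolding c[OF \<open>j < ?n\<close>] by (simp add: distrib_right)
        qed
        also have "\<dots> = (if i = 0 then v $ 0 else 0) + row S i \<bullet> v"
          using i S sv by (simp add: sum.distrib scalar_prod_def del: sum.op_ivl_Suc)
        finally show ?thesis .
      qed
      then show "((1\<^sub>m 1 \<oplus>\<^sub>d W) *\<^sub>v v) $ i = 0\<^sub>v ?n $ i"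
        using Sv[of i] i v0 S W by simp
    qed (use W in simp)
    moreover have "1\<^sub>m 1 \<oplus>\<^sub>d W \<in> carrier_mat ?n ?n" using dsum_carrier[of "1\<^sub>m 1" 1 W m] W by simp
    moreover have "det (1\<^sub>m 1 \<oplus>\<^sub>d W) \<noteq> 0" using W by (simp add: det_dsum[of _ 1 _ m])
    ultimately have "v = 0\<^sub>v ?n" using det_0_iff_vec_prod_zero_field sv(2) by blast
    then show "x = (0, 0\<^sub>v ?n)" using sv s by simp
  next
    fix x y z :: "real \<times> real vec"
    assume "x \<in> UNIV \<times> carrier_vec ?n" "y \<in> UNIV \<times> carrier_vec ?n" "z \<in> UNIV \<times> carrier_vec ?n"
    then obtain s v t u r a where x: "x = (s, v)" "y = (t, u)" "z = (r, a)"
      and c: "v \<in> carrier_vec ?n" "u \<in> carrier_vec ?n" "a \<in> carrier_vec ?n" by auto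
    have cA: "M *\<^sub>v v \<in> carrier_vec ?n" "M *\<^sub>v u \<in> carrier_vec ?n" "M *\<^sub>v a \<in> carrier_vec ?n"
      using A c by (auto intro: mult_mat_vec_carrier)
    define v' u' a' where "v' = M *\<^sub>v v" "u' = M *\<^sub>v u" "a' = M *\<^sub>v a"
    note cA = cA[folded v'_u'_a'_def]
    have sub: "p \<cdot>\<^sub>v e - q \<cdot>\<^sub>v f = p \<cdot>\<^sub>v e + (- q) \<cdot>\<^sub>v f" if "e \<in> carrier_vec ?n" "f \<in> carrier_vec ?n"
      for p q and e f :: "real vec"
      using that by (auto intro!: eq_vecI)
    \<comment> \<open>A skew-adjoint operator makes \<open>B (M v) u\<close> symmetric in
      \<open>v\<close> and \<open>u\<close>, because \<open>B\<close> is skew. With this the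
      \<open>B\<close>-terms of the cyclic sum cancel in pairs; the terms from the first coordinate
      cancel by themselves.\<close>
    have b: "B u' a = B a' u" "B v' a = B a' v" "B v' u = B u' v"
      using BA[of u a] BA[of v a] BA[of v u] Bsw[of u a'] Bsw[of v a'] Bsw[of v u'] c cA
      by (simp_all add: v'_u'_a'_def)
    show "\<omega> (lie_bracket (almost_abelian M) x y) z + \<omega> (lie_bracket (almost_abelian M) y z) x +
        \<omega> (lie_bracket (almost_abelian M) z x) y = 0"
      unfolding x simps(5) v'_u'_a'_def[symmetric]
      using c cA by (simp add: \<omega>_def sub Badd Bsm b algebra_simps)
  qed
  then show ?thesis unfolding M_def by (rule that)
qed

text \<open>In a basis that brings the restricted form \<open>S\<close> to a zero block followed by
  \<open>J_mat\<close>, the radical comes first; skew-adjointness read off block by block forces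
  both the zero column below the corner and the Hamiltonian block.\<close>

lemma symplectic_structure_normal_form:
  assumes A: "A \<in> carrier_mat (2 * k + 1) (2 * k + 1)"
    and \<omega>: "symplectic_structure (almost_abelian A) \<omega>"
  obtains l w D where "w \<in> carrier_mat 1 (2 * k)" "D \<in> carrier_mat (2 * k) (2 * k)" "hamiltonian D"
    "similar_mat A (four_block_mat (l \<cdot>\<^sub>m 1\<^sub>m 1) w (0\<^sub>m (2 * k) 1) D)"
proof -
  let ?n = "2 * k + 1"
  note simps = almost_abelian_simps[OF A]
  have two: "two_form (almost_abelian A) \<omega>"
    and nondeg: "\<And>x. x \<in> UNIV \<times> carrier_vec ?n \<Longrightarrow> (\<And>y. y \<in> UNIV \<times> carrier_vec ?n \<Longrightarrow> \<omega> x y = 0) \<Longrightarrow> x =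
      (0, 0\<^sub>v ?n)"
    and closed: "\<And>x y z. x \<in> UNIV \<times> carrier_vec ?n \<Longrightarrow> y \<in> UNIV \<times> carrier_vec ?n \<Longrightarrow>
      z \<in> UNIV \<times> carrier_vec ?n \<Longrightarrow>
      \<omega> (lie_bracket (almost_abelian A) x y) z + \<omega> (lie_bracket (almost_abelian A) y z) x
        + \<omega> (lie_bracket (almost_abelian A) z x) y = 0"
    using \<omega> unfolding symplectic_structure_def simps(1,2) by blast+
  have add: "\<omega> (s + t, v + u) (r, a) = \<omega> (s, v) (r, a) + \<omega> (t, u) (r, a)"
    "\<omega> (r, a) (s + t, v + u) = \<omega> (r, a) (s, v) + \<omega> (r, a) (t, u)"
    if "v \<in> carrier_vec ?n" "u \<in> carrier_vec ?n" "a \<in> carrier_vec ?n" for s t r v u a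
    using two that unfolding two_form_def simps(1) by (auto simp flip: simps(3))
  have sm: "\<omega> (c * s, c \<cdot>\<^sub>v v) (t, u) = c * \<omega> (s, v) (t, u)"
    "\<omega> (s, v) (c * t, c \<cdot>\<^sub>v u) = c * \<omega> (s, v) (t, u)"
    if "v \<in> carrier_vec ?n" "u \<in> carrier_vec ?n" for c s t v u
    using two that unfolding two_form_def simps(1) by (auto simp flip: simps(4))
  have alt: "\<omega> (s, v) (s, v) = 0" if "v \<in> carrier_vec ?n" for s v
    using two that unfolding two_form_def simps(1) by auto
  define B where "B v u = \<omega> (0, v) (0, u)" for v u
  obtain S where S: "S \<in> carrier_mat ?n ?n"
    and BS: "\<And>v u. v \<in> carrier_vec ?n \<Longrightarrow> u \<in> carrier_vec ?n \<Longrightarrow> B v u = v \<bullet> (S *\<^sub>v u)"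
  proof (rule bilinear_matrix[of ?n B])
    show "B (u + v) w = B u w + B v w" "B u (v + w) = B u v + B u w"
      if "u \<in> carrier_vec ?n" "v \<in> carrier_vec ?n" "w \<in> carrier_vec ?n" for u v w
      using that add(1)[of u v w 0 0 0] add(2)[of v w u 0 0 0] by (simp_all add: B_def)
    show "B (a \<cdot>\<^sub>v v) w = a * B v w" "B v (a \<cdot>\<^sub>v w) = a * B v w"
      if "v \<in> carrier_vec ?n" "w \<in> carrier_vec ?n" for a v w
      using that sm(1)[of v w a 0 0] sm(2)[of v w 0 a 0] by (simp_all add: B_def)
  qed auto
  have Bsw: "B v u = - B u v" if "v \<in> carrier_vec ?n" "u \<in> carrier_vec ?n" for v u
    using alt[of "v + u" 0] alt[of v 0] alt[of u 0] add(1)[of v u "v + u" 0 0 0]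
      add(2)[of v u v 0 0 0]
      add(2)[of v u u 0 0 0] that by (simp add: B_def)
  have entry: "unit_vec ?n i \<bullet> (M *\<^sub>v unit_vec ?n j) = M $$ (i, j)"
    if "M \<in> carrier_mat ?n ?n" "i < ?n" "j < ?n" for M :: "real mat" and i j
    using unit_vec_mult_mat[OF that] .
  have skew: "transpose_mat S = - S"
  proof (rule eq_matI)
    fix i j assume "i < dim_row (- S)" "j < dim_col (- S)"
    then have ij: "i < ?n" "j < ?n" using S by auto
    have "S $$ (j, i) = - S $$ (i, j)"
      using Bsw[of "unit_vec ?n j" "unit_vec ?n i"] BS[of "unit_vec ?n j" "unit_vec ?n i"]
        BS[of "unit_vec ?n i" "unit_vec ?n j"] entry[OF S ij] entry[OF S ij(2,1)] by simp
    then show "transpose_mat S $$ (i, j) = (- S) $$ (i, j)" using ij S by simp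
  qed (use S in auto)
  \<comment> \<open>Closedness on \<open>e_0, v, u\<close>: the bracket of \<open>v\<close> and
    \<open>u\<close> is zero, so only the two brackets with \<open>e_0\<close> remain.\<close>
  have AB: "B (A *\<^sub>v v) u = - B v (A *\<^sub>v u)" if "v \<in> carrier_vec ?n" "u \<in> carrier_vec ?n" for v u
  proof -
    have c: "A *\<^sub>v v \<in> carrier_vec ?n" "A *\<^sub>v u \<in> carrier_vec ?n" using A that by auto
    have z: "\<omega> (0, 0\<^sub>v ?n) (1, 0\<^sub>v ?n) = 0" using sm(1)[of "0\<^sub>v ?n" "0\<^sub>v ?n" 0 0 1]
      by (simp add: zero_smult_vec[of _ ?n])
    have b: "1 \<cdot>\<^sub>v (A *\<^sub>v v) - 0 \<cdot>\<^sub>v (A *\<^sub>v 0\<^sub>v ?n) = A *\<^sub>v v" "0 \<cdot>\<^sub>v (A *\<^sub>v u) - 0 \<cdot>\<^sub>v (A *\<^sub>v v) = 0\<^sub>v ?n"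
      "0 \<cdot>\<^sub>v (A *\<^sub>v 0\<^sub>v ?n) - 1 \<cdot>\<^sub>v (A *\<^sub>v u) = (- 1) \<cdot>\<^sub>v (A *\<^sub>v u)"
      using A that by (auto intro!: eq_vecI)
    have "B (A *\<^sub>v v) u + B ((- 1) \<cdot>\<^sub>v (A *\<^sub>v u)) v = 0"
      using closed[of "(1, 0\<^sub>v ?n)" "(0, v)" "(0, u)"] that z unfolding simps(5) b
        by (simp add: B_def)
    moreover have "B ((- 1) \<cdot>\<^sub>v (A *\<^sub>v u)) v = - B (A *\<^sub>v u) v"
      using sm(1)[OF c(2) that(1), of "- 1" 0 0] by (simp add: B_def)
    ultimately show ?thesis using Bsw[OF c(2) that(1)] by simp
  qed
  have AS: "transpose_mat A * S = - (S * A)"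
  proof (rule eq_matI)
    fix i j assume "i < dim_row (- (S * A))" "j < dim_col (- (S * A))"
    then have ij: "i < ?n" "j < ?n" using S A by auto
    let ?e = "unit_vec ?n i :: real vec" and ?f = "unit_vec ?n j :: real vec"
    have ef: "?e \<in> carrier_vec ?n" "?f \<in> carrier_vec ?n" by auto
    have m: "transpose_mat A * S \<in> carrier_mat ?n ?n" "S * A \<in> carrier_mat ?n ?n" using S A by auto
    have Sf: "S *\<^sub>v ?f \<in> carrier_vec ?n" "A *\<^sub>v ?e \<in> carrier_vec ?n" "A *\<^sub>v ?f \<in> carrier_vec ?n"
      using S A ef by (auto intro!: mult_mat_vec_carrier)
    have "(transpose_mat A * S) $$ (i, j) = ?e \<bullet> ((transpose_mat A * S) *\<^sub>v ?f)"
      using entry[OF m(1) ij] by simp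
    also have "(transpose_mat A * S) *\<^sub>v ?f = transpose_mat A *\<^sub>v (S *\<^sub>v ?f)"
      using A S ef by (intro assoc_mult_mat_vec) auto
    also have "?e \<bullet> (transpose_mat A *\<^sub>v (S *\<^sub>v ?f)) = (A *\<^sub>v ?e) \<bullet> (S *\<^sub>v ?f)"
      by (rule scalar_prod_mult_mat_vec[OF A ef(1) Sf(1), symmetric])
    also have "\<dots> = - (?e \<bullet> (S *\<^sub>v (A *\<^sub>v ?f)))"
      using AB[OF ef] BS[OF Sf(2) ef(2)] BS[OF ef(1) Sf(3)] by simp
    also have "S *\<^sub>v (A *\<^sub>v ?f) = (S * A) *\<^sub>v ?f" by (rule assoc_mult_mat_vec[OF S A ef(2), symmetric])
    also have "?e \<bullet> ((S * A) *\<^sub>v ?f) = (S * A) $$ (i, j)" by (rule entry[OF m(2) ij])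
    finally show "(transpose_mat A * S) $$ (i, j) = (- (S * A)) $$ (i, j)" using ij S A by simp
  qed (use S A in auto)
  obtain q r where qr: "?n = q + 2 * r" "congruent_mat S (0\<^sub>m q q \<oplus>\<^sub>d J_mat r)"
    using skew_normal_form[OF S skew] .
  obtain P where P: "P \<in> carrier_mat ?n ?n" "det P \<noteq> 0"
    "0\<^sub>m q q \<oplus>\<^sub>d J_mat r = transpose_mat P * S * P"
    using congruent_matE[OF qr(2) S] .
  obtain Q where Q: "Q \<in> carrier_mat ?n ?n" "P * Q = 1\<^sub>m ?n" "Q * P = 1\<^sub>m ?n"
    using det_nonzero_inverse[OF P(1,2)] .
  have tQP: "transpose_mat Q * transpose_mat P = 1\<^sub>m ?n"
    using transpose_mult[OF P(1) Q(1)] unfolding Q(2) by simp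
  have "S * P = transpose_mat Q * transpose_mat P * (S * P)" unfolding tQP using S P by simp
  also have "\<dots> = transpose_mat Q * (0\<^sub>m q q \<oplus>\<^sub>d J_mat r)"
    unfolding P(3) using S P(1) Q(1) by (simp add: assoc_mult_mat[of _ ?n ?n _ ?n _ ?n])
  finally have SP: "S * P = transpose_mat Q * (0\<^sub>m q q \<oplus>\<^sub>d J_mat r)" .
  have "q < 2"
  proof (rule ccontr)
    assume q: "\<not> q < 2"
    define a where "a i = \<omega> (0, P *\<^sub>v unit_vec ?n i) (1, 0\<^sub>v ?n)" for i
    \<comment> \<open>The functional \<open>a\<close> gives the pairing of the first two radical
      vectors with \<open>e_0\<close>. A single functional has a non-zero kernel vector
      \<open>y\<close> in a plane: the second unit vector if \<open>a 1 = 0\<close>, otherwise a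
      combination whose first coefficient \<open>a 1\<close> is non-zero.\<close>
    define y :: "real vec"
      where "y = (if a 1 = 0 then unit_vec ?n 1 else a 1 \<cdot>\<^sub>v unit_vec ?n 0 + (- a 0) \<cdot>\<^sub>v unit_vec ?n
      1)"
    have y: "y \<in> carrier_vec ?n" by (simp add: y_def)
    have n2: "1 < ?n" using q qr(1) by simp
    have N: "(0\<^sub>m q q \<oplus>\<^sub>d J_mat r) *\<^sub>v y = 0\<^sub>v ?n"
    proof (rule eq_vecI)
      fix i assume i: "i < dim_vec (0\<^sub>v ?n :: real vec)"
      have "row (0\<^sub>m q q \<oplus>\<^sub>d J_mat r) i \<bullet> y = (\<Sum>j\<in>{0..<?n}. (0\<^sub>m q q \<oplus>\<^sub>d J_mat r) $$ (i, j) * y $ j)"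
        using y i qr(1) by (auto simp: scalar_prod_def intro!: sum.cong)
      also have "\<dots> = 0"
        using q qr(1) i n2 by (intro sum.neutral) (auto simp: y_def dsum_def)
      finally show "((0\<^sub>m q q \<oplus>\<^sub>d J_mat r) *\<^sub>v y) $ i = 0\<^sub>v ?n $ i" using i qr(1) by simp
    qed (use qr(1) in simp)
    define x where "x = P *\<^sub>v y"
    have x: "x \<in> carrier_vec ?n" using P y by (simp add: x_def)
    have Nc: "0\<^sub>m q q \<oplus>\<^sub>d J_mat r \<in> carrier_mat ?n ?n" using P S by simp
    have "S *\<^sub>v x = (S * P) *\<^sub>v y" unfolding x_def
      by (rule assoc_mult_mat_vec[OF S P(1) y, symmetric])
    also have "\<dots> = transpose_mat Q *\<^sub>v ((0\<^sub>m q q \<oplus>\<^sub>d J_mat r) *\<^sub>v y)"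
      unfolding SP using Q(1) Nc y by (intro assoc_mult_mat_vec[of _ ?n ?n _ ?n]) auto
    also have "\<dots> = 0\<^sub>v ?n" unfolding N using Q(1) by (intro eq_vecI) auto
    finally have Sx: "S *\<^sub>v x = 0\<^sub>v ?n" .
    have wx: "\<omega> (0, x) (1, 0\<^sub>v ?n) = 0"
    proof (cases "a 1 = 0")
      case True
      then show ?thesis by (simp add: x_def y_def a_def)
    next
      case False
      have c: "P *\<^sub>v unit_vec ?n i \<in> carrier_vec ?n" for i using P by simp
      have "x = a 1 \<cdot>\<^sub>v (P *\<^sub>v unit_vec ?n 0) + (- a 0) \<cdot>\<^sub>v (P *\<^sub>v unit_vec ?n 1)"
        using P False
          by (simp add: x_def y_def mult_add_distrib_mat_vec[of _ ?n ?n] mult_mat_vec[of _ ?n ?n])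
      then have "\<omega> (0, x) (1, 0\<^sub>v ?n) = a 1 * a 0 + (- a 0) * a 1"
        using c add(1)[of "a 1 \<cdot>\<^sub>v (P *\<^sub>v unit_vec ?n 0)" "(- a 0) \<cdot>\<^sub>v (P *\<^sub>v unit_vec ?n 1)"
          "0\<^sub>v ?n" 0 0 1]
          sm(1)[of "P *\<^sub>v unit_vec ?n 0" "0\<^sub>v ?n" "a 1" 0 1] sm(1)[of "P *\<^sub>v unit_vec ?n 1" "0\<^sub>v ?n"
            "- a 0" 0 1]
        by (simp add: a_def)
      then show ?thesis by simp
    qed
    have "(0 :: real, x) = (0, 0\<^sub>v ?n)"
    proof (rule nondeg)
      fix z :: "real \<times> real vec" assume "z \<in> UNIV \<times> carrier_vec ?n"
      then obtain t u where z: "z = (t, u)" "u \<in> carrier_vec ?n" by auto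
      have "\<omega> (0, x) (0, u) = - (u \<bullet> (S *\<^sub>v x))" using Bsw[OF x z(2)] BS[OF z(2) x]
        by (simp add: B_def)
      also have "\<dots> = 0" unfolding Sx using z by simp
      finally have "\<omega> (0, x) (0, u) = 0" .
      moreover have "\<omega> (0, x) (t, 0\<^sub>v ?n) = t * \<omega> (0, x) (1, 0\<^sub>v ?n)"
      proof -
        have "t \<cdot>\<^sub>v 0\<^sub>v ?n = 0\<^sub>v ?n" by (intro eq_vecI) auto
        then show ?thesis using sm(2)[OF x zero_carrier_vec, of 0 t 1] by simp
      qed
      moreover have "\<omega> (0, x) (t, u) = \<omega> (0, x) (t, 0\<^sub>v ?n) + \<omega> (0, x) (0, u)"
        using add(2)[OF zero_carrier_vec z(2) x, of 0 t 0] z by simp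
      ultimately show "\<omega> (0, x) z = 0" using wx z by simp
    qed (use x in simp)
    then have "x = 0\<^sub>v ?n" by simp
    have "y = (Q * P) *\<^sub>v y" unfolding Q(3) using y by simp
    also have "\<dots> = Q *\<^sub>v x" unfolding x_def by (rule assoc_mult_mat_vec[OF Q(1) P(1) y])
    also have "\<dots> = 0\<^sub>v ?n" unfolding \<open>x = 0\<^sub>v ?n\<close> using Q by (intro eq_vecI) auto
    finally have y0: "y = 0\<^sub>v ?n" .
    show False
      using arg_cong[OF y0, of "\<lambda>v. v $ 0"] arg_cong[OF y0, of "\<lambda>v. v $ 1"] n2
      by (auto simp: y_def split: if_splits)
  qed
  \<comment> \<open>The ideal has odd dimension \<open>q + 2 * r\<close>, so \<open>q < 2\<close>
    leaves only \<open>q = 1\<close>.\<close>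
  then have q: "q = 1" and r: "r = k" using qr(1) by presburger+
  define A' where "A' = Q * A * P"
  have A': "A' \<in> carrier_mat (1 + 2 * k) (1 + 2 * k)" using A P Q by (simp add: A'_def)
  have sim: "similar_mat A A'"
  proof -
    have "P * A' = P * Q * (A * P)" using P(1) Q(1) A
      by (simp add: A'_def assoc_mult_mat[of _ ?n ?n _ ?n _ ?n])
    then have "A * P = P * A'" using A P Q by simp
    then show ?thesis using A A' P by (subst similar_mat_iff[of _ ?n]) auto
  qed
  let ?J = "J_mat k"
  have AN: "transpose_mat A' * (0\<^sub>m 1 1 \<oplus>\<^sub>d ?J) = - ((0\<^sub>m 1 1 \<oplus>\<^sub>d ?J) * A')"
    using skew_adjoint_change_basis[OF A S P(1) Q(1,2) AS] unfolding P(3)[symmetric] q r A'_def .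
  obtain a w x D where b: "A' = four_block_mat a w x D" "a \<in> carrier_mat 1 1"
    "w \<in> carrier_mat 1 (2 * k)"
    "x \<in> carrier_mat (2 * k) 1" "D \<in> carrier_mat (2 * k) (2 * k)"
    using four_block_cases[OF A'] .
  have Nb: "0\<^sub>m 1 1 \<oplus>\<^sub>d ?J = four_block_mat (0\<^sub>m 1 1) (0\<^sub>m 1 (2 * k)) (0\<^sub>m (2 * k) 1) ?J"
    by (simp add: dsum_four_block[of _ 1 _ "2 * k"])
  have "transpose_mat A' * (0\<^sub>m 1 1 \<oplus>\<^sub>d ?J) =
    four_block_mat (0\<^sub>m 1 1) (transpose_mat x * ?J) (0\<^sub>m (2 * k) 1) (transpose_mat D * ?J)"
    unfolding b(1) Nb transpose_four_block_mat[OF b(2-5)] using b(2-5)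
    by (subst mult_four_block_mat[of _ 1 1 _ "2 * k" _ "2 * k"]) auto
  moreover have "- ((0\<^sub>m 1 1 \<oplus>\<^sub>d ?J) * A') =
    four_block_mat (0\<^sub>m 1 1) (0\<^sub>m 1 (2 * k)) (- (?J * x)) (- (?J * D))"
    unfolding b(1) Nb using b(2-5)
    by (subst mult_four_block_mat[of _ 1 1 _ "2 * k" _ "2 * k"]) (auto intro!: eq_matI)
  moreover have "?J * x \<in> carrier_mat (2 * k) 1" "?J * D \<in> carrier_mat (2 * k) (2 * k)"
    using b(4,5) by (auto intro: mult_carrier_mat[OF J_mat_carrier])
  ultimately have eq: "transpose_mat x * ?J = 0\<^sub>m 1 (2 * k)" "transpose_mat D * ?J = - (?J * D)"
    using AN b(2-5) four_block_eq_iff[of "0\<^sub>m 1 1" 1 1 "transpose_mat x * ?J" "2 * k"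
      "0\<^sub>m (2 * k) 1" "2 * k"
      "transpose_mat D * ?J" "0\<^sub>m 1 1" "0\<^sub>m 1 (2 * k)" "- (?J * x)" "- (?J * D)"] by auto
  \<comment> \<open>The block \<open>x\<close> is the part of the first column below the corner; its
    vanishing is the invariance of the radical line, and it follows because \<open>J_mat k\<close>
    is invertible.\<close>
  have "transpose_mat x = 0\<^sub>m 1 (2 * k)"
    using mult_invertible_zero[of "transpose_mat x" 1 "2 * k" ?J] b J_mat_det eq by simp
  then have "transpose_mat (transpose_mat x) = 0\<^sub>m (2 * k) 1" by simp
  then have x: "x = 0\<^sub>m (2 * k) 1" by simp
  have "hamiltonian D"
    using hamiltonianI[OF b(5) J_mat_carrier J_mat_skew J_mat_det eq(2)] .
  moreover have "a = (a $$ (0, 0)) \<cdot>\<^sub>m 1\<^sub>m 1" using b(2) by (auto intro!: eq_matI)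
  ultimately show ?thesis using that[OF b(3,5)] sim unfolding b(1) x by metis
qed

subsection \<open>Kernel dimensions and one-dimensional extensions\<close>

lemma kernel_dim_dsum:
  fixes A :: "'a :: field mat"
  assumes "A \<in> carrier_mat n n" "B \<in> carrier_mat m m"
  shows "kernel_dim (A \<oplus>\<^sub>d B) = kernel_dim A + kernel_dim B"
  using kernel_four_block_0_mat[OF dsum_four_block[OF assms] assms] assms
    by (simp add: kernel_dim_def)

lemma kernel_dim_mult_right:
  fixes A :: "'a :: field mat"
  assumes A: "A \<in> carrier_mat n n" and B: "B \<in> carrier_mat n n" and d: "det B \<noteq> 0"
  shows "kernel_dim (A * B) = kernel_dim A"
proof -
  obtain C where "C \<in> carrier_mat n n" "B * C = 1\<^sub>m n" using det_nonzero_inverse[OF B d] by metis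
  then show ?thesis using mat_kernel_dim_mult_eq_right[OF A B] A B by (simp add: kernel_dim_def)
qed

lemma kernel_dim_mult_left:
  fixes A :: "'a :: field mat"
  assumes A: "A \<in> carrier_mat n n" and B: "B \<in> carrier_mat n n" and d: "det B \<noteq> 0"
  shows "kernel_dim (B * A) = kernel_dim A"
proof -
  obtain C where C: "C \<in> carrier_mat n n" "C * B = 1\<^sub>m n" using det_nonzero_inverse[OF B d] by metis
  show ?thesis using mat_kernel_mult_eq[OF A B C] A B by (simp add: kernel_dim_def)
qed

lemma kernel_dim_invertible:
  fixes A :: "'a :: field mat"
  assumes A: "A \<in> carrier_mat n n" and d: "det A \<noteq> 0"
  shows "kernel_dim A = 0"
  using kernel_dim_mult_left[of "1\<^sub>m n" n A] kernel_one_mat(1)[of n, where 'a = 'a] A d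
  by (simp add: kernel_dim_def)

text \<open>Dimension of the kernel of the \<open>k\<close>-th power of a nilpotent matrix with
  block sizes \<open>ns\<close>; equivalently the sum of the first \<open>k\<close> parts of the
  conjugate partition.\<close>

definition kernel_profile :: "nat list \<Rightarrow> nat \<Rightarrow> nat" where
  "kernel_profile ns k = (\<Sum>n\<leftarrow>ns. min k n)"

lemma dim_gen_eigenspace_lower_jordan:
  assumes "0 \<notin> set ns"
  shows "dim_gen_eigenspace (lower_jordan ns b) b k = kernel_profile ns k"
proof -
  have "map fst [(n, e)\<leftarrow>map (\<lambda>k. (k, b)) ns. e = b] = ns" by (induction ns) auto
  then show ?thesis
    unfolding dim_gen_eigenspace[OF jordan_nf_lower_jordan[OF assms]] kernel_profile_def by simp
qed

text \<open>As a function of \<open>k\<close>, \<open>min k n\<close> has slope 1 up to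
  \<open>n\<close> and slope 0 afterwards, so its second difference is -1 at \<open>k = n\<close>
  and 0 at the other positive \<open>k\<close>.\<close>

lemma count_kernel_profile:
  assumes "k > 0"
  shows "count (mset ns) k + kernel_profile ns (k - 1) + kernel_profile ns (k + 1) =
    2 * kernel_profile ns k"
  using assms by (induction ns) (auto simp: kernel_profile_def)

lemma kernel_dim_zero: "kernel_dim (0\<^sub>m q q :: real mat) = q"
proof -
  have "char_matrix (0\<^sub>m q q) (0 :: real) ^\<^sub>m 1 = 0\<^sub>m q q"
    by (auto simp: char_matrix_def intro!: eq_matI)
  moreover have "lower_jordan (replicate q 1) 0 = 0\<^sub>m q q"
    unfolding lower_jordan_replicate_one by (auto intro!: eq_matI)
  ultimately show ?thesis
    using dim_gen_eigenspace_lower_jordan[of "replicate q 1" 0 1]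
    by (simp add: dim_gen_eigenspace_def kernel_profile_def sum_list_replicate)
qed

text \<open>In the normal form the kernel is the zero block of size \<open>q\<close>, and
  \<open>q\<close> differs from \<open>n\<close> by an even number.\<close>

lemma skew_kernel_dim_even:
  fixes S :: "real mat"
  assumes "S \<in> carrier_mat n n" "transpose_mat S = - S" "even n"
  shows "even (kernel_dim S)"
proof -
  obtain q r where qr: "n = q + 2 * r" "congruent_mat S (0\<^sub>m q q \<oplus>\<^sub>d J_mat r)"
    using skew_normal_form[OF assms(1,2)] .
  obtain P where P: "P \<in> carrier_mat n n" "det P \<noteq> 0" "0\<^sub>m q q \<oplus>\<^sub>d J_mat r = transpose_mat P * S * P"
    using congruent_matE[OF qr(2) assms(1)] .
  have "kernel_dim (0\<^sub>m q q \<oplus>\<^sub>d J_mat r) = kernel_dim S"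
    unfolding P(3) using P assms(1)
    by (subst kernel_dim_mult_right[of _ n], simp_all only: mult_carrier_mat transpose_carrier_mat
      kernel_dim_mult_left[of _ n] det_transpose)
  moreover have "kernel_dim (0\<^sub>m q q \<oplus>\<^sub>d J_mat r) = q"
    by (simp add: kernel_dim_dsum[of _ q _ "2 * r"] kernel_dim_zero kernel_dim_invertible[OF
      J_mat_carrier J_mat_det])
  ultimately show ?thesis using qr(1) assms(3) by simp
qed

lemma uminus_pow_even:
  fixes A :: "'a :: comm_ring_1 mat"
  assumes A: "A \<in> carrier_mat n n"
  shows "(- A) ^\<^sub>m (2 * j) = A ^\<^sub>m (2 * j)"
proof (induction j)
  case (Suc j)
  have c: "A ^\<^sub>m (2 * j) \<in> carrier_mat n n" using A by (rule pow_carrier_mat)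
  have "(- A) ^\<^sub>m (2 * Suc j) = (- A) ^\<^sub>m (2 * j) * (- A) * (- A)" by simp
  also have "\<dots> = A ^\<^sub>m (2 * j) * A * A" unfolding Suc using A c by simp
  finally show ?case by simp
qed (use A in simp)

text \<open>For an even exponent \<open>j\<close> the matrix \<open>W N\<^sup>j\<close> is skew-symmetric, so its rank is even; the number of
  blocks of odd size \<open>k\<close> is, up to an even number, a sum of two such ranks.\<close>

lemma hamiltonian_nilpotent_count:
  assumes ns: "0 \<notin> set ns" and h: "hamiltonian (lower_jordan ns 0)" and k: "odd k"
  shows "even (count (mset ns) k)"
proof -
  let ?N = "lower_jordan ns 0" and ?n = "sum_list ns"
  have N: "?N \<in> carrier_mat ?n ?n" by simp
  obtain W where W: "W \<in> carrier_mat ?n ?n" "transpose_mat W = - W" "det W \<noteq> 0"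
    "transpose_mat ?N * W = - (W * ?N)"
    using hamiltonianE[OF h N] .
  obtain r E where "?N \<in> carrier_mat (2 * r) (2 * r)" using hamiltonian_similar_sp[OF h] by metis
  then have n: "even ?n" by auto
  have e: "even (kernel_profile ns j)" if "even j" for j
  proof -
    have Nj: "?N ^\<^sub>m j \<in> carrier_mat ?n ?n" using N by (rule pow_carrier_mat)
    have tN: "transpose_mat ?N \<in> carrier_mat ?n ?n" "- ?N \<in> carrier_mat ?n ?n" by simp_all
    have "transpose_mat ?N * W = W * (- ?N)" using W N by simp
    from intertwine_pow[OF tN W(1) this, of j]
    have "transpose_mat ?N ^\<^sub>m j * W = W * ?N ^\<^sub>m j"
      using that uminus_pow_even[OF N] by (auto elim!: evenE)
    moreover have "transpose_mat (W * ?N ^\<^sub>m j) = transpose_mat ?N ^\<^sub>m j * (- W)"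
      unfolding transpose_mult[OF W(1) Nj] W(2) transpose_pow_mat[OF N] ..
    ultimately have "transpose_mat (W * ?N ^\<^sub>m j) = - (W * ?N ^\<^sub>m j)"
      using W(1) pow_carrier_mat[OF tN(1), of j] by simp
    then have "even (kernel_dim (W * ?N ^\<^sub>m j))" using W Nj n by (intro skew_kernel_dim_even) auto
    also have "kernel_dim (W * ?N ^\<^sub>m j) = kernel_dim (?N ^\<^sub>m j)"
      by (rule kernel_dim_mult_left[OF Nj W(1,3)])
    also have "?N = char_matrix ?N 0" by (auto simp: char_matrix_def intro!: eq_matI)
    finally show ?thesis using dim_gen_eigenspace_lower_jordan[OF ns, of 0 j]
      by (simp add: dim_gen_eigenspace_def)
  qed
  have "count (mset ns) k + kernel_profile ns (k - 1) + kernel_profile ns (k + 1) =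
    2 * kernel_profile ns k"
    using k by (intro count_kernel_profile) (auto intro: gr0I)
  moreover have "even (kernel_profile ns (k - 1))" "even (kernel_profile ns (k + 1))" using k
    by (auto intro: e)
  ultimately show ?thesis by presburger
qed

text \<open>The kernel consists of a free first coordinate and the vectors of the kernel of
  \<open>M\<close> on which \<open>x\<close> vanishes. If \<open>x\<close> is non-zero on that
  kernel, the dimension lost there compensates the one gained.\<close>

lemma kernel_dim_extension:
  fixes M :: "real mat"
  assumes x: "x \<in> carrier_mat 1 m" and M: "M \<in> carrier_mat m m"
  shows "kernel_dim (four_block_mat (0\<^sub>m 1 1) x (0\<^sub>m m 1) M) =
    kernel_dim M + (if \<forall>v\<in>mat_kernel M. x *\<^sub>v v = 0\<^sub>v 1 then 1 else 0)"
proof -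
  let ?T = "four_block_mat (0\<^sub>m 1 1) x (0\<^sub>m m 1) M"
  have T: "?T \<in> carrier_mat (1 + m) (1 + m)" using M by (intro four_block_carrier_mat) auto
  show ?thesis
  proof (cases "\<forall>v\<in>mat_kernel M. x *\<^sub>v v = 0\<^sub>v 1")
    case True
    have D: "0\<^sub>m 1 1 \<oplus>\<^sub>d M = four_block_mat (0\<^sub>m 1 1) (0\<^sub>m 1 m) (0\<^sub>m m 1) M"
      using M by (simp add: dsum_four_block[of _ 1 _ m])
    have prod: "four_block_mat (0\<^sub>m 1 1) y (0\<^sub>m m 1) M *\<^sub>v (a @\<^sub>v d) = (y *\<^sub>v d) @\<^sub>v (M *\<^sub>v d)"
      if "y \<in> carrier_mat 1 m" "a \<in> carrier_vec 1" "d \<in> carrier_vec m" for y and a d :: "real vec"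
      using that M by (subst four_block_mat_mult_vec[of _ 1 1 _ m _ m]) auto
    have ker: "a @\<^sub>v d \<in> mat_kernel (four_block_mat (0\<^sub>m 1 1) y (0\<^sub>m m 1) M) \<longleftrightarrow> y *\<^sub>v d = 0\<^sub>v 1 \<and>
      d \<in> mat_kernel M"
      if y: "y \<in> carrier_mat 1 m" and a: "a \<in> carrier_vec 1" and d: "d \<in> carrier_vec m" for y
        and a d :: "real vec"
    proof -
      have c: "four_block_mat (0\<^sub>m 1 1) y (0\<^sub>m m 1) M \<in> carrier_mat (1 + m) (1 + m)"
        using M by (intro four_block_carrier_mat) auto
      have z: "0\<^sub>v (1 + m) = (0\<^sub>v 1 @\<^sub>v 0\<^sub>v m :: real vec)" by (intro eq_vecI) auto
      have "a @\<^sub>v d \<in> mat_kernel (four_block_mat (0\<^sub>m 1 1) y (0\<^sub>m m 1) M) \<longleftrightarrow>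
        (y *\<^sub>v d) @\<^sub>v (M *\<^sub>v d) = 0\<^sub>v 1 @\<^sub>v 0\<^sub>v m"
        unfolding mat_kernel[OF c] z mem_Collect_eq prod[OF that] using append_carrier_vec[OF a d]
          by blast
      also have "\<dots> \<longleftrightarrow> y *\<^sub>v d = 0\<^sub>v 1 \<and> M *\<^sub>v d = 0\<^sub>v m"
        using y M d by (subst append_vec_eq[of _ 1]) auto
      finally show ?thesis unfolding mat_kernel[OF M] using d by simp
    qed
    have "mat_kernel ?T = mat_kernel (0\<^sub>m 1 1 \<oplus>\<^sub>d M)"
    proof (rule Set.set_eqI)
      fix v :: "real vec"
      have v: "v = vec_first v 1 @\<^sub>v vec_last v m" if "v \<in> carrier_vec (1 + m)"
        using that by simp
      show "v \<in> mat_kernel ?T \<longleftrightarrow> v \<in> mat_kernel (0\<^sub>m 1 1 \<oplus>\<^sub>d M)"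
      proof (cases "v \<in> carrier_vec (1 + m)")
        case vc: True
        have c: "vec_first v 1 \<in> carrier_vec 1" "vec_last v m \<in> carrier_vec m" by simp_all
        have z: "0\<^sub>m 1 m *\<^sub>v vec_last v m = 0\<^sub>v 1" by (intro eq_vecI) auto
        show ?thesis
          unfolding D using ker[OF x c] ker[OF zero_carrier_mat c] z v[OF vc] True by metis
      next
        case False
        then show ?thesis using mat_kernelD(1)[OF T] mat_kernelD(1)[of "0\<^sub>m 1 1 \<oplus>\<^sub>d M" "1 + m"
          "1 + m" v] M
          by (metis dsum_carrier zero_carrier_mat)
      qed
    qed
    then have "kernel_dim ?T = kernel_dim (0\<^sub>m 1 1 \<oplus>\<^sub>d M)" using M by (simp add: kernel_dim_def)
    also have "\<dots> = 1 + kernel_dim M" using M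
      by (simp add: kernel_dim_dsum[of _ 1 _ m] kernel_dim_zero)
    finally show ?thesis using True by simp
  next
    case False
    then obtain v where v: "v \<in> mat_kernel M" "x *\<^sub>v v \<noteq> 0\<^sub>v 1" by auto
    note vk = mat_kernelD[OF M v(1)]
    define s where "s = row x 0 \<bullet> v"
    have s: "s \<noteq> 0" using v(2) x vk by (auto simp: s_def intro!: eq_vecI)
    \<comment> \<open>The kernel vector \<open>v\<close> is normalised so that
      \<open>x * V = 1\<close>.\<close>
    define V where "V = mat m 1 (\<lambda>(i, j). v $ i / s)"
    have V: "V \<in> carrier_mat m 1" by (simp add: V_def)
    have colV: "col V 0 = (1 / s) \<cdot>\<^sub>v v" using vk by (auto simp: V_def intro!: eq_vecI)
    have xV: "x * V = 1\<^sub>m 1"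
      using x V s vk by (intro eq_matI) (auto simp: colV s_def[symmetric])
    have MV: "M * V = 0\<^sub>m m 1"
    proof (rule eq_matI)
      fix i j assume "i < dim_row (0\<^sub>m m 1 :: real mat)" "j < dim_col (0\<^sub>m m 1 :: real mat)"
      then have ij: "i < m" "j = 0" by auto
      have "row M i \<bullet> v = 0" using arg_cong[OF vk(2), of "\<lambda>u. u $ i"] ij M by simp
      then show "(M * V) $$ (i, j) = 0\<^sub>m m 1 $$ (i, j)" using ij M V vk by (simp add: colV)
    qed (use M V in auto)
    \<comment> \<open>\<open>R\<close> is the projection onto the kernel of \<open>x\<close> along
      \<open>V\<close>; since \<open>M * V = 0\<close>, it does not change \<open>M\<close>.\<close>
    define R where "R = 1\<^sub>m m + - (V * x)"
    have R: "R \<in> carrier_mat m m" using V x by (simp add: R_def)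
    have Vx: "V * x \<in> carrier_mat m m" using V x by simp
    have xR: "x * R = 0\<^sub>m 1 m"
    proof -
      have "x * R = x + - (x * (V * x))" unfolding R_def
        using x Vx
          by (simp only: mult_add_distrib_mat[OF x one_carrier_mat uminus_carrier_mat[OF Vx]]
          right_mult_one_mat[OF x] uminus_mult_right_mat[of x "V * x"] carrier_matD)
      also have "x * (V * x) = x * V * x" by (rule assoc_mult_mat[OF x V x, symmetric])
      also have "x * V * x = x" unfolding xV using x by simp
      finally show ?thesis using minus_r_inv_mat[OF x] add_uminus_minus_mat[OF x x] by simp
    qed
    have MR: "M * R = M"
    proof -
      have "M * R = M + - (M * (V * x))" unfolding R_def using M Vx 
        by (simp only: mult_add_distrib_mat[OF M one_carrier_mat uminus_carrier_mat[OF Vx]]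
          right_mult_one_mat[OF M] uminus_mult_right_mat[of M "V * x"] carrier_matD)
      also have "M * (V * x) = M * V * x" by (rule assoc_mult_mat[OF M V x, symmetric])
      also have "\<dots> = 0\<^sub>m m m" unfolding MV using x by simp
      finally show ?thesis using M by (auto intro!: eq_matI)
    qed
    have RV: "R * V = 0\<^sub>m m 1"
    proof -
      have "R * V = V + - (V * x * V)" unfolding R_def using x V Vx
        by (simp add: add_mult_distrib_mat[of _ m m])
      also have "V * x * V = V * (x * V)" by (rule assoc_mult_mat[OF V x V])
      also have "\<dots> = V" unfolding xV using V by simp
      finally show ?thesis using minus_r_inv_mat[OF V] add_uminus_minus_mat[OF V V] by simp
    qed
    have RR: "V * x + R * R = 1\<^sub>m m"
    proof -
      have "R * R = R + - (R * (V * x))"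
        by (subst (2) R_def) (use R V x Vx in \<open>simp add: mult_add_distrib_mat[of _ m m _ m]\<close>)
      also have "R * (V * x) = R * V * x" by (rule assoc_mult_mat[OF R V x, symmetric])
      also have "\<dots> = 0\<^sub>m m m" unfolding RV using x by simp
      finally have "R * R = R" using R by (auto intro!: eq_matI)
      moreover have "X + (1\<^sub>m m + - X) = 1\<^sub>m m" if "X \<in> carrier_mat m m" for X :: "real mat"
        using that by (intro eq_matI) auto
      from this[OF Vx] have "V * x + R = 1\<^sub>m m" unfolding R_def .
      ultimately show ?thesis by simp
    qed
    \<comment> \<open>The involution \<open>?P\<close> exchanges the new basis vector with
      \<open>V\<close> and fixes the kernel of \<open>x\<close>. Multiplying the extension by it
      from the right yields the block sum of \<open>1\<close> and \<open>M\<close>, so the kernel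
      dimension is that of \<open>M\<close>.\<close>
    let ?P = "four_block_mat (0\<^sub>m 1 1) x V R"
    have P: "?P \<in> carrier_mat (1 + m) (1 + m)" using R by (intro four_block_carrier_mat) auto
    have "?P * ?P = four_block_mat (x * V) (x * R) (R * V) (V * x + R * R)"
      using x V R by (subst mult_four_block_mat[of _ 1 1 _ m _ m]) auto
    then have "?P * ?P = 1\<^sub>m (1 + m)" unfolding xV xR RV RR by (simp del: One_nat_def)
    then have dP: "det ?P \<noteq> 0" by (rule inverse_det_nonzero[OF P P])
    have "?T * ?P = four_block_mat (x * V) (x * R) (M * V) (M * R)"
      using x V R M by (subst mult_four_block_mat[of _ 1 1 _ m _ m]) auto
    then have "?T * ?P = 1\<^sub>m 1 \<oplus>\<^sub>d M" unfolding xV xR MV MR using M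
      by (simp add: dsum_four_block[of _ 1 _ m])
    then have "kernel_dim ?T = kernel_dim (1\<^sub>m 1 \<oplus>\<^sub>d M)" using kernel_dim_mult_right[OF T P dP]
      by simp
    also have "\<dots> = kernel_dim M"
      using M kernel_dim_invertible[of "1\<^sub>m 1" 1] by (simp add: kernel_dim_dsum[of _ 1 _ m])
    finally show ?thesis using False by simp
  qed
qed

lemma extension_pow:
  fixes N :: "'a :: comm_ring_1 mat"
  assumes w: "w \<in> carrier_mat 1 m" and N: "N \<in> carrier_mat m m"
  shows "four_block_mat (0\<^sub>m 1 1) w (0\<^sub>m m 1) N ^\<^sub>m Suc k =
    four_block_mat (0\<^sub>m 1 1) (w * N ^\<^sub>m k) (0\<^sub>m m 1) (N ^\<^sub>m Suc k)"
proof (induction k)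
  case 0
  show ?case using w N by auto
next
  case (Suc k)
  have c: "N ^\<^sub>m k \<in> carrier_mat m m" "N ^\<^sub>m Suc k \<in> carrier_mat m m"
    using N by (auto intro: pow_carrier_mat simp del: pow_mat.simps)
  have "w * N ^\<^sub>m k * N = w * N ^\<^sub>m Suc k" using assoc_mult_mat[OF w c(1) N] by simp
  moreover have "four_block_mat (0\<^sub>m 1 1) (w * N ^\<^sub>m k) (0\<^sub>m m 1) (N ^\<^sub>m Suc k) *
      four_block_mat (0\<^sub>m 1 1) w (0\<^sub>m m 1) N =
    four_block_mat (0\<^sub>m 1 1) (w * N ^\<^sub>m k * N) (0\<^sub>m m 1) (N ^\<^sub>m Suc k * N)"
    using w N c by (subst mult_four_block_mat[of _ 1 1 _ m _ m]) (auto simp del: pow_mat.simps)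
  ultimately show ?case by (simp only: Suc pow_mat.simps(2)[of _ "Suc k"])
qed

text \<open>Passing from \<open>N\<close> to the extension raises the dimension of the kernel of the \<open>k\<close>-th power by
  one precisely for the exponents \<open>k\<close> beyond a threshold \<open>a\<close>. Taking second differences, one block of
  size \<open>a\<close> has grown to size \<open>a + 1\<close>.\<close>

lemma extension_grows:
  assumes w: "w \<in> carrier_mat 1 m" and N: "N \<in> carrier_mat m m"
    and ns: "0 \<notin> set ns" "similar_mat N (lower_jordan ns b)"
    and ms: "0 \<notin> set ms" "similar_mat (four_block_mat (b \<cdot>\<^sub>m 1\<^sub>m 1) w (0\<^sub>m m 1) N) (lower_jordan ms b)"
  shows "grows (mset ns) (mset ms)"
proof -
  let ?A = "four_block_mat (b \<cdot>\<^sub>m 1\<^sub>m 1) w (0\<^sub>m m 1) N"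
  define C where "C = char_matrix N b"
  have C: "C \<in> carrier_mat m m" using N by (simp add: C_def)
  have Cp: "C ^\<^sub>m k \<in> carrier_mat m m" for k using C by (rule pow_carrier_mat)
  have chA: "char_matrix ?A b = four_block_mat (0\<^sub>m 1 1) w (0\<^sub>m m 1) C"
    using w N by (auto simp: C_def char_matrix_def intro!: eq_matI)
  \<comment> \<open>\<open>H k\<close> is the criterion of \<open>kernel_dim_extension\<close> for
    the power \<open>Suc k\<close>, whose first row is \<open>w * C ^\<^sub>m k\<close>.\<close>
  define H where "H k \<longleftrightarrow> (\<forall>v\<in>mat_kernel (C ^\<^sub>m Suc k). (w * C ^\<^sub>m k) *\<^sub>v v = 0\<^sub>v 1)" for k
  have pN: "kernel_profile ns k = kernel_dim (C ^\<^sub>m k)" for k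
    using fun_cong[OF fun_cong[OF dim_gen_eigenspace_similar[OF ns(2)], of b], of k]
      dim_gen_eigenspace_lower_jordan[OF ns(1), of b k]
    by (simp add: C_def dim_gen_eigenspace_def)
  have pA: "kernel_profile ms k = kernel_dim (char_matrix ?A b ^\<^sub>m k)" for k
    using fun_cong[OF fun_cong[OF dim_gen_eigenspace_similar[OF ms(2)], of b], of k]
      dim_gen_eigenspace_lower_jordan[OF ms(1), of b k]
    by (simp add: dim_gen_eigenspace_def)
  have step: "kernel_profile ms (Suc k) = kernel_profile ns (Suc k) + (if H k then 1 else 0)" for k
    unfolding pA pN chA extension_pow[OF w C] H_def
    using w Cp[of k] by (intro kernel_dim_extension[OF _ Cp]) simp
  have p0: "kernel_profile xs 0 = 0" for xs by (simp add: kernel_profile_def)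
  \<comment> \<open>\<open>C\<close> maps the kernel of its power \<open>k + 2\<close> into that of
    its power \<open>k + 1\<close>, so the vanishing is inherited by larger exponents.\<close>
  have mono: "H (Suc k)" if "H k" for k
    unfolding H_def
  proof
    fix v assume v: "v \<in> mat_kernel (C ^\<^sub>m Suc (Suc k))"
    note vk = mat_kernelD[OF Cp v]
    have comm: "C ^\<^sub>m j * C = C * C ^\<^sub>m j" for j
      using intertwine_pow[OF C C C refl, of j] by simp
    have "C ^\<^sub>m Suc k *\<^sub>v (C *\<^sub>v v) = C ^\<^sub>m Suc (Suc k) *\<^sub>v v"
      using assoc_mult_mat_vec[OF Cp[of "Suc k"] C vk(1)] by simp
    then have "C *\<^sub>v v \<in> mat_kernel (C ^\<^sub>m Suc k)"
      using vk C by (intro mat_kernelI[OF Cp]) auto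
    then have "(w * C ^\<^sub>m k) *\<^sub>v (C *\<^sub>v v) = 0\<^sub>v 1" using that unfolding H_def by blast
    moreover have "(w * C ^\<^sub>m k) *\<^sub>v (C *\<^sub>v v) = (w * C ^\<^sub>m Suc k) *\<^sub>v v"
    proof -
      have "(w * C ^\<^sub>m k) *\<^sub>v (C *\<^sub>v v) = (w * C ^\<^sub>m k * C) *\<^sub>v v"
        using w Cp C vk by (intro assoc_mult_mat_vec[symmetric]) auto
      also have "w * C ^\<^sub>m k * C = w * C ^\<^sub>m Suc k" using assoc_mult_mat[OF w Cp C] by simp
      finally show ?thesis .
    qed
    ultimately show "(w * C ^\<^sub>m Suc k) *\<^sub>v v = 0\<^sub>v 1" by simp
  qed
  have "H m"
    unfolding H_def
  proof
    fix v assume v: "v \<in> mat_kernel (C ^\<^sub>m Suc m)"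
    have m: "sum_list ns = m" using similar_mat_carrier[OF ns(2), of m] N by auto
    have "C ^\<^sub>m m = 0\<^sub>m m m"
      unfolding C_def using lower_jordan_nilpotent[of ns m b] m
      by (intro similar_char_matrix_pow_zero[OF ns(2) N]) simp
    then have "w * C ^\<^sub>m m = 0\<^sub>m 1 m" using w by simp
    then show "(w * C ^\<^sub>m m) *\<^sub>v v = 0\<^sub>v 1" using mat_kernelD(1)[OF Cp v] by (auto intro!: eq_vecI)
  qed
  define a where "a = (LEAST k. H k)"
  have Ha: "H a" unfolding a_def using \<open>H m\<close> by (rule LeastI)
  have H: "H k \<longleftrightarrow> a \<le> k" for k
  proof
    show "H k \<Longrightarrow> a \<le> k" unfolding a_def by (rule Least_le)
    show "a \<le> k \<Longrightarrow> H k" by (induction rule: dec_induct) (use Ha mono in auto)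
  qed
  \<comment> \<open>The jump belongs to \<open>Suc k\<close> whenever \<open>H k\<close> holds, so
    it is present for exponents strictly larger than \<open>a\<close>.\<close>
  define h where "h k = (if a < k then 1 else 0 :: nat)" for k
  have prof: "kernel_profile ms k = kernel_profile ns k + h k" for k
    by (cases k) (auto simp: p0 step H h_def)
  have cnt: "count (mset ms) k + h (k - 1) + h (k + 1) = count (mset ns) k + 2 * h k" if "k > 0"
    for k
    using count_kernel_profile[OF that, of ns] count_kernel_profile[OF that, of ms] unfolding prof
      by simp
  \<comment> \<open>At \<open>k = a > 0\<close> the jump has not happened at \<open>a\<close> but
    has at \<open>a + 1\<close>, so \<open>cnt\<close> says that one block of size \<open>a\<close>
    is lost; there must have been one.\<close>
  have a: "a = 0 \<or> a \<in># mset ns"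
  proof (cases "a = 0")
    case False
    then have "count (mset ns) a \<noteq> 0" using cnt[of a]
      by (auto simp: h_def simp del: count_mset_0_iff count_eq_zero_iff)
    then show ?thesis by (metis count_eq_zero_iff)
  qed simp
  have z: "count (mset ns) 0 = 0" "count (mset ms) 0 = 0"
    using ns(1) ms(1) by (metis count_eq_zero_iff set_mset_mset)+
  have "mset ms = add_mset (a + 1) (mset ns - {#a#})"
  proof (rule multiset_eqI)
    fix k
    show "count (mset ms) k = count (add_mset (a + 1) (mset ns - {#a#})) k"
    proof (cases "k = 0")
      case True
      have "count (mset ns - {#a#}) 0 = 0" unfolding count_diff z(1) by simp
      then show ?thesis unfolding True z(2) by simp
    next
      case False
      then have "k > 0" by simp
      consider "k < a" | "k = a" | "k = a + 1" | "k > a + 1" by linarith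
      then show ?thesis
        using cnt[OF \<open>k > 0\<close>] \<open>k > 0\<close> by cases (auto simp: h_def split: if_splits)
    qed
  qed
  with a show ?thesis unfolding grows_def by blast
qed

text \<open>Rebracketing in the opposite direction: the first row is padded with zeros above the
  summand \<open>B\<close>.\<close>

lemma block_dsum:
  fixes A :: "'a :: field mat"
  assumes "w \<in> carrier_mat 1 k" "A \<in> carrier_mat k k" "B \<in> carrier_mat m m" "a \<in> carrier_mat 1 1"
  obtains v where "v \<in> carrier_mat 1 (k + m)"
    "four_block_mat a w (0\<^sub>m k 1) A \<oplus>\<^sub>d B = four_block_mat a v (0\<^sub>m (k + m) 1) (A \<oplus>\<^sub>d B)"
proof -
  define v where "v = mat 1 (k + m) (\<lambda>(i, j). if j < k then w $$ (0, j) else 0)"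
  have "four_block_mat a w (0\<^sub>m k 1) A \<oplus>\<^sub>d B = four_block_mat a v (0\<^sub>m (k + m) 1) (A \<oplus>\<^sub>d B)"
    (is "?F = ?G")
  proof (rule eq_matI)
    fix i j assume "i < dim_row ?G" "j < dim_col ?G"
    then have ij: "i < 1 + k + m" "j < 1 + k + m" using assms by auto
    have "i = 0 \<or> 0 < i \<and> i < 1 + k \<or> 1 + k \<le> i" "j = 0 \<or> 0 < j \<and> j < 1 + k \<or> 1 + k \<le> j"
      by linarith+
    then show "?F $$ (i, j) = ?G $$ (i, j)"
      using ij assms by (elim disjE conjE; simp add: v_def dsum_def; (intro conjI impI; linarith)?)
  qed (use assms in auto)
  then show ?thesis by (intro that[of v]) (auto simp: v_def)
qed

text \<open>Growth is realised by an explicit row: the zero row for a new block of size 1, and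
  otherwise a row attached only to the block of size \<open>a\<close> that is to be enlarged. The
  remaining blocks are carried along as a direct summand.\<close>

lemma grows_extension:
  assumes ns: "0 \<notin> set ns" and g: "grows (mset ns) (mset ms)"
  obtains w where "w \<in> carrier_mat 1 (sum_list ns)"
    "similar_mat (lower_jordan ms b) (four_block_mat (b \<cdot>\<^sub>m 1\<^sub>m 1) w (0\<^sub>m (sum_list ns) 1)
      (lower_jordan ns b))"
proof -
  let ?b = "b \<cdot>\<^sub>m 1\<^sub>m 1 :: real mat"
  have b1: "?b \<in> carrier_mat 1 1" by simp
  obtain a where a: "a = 0 \<or> a \<in> set ns" "mset ms = add_mset (a + 1) (mset ns - {#a#})"
    using g by (auto simp: grows_def)
  show ?thesis
  proof (cases "a = 0")
    case True
    then have "mset ms = mset (1 # ns)" using a ns by (simp add: diff_single_trivial)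
    then have "similar_mat (lower_jordan ms b) (lower_jordan (1 # ns) b)"
      by (rule lower_jordan_similar_mset)
    moreover have "lower_jordan (1 # ns) b = ?b \<oplus>\<^sub>d lower_jordan ns b"
      using lower_jordan_replicate_one[of 1 b] by (simp add: lower_jordan_Cons)
    ultimately show ?thesis using that[of "0\<^sub>m 1 (sum_list ns)"]
      by (simp add: dsum_four_block[of _ 1 _ "sum_list ns"])
  next
    case False
    then have "a \<in> set ns" using a by simp
    define rs where "rs = remove1 a ns"
    have m: "mset (a # rs) = mset ns" "mset ms = mset ((a + 1) # rs)"
      using \<open>a \<in> set ns\<close> a by (simp_all add: rs_def)
    have s: "a + sum_list rs = sum_list ns"
      using arg_cong[OF m(1), of sum_mset] by (simp add: sum_mset_sum_list)
    define e :: "real mat" where "e = mat 1 a (\<lambda>(i, j). if j = 0 then 1 else 0)"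
    have e: "e \<in> carrier_mat 1 a" by (simp add: e_def)
    \<comment> \<open>The superdiagonal convention is used here because deleting the first row and
      column of a block leaves the smaller block, with \<open>e\<close> as the remaining first
      row.\<close>
    have J: "jordan_block (a + 1) b = four_block_mat ?b e (0\<^sub>m a 1) (jordan_block a b)"
    proof (rule eq_matI)
      fix i j assume "i < dim_row (four_block_mat ?b e (0\<^sub>m a 1) (jordan_block a b))"
        "j < dim_col (four_block_mat ?b e (0\<^sub>m a 1) (jordan_block a b))"
      then have "i < Suc a" "j < Suc a" by simp_all
      then show "jordan_block (a + 1) b $$ (i, j) = four_block_mat ?b e (0\<^sub>m a 1)
        (jordan_block a b) $$ (i, j)"
        by (cases i; cases j) (auto simp: e_def)
    qed simp_all
    obtain v where v: "v \<in> carrier_mat 1 (a + sum_list rs)"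
      "jordan_block (a + 1) b \<oplus>\<^sub>d lower_jordan rs b =
        four_block_mat ?b v (0\<^sub>m (a + sum_list rs) 1) (jordan_block a b \<oplus>\<^sub>d lower_jordan rs b)"
      unfolding J using block_dsum[OF e jordan_block_carrier lower_jordan_carrier b1] by blast
    have "similar_mat (jordan_block a b \<oplus>\<^sub>d lower_jordan rs b) (lower_jordan_block a b \<oplus>\<^sub>d
      lower_jordan rs b)"
      by (intro similar_mat_dsum similar_mat_sym[OF lower_jordan_block_similar]
        similar_mat_refl[OF lower_jordan_carrier])
    also have "lower_jordan_block a b \<oplus>\<^sub>d lower_jordan rs b = lower_jordan (a # rs) b"
      by (simp add: lower_jordan_Cons)
    finally have J': "similar_mat (jordan_block a b \<oplus>\<^sub>d lower_jordan rs b) (lower_jordan ns b)"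
      using lower_jordan_similar_mset[OF m(1), of b] similar_mat_trans by blast
    have c: "jordan_block a b \<oplus>\<^sub>d lower_jordan rs b \<in> carrier_mat (a + sum_list rs)
      (a + sum_list rs)" by simp
    obtain w where w: "w \<in> carrier_mat 1 (a + sum_list rs)"
      "similar_mat (jordan_block (a + 1) b \<oplus>\<^sub>d lower_jordan rs b)
        (four_block_mat ?b w (0\<^sub>m (a + sum_list rs) 1) (lower_jordan ns b))"
      unfolding v(2) using block_upper_similar[OF similar_mat_refl[OF b1] J' b1 c v(1)] by blast
    have "similar_mat (lower_jordan ms b) (lower_jordan ((a + 1) # rs) b)"
      by (rule lower_jordan_similar_mset[OF m(2)])
    moreover have "similar_mat (lower_jordan ((a + 1) # rs) b) (jordan_block (a + 1) b \<oplus>\<^sub>d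
      lower_jordan rs b)"
      unfolding lower_jordan_Cons
      by (intro similar_mat_dsum lower_jordan_block_similar
        similar_mat_refl[OF lower_jordan_carrier])
    ultimately have "similar_mat (lower_jordan ms b) (four_block_mat ?b w (0\<^sub>m (a + sum_list rs) 1)
      (lower_jordan ns b))"
      using w(2) by (metis similar_mat_trans)
    then show ?thesis using that w(1) unfolding s by blast
  qed
qed

lemma extension_jordan_type:
  assumes w: "w \<in> carrier_mat 1 (sum_list ns)" and ns: "0 \<notin> set ns"
  obtains ms where "0 \<notin> set ms" "grows (mset ns) (mset ms)" "sum_list ms = 1 + sum_list ns"
    "similar_mat (four_block_mat (b \<cdot>\<^sub>m 1\<^sub>m 1) w (0\<^sub>m (sum_list ns) 1) (lower_jordan ns b))
      (lower_jordan ms b)"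
proof -
  let ?A = "four_block_mat (b \<cdot>\<^sub>m 1\<^sub>m 1) w (0\<^sub>m (sum_list ns) 1) (lower_jordan ns b)"
  have b1: "b \<cdot>\<^sub>m 1\<^sub>m 1 \<in> carrier_mat 1 1" by simp
  have A: "?A \<in> carrier_mat (1 + sum_list ns) (1 + sum_list ns)"
    by (intro four_block_carrier_mat) auto
  have "char_poly (b \<cdot>\<^sub>m 1\<^sub>m 1) = [:- b, 1:]"
    using char_poly_lower_jordan[of "replicate 1 1" b] unfolding lower_jordan_replicate_one by simp
  then have "char_poly ?A = [:- b, 1:] ^ (1 + sum_list ns)"
    using char_poly_block_upper[OF b1 lower_jordan_carrier w, of b]
      by (simp add: char_poly_lower_jordan)
  then obtain ms where "0 \<notin> set ms" "sum_list ms = 1 + sum_list ns"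
    "similar_mat ?A (lower_jordan ms b)"
    using lower_jordan_exists[OF A] by blast
  then show ?thesis
    using that extension_grows[OF w lower_jordan_carrier ns
      similar_mat_refl[OF lower_jordan_carrier]] by blast
qed

text \<open>Only odd sizes matter. Enlarging an even \<open>c\<close>, including 0, adds one to the
  multiplicity of the odd size \<open>c + 1\<close>; enlarging an odd \<open>c\<close> removes one
  from its own multiplicity and adds to an even size. Either way exactly one odd size changes
  parity.\<close>

lemma hamiltonian_type_grows:
  assumes "0 \<notin># M"
  shows "(\<exists>!a. odd a \<and> odd (count M a)) \<longleftrightarrow> (\<exists>N. 0 \<notin># N \<and> (\<forall>k. odd k \<longrightarrow> even (count N k)) \<and> grows N M)"
proof
  assume "\<exists>!a. odd a \<and> odd (count M a)"
  then obtain a where a: "odd a" "odd (count M a)" "\<And>b. odd b \<Longrightarrow> odd (count M b) \<Longrightarrow> b = a" by blast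
  have aM: "a \<in># M" using a(2) by (metis count_eq_zero_iff even_zero)
  obtain c where c: "a = Suc c" using a(1) by (cases a) auto
  \<comment> \<open>The exceptional odd size \<open>a\<close> is shrunk by one. The new size
    \<open>c\<close> is even, so it imposes no parity condition; if it is 0 the part
    disappears.\<close>
  define N where "N = (if c = 0 then M - {#a#} else add_mset c (M - {#a#}))"
  have "0 \<notin># N" using assms by (auto simp: N_def dest: in_diffD split: if_splits)
  moreover have "even (count N k)" if "odd k" for k
  proof -
    have "k \<noteq> c" using that a(1) c by auto
    then have "count N k = count M k - (if k = a then 1 else 0)" by (simp add: N_def)
    then have e: "count N k = count M k - (if k = a then 1 else 0)" .
    show ?thesis
    proof (cases "k = a")
      case True
      have "count N k = count M a - 1" using e True by simp
      then show ?thesis using a(2) by simp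
    next
      case False
      have "count N k = count M k" using e False by simp
      then show ?thesis using a(3)[OF that] False by metis
    qed
  qed
  moreover have "grows N M"
    unfolding grows_def
  proof (intro exI[of _ c] conjI)
    show "c = 0 \<or> c \<in># N" by (simp add: N_def)
    have "0 \<notin># M - {#a#}" using assms by (auto dest: in_diffD)
    then show "M = add_mset (c + 1) (N - {#c#})"
    proof (cases "c = 0")
      case True
      have "N - {#c#} = M - {#a#}"
        unfolding N_def using True \<open>0 \<notin># M - {#a#}\<close> by (metis diff_single_trivial)
      then show ?thesis using aM c by simp
    next
      case False
      then show ?thesis unfolding N_def using aM c by simp
    qed
  qed
  ultimately show "\<exists>N. 0 \<notin># N \<and> (\<forall>k. odd k \<longrightarrow> even (count N k)) \<and> grows N M" by blast
next
  assume "\<exists>N. 0 \<notin># N \<and> (\<forall>k. odd k \<longrightarrow> even (count N k)) \<and> grows N M"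
  then obtain N c where N: "0 \<notin># N" "\<And>k. odd k \<Longrightarrow> even (count N k)" "c = 0 \<or> c \<in># N"
    "M = add_mset (c + 1) (N - {#c#})" unfolding grows_def by blast
  have cnt: "count M k = (if k = c + 1 then 1 else 0) + (count N k - (if k = c then 1 else 0))"
    for k
    unfolding N(4) by simp
  show "\<exists>!a. odd a \<and> odd (count M a)"
  proof (cases "even c")
    case True
    show ?thesis
    proof (rule ex1I[of _ "c + 1"])
      show "odd (c + 1) \<and> odd (count M (c + 1))" using True N(2)[of "c + 1"] cnt[of "c + 1"] by simp
      show "k = c + 1" if "odd k \<and> odd (count M k)" for k
        using that True N(2)[of k] cnt[of k] by (auto split: if_splits)
    qed
  next
    case False
    then have "c \<in># N" using N(3) by auto
    then have "count N c > 0" by simp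
    show ?thesis
    proof (rule ex1I[of _ c])
      show "odd c \<and> odd (count M c)" using False N(2)[of c] cnt[of c] \<open>count N c > 0\<close> by simp
      show "k = c" if "odd k \<and> odd (count M k)" for k
        using that False N(2)[of k] cnt[of k] by (auto split: if_splits)
    qed
  qed
qed

subsection \<open>Spectra and multiplicities\<close>

lemma spec_similar: "similar_mat A B \<Longrightarrow> spec A = spec B"
proof -
  assume s: "similar_mat A B"
  then obtain n where n: "A \<in> carrier_mat n n" "B \<in> carrier_mat n n" using similar_matD[OF s]
    by blast
  show ?thesis using spec_carrier[OF n(1)] spec_carrier[OF n(2)] char_poly_similar[OF s] by simp
qed

lemma spec_dsum:
  assumes "A \<in> carrier_mat n n" "B \<in> carrier_mat m m"
  shows "spec (A \<oplus>\<^sub>d B) = spec A \<union> spec B"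
proof -
  let ?h = "map_mat complex_of_real"
  have "?h (A \<oplus>\<^sub>d B) = ?h A \<oplus>\<^sub>d ?h B"
    using assms by (intro eq_matI) (auto simp: dsum_def)
  moreover have "eigenvalue (?h A \<oplus>\<^sub>d ?h B) x \<longleftrightarrow> eigenvalue (?h A) x \<or> eigenvalue (?h B) x" for x
    using assms by (intro eigenvalue_dsum) auto
  ultimately show ?thesis by (auto simp: spec_def spectrum_def)
qed

lemma spec_smult:
  assumes A: "A \<in> carrier_mat n n" and c: "c \<noteq> 0"
  shows "spec (c \<cdot>\<^sub>m A) = (\<lambda>x. of_real c * x) ` spec A"
proof -
  let ?h = "map_mat complex_of_real"
  have A': "?h A \<in> carrier_mat n n" using A by simp
  have e: "?h (c \<cdot>\<^sub>m A) = of_real c \<cdot>\<^sub>m ?h A" by (intro eq_matI) auto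
  have m: "of_real c * x \<in> spec (c \<cdot>\<^sub>m A) \<longleftrightarrow> x \<in> spec A" for x
    using eigenvalue_smult[OF A', of "of_real c" x] c unfolding spec_def spectrum_def e by simp
  have "x \<in> (\<lambda>x. of_real c * x) ` spec A" if "x \<in> spec (c \<cdot>\<^sub>m A)" for x
    using m[of "x / of_real c"] that c by (intro image_eqI[of _ _ "x / of_real c"]) auto
  then show ?thesis using m by blast
qed

lemma spec_finite: "A \<in> carrier_mat n n \<Longrightarrow> finite (spec A)"
  unfolding spec_def by (intro card_finite_spectrum(1)[of _ n]) simp

lemma spec_nonempty: "A \<in> carrier_mat n n \<Longrightarrow> n > 0 \<Longrightarrow> spec A \<noteq> {}"
  unfolding spec_def by (intro spectrum_non_empty[of _ n]) auto

lemma spec_empty: "A \<in> carrier_mat 0 0 \<Longrightarrow> spec A = {}"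
proof -
  assume A: "A \<in> carrier_mat 0 0"
  have "char_poly A = 1" using A by (simp add: char_poly_def char_poly_matrix_def det_def')
  then show ?thesis using spec_carrier[OF A] by simp
qed

lemma nilpotent_spec:
  assumes A: "A \<in> carrier_mat n n" and "nilpotent_mat A" and x: "x \<in> spec A"
  shows "x = 0"
proof -
  let ?A = "map_mat complex_of_real A"
  have A': "?A \<in> carrier_mat n n" using A by simp
  obtain k where "A ^\<^sub>m k = 0\<^sub>m n n" using assms(2) A by (auto simp: nilpotent_mat_def)
  then have k: "?A ^\<^sub>m k = 0\<^sub>m n n"
    unfolding of_real_hom.mat_hom_pow[OF A, symmetric] by (auto intro!: eq_matI)
  obtain v where v: "eigenvector ?A v x"
    using x by (auto simp: spec_def spectrum_def eigenvalue_def)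
  then have vc: "v \<in> carrier_vec n" "v \<noteq> 0\<^sub>v n" using A by (auto simp: eigenvector_def)
  have "0\<^sub>m n n *\<^sub>v v = 0\<^sub>v n" using vc by (intro eq_vecI) auto
  then have 0: "x ^ k \<cdot>\<^sub>v v = 0\<^sub>v n" using eigenvector_pow[OF A' v, of k] unfolding k by simp
  obtain i where i: "i < n" "v $ i \<noteq> 0" using vc by (auto simp: vec_eq_iff)
  then have "x ^ k * v $ i = 0" using arg_cong[OF 0, of "\<lambda>u. u $ i"] vc by simp
  then show ?thesis using i by simp
qed

lemma similar_lower_jordan_nilpotent:
  assumes "similar_mat A (lower_jordan ns 0)"
  shows "nilpotent_mat A"
proof -
  let ?n = "sum_list ns"
  have A: "A \<in> carrier_mat ?n ?n" using similar_mat_carrier[OF assms, of ?n] by simp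
  have "char_matrix A 0 ^\<^sub>m ?n = 0\<^sub>m ?n ?n"
    by (rule similar_char_matrix_pow_zero[OF assms A]) (rule lower_jordan_nilpotent[OF order_refl])
  moreover have "char_matrix A 0 = A" using A by (intro eq_matI) (auto simp: char_matrix_def)
  ultimately show ?thesis using A by (auto simp: nilpotent_mat_def)
qed

text \<open>A list in decreasing order of modulus starts with an eigenvalue of largest modulus, so
  the normalisation says that the spectral radius is 1. Such a list exists since the spectrum is
  finite.\<close>

lemma normalized_spec_iff:
  assumes Q: "Q \<in> carrier_mat n n"
  shows "normalized_spec Q \<longleftrightarrow> 0 \<notin> spec Q \<and> (\<exists>x\<in>spec Q. cmod x = 1) \<and> (\<forall>x\<in>spec Q. cmod x \<le> 1)"
proof
  assume "normalized_spec Q"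
  then obtain xs where xs: "0 \<notin> spec Q" "set xs = spec Q" "xs \<noteq> []" "cmod (hd xs) = 1"
    "sorted_wrt (\<lambda>x y. cmod x \<ge> cmod y) xs"
    unfolding normalized_spec_def by blast
  then show "0 \<notin> spec Q \<and> (\<exists>x\<in>spec Q. cmod x = 1) \<and> (\<forall>x\<in>spec Q. cmod x \<le> 1)"
    unfolding xs(2)[symmetric] by (cases xs) auto
next
  assume h: "0 \<notin> spec Q \<and> (\<exists>x\<in>spec Q. cmod x = 1) \<and> (\<forall>x\<in>spec Q. cmod x \<le> 1)"
  obtain ys where ys: "set ys = spec Q" "distinct ys"
    using finite_distinct_list[OF spec_finite[OF Q]] by blast
  define xs where "xs = sort_key (\<lambda>x. - cmod x) ys"
  have xs: "set xs = spec Q" "distinct xs" using ys by (auto simp: xs_def)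
  have "sorted (map (\<lambda>x. - cmod x) xs)" unfolding xs_def by simp
  then have s: "sorted_wrt (\<lambda>x y. cmod x \<ge> cmod y) xs" by (simp add: sorted_wrt_map)
  have ne: "xs \<noteq> []" using xs(1) h by auto
  then obtain z zs where z: "xs = z # zs" by (cases xs) auto
  have "cmod (hd xs) = 1"
  proof -
    obtain x where "x \<in> set xs" "cmod x = 1" using h xs(1) by auto
    then have "cmod z \<ge> 1" using s unfolding z by auto
    moreover have "cmod z \<le> 1" using h xs(1) z by auto
    ultimately show ?thesis using z by simp
  qed
  moreover have "cmod (last xs) > 0" using h xs(1) last_in_set[OF ne] by auto
  ultimately show "normalized_spec Q" unfolding normalized_spec_def using h xs s ne by blast
qed

lemma normalized_spec_similar: "similar_mat Q R \<Longrightarrow> normalized_spec Q \<longleftrightarrow> normalized_spec R"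
  by (simp add: normalized_spec_def spec_similar)

text \<open>Scaling by \<open>c\<close> multiplies the spectral radius by the absolute value of
  \<open>c\<close>, and both radii are 1. Hence the sign is the only ambiguity left, as in the
  relation defining \<open>S0\<close>.\<close>

lemma normalized_spec_smult:
  assumes "normalized_spec Q" "normalized_spec (c \<cdot>\<^sub>m Q)" "Q \<in> carrier_mat n n" "c \<noteq> 0"
  shows "\<bar>c\<bar> = 1"
proof -
  have cQ: "c \<cdot>\<^sub>m Q \<in> carrier_mat n n" using assms(3) by simp
  have s: "spec (c \<cdot>\<^sub>m Q) = (\<lambda>x. of_real c * x) ` spec Q" by (rule spec_smult[OF assms(3,4)])
  obtain x where x: "x \<in> spec Q" "cmod x = 1" using assms(1) normalized_spec_iff[OF assms(3)]
    by blast
  obtain y where y: "y \<in> spec Q" "cmod (of_real c * y) = 1"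
    using assms(2) normalized_spec_iff[OF cQ] s by auto
  have "cmod (of_real c * x) \<le> 1" using assms(2) normalized_spec_iff[OF cQ] s x(1) by blast
  moreover have "cmod y \<le> 1" using assms(1) normalized_spec_iff[OF assms(3)] y(1) by blast
  ultimately show ?thesis using x(2) y(2) mult_left_le[of "cmod y" "\<bar>c\<bar>"] by (simp add: norm_mult)
qed

text \<open>The factor is the inverse of the spectral radius, which is positive because the matrix
  is non-empty and 0 is not in its spectrum.\<close>

lemma normalized_spec_scaling:
  assumes Q: "Q \<in> carrier_mat n n" "n > 0" and z: "0 \<notin> spec Q"
  obtains c where "c \<noteq> 0" "normalized_spec (c \<cdot>\<^sub>m Q)"
proof -
  let ?S = "cmod ` spec Q"
  have fin: "finite ?S" "?S \<noteq> {}" using spec_finite[OF Q(1)] spec_nonempty[OF Q] by auto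
  obtain x where x: "x \<in> spec Q" "cmod x = Max ?S" using Max_in[OF fin] by (metis imageE)
  have le: "cmod y \<le> cmod x" if "y \<in> spec Q" for y unfolding x(2) using fin that by simp
  have x0: "cmod x > 0" using x(1) z by auto
  define c where "c = inverse (cmod x)"
  have c: "c \<noteq> 0" using x0 by (simp add: c_def)
  have cQ: "c \<cdot>\<^sub>m Q \<in> carrier_mat n n" using Q(1) by simp
  have "normalized_spec (c \<cdot>\<^sub>m Q)"
    unfolding normalized_spec_iff[OF cQ] spec_smult[OF Q(1) c]
  proof (intro conjI ballI)
    show "0 \<notin> (\<lambda>x. of_real c * x) ` spec Q" using z c by auto
    show "\<exists>y\<in>(\<lambda>x. of_real c * x) ` spec Q. cmod y = 1"
      using x(1) x0 by (intro bexI[of _ "of_real c * x"]) (auto simp: c_def norm_mult norm_inverse)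
    show "cmod y \<le> 1" if y: "y \<in> (\<lambda>x. of_real c * x) ` spec Q" for y
    proof -
      obtain z where z: "z \<in> spec Q" "y = of_real c * z" using y by blast
      have "cmod y = cmod z / cmod x" using z(2) x0
        by (simp add: c_def norm_mult norm_inverse divide_inverse)
      then show ?thesis using le[OF z(1)] x0 by simp
    qed
  qed
  with c show thesis by (rule that)
qed

lemma alg_mult_dsum:
  assumes A: "A \<in> carrier_mat n n" and B: "B \<in> carrier_mat m m"
  shows "alg_mult (A \<oplus>\<^sub>d B) b = alg_mult A b + alg_mult B b"
proof -
  have "char_poly A \<noteq> 0" "char_poly B \<noteq> 0"
    using degree_monic_char_poly[OF A] degree_monic_char_poly[OF B] by auto
  then show ?thesis unfolding alg_mult_def char_poly_dsum[OF A B] by (intro order_mult) simp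
qed

lemma alg_mult_no_eigenvalue: "A \<in> carrier_mat n n \<Longrightarrow> \<not> eigenvalue A b \<Longrightarrow> alg_mult A b = 0"
  unfolding alg_mult_def by (rule order_char_poly_zero)

lemma alg_mult_lower_jordan: "alg_mult (lower_jordan ns b) c = (if c = b then sum_list ns else 0)"
proof (cases "c = b")
  case True
  have "\<not> eigenvalue (0\<^sub>m 0 0 :: real mat) b"
    using eigenvalue_lower_jordan[of "[]" b b] by simp
  then show ?thesis using alg_mult_lower_jordan_dsum[of "0\<^sub>m 0 0" 0 b ns] True by simp
next
  case False
  then show ?thesis
    using alg_mult_no_eigenvalue[OF lower_jordan_carrier, of ns b c]
      by (simp add: eigenvalue_lower_jordan)
qed

text \<open>Read off from the splitting: scaling turns the part for \<open>b\<close> into the part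
  for \<open>c * b\<close> with the same block sizes, and the complement still avoids that
  eigenvalue.\<close>

lemma alg_mult_smult:
  assumes A: "A \<in> carrier_mat n n" and c: "c \<noteq> 0"
  shows "alg_mult (c \<cdot>\<^sub>m A) (c * b) = alg_mult A b"
proof -
  obtain ns B k where d: "B \<in> carrier_mat k k" "\<not> eigenvalue B b"
    "similar_mat A (lower_jordan ns b \<oplus>\<^sub>d B)"
    using jordan_splitting[OF A, of b] by metis
  have "similar_mat (c \<cdot>\<^sub>m A) (c \<cdot>\<^sub>m (lower_jordan ns b \<oplus>\<^sub>d B))" by (rule similar_mat_smult[OF d(3)])
  also have "c \<cdot>\<^sub>m (lower_jordan ns b \<oplus>\<^sub>d B) = (c \<cdot>\<^sub>m lower_jordan ns b) \<oplus>\<^sub>d (c \<cdot>\<^sub>m B)"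
    by (rule dsum_smult[OF lower_jordan_carrier d(1)])
  finally have s: "similar_mat (c \<cdot>\<^sub>m A) ((c \<cdot>\<^sub>m lower_jordan ns b) \<oplus>\<^sub>d (c \<cdot>\<^sub>m B))" .
  have cB: "c \<cdot>\<^sub>m B \<in> carrier_mat k k" using d(1) by simp
  have "similar_mat (c \<cdot>\<^sub>m A) (lower_jordan ns (c * b) \<oplus>\<^sub>d (c \<cdot>\<^sub>m B))"
    using similar_mat_trans[OF s similar_mat_dsum[OF lower_jordan_smult[OF c]
      similar_mat_refl[OF cB]]] .
  then have "alg_mult (c \<cdot>\<^sub>m A) (c * b) = sum_list ns"
    using alg_mult_similar alg_mult_lower_jordan_dsum[OF cB] eigenvalue_smult[OF d(1) c] d(2)
      by metis
  also have "\<dots> = alg_mult A b"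
    using alg_mult_similar[OF d(3)] alg_mult_lower_jordan_dsum[OF d(1,2)] by metis
  finally show ?thesis .
qed

lemma hamiltonian_alg_mult_uminus:
  assumes h: "hamiltonian D"
  shows "alg_mult D (- b) = alg_mult D b"
proof -
  obtain n where D: "D \<in> carrier_mat n n" using h by (auto simp: hamiltonian_def)
  have "alg_mult D (- b) = alg_mult ((- 1) \<cdot>\<^sub>m transpose_mat D) ((- 1) * b)"
    using alg_mult_similar[OF hamiltonian_similar_uminus_transpose[OF h], of "- b"]
    by (simp add: uminus_mat_smult)
  also have "\<dots> = alg_mult (transpose_mat D) b" using D by (intro alg_mult_smult[of _ n]) auto
  also have "\<dots> = alg_mult D b" using D by (simp add: alg_mult_def)
  finally show ?thesis .
qed

subsection \<open>The four normal forms\<close>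

lemma diag_block_mat_pair: "diag_block_mat [A, B] = A \<oplus>\<^sub>d B"
proof -
  have "diag_block_mat ([] :: 'a mat list) = 0\<^sub>m 0 0" by simp
  then show ?thesis by (simp only: diag_block_mat_dsum dsum_empty)
qed

lemma diag_block_mat_triple: "diag_block_mat [A, B, C] = A \<oplus>\<^sub>d B \<oplus>\<^sub>d C"
  by (simp only: diag_block_mat_dsum[of A "[B, C]"] diag_block_mat_pair)

lemma is_jordan_partI:
  assumes "similar_mat M (lower_jordan ns b \<oplus>\<^sub>d R)" "R \<in> carrier_mat k k" "\<not> eigenvalue R b"
    "0 \<notin> set ns" "ns \<noteq> []"
  shows "is_jordan_part M b (lower_jordan ns b)"
  unfolding is_jordan_part_def
proof (intro conjI exI[of _ ns] exI[of _ R])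
  have "sum_list ns \<noteq> 0" using assms(4,5) by (cases ns) auto
  then show "eigenvalue M b"
    using eigenvalue_similar[OF assms(1)] eigenvalue_dsum[OF lower_jordan_carrier assms(2)]
    by (simp add: eigenvalue_lower_jordan)
  show "\<forall>k\<in>set ns. k \<ge> 1" using assms(4) by (metis One_nat_def Suc_leI gr0I)
  show "lower_jordan ns b = diag_block_mat (map (\<lambda>k. lower_jordan_block k b) ns)"
    by (simp add: lower_jordan_def)
  show "square_mat R" using assms(2) by auto
  show "complex_of_real b \<notin> spec R" using spec_of_real_iff[OF assms(2)] assms(3) by simp
  show "similar_mat M (diag_block_mat [lower_jordan ns b, R])"
    using assms(1) by (simp only: diag_block_mat_pair)
qed

text \<open>The complement does not have the eigenvalue \<open>b\<close> while \<open>M\<close> has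
  it, so the list of blocks is non-empty and its total size is the algebraic multiplicity.\<close>

lemma is_jordan_partE:
  assumes "is_jordan_part M b N"
  obtains ns where "0 \<notin> set ns" "ns \<noteq> []" "N = lower_jordan ns b" "alg_mult M b = sum_list ns"
proof -
  obtain ns R where d: "eigenvalue M b" "\<forall>k\<in>set ns. k \<ge> 1" "N = lower_jordan ns b" "square_mat R"
    "complex_of_real b \<notin> spec R" "similar_mat M (N \<oplus>\<^sub>d R)"
    using assms unfolding is_jordan_part_def diag_block_mat_pair lower_jordan_def by blast
  obtain k where R: "R \<in> carrier_mat k k" using d(4) by auto
  have ev: "\<not> eigenvalue R b" using spec_of_real_iff[OF R] d(5) by simp
  have ns: "0 \<notin> set ns" using d(2) by auto
  have "ns \<noteq> []"
    using d(1) ev eigenvalue_similar[OF d(6)] unfolding d(3) by auto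
  moreover have "alg_mult M b = sum_list ns"
    unfolding alg_mult_similar[OF d(6)] d(3) by (rule alg_mult_lower_jordan_dsum[OF R ev])
  ultimately show thesis using that ns d(3) by blast
qed

text \<open>Parameters of form (1): the existence of a unique odd size with odd multiplicity is
  \<open>types_s\<close> expressed on block sizes. The size equation is written additively to avoid
  truncated subtraction.\<close>

definition zero_form :: "nat \<Rightarrow> nat list \<Rightarrow> nat \<Rightarrow> real mat \<Rightarrow> bool" where
  "zero_form n ns r Q \<longleftrightarrow> 0 \<notin> set ns \<and> (\<exists>!a. odd a \<and> odd (count (mset ns) a)) \<and>
     Q \<in> sp r \<and> normalized_spec Q \<and> sum_list ns + 2 * r + 1 = 2 * n"

text \<open>One family for the forms (2), (3) and (4): an empty \<open>ns\<close> gives (2), a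
  non-empty \<open>ns\<close> with \<open>r = 0\<close> gives (3), and a non-empty \<open>ns\<close>
  with \<open>r \<ge> 1\<close> gives (4). The list \<open>ms\<close> belongs to the eigenvalue 1
  and \<open>ns\<close> to -1.\<close>

definition pair_form :: "nat \<Rightarrow> nat list \<Rightarrow> nat list \<Rightarrow> nat \<Rightarrow> real mat \<Rightarrow> bool" where
  "pair_form n ms ns r Q \<longleftrightarrow> 0 \<notin> set ns \<and> 0 \<notin> set ms \<and> grows (mset ns) (mset ms) \<and>
     Q \<in> sp r \<and> 1 \<notin> spec Q \<and> sum_list ns + r + 1 = n"

definition zero_sum :: "nat list \<Rightarrow> real mat \<Rightarrow> real mat" where
  "zero_sum ns Q = lower_jordan ns 0 \<oplus>\<^sub>d Q"

definition pair_sum :: "nat list \<Rightarrow> nat list \<Rightarrow> real mat \<Rightarrow> real mat" where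
  "pair_sum ms ns Q = lower_jordan ms 1 \<oplus>\<^sub>d lower_jordan ns (- 1) \<oplus>\<^sub>d Q"

lemma sp_carrier: "Q \<in> sp r \<Longrightarrow> Q \<in> carrier_mat (2 * r) (2 * r)"
  by (simp add: sp_def)

lemma grows_sum_list: "grows (mset ns) (mset ms) \<Longrightarrow> sum_list ms = sum_list ns + 1"
proof -
  assume "grows (mset ns) (mset ms)"
  then obtain a where a: "a = 0 \<or> a \<in># mset ns" "mset ms = add_mset (a + 1) (mset ns - {#a#})"
    unfolding grows_def by blast
  have "sum_mset (mset ms) = a + 1 + sum_mset (mset ns - {#a#})" unfolding a(2) by simp
  moreover have "sum_mset (mset ns) = a + sum_mset (mset ns - {#a#})"
  proof (cases "a \<in># mset ns")
    case True
    then have "mset ns = add_mset a (mset ns - {#a#})" by simp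
    from arg_cong[OF this, of sum_mset] show ?thesis by simp
  next
    case False
    then have "a = 0" "mset ns - {#a#} = mset ns" using a(1) diff_single_trivial[OF False]
      by simp_all
    then show ?thesis by simp
  qed
  ultimately show ?thesis unfolding sum_mset_sum_list by simp
qed

lemma zero_sum_carrier:
  assumes "zero_form n ns r Q"
  shows "zero_sum ns Q \<in> carrier_mat (2 * n - 1) (2 * n - 1)"
proof -
  have "sum_list ns + 2 * r + 1 = 2 * n" using assms unfolding zero_form_def by blast
  then have "sum_list ns + 2 * r = 2 * n - 1" by linarith
  then show ?thesis
    using dsum_carrier[OF lower_jordan_carrier sp_carrier, of Q r ns 0] assms
    by (simp add: zero_form_def zero_sum_def)
qed

lemma pair_sum_carrier:
  assumes "pair_form n ms ns r Q"
  shows "pair_sum ms ns Q \<in> carrier_mat (2 * n - 1) (2 * n - 1)"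
proof -
  have "sum_list ms + (sum_list ns + 2 * r) = 2 * n - 1"
    using assms grows_sum_list[of ns ms] by (auto simp: pair_form_def)
  then show ?thesis
    using dsum_carrier[OF lower_jordan_carrier dsum_carrier[OF lower_jordan_carrier sp_carrier],
      of Q r ms 1 ns "- 1"] assms
    by (simp add: pair_form_def pair_sum_def)
qed

lemma zero_form_no_eigenvalue: "zero_form n ns r Q \<Longrightarrow> \<not> eigenvalue Q 0"
  using spec_of_real_iff[OF sp_carrier, of Q r 0] normalized_spec_iff[OF sp_carrier, of Q r]
  by (auto simp: zero_form_def)

text \<open>The spectrum of a Hamiltonian matrix is symmetric, so excluding 1 also excludes -1;
  cancellation at either eigenvalue then leaves \<open>Q\<close> untouched.\<close>

lemma pair_form_no_eigenvalue:
  assumes "pair_form n ms ns r Q"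
  shows "\<not> eigenvalue Q 1" "\<not> eigenvalue Q (- 1)"
proof -
  show "\<not> eigenvalue Q 1"
    using spec_of_real_iff[OF sp_carrier, of Q r 1] assms by (simp add: pair_form_def)
  then show "\<not> eigenvalue Q (- 1)"
    using hamiltonian_eigenvalue_uminus[OF sp_hamiltonian, of Q r 1] assms
      by (simp add: pair_form_def)
qed

lemma zero_sum_not_nilpotent:
  assumes "zero_form n ns r Q"
  shows "\<not> nilpotent_mat (zero_sum ns Q)"
proof
  assume nil: "nilpotent_mat (zero_sum ns Q)"
  have Q: "Q \<in> carrier_mat (2 * r) (2 * r)" "normalized_spec Q"
    using assms by (auto simp: zero_form_def sp_carrier)
  obtain x where x: "x \<in> spec Q" "cmod x = 1" using Q(2) normalized_spec_iff[OF Q(1)] by blast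
  then have "x \<in> spec (zero_sum ns Q)"
    unfolding zero_sum_def spec_dsum[OF lower_jordan_carrier Q(1)] by simp
  then have "x = 0" by (rule nilpotent_spec[OF zero_sum_carrier[OF assms] nil])
  then show False using x(2) by simp
qed

lemma pair_sum_not_nilpotent:
  assumes "pair_form n ms ns r Q"
  shows "\<not> nilpotent_mat (pair_sum ms ns Q)"
proof
  assume nil: "nilpotent_mat (pair_sum ms ns Q)"
  have s: "sum_list ms \<noteq> 0" using assms grows_sum_list[of ns ms] by (simp add: pair_form_def)
  have Q: "Q \<in> carrier_mat (2 * r) (2 * r)" using assms by (simp add: pair_form_def sp_carrier)
  have "eigenvalue (pair_sum ms ns Q) 1"
    unfolding pair_sum_def eigenvalue_dsum[OF lower_jordan_carrier
      dsum_carrier[OF lower_jordan_carrier Q]]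
    using s by (simp add: eigenvalue_lower_jordan)
  then have "complex_of_real 1 \<in> spec (pair_sum ms ns Q)"
    using spec_of_real_iff[OF pair_sum_carrier[OF assms]] by blast
  then have "complex_of_real 1 = 0" by (rule nilpotent_spec[OF pair_sum_carrier[OF assms] nil])
  then show False by simp
qed

lemma lie_iso_almost_abelian_similar:
  assumes A: "A \<in> carrier_mat n n" and sim: "similar_mat A B"
  shows "lie_iso (almost_abelian A) (almost_abelian B)"
proof (rule lie_iso_almost_abelianI[OF A _ one_neq_zero])
  show "B \<in> carrier_mat n n" using similar_mat_carrier[OF sim] A by blast
  have "(1 :: real) \<cdot>\<^sub>m B = B" by (intro eq_matI) auto
  then show "similar_mat A (1 \<cdot>\<^sub>m B)" using sim by simp
qed

text \<open>Undoing one growth step gives sizes \<open>ks\<close> whose nilpotent blocks are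
  Hamiltonian. Together with \<open>Q\<close> they form the Hamiltonian quotient, and the row that
  realises the growth gives the extension with corner 0.\<close>

lemma symplectic_zero_sum:
  assumes "zero_form n ns r Q"
  obtains \<omega> where "symplectic_structure (almost_abelian (zero_sum ns Q)) \<omega>"
proof -
  have ns: "0 \<notin># mset ns" "\<exists>!a. odd a \<and> odd (count (mset ns) a)" "Q \<in> sp r"
    using assms by (auto simp: zero_form_def)
  obtain N where N: "0 \<notin># N" "\<forall>k. odd k \<longrightarrow> even (count N k)" "grows N (mset ns)"
    using hamiltonian_type_grows[OF ns(1), THEN iffD1, OF ns(2)] by (elim exE conjE)
  obtain ks where ks: "mset ks = N" using ex_mset by blast
  have ks': "0 \<notin> set ks" "grows (mset ks) (mset ns)" using N ks by auto
  obtain w where w: "w \<in> carrier_mat 1 (sum_list ks)"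
    "similar_mat (lower_jordan ns 0) (four_block_mat (0 \<cdot>\<^sub>m 1\<^sub>m 1) w (0\<^sub>m (sum_list ks) 1)
      (lower_jordan ks 0))"
    by (rule grows_extension[OF ks', of 0])
  have Q: "Q \<in> carrier_mat (2 * r) (2 * r)" by (rule sp_carrier[OF ns(3)])
  obtain v where v: "v \<in> carrier_mat 1 (sum_list ks + 2 * r)"
    "four_block_mat (0 \<cdot>\<^sub>m 1\<^sub>m 1) w (0\<^sub>m (sum_list ks) 1) (lower_jordan ks 0) \<oplus>\<^sub>d Q =
      four_block_mat (0 \<cdot>\<^sub>m 1\<^sub>m 1) v (0\<^sub>m (sum_list ks + 2 * r) 1) (lower_jordan ks 0 \<oplus>\<^sub>d Q)"
    by (rule block_dsum[OF w(1) lower_jordan_carrier Q smult_carrier_mat[OF one_carrier_mat]])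
  have D: "lower_jordan ks 0 \<oplus>\<^sub>d Q \<in> carrier_mat (sum_list ks + 2 * r) (sum_list ks + 2 * r)"
    by (rule dsum_carrier[OF lower_jordan_carrier Q])
  have H: "hamiltonian (lower_jordan ks 0 \<oplus>\<^sub>d Q)"
    by (intro hamiltonian_dsum hamiltonian_nilpotent_jordan sp_hamiltonian[OF ns(3)])
      (use N(2) ks in blast)
  obtain \<omega> where \<omega>: "symplectic_structure (almost_abelian
      (four_block_mat (0 \<cdot>\<^sub>m 1\<^sub>m 1) v (0\<^sub>m (sum_list ks + 2 * r) 1) (lower_jordan ks 0 \<oplus>\<^sub>d Q))) \<omega>"
    by (rule symplectic_structure_block[OF v(1) D H])
  have sim: "similar_mat (zero_sum ns Q)
      (four_block_mat (0 \<cdot>\<^sub>m 1\<^sub>m 1) v (0\<^sub>m (sum_list ks + 2 * r) 1) (lower_jordan ks 0 \<oplus>\<^sub>d Q))"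
    unfolding zero_sum_def v(2)[symmetric]
      by (rule similar_mat_dsum[OF w(2) similar_mat_refl[OF Q]])
  note c = zero_sum_carrier[OF assms]
  note c' = similar_mat_carrier[OF sim, THEN iffD2, OF c]
  show thesis
    by (rule symplectic_structure_lie_iso[OF c c' lie_iso_almost_abelian_similar[OF c sim] \<omega>])
      (rule that)
qed

text \<open>The Hamiltonian quotient has the sizes \<open>ns\<close> at both 1 and -1, plus
  \<open>Q\<close>; extending it with corner 1 enlarges only the part at 1, from \<open>ns\<close>
  to \<open>ms\<close>.\<close>

lemma symplectic_pair_sum:
  assumes "pair_form n ms ns r Q"
  obtains \<omega> where "symplectic_structure (almost_abelian (pair_sum ms ns Q)) \<omega>"
proof -
  have ns: "0 \<notin> set ns" "grows (mset ns) (mset ms)" "Q \<in> sp r"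
    using assms by (auto simp: pair_form_def)
  obtain w where w: "w \<in> carrier_mat 1 (sum_list ns)"
    "similar_mat (lower_jordan ms 1) (four_block_mat (1 \<cdot>\<^sub>m 1\<^sub>m 1) w (0\<^sub>m (sum_list ns) 1)
      (lower_jordan ns 1))"
    by (rule grows_extension[OF ns(1,2), of 1])
  have Q: "Q \<in> carrier_mat (2 * r) (2 * r)" by (rule sp_carrier[OF ns(3)])
  define E where "E = lower_jordan ns (- 1) \<oplus>\<^sub>d Q"
  define e where "e = sum_list ns + 2 * r"
  have E: "E \<in> carrier_mat e e" unfolding E_def e_def
    by (rule dsum_carrier[OF lower_jordan_carrier Q])
  obtain v where v: "v \<in> carrier_mat 1 (sum_list ns + e)"
    "four_block_mat (1 \<cdot>\<^sub>m 1\<^sub>m 1) w (0\<^sub>m (sum_list ns) 1) (lower_jordan ns 1) \<oplus>\<^sub>d E =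
      four_block_mat (1 \<cdot>\<^sub>m 1\<^sub>m 1) v (0\<^sub>m (sum_list ns + e) 1) (lower_jordan ns 1 \<oplus>\<^sub>d E)"
    by (rule block_dsum[OF w(1) lower_jordan_carrier E smult_carrier_mat[OF one_carrier_mat]])
  have D: "lower_jordan ns 1 \<oplus>\<^sub>d E \<in> carrier_mat (sum_list ns + e) (sum_list ns + e)"
    by (rule dsum_carrier[OF lower_jordan_carrier E])
  have H: "hamiltonian (lower_jordan ns 1 \<oplus>\<^sub>d E)"
    unfolding E_def dsum_assoc[symmetric]
    by (intro hamiltonian_dsum hamiltonian_lower_jordan_pair sp_hamiltonian[OF ns(3)])
  obtain \<omega> where \<omega>: "symplectic_structure (almost_abelian
      (four_block_mat (1 \<cdot>\<^sub>m 1\<^sub>m 1) v (0\<^sub>m (sum_list ns + e) 1) (lower_jordan ns 1 \<oplus>\<^sub>d E))) \<omega>"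
    by (rule symplectic_structure_block[OF v(1) D H])
  have sim: "similar_mat (pair_sum ms ns Q)
      (four_block_mat (1 \<cdot>\<^sub>m 1\<^sub>m 1) v (0\<^sub>m (sum_list ns + e) 1) (lower_jordan ns 1 \<oplus>\<^sub>d E))"
    unfolding pair_sum_def v(2)[symmetric] E_def[symmetric]
      by (rule similar_mat_dsum[OF w(2) similar_mat_refl[OF E]])
  note c = pair_sum_carrier[OF assms]
  note c' = similar_mat_carrier[OF sim, THEN iffD2, OF c]
  show thesis
    by (rule symplectic_structure_lie_iso[OF c c' lie_iso_almost_abelian_similar[OF c sim] \<omega>])
      (rule that)
qed

subsection \<open>Isomorphisms between the normal forms\<close>

lemma lower_jordan_dsum_smult:
  assumes B: "B \<in> carrier_mat k k" and c: "c \<noteq> 0"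
  shows "similar_mat (c \<cdot>\<^sub>m (lower_jordan ns b \<oplus>\<^sub>d B)) (lower_jordan ns (c * b) \<oplus>\<^sub>d (c \<cdot>\<^sub>m B))"
proof -
  have "similar_mat (c \<cdot>\<^sub>m B) (c \<cdot>\<^sub>m B)" using B by (intro similar_mat_refl[of _ k]) simp
  then show ?thesis
    unfolding dsum_smult[OF lower_jordan_carrier B]
      by (rule similar_mat_dsum[OF lower_jordan_smult[OF c]])
qed

lemma smult_one_mat: "(1 :: 'a :: comm_ring_1) \<cdot>\<^sub>m A = A"
  by (intro eq_matI) auto

lemma iso_class_almost_abelian_iff:
  assumes "A \<in> carrier_mat n n" "B \<in> carrier_mat n n" "\<not> nilpotent_mat A" "\<not> nilpotent_mat B"
  shows "iso_class (almost_abelian A) = iso_class (almost_abelian B) \<longleftrightarrow>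
    (\<exists>c. c \<noteq> 0 \<and> similar_mat A (c \<cdot>\<^sub>m B))"
  unfolding iso_class_eq_iff[OF real_lie_algebra_almost_abelian[OF assms(1)]
    real_lie_algebra_almost_abelian[OF assms(2)]]
  using lie_iso_almost_abelianD[OF assms] lie_iso_almost_abelianI[OF assms(1,2)] by metis

text \<open>Scaling does not change the type of the nilpotent part. After cancelling that part only
  \<open>Q\<close> feels the factor \<open>c\<close>, and the normalisation of the spectrum reduces
  \<open>c\<close> to a sign.\<close>

lemma iso_class_zero_sum_iff:
  assumes f: "zero_form n ns r Q" and g: "zero_form n ms s R"
  shows "iso_class (almost_abelian (zero_sum ns Q)) = iso_class (almost_abelian (zero_sum ms R)) \<longleftrightarrow>
    mset ns = mset ms \<and> (similar_mat Q R \<or> similar_mat Q (- R))"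
proof -
  have Q: "Q \<in> carrier_mat (2 * r) (2 * r)" "normalized_spec Q" "0 \<notin> set ns"
    using f by (auto simp: zero_form_def sp_carrier)
  have R: "R \<in> carrier_mat (2 * s) (2 * s)" "normalized_spec R" "0 \<notin> set ms"
    using g by (auto simp: zero_form_def sp_carrier)
  have iff: "iso_class (almost_abelian (zero_sum ns Q)) =
    iso_class (almost_abelian (zero_sum ms R)) \<longleftrightarrow>
    (\<exists>c. c \<noteq> 0 \<and> similar_mat (zero_sum ns Q) (c \<cdot>\<^sub>m zero_sum ms R))"
    by (rule iso_class_almost_abelian_iff[OF zero_sum_carrier[OF f] zero_sum_carrier[OF g]
      zero_sum_not_nilpotent[OF f] zero_sum_not_nilpotent[OF g]])
  have red: "similar_mat (c \<cdot>\<^sub>m zero_sum ms R) (lower_jordan ms 0 \<oplus>\<^sub>d (c \<cdot>\<^sub>m R))" if "c \<noteq> 0" for c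
    using lower_jordan_dsum_smult[OF R(1) that, of ms 0] by (simp add: zero_sum_def)
  show ?thesis
    unfolding iff
  proof
    assume "\<exists>c. c \<noteq> 0 \<and> similar_mat (zero_sum ns Q) (c \<cdot>\<^sub>m zero_sum ms R)"
    then obtain c where c: "c \<noteq> 0" "similar_mat (zero_sum ns Q) (c \<cdot>\<^sub>m zero_sum ms R)" by blast
    have cR: "c \<cdot>\<^sub>m R \<in> carrier_mat (2 * s) (2 * s)" using R(1) by simp
    have "\<not> eigenvalue (c \<cdot>\<^sub>m R) 0"
      using eigenvalue_smult[OF R(1) c(1), of 0] zero_form_no_eigenvalue[OF g] by simp
    note canc = jordan_cancel[OF Q(3) R(3) Q(1) cR zero_form_no_eigenvalue[OF f] this
      similar_mat_trans[OF c(2) red[OF c(1)], unfolded zero_sum_def]]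
    have "normalized_spec (c \<cdot>\<^sub>m R)" using normalized_spec_similar[OF canc(2)] Q(2) by simp
    then have "\<bar>c\<bar> = 1" by (rule normalized_spec_smult[OF R(2) _ R(1) c(1)])
    then have "c = 1 \<or> c = - 1" by linarith
    then show "mset ns = mset ms \<and> (similar_mat Q R \<or> similar_mat Q (- R))"
      using canc(1,2) by (auto simp: smult_one_mat uminus_mat_smult)
  next
    assume h: "mset ns = mset ms \<and> (similar_mat Q R \<or> similar_mat Q (- R))"
    then obtain c :: real where c: "c \<noteq> 0" "similar_mat Q (c \<cdot>\<^sub>m R)"
      by (metis smult_one_mat uminus_mat_smult one_neq_zero zero_neq_neg_one)
    have "similar_mat (zero_sum ns Q) (lower_jordan ms 0 \<oplus>\<^sub>d (c \<cdot>\<^sub>m R))"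
      unfolding zero_sum_def by (rule similar_mat_dsum[OF lower_jordan_similar_mset c(2)])
        (use h in blast)
    then have "similar_mat (zero_sum ns Q) (c \<cdot>\<^sub>m zero_sum ms R)"
      by (rule similar_mat_trans[OF _ similar_mat_sym[OF red[OF c(1)]]])
    then show "\<exists>c. c \<noteq> 0 \<and> similar_mat (zero_sum ns Q) (c \<cdot>\<^sub>m zero_sum ms R)" using c(1) by blast
  qed
qed

lemma alg_mult_pair_sum:
  assumes f: "pair_form n ms ns r Q"
  shows "alg_mult (pair_sum ms ns Q) x =
    (if x = 1 then sum_list ms else if x = - 1 then sum_list ns else alg_mult Q x)"
proof -
  have Q: "Q \<in> carrier_mat (2 * r) (2 * r)" using f by (simp add: pair_form_def sp_carrier)
  have "alg_mult Q 1 = 0" "alg_mult Q (- 1) = 0"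
    using alg_mult_no_eigenvalue[OF Q] pair_form_no_eigenvalue[OF f] by blast+
  then show ?thesis
    unfolding pair_sum_def alg_mult_dsum[OF lower_jordan_carrier
      dsum_carrier[OF lower_jordan_carrier Q]]
      alg_mult_dsum[OF lower_jordan_carrier Q] alg_mult_lower_jordan by auto
qed

text \<open>The number 1 is the only \<open>c\<close> for which the multiplicity of \<open>c\<close> exceeds that of \<open>- c\<close>,
  so no rescaling relates two matrices of this form.\<close>

lemma pair_sum_scaling:
  assumes f: "pair_form n ms ns r Q" and g: "pair_form n ms' ns' s R" and c: "c \<noteq> 0"
    and sim: "similar_mat (pair_sum ms ns Q) (c \<cdot>\<^sub>m pair_sum ms' ns' R)"
  shows "c = 1"
proof -
  have m: "alg_mult (pair_sum ms ns Q) (c * x) = alg_mult (pair_sum ms' ns' R) x" for x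
    using alg_mult_similar[OF sim] alg_mult_smult[OF pair_sum_carrier[OF g] c] by simp
  have "sum_list ms' = sum_list ns' + 1" "sum_list ms = sum_list ns + 1"
    using f g grows_sum_list by (auto simp: pair_form_def)
  then have "alg_mult (pair_sum ms ns Q) c = alg_mult (pair_sum ms ns Q) (- c) + 1"
    using m[of 1] m[of "- 1"] alg_mult_pair_sum[OF g] by simp
  moreover have "alg_mult Q (- c) = alg_mult Q c"
    using f by (intro hamiltonian_alg_mult_uminus sp_hamiltonian[of _ r]) (simp add: pair_form_def)
  ultimately show ?thesis
    using \<open>sum_list ms = sum_list ns + 1\<close> by (auto simp: alg_mult_pair_sum[OF f] split: if_splits)
qed

text \<open>No rescaling is possible here, so isomorphism is similarity; cancelling first at 1 and
  then at -1 compares the three summands separately.\<close>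

lemma iso_class_pair_sum_iff:
  assumes f: "pair_form n ms ns r Q" and g: "pair_form n ms' ns' s R"
  shows "iso_class (almost_abelian (pair_sum ms ns Q)) =
    iso_class (almost_abelian (pair_sum ms' ns' R)) \<longleftrightarrow>
    mset ms = mset ms' \<and> mset ns = mset ns' \<and> similar_mat Q R"
proof -
  have Q: "Q \<in> carrier_mat (2 * r) (2 * r)" "0 \<notin> set ns" "0 \<notin> set ms"
    using f by (auto simp: pair_form_def sp_carrier)
  have R: "R \<in> carrier_mat (2 * s) (2 * s)" "0 \<notin> set ns'" "0 \<notin> set ms'"
    using g by (auto simp: pair_form_def sp_carrier)
  have iff: "iso_class (almost_abelian (pair_sum ms ns Q)) =
    iso_class (almost_abelian (pair_sum ms' ns' R)) \<longleftrightarrow>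
    (\<exists>c. c \<noteq> 0 \<and> similar_mat (pair_sum ms ns Q) (c \<cdot>\<^sub>m pair_sum ms' ns' R))"
    by (rule iso_class_almost_abelian_iff[OF pair_sum_carrier[OF f] pair_sum_carrier[OF g]
      pair_sum_not_nilpotent[OF f] pair_sum_not_nilpotent[OF g]])
  have "(\<exists>c. c \<noteq> 0 \<and> similar_mat (pair_sum ms ns Q) (c \<cdot>\<^sub>m pair_sum ms' ns' R)) \<longleftrightarrow>
      similar_mat (pair_sum ms ns Q) (pair_sum ms' ns' R)"
    using pair_sum_scaling[OF f g] by (metis smult_one_mat one_neq_zero)
  also have "\<dots> \<longleftrightarrow> mset ms = mset ms' \<and> mset ns = mset ns' \<and> similar_mat Q R"
  proof
    assume sim: "similar_mat (pair_sum ms ns Q) (pair_sum ms' ns' R)"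
    have ev: "\<not> eigenvalue (lower_jordan ns (- 1) \<oplus>\<^sub>d Q) 1"
      "\<not> eigenvalue (lower_jordan ns' (- 1) \<oplus>\<^sub>d R) 1"
      unfolding eigenvalue_dsum[OF lower_jordan_carrier Q(1)]
        eigenvalue_dsum[OF lower_jordan_carrier R(1)]
        eigenvalue_lower_jordan using pair_form_no_eigenvalue[OF f] pair_form_no_eigenvalue[OF g]
          by auto
    note c1 = jordan_cancel[OF Q(3) R(3) dsum_carrier[OF lower_jordan_carrier Q(1)]
      dsum_carrier[OF lower_jordan_carrier R(1)] ev sim[unfolded pair_sum_def]]
    note c2 = jordan_cancel[OF Q(2) R(2) Q(1) R(1) pair_form_no_eigenvalue(2)[OF f]
      pair_form_no_eigenvalue(2)[OF g] c1(2)]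
    show "mset ms = mset ms' \<and> mset ns = mset ns' \<and> similar_mat Q R" using c1(1) c2(1,2) by blast
  next
    assume "mset ms = mset ms' \<and> mset ns = mset ns' \<and> similar_mat Q R"
    then show "similar_mat (pair_sum ms ns Q) (pair_sum ms' ns' R)"
      unfolding pair_sum_def by (intro similar_mat_dsum lower_jordan_similar_mset) auto
  qed
  finally show ?thesis unfolding iff .
qed

subsection \<open>Reduction of a symplectic almost abelian Lie algebra\<close>

text \<open>The row \<open>w\<close> also has entries above \<open>B\<close>. They form a corner
  between the enlarged part for \<open>b\<close> and \<open>B\<close>, which a Sylvester equation
  removes, so only the sizes at \<open>b\<close> are affected.\<close>

lemma extension_splitting:
  assumes w: "w \<in> carrier_mat 1 N" and D: "D \<in> carrier_mat N N" and B: "B \<in> carrier_mat m m"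
    and ks: "0 \<notin> set ks" and sim: "similar_mat D (lower_jordan ks b \<oplus>\<^sub>d B)"
      and ev: "\<not> eigenvalue B b"
  obtains ms where "0 \<notin> set ms" "grows (mset ks) (mset ms)"
    "similar_mat (four_block_mat (b \<cdot>\<^sub>m 1\<^sub>m 1) w (0\<^sub>m N 1) D) (lower_jordan ms b \<oplus>\<^sub>d B)"
proof -
  let ?b = "b \<cdot>\<^sub>m 1\<^sub>m 1 :: real mat" and ?k = "sum_list ks"
  have b: "?b \<in> carrier_mat 1 1" by simp
  have "lower_jordan ks b \<oplus>\<^sub>d B \<in> carrier_mat N N" using similar_mat_carrier[OF sim] D by blast
  then have N: "N = ?k + m" using dsum_carrier[OF lower_jordan_carrier B, of ks b]
    by (metis carrier_matD(1))
  obtain v where v: "v \<in> carrier_mat 1 N" "similar_mat (four_block_mat ?b w (0\<^sub>m N 1) D)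
      (four_block_mat ?b v (0\<^sub>m N 1) (lower_jordan ks b \<oplus>\<^sub>d B))"
    by (rule block_upper_similar[OF similar_mat_refl[OF b] sim b D w])
  obtain w1 U where U: "w1 \<in> carrier_mat 1 ?k" "U \<in> carrier_mat (1 + ?k) m"
    "four_block_mat ?b v (0\<^sub>m N 1) (lower_jordan ks b \<oplus>\<^sub>d B) =
      four_block_mat (four_block_mat ?b w1 (0\<^sub>m ?k 1) (lower_jordan ks b)) U (0\<^sub>m m (1 + ?k)) B"
    unfolding N by (rule block_upper_regroup[OF v(1)[unfolded N] lower_jordan_carrier B b])
  obtain ms where ms: "0 \<notin> set ms" "grows (mset ks) (mset ms)" "sum_list ms = 1 + ?k"
    "similar_mat (four_block_mat ?b w1 (0\<^sub>m ?k 1) (lower_jordan ks b)) (lower_jordan ms b)"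
    by (rule extension_jordan_type[OF U(1) ks])
  have c: "four_block_mat ?b w1 (0\<^sub>m ?k 1) (lower_jordan ks b) \<in> carrier_mat (1 + ?k) (1 + ?k)"
    by (rule four_block_carrier_mat[OF b lower_jordan_carrier])
  obtain V where V: "V \<in> carrier_mat (1 + ?k) m"
    "similar_mat (four_block_mat (four_block_mat ?b w1 (0\<^sub>m ?k 1) (lower_jordan ks b)) U
      (0\<^sub>m m (1 + ?k)) B)
      (four_block_mat (lower_jordan ms b) V (0\<^sub>m m (1 + ?k)) B)"
    by (rule block_upper_similar[OF ms(4) similar_mat_refl[OF B] c B U(2)])
  have "similar_mat (four_block_mat (lower_jordan ms b) V (0\<^sub>m m (1 + ?k)) B)
    (lower_jordan ms b \<oplus>\<^sub>d B)"
    using block_upper_similar_dsum[OF lower_jordan_carrier B _ lower_jordan_nilpotent[OF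
      order_refl] ev] V(1)
    unfolding ms(3)[symmetric] by blast
  with V(2) have "similar_mat (four_block_mat ?b v (0\<^sub>m N 1) (lower_jordan ks b \<oplus>\<^sub>d B))
    (lower_jordan ms b \<oplus>\<^sub>d B)"
    unfolding U(3) by (rule similar_mat_trans)
  with v(2) have "similar_mat (four_block_mat ?b w (0\<^sub>m N 1) D) (lower_jordan ms b \<oplus>\<^sub>d B)"
    by (rule similar_mat_trans)
  then show thesis by (rule that[OF ms(1,2)])
qed

lemma symplectic_zero_case:
  assumes A: "A \<in> carrier_mat (2 * n - 1) (2 * n - 1)" and nil: "\<not> nilpotent_mat A"
    and w: "w \<in> carrier_mat 1 N" and D: "D \<in> carrier_mat N N" and h: "hamiltonian D"
    and N: "2 * n = N + 2"
    and sim: "similar_mat A (four_block_mat (0 \<cdot>\<^sub>m 1\<^sub>m 1) w (0\<^sub>m N 1) D)"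
  obtains ns r Q where "zero_form n ns r Q"
    "lie_iso (almost_abelian A) (almost_abelian (zero_sum ns Q))"
proof -
  obtain ks B m where B: "0 \<notin> set ks" "B \<in> carrier_mat m m" "sum_list ks + m = N" "\<not> eigenvalue B 0"
    "similar_mat D (lower_jordan ks 0 \<oplus>\<^sub>d B)"
    by (rule jordan_splitting[OF D, of 0])
  note ham = hamiltonian_split_zero[OF B(2,4) hamiltonian_similar[OF B(5) h]]
  obtain ms where ms: "0 \<notin> set ms" "grows (mset ks) (mset ms)"
    "similar_mat (four_block_mat (0 \<cdot>\<^sub>m 1\<^sub>m 1) w (0\<^sub>m N 1) D) (lower_jordan ms 0 \<oplus>\<^sub>d B)"
    by (rule extension_splitting[OF w D B(2,1,5,4)])
  have sim': "similar_mat A (lower_jordan ms 0 \<oplus>\<^sub>d B)" by (rule similar_mat_trans[OF sim ms(3)])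
  \<comment> \<open>If nothing were left besides the eigenvalue 0, then \<open>A\<close> would be
    nilpotent. A non-empty complement is what allows its spectrum to be normalised.\<close>
  have m: "m > 0"
  proof (rule ccontr)
    assume "\<not> m > 0"
    then have "B \<in> carrier_mat 0 0" using B(2) by simp
    then have "similar_mat A (lower_jordan ms 0)" using sim' by simp
    then show False using similar_lower_jordan_nilpotent nil by blast
  qed
  have z: "0 \<notin> spec B" using spec_of_real_iff[OF B(2), of 0] B(4) by simp
  obtain c where c: "c \<noteq> 0" "normalized_spec (c \<cdot>\<^sub>m B)"
    by (rule normalized_spec_scaling[OF B(2) m z])
  obtain r E where E: "E \<in> sp r" "similar_mat (c \<cdot>\<^sub>m B) E" "c \<cdot>\<^sub>m B \<in> carrier_mat (2 * r) (2 * r)"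
    by (rule hamiltonian_similar_sp[OF hamiltonian_smult[OF ham(2), of c]])
  have r: "m = 2 * r" using E(3) B(2) by auto
  have odd: "\<exists>!a. odd a \<and> odd (count (mset ms) a)"
  proof -
    have z: "0 \<notin># mset ms" using ms(1) by simp
    have "0 \<notin># mset ks \<and> (\<forall>k. odd k \<longrightarrow> even (count (mset ks) k)) \<and> grows (mset ks) (mset ms)"
      using hamiltonian_nilpotent_count[OF B(1) ham(1)] B(1) ms(2) by simp
    then show ?thesis by (intro hamiltonian_type_grows[OF z, THEN iffD2] exI)
  qed
  have form: "zero_form n ms r E"
    unfolding zero_form_def
  proof (intro conjI ms(1) odd E(1))
    show "normalized_spec E" using normalized_spec_similar[OF E(2)] c(2) by simp
    show "sum_list ms + 2 * r + 1 = 2 * n" using grows_sum_list[OF ms(2)] B(3) r N by linarith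
  qed
  have Ec: "E \<in> carrier_mat (2 * r) (2 * r)" by (rule sp_carrier[OF E(1)])
  have c': "1 / c \<noteq> 0" using c(1) by simp
  \<comment> \<open>The normalisation is undone: the factor \<open>1 / c\<close> can be pulled out
    of the whole sum because the nilpotent part absorbs any non-zero factor.\<close>
  have "(1 / c) \<cdot>\<^sub>m (c \<cdot>\<^sub>m B) = B" using c(1) by (intro eq_matI) auto
  then have "similar_mat B ((1 / c) \<cdot>\<^sub>m E)" using similar_mat_smult[OF E(2), of "1 / c"] by simp
  then have "similar_mat (lower_jordan ms 0 \<oplus>\<^sub>d B) (lower_jordan ms 0 \<oplus>\<^sub>d ((1 / c) \<cdot>\<^sub>m E))"
    by (rule similar_mat_dsum[OF similar_mat_refl[OF lower_jordan_carrier]])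
  moreover have "similar_mat (lower_jordan ms 0 \<oplus>\<^sub>d ((1 / c) \<cdot>\<^sub>m E)) ((1 / c) \<cdot>\<^sub>m zero_sum ms E)"
    using similar_mat_sym[OF lower_jordan_dsum_smult[OF Ec c', of ms 0]] by (simp add: zero_sum_def)
  ultimately have "similar_mat A ((1 / c) \<cdot>\<^sub>m zero_sum ms E)"
    by (rule similar_mat_trans[OF sim' similar_mat_trans])
  then have "lie_iso (almost_abelian A) (almost_abelian (zero_sum ms E))"
    by (rule lie_iso_almost_abelianI[OF A zero_sum_carrier[OF form] c'])
  with form show thesis by (rule that)
qed

text \<open>Dividing by \<open>l\<close> makes the corner 1. The quotient is split at 1 and then at
  -1, the two lists of sizes agree because it is Hamiltonian, and the extension enlarges only the
  first list.\<close>

lemma symplectic_nonzero_case: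
  assumes A: "A \<in> carrier_mat (2 * n - 1) (2 * n - 1)" and l: "l \<noteq> 0"
    and w: "w \<in> carrier_mat 1 N" and D: "D \<in> carrier_mat N N" and h: "hamiltonian D"
    and N: "2 * n = N + 2"
    and sim: "similar_mat A (four_block_mat (l \<cdot>\<^sub>m 1\<^sub>m 1) w (0\<^sub>m N 1) D)"
  obtains ms ns r Q where "pair_form n ms ns r Q"
    "lie_iso (almost_abelian A) (almost_abelian (pair_sum ms ns Q))"
proof -
  define D' where "D' = (1 / l) \<cdot>\<^sub>m D"
  have D': "D' \<in> carrier_mat N N" "hamiltonian D'"
    using D hamiltonian_smult[OF h] by (auto simp: D'_def)
  define w' where "w' = (1 / l) \<cdot>\<^sub>m w"
  have w': "w' \<in> carrier_mat 1 N" using w by (simp add: w'_def)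
  obtain ks B m where B: "0 \<notin> set ks" "B \<in> carrier_mat m m" "sum_list ks + m = N" "\<not> eigenvalue B 1"
    "similar_mat D' (lower_jordan ks 1 \<oplus>\<^sub>d B)"
    by (rule jordan_splitting[OF D'(1), of 1])
  obtain js C q where C: "0 \<notin> set js" "C \<in> carrier_mat q q" "sum_list js + q = m"
    "\<not> eigenvalue C (- 1)"
    "similar_mat B (lower_jordan js (- 1) \<oplus>\<^sub>d C)"
    by (rule jordan_splitting[OF B(2), of "- 1"])
  have C1: "\<not> eigenvalue C 1"
    using B(4) unfolding eigenvalue_similar[OF C(5)] eigenvalue_dsum[OF lower_jordan_carrier C(2)]
      by blast
  have "similar_mat D' (lower_jordan ks 1 \<oplus>\<^sub>d lower_jordan js (- 1) \<oplus>\<^sub>d C)"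
    by (rule similar_mat_trans[OF B(5)
      similar_mat_dsum[OF similar_mat_refl[OF lower_jordan_carrier] C(5)]])
  note ham = hamiltonian_split_pair[OF C(2) one_neq_zero C1 C(4) B(1) C(1)
    hamiltonian_similar[OF this D'(2)]]
  obtain r E where E: "E \<in> sp r" "similar_mat C E" "C \<in> carrier_mat (2 * r) (2 * r)"
    by (rule hamiltonian_similar_sp[OF ham(2)])
  obtain ms where ms: "0 \<notin> set ms" "grows (mset ks) (mset ms)"
    "similar_mat (four_block_mat (1 \<cdot>\<^sub>m 1\<^sub>m 1) w' (0\<^sub>m N 1) D') (lower_jordan ms 1 \<oplus>\<^sub>d B)"
    by (rule extension_splitting[OF w' D'(1) B(2,1,5,4)])
  have form: "pair_form n ms js r E"
    unfolding pair_form_def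
  proof (intro conjI ms(1) C(1) E(1))
    show "grows (mset js) (mset ms)" using ms(2) ham(1) by simp
    show "1 \<notin> spec E" using spec_similar[OF E(2)] spec_of_real_iff[OF C(2), of 1] C1 by simp
    have "q = 2 * r" using C(2) E(3) by auto
    moreover have "sum_list ks = sum_list js" using ham(1) by (metis sum_mset_sum_list)
    ultimately show "sum_list js + r + 1 = n" using B(3) C(3) N by linarith
  qed
  have "l \<cdot>\<^sub>m four_block_mat (1 \<cdot>\<^sub>m 1\<^sub>m 1) w' (0\<^sub>m N 1) D' =
      four_block_mat (l \<cdot>\<^sub>m (1 \<cdot>\<^sub>m 1\<^sub>m 1)) (l \<cdot>\<^sub>m w') (l \<cdot>\<^sub>m 0\<^sub>m N 1) (l \<cdot>\<^sub>m D')"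
    by (rule smult_four_block_mat[of _ 1 1 _ N _ N]) (use w' D' in auto)
  also have "\<dots> = four_block_mat (l \<cdot>\<^sub>m 1\<^sub>m 1) w (0\<^sub>m N 1) D"
  proof -
    have e: "l \<cdot>\<^sub>m w' = w" "l \<cdot>\<^sub>m D' = D" "l \<cdot>\<^sub>m 0\<^sub>m N 1 = 0\<^sub>m N 1"
      using l by (auto simp: w'_def D'_def intro!: eq_matI)
    show ?thesis unfolding e smult_one_mat ..
  qed
  finally have "similar_mat A (l \<cdot>\<^sub>m four_block_mat (1 \<cdot>\<^sub>m 1\<^sub>m 1) w' (0\<^sub>m N 1) D')" using sim by simp
  moreover have "similar_mat (lower_jordan ms 1 \<oplus>\<^sub>d B) (pair_sum ms js E)"
    unfolding pair_sum_def
    by (rule similar_mat_dsum[OF similar_mat_refl[OF lower_jordan_carrier] similar_mat_trans[OF C(5)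
      similar_mat_dsum[OF similar_mat_refl[OF lower_jordan_carrier] E(2)]]])
  ultimately have "similar_mat A (l \<cdot>\<^sub>m pair_sum ms js E)"
    using similar_mat_trans[OF _ similar_mat_smult[OF similar_mat_trans[OF ms(3)]]] by blast
  then have "lie_iso (almost_abelian A) (almost_abelian (pair_sum ms js E))"
    by (rule lie_iso_almost_abelianI[OF A pair_sum_carrier[OF form] l])
  with form show thesis by (rule that)
qed

lemma symplectic_cases:
  assumes A: "A \<in> carrier_mat (2 * n - 1) (2 * n - 1)" and n: "n \<ge> 1" and nil: "\<not> nilpotent_mat A"
    and \<omega>: "symplectic_structure (almost_abelian A) \<omega>"
  obtains (zero) ns r Q where "zero_form n ns r Q"
    "lie_iso (almost_abelian A) (almost_abelian (zero_sum ns Q))"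
  | (pair) ms ns r Q where "pair_form n ms ns r Q"
    "lie_iso (almost_abelian A) (almost_abelian (pair_sum ms ns Q))"
proof -
  have k: "2 * n - 1 = 2 * (n - 1) + 1" "2 * n = 2 * (n - 1) + 2" using n by auto
  obtain l w D where d: "w \<in> carrier_mat 1 (2 * (n - 1))"
    "D \<in> carrier_mat (2 * (n - 1)) (2 * (n - 1))" "hamiltonian D"
    "similar_mat A (four_block_mat (l \<cdot>\<^sub>m 1\<^sub>m 1) w (0\<^sub>m (2 * (n - 1)) 1) D)"
    by (rule symplectic_structure_normal_form[OF A[unfolded k(1)] \<omega>])
  show thesis
  proof (cases "l = 0")
    case True
    show ?thesis
      by (rule symplectic_zero_case[OF A nil d(1-3) k(2) d(4)[unfolded True]]) (rule zero)
  next
    case False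
    show ?thesis
      by (rule symplectic_nonzero_case[OF A False d(1-3) k(2) d(4)]) (rule pair)
  qed
qed

subsection \<open>Parametrization of the isomorphism classes\<close>

lemma form1_iff:
  assumes n: "n \<ge> 1"
  shows "form1 n M M0 Q \<longleftrightarrow> (\<exists>ns r. zero_form n ns r Q \<and> M0 = lower_jordan ns 0 \<and> M = zero_sum ns Q)"
proof
  assume f: "form1 n M M0 Q"
  obtain ns where ns: "0 \<notin> set ns" "ns \<noteq> []" "M0 = lower_jordan ns 0" "alg_mult M 0 = sum_list ns"
    using f by (auto simp: form1_def elim: is_jordan_partE)
  obtain r where r: "Q \<in> sp r" using f by (auto simp: form1_def)
  have M: "M = zero_sum ns Q" using f
    by (simp only: form1_def diag_block_mat_pair zero_sum_def ns(3))
  have "M \<in> carrier_mat (2 * n - 1) (2 * n - 1)" using f unfolding form1_def by blast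
  moreover have "M \<in> carrier_mat (sum_list ns + 2 * r) (sum_list ns + 2 * r)"
    unfolding M zero_sum_def by (rule dsum_carrier[OF lower_jordan_carrier sp_carrier[OF r]])
  ultimately have s: "sum_list ns + 2 * r + 1 = 2 * n" using n by auto
  have "odd (sum_list ns)" "jtype M0 \<in> types_s (sum_list ns)" using f ns(4)
    by (auto simp: form1_def)
  then have "\<exists>!a. odd a \<and> odd (count (mset ns) a)"
    using types_s_iff[OF jtype_lower_jordan(1)[OF ns(1)], of 0] jtype_lower_jordan(2)[OF ns(1)]
      ns(3) by simp
  then have "zero_form n ns r Q" using ns(1) r s f by (simp add: zero_form_def form1_def)
  then show "\<exists>ns r. zero_form n ns r Q \<and> M0 = lower_jordan ns 0 \<and> M = zero_sum ns Q" using ns(3) M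
    by blast
next
  assume "\<exists>ns r. zero_form n ns r Q \<and> M0 = lower_jordan ns 0 \<and> M = zero_sum ns Q"
  then obtain ns r where f: "zero_form n ns r Q" "M0 = lower_jordan ns 0" "M = zero_sum ns Q"
    by blast
  have ns: "0 \<notin> set ns" "\<exists>!a. odd a \<and> odd (count (mset ns) a)" "Q \<in> sp r" "normalized_spec Q"
    "sum_list ns + 2 * r + 1 = 2 * n" using f(1) unfolding zero_form_def by blast+
  have ne: "ns \<noteq> []" using ns(2) by auto
  note Q = sp_carrier[OF ns(3)]
  note ev = zero_form_no_eigenvalue[OF f(1)]
  have M: "M = lower_jordan ns 0 \<oplus>\<^sub>d Q" unfolding f(3) zero_sum_def ..
  have a: "alg_mult M 0 = sum_list ns" unfolding M by (rule alg_mult_lower_jordan_dsum[OF Q ev])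
  have o: "odd (sum_list ns)" using arg_cong[OF ns(5), of even] by auto
  show "form1 n M M0 Q"
    unfolding form1_def a diag_block_mat_pair
  proof (intro conjI)
    show "M \<in> carrier_mat (2 * n - 1) (2 * n - 1)" unfolding f(3)
      by (rule zero_sum_carrier[OF f(1)])
    show "M = M0 \<oplus>\<^sub>d Q" unfolding M f(2) ..
    show "is_jordan_part M 0 M0"
      unfolding f(2) M
      by (rule is_jordan_partI[OF similar_mat_refl[OF dsum_carrier[OF lower_jordan_carrier Q]] Q
        ev ns(1) ne])
    show "jtype M0 \<in> types_s (sum_list ns)"
      unfolding f(2) types_s_iff[OF jtype_lower_jordan(1)[OF ns(1)] o] jtype_lower_jordan(2)[OF
        ns(1)] by (rule ns(2))
    show "1 \<le> sum_list ns" using o by (cases "sum_list ns") auto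
    have "2 * r = 2 * n - sum_list ns - 1" using ns(5) by linarith
    then show "\<exists>r. 2 * r = 2 * n - sum_list ns - 1 \<and> Q \<in> sp r" using ns(3) by blast
  qed (use o ns(4) in auto)
qed

text \<open>To exhibit the part at -1 the first two summands are exchanged. It requires a non-empty
  \<open>ns\<close>, since \<open>is_jordan_part\<close> demands an eigenvalue.\<close>

lemma pair_sum_jordan_parts:
  assumes f: "pair_form n ms ns r Q"
  shows "is_jordan_part (pair_sum ms ns Q) 1 (lower_jordan ms 1)"
    "ns \<noteq> [] \<Longrightarrow> is_jordan_part (pair_sum ms ns Q) (- 1) (lower_jordan ns (- 1))"
proof -
  have Q: "Q \<in> carrier_mat (2 * r) (2 * r)" using f by (simp add: pair_form_def sp_carrier)
  note ev = pair_form_no_eigenvalue[OF f]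
  have ms: "0 \<notin> set ms" "0 \<notin> set ns" "ms \<noteq> []" using f grows_sum_list[of ns ms]
    by (auto simp: pair_form_def)
  note c = lower_jordan_carrier dsum_carrier[OF lower_jordan_carrier Q]
  have e1: "\<not> eigenvalue (lower_jordan ns (- 1) \<oplus>\<^sub>d Q) 1"
    unfolding eigenvalue_dsum[OF lower_jordan_carrier Q] eigenvalue_lower_jordan using ev by simp
  show "is_jordan_part (pair_sum ms ns Q) 1 (lower_jordan ms 1)"
    unfolding pair_sum_def
    by (rule is_jordan_partI[OF similar_mat_refl[OF dsum_carrier[OF lower_jordan_carrier c(2)]]
      c(2) e1 ms(1,3)])
  have e2: "\<not> eigenvalue (lower_jordan ms 1 \<oplus>\<^sub>d Q) (- 1)"
    unfolding eigenvalue_dsum[OF lower_jordan_carrier Q] eigenvalue_lower_jordan using ev by simp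
  have "similar_mat (pair_sum ms ns Q) (lower_jordan ns (- 1) \<oplus>\<^sub>d lower_jordan ms 1 \<oplus>\<^sub>d Q)"
    unfolding pair_sum_def dsum_assoc[symmetric]
    by (rule similar_mat_dsum[OF similar_mat_dsum_commute[OF lower_jordan_carrier
      lower_jordan_carrier] similar_mat_refl[OF Q]])
  then show "is_jordan_part (pair_sum ms ns Q) (- 1) (lower_jordan ns (- 1))" if "ns \<noteq> []"
    by (rule is_jordan_partI[OF _ c(2) e2 ms(2) that])
qed

lemma pair_form_Nil: "pair_form n ms [] r Q \<Longrightarrow> ms = [1]"
proof -
  assume "pair_form n ms [] r Q"
  then have "mset ms = {#1#}" by (auto simp: pair_form_def grows_def)
  then show "ms = [1]" by simp
qed

text \<open>Multiplicity 1 means a single block of size 1, which is the partition obtained by one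
  growth step from the empty one; so this is the pair form with no block at -1.\<close>

lemma form2_iff:
  assumes n: "n \<ge> 1"
  shows "form2 n M M1 Q \<longleftrightarrow> (\<exists>r. pair_form n [1] [] r Q \<and> M1 = lower_jordan [1] 1 \<and> M =
    pair_sum [1] [] Q)"
proof
  assume f: "form2 n M M1 Q"
  obtain ms where ms: "0 \<notin> set ms" "M1 = lower_jordan ms 1" "alg_mult M 1 = sum_list ms"
    using f by (auto simp: form2_def elim: is_jordan_partE)
  have "sum_list ms = 1" using f ms(3) by (simp add: form2_def)
  then have ms1: "ms = [1]" using ms(1)
  proof (cases ms)
    case (Cons a as)
    have "a \<noteq> 0" "a + sum_list as = 1" using \<open>sum_list ms = 1\<close> ms(1) unfolding Cons by auto
    then have "a = 1" "sum_list as = 0" by linarith+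
    moreover have "as = []"
      using \<open>sum_list as = 0\<close> ms(1) unfolding Cons by (cases as) (simp_all del: sum_list_eq_0_iff)
    ultimately show ?thesis using Cons by simp
  qed simp
  have "grows (mset ([] :: nat list)) (mset [1])" by (simp add: grows_def)
  then have "pair_form n [1] [] (n - 1) Q" using f n by (simp add: pair_form_def form2_def)
  moreover have "M = pair_sum [1] [] Q"
    using f by (simp only: form2_def diag_block_mat_pair pair_sum_def ms(2) ms1 lower_jordan_Nil
      dsum_empty)
  ultimately show "\<exists>r. pair_form n [1] [] r Q \<and> M1 = lower_jordan [1] 1 \<and> M = pair_sum [1] [] Q"
    using ms(2) ms1 by blast
next
  assume "\<exists>r. pair_form n [1] [] r Q \<and> M1 = lower_jordan [1] 1 \<and> M = pair_sum [1] [] Q"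
  then obtain r where f: "pair_form n [1] [] r Q" "M1 = lower_jordan [1] 1"
    "M = pair_sum [1] [] Q" by blast
  have r: "r = n - 1" using f(1) by (auto simp: pair_form_def)
  show "form2 n M M1 Q"
    unfolding form2_def diag_block_mat_pair f(2,3)
  proof (intro conjI)
    show "pair_sum [1] [] Q \<in> carrier_mat (2 * n - 1) (2 * n - 1)"
      by (rule pair_sum_carrier[OF f(1)])
    show "pair_sum [1] [] Q = lower_jordan [1] 1 \<oplus>\<^sub>d Q"
      by (simp only: pair_sum_def lower_jordan_Nil dsum_empty)
    show "is_jordan_part (pair_sum [1] [] Q) 1 (lower_jordan [1] 1)"
      by (rule pair_sum_jordan_parts(1)[OF f(1)])
    show "alg_mult (pair_sum [1] [] Q) 1 = 1" unfolding alg_mult_pair_sum[OF f(1)] by simp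
    show "Q \<in> sp (n - 1)" "1 \<notin> spec Q" using f(1) r by (auto simp: pair_form_def)
  qed
qed

lemma sp_zero: "0\<^sub>m 0 0 \<in> sp 0" "Q \<in> sp 0 \<Longrightarrow> Q = 0\<^sub>m 0 0"
proof -
  have "J_mat 0 \<in> carrier_mat 0 0" using J_mat_carrier[of 0] by simp
  moreover have "(0\<^sub>m 0 0 :: real mat) = - 0\<^sub>m 0 0" by (intro eq_matI) auto
  ultimately show "0\<^sub>m 0 0 \<in> sp 0" by (simp add: sp_iff)
  show "Q \<in> sp 0 \<Longrightarrow> Q = 0\<^sub>m 0 0" using sp_carrier[of Q 0] by auto
qed

lemma form3_iff:
  assumes n: "n \<ge> 2"
  shows "form3 n M M1 N1 \<longleftrightarrow> (\<exists>ms ns. pair_form n ms ns 0 (0\<^sub>m 0 0) \<and> M1 = lower_jordan ms 1 \<and>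
    N1 = lower_jordan ns (- 1) \<and> M = pair_sum ms ns (0\<^sub>m 0 0))"
proof
  assume f: "form3 n M M1 N1"
  obtain ms where ms: "0 \<notin> set ms" "M1 = lower_jordan ms 1" "alg_mult M 1 = sum_list ms"
    using f by (auto simp: form3_def elim: is_jordan_partE)
  obtain ns where ns: "0 \<notin> set ns" "N1 = lower_jordan ns (- 1)" "alg_mult M (- 1) = sum_list ns"
    using f by (auto simp: form3_def elim: is_jordan_partE)
  have M: "M = lower_jordan ms 1 \<oplus>\<^sub>d lower_jordan ns (- 1)"
    using f by (simp only: form3_def diag_block_mat_pair ms(2) ns(2))
  have "M \<in> carrier_mat (2 * n - 1) (2 * n - 1)" using f unfolding form3_def by blast
  moreover have "M \<in> carrier_mat (sum_list ms + sum_list ns) (sum_list ms + sum_list ns)"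
    unfolding M by (rule dsum_carrier[OF lower_jordan_carrier lower_jordan_carrier])
  ultimately have "sum_list ms + sum_list ns = 2 * n - 1" by auto
  \<comment> \<open>Two numbers that differ by one and add up to \<open>2 * n - 1\<close> must be
    \<open>n\<close> and \<open>n - 1\<close>.\<close>
  moreover have "sum_list ms = sum_list ns + 1" using f ms(3) ns(3) by (simp add: form3_def)
  ultimately have s: "sum_list ms = n" "sum_list ns = n - 1" using n by auto
  have t: "jtype N1 \<in> types (n - 1)" "jtype M1 \<in> types n"
    using jtype_lower_jordan(1)[OF ns(1), of "- 1"] jtype_lower_jordan(1)[OF ms(1), of 1] s ms(2)
      ns(2) by simp_all
  have "grows (mset ns) (mset ms)"
    using Sigma_set_iff[OF n t, of 1] f jtype_lower_jordan(2)[OF ns(1), of "- 1"]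
      jtype_lower_jordan(2)[OF ms(1), of 1]
    by (simp add: form3_def ms(2) ns(2))
  then have "pair_form n ms ns 0 (0\<^sub>m 0 0)"
    using ms(1) ns(1) s(2) n spec_empty[of "0\<^sub>m 0 0"] sp_zero(1) by (simp add: pair_form_def)
  moreover have "M = pair_sum ms ns (0\<^sub>m 0 0)" unfolding M pair_sum_def by simp
  ultimately show "\<exists>ms ns. pair_form n ms ns 0 (0\<^sub>m 0 0) \<and> M1 = lower_jordan ms 1 \<and>
    N1 = lower_jordan ns (- 1) \<and> M = pair_sum ms ns (0\<^sub>m 0 0)" using ms(2) ns(2) by blast
next
  assume "\<exists>ms ns. pair_form n ms ns 0 (0\<^sub>m 0 0) \<and> M1 = lower_jordan ms 1 \<and>
    N1 = lower_jordan ns (- 1) \<and> M = pair_sum ms ns (0\<^sub>m 0 0)"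
  then obtain ms ns where f: "pair_form n ms ns 0 (0\<^sub>m 0 0)" "M1 = lower_jordan ms 1"
    "N1 = lower_jordan ns (- 1)" "M = pair_sum ms ns (0\<^sub>m 0 0)" by blast
  have ms: "0 \<notin> set ms" "0 \<notin> set ns" "grows (mset ns) (mset ms)" "sum_list ns + 1 = n"
    using f(1) unfolding pair_form_def by auto
  have s: "sum_list ns = n - 1" "sum_list ms = n" using ms(4) grows_sum_list[OF ms(3)] by auto
  have ne: "ns \<noteq> []" using s n by auto
  show "form3 n M M1 N1"
    unfolding form3_def diag_block_mat_pair f(2-4)
  proof (intro conjI)
    show "pair_sum ms ns (0\<^sub>m 0 0) \<in> carrier_mat (2 * n - 1) (2 * n - 1)"
      by (rule pair_sum_carrier[OF f(1)])
    show "pair_sum ms ns (0\<^sub>m 0 0) = lower_jordan ms 1 \<oplus>\<^sub>d lower_jordan ns (- 1)"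
      by (simp only: pair_sum_def dsum_empty)
    show "is_jordan_part (pair_sum ms ns (0\<^sub>m 0 0)) 1 (lower_jordan ms 1)"
      "is_jordan_part (pair_sum ms ns (0\<^sub>m 0 0)) (- 1) (lower_jordan ns (- 1))"
      using pair_sum_jordan_parts[OF f(1)] ne by blast+
    show "alg_mult (pair_sum ms ns (0\<^sub>m 0 0)) 1 = alg_mult (pair_sum ms ns (0\<^sub>m 0 0)) (- 1) + 1"
      unfolding alg_mult_pair_sum[OF f(1)] using grows_sum_list[OF ms(3)] by simp
    have t: "jtype (lower_jordan ns (- 1)) \<in> types (n - 1)" "jtype (lower_jordan ms 1) \<in> types n"
      using jtype_lower_jordan(1)[OF ms(2), of "- 1"] jtype_lower_jordan(1)[OF ms(1), of 1] s
        by simp_all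
    show "(jtype (lower_jordan ns (- 1)), jtype (lower_jordan ms 1)) \<in> Sigma_set n 1"
      unfolding Sigma_set_iff[OF n t] jtype_lower_jordan(2)[OF ms(1)] jtype_lower_jordan(2)[OF
        ms(2)] by (rule ms(3))
  qed
qed

text \<open>That the multiplicities at 1 and -1 differ by one is not part of \<open>form4\<close>
  explicitly; it is recovered from the sizes of the two types in \<open>Sigma_set\<close>.\<close>

lemma form4_iff:
  "form4 n M M1 N1 Q \<longleftrightarrow> (\<exists>ms ns r. pair_form n ms ns r Q \<and> ns \<noteq> [] \<and> r \<ge> 1 \<and> M1 = lower_jordan ms 1 \<and>
    N1 = lower_jordan ns (- 1) \<and> M = pair_sum ms ns Q)"
proof
  assume f: "form4 n M M1 N1 Q"
  obtain ms where ms: "0 \<notin> set ms" "M1 = lower_jordan ms 1" "alg_mult M 1 = sum_list ms"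
    using f by (auto simp: form4_def elim: is_jordan_partE)
  obtain ns where ns: "0 \<notin> set ns" "N1 = lower_jordan ns (- 1)" "alg_mult M (- 1) = sum_list ns"
    "ns \<noteq> []"
    using f by (auto simp: form4_def elim: is_jordan_partE)
  obtain r where r: "r \<ge> 1" "2 * r = 2 * n - 2 - 2 * sum_list ns" "Q \<in> sp r"
    using f ns(3) by (auto simp: form4_def)
  have M: "M = pair_sum ms ns Q"
    using f by (simp only: form4_def diag_block_mat_triple ms(2) ns(2) pair_sum_def)
  have S: "(jtype N1, jtype M1) \<in> Sigma_set (sum_list ms) 1" using f ms(3) by (simp add: form4_def)
  note jn = jtype_lower_jordan[OF ns(1), of "- 1", folded ns(2)]
  note jm = jtype_lower_jordan[OF ms(1), of 1, folded ms(2)]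
  have t: "jtype N1 \<in> types (sum_list ms - 1)" using S by (simp add: Sigma_set_def)
  have s: "sum_list ns = sum_list ms - 1" using sum_mset_parts[OF jn(1)] sum_mset_parts[OF t]
    by simp
  moreover have "sum_list ns \<noteq> 0" using ns(1,4) by (cases ns) auto
  ultimately have "sum_list ms \<ge> 2" by simp
  from Sigma_set_iff[OF this t jm(1), of 1] S have "grows (mset ns) (mset ms)"
    unfolding jn(2) jm(2) by blast
  \<comment> \<open>By the symmetry of a Hamiltonian spectrum, 1 and -1 are eigenvalues of
    \<open>Q\<close> together or not at all, so missing one of them means missing 1.\<close>
  moreover have "1 \<notin> spec Q"
  proof -
    have Q: "Q \<in> carrier_mat (2 * r) (2 * r)" by (rule sp_carrier[OF r(3)])
    have "\<not> {1, - 1} \<subseteq> spec Q" using f by (simp add: form4_def)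
    moreover have "1 \<in> spec Q \<longleftrightarrow> eigenvalue Q 1" "- 1 \<in> spec Q \<longleftrightarrow> eigenvalue Q (- 1)"
      using spec_of_real_iff[OF Q, of 1] spec_of_real_iff[OF Q, of "- 1"] by simp_all
    ultimately show ?thesis using hamiltonian_eigenvalue_uminus[OF sp_hamiltonian[OF r(3)], of 1]
      by blast
  qed
  moreover have "sum_list ns + r + 1 = n" using r(1,2) by linarith
  ultimately have "pair_form n ms ns r Q" using ms(1) ns(1) r(3) by (simp add: pair_form_def)
  then show "\<exists>ms ns r. pair_form n ms ns r Q \<and> ns \<noteq> [] \<and> r \<ge> 1 \<and> M1 = lower_jordan ms 1 \<and>
    N1 = lower_jordan ns (- 1) \<and> M = pair_sum ms ns Q" using ns(4) r(1) ms(2) ns(2) M by blast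
next
  assume "\<exists>ms ns r. pair_form n ms ns r Q \<and> ns \<noteq> [] \<and> r \<ge> 1 \<and> M1 = lower_jordan ms 1 \<and>
    N1 = lower_jordan ns (- 1) \<and> M = pair_sum ms ns Q"
  then obtain ms ns r where f: "pair_form n ms ns r Q" "ns \<noteq> []" "r \<ge> 1" "M1 = lower_jordan ms 1"
    "N1 = lower_jordan ns (- 1)" "M = pair_sum ms ns Q" by blast
  have ms: "0 \<notin> set ms" "0 \<notin> set ns" "grows (mset ns) (mset ms)" "Q \<in> sp r" "1 \<notin> spec Q"
    "sum_list ns + r + 1 = n"
    using f(1) unfolding pair_form_def by auto
  have s: "sum_list ms = sum_list ns + 1" by (rule grows_sum_list[OF ms(3)])
  have "sum_list ns \<noteq> 0" using ms(2) f(2) by (cases ns) auto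
  then have two: "sum_list ms \<ge> 2" using s by linarith
  have a: "alg_mult (pair_sum ms ns Q) 1 = sum_list ms"
    "alg_mult (pair_sum ms ns Q) (- 1) = sum_list ns"
    unfolding alg_mult_pair_sum[OF f(1)] by simp_all
  show "form4 n M M1 N1 Q"
    unfolding form4_def diag_block_mat_triple f(4-6) a
  proof (intro conjI)
    show "pair_sum ms ns Q \<in> carrier_mat (2 * n - 1) (2 * n - 1)"
      by (rule pair_sum_carrier[OF f(1)])
    show "pair_sum ms ns Q = lower_jordan ms 1 \<oplus>\<^sub>d lower_jordan ns (- 1) \<oplus>\<^sub>d Q"
      by (simp only: pair_sum_def)
    show "is_jordan_part (pair_sum ms ns Q) 1 (lower_jordan ms 1)"
      "is_jordan_part (pair_sum ms ns Q) (- 1) (lower_jordan ns (- 1))"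
      using pair_sum_jordan_parts[OF f(1)] f(2) by blast+
    have t: "jtype (lower_jordan ns (- 1)) \<in> types (sum_list ms - 1)"
      "jtype (lower_jordan ms 1) \<in> types (sum_list ms)"
      using jtype_lower_jordan(1)[OF ms(2), of "- 1"] jtype_lower_jordan(1)[OF ms(1), of 1] s
        by simp_all
    show "(jtype (lower_jordan ns (- 1)), jtype (lower_jordan ms 1)) \<in> Sigma_set (sum_list ms) 1"
      unfolding Sigma_set_iff[OF two t] jtype_lower_jordan(2)[OF ms(1)] jtype_lower_jordan(2)[OF
        ms(2)] by (rule ms(3))
    have "2 * r = 2 * n - 2 - 2 * sum_list ns" using ms(6) by linarith
    then show "\<exists>r\<ge>1. 2 * r = 2 * n - 2 - 2 * sum_list ns \<and> Q \<in> sp r" using f(3) ms(4) by blast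
    show "\<not> {1, - 1} \<subseteq> spec Q" using ms(5) by simp
  qed
qed

text \<open>A parameter \<open>x\<close> represents the class \<open>c x\<close> and has the
  invariant \<open>g x\<close>. The map sends a class to the invariant of a chosen representative;
  the equivalence in \<open>inj\<close> gives well-definedness and injectivity at once.\<close>

lemma bij_betw_classes:
  assumes inj: "\<And>x y. F x \<Longrightarrow> F y \<Longrightarrow> c x = c y \<longleftrightarrow> g x = g y" and img: "g ` {x. F x} = T"
  shows "\<exists>f. bij_betw f {c x | x. F x} T \<and> (\<forall>x. F x \<longrightarrow> f (c x) = g x)"
proof -
  define f where "f y = g (SOME x. F x \<and> c x = y)" for y
  have f: "f (c x) = g x" if "F x" for x
  proof -
    have "F (SOME z. F z \<and> c z = c x) \<and> c (SOME z. F z \<and> c z = c x) = c x"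
      by (rule someI[of _ x]) (simp add: that)
    then show ?thesis unfolding f_def using inj that by metis
  qed
  have "bij_betw f {c x | x. F x} T"
    unfolding bij_betw_def inj_on_def img[symmetric] using f inj
      by (auto simp: image_iff) (metis f)+
  with f show ?thesis by blast
qed

lemma quotient_class_eq_iff:
  assumes R: "R = {(x, y). x \<in> X \<and> y \<in> X \<and> P x y}"
    and P: "\<And>x. x \<in> X \<Longrightarrow> P x x" "\<And>x y. x \<in> X \<Longrightarrow> y \<in> X \<Longrightarrow> P x y \<Longrightarrow> P y x"
      "\<And>x y z. x \<in> X \<Longrightarrow> y \<in> X \<Longrightarrow> z \<in> X \<Longrightarrow> P x y \<Longrightarrow> P y z \<Longrightarrow> P x z"
    and xy: "x \<in> X" "y \<in> X"
  shows "R `` {x} = R `` {y} \<longleftrightarrow> P x y"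
proof
  assume "R `` {x} = R `` {y}"
  moreover have "y \<in> R `` {y}" using xy P(1) by (auto simp: R)
  ultimately show "P x y" by (auto simp: R)
next
  assume "P x y"
  then show "R `` {x} = R `` {y}" using xy P(2,3) unfolding R by blast
qed

text \<open>The sizes of \<open>Q\<close> and \<open>R\<close> are allowed to differ, because the
  union over \<open>k\<close> in form (4) mixes sizes; either side of the equivalence forces them to
  agree.\<close>

lemma S1_class_eq_iff:
  assumes Q: "Q \<in> S1_set r" and R: "R \<in> S1_set s"
  shows "S1_class Q = S1_class R \<longleftrightarrow> similar_mat Q R"
proof -
  have c: "Q \<in> carrier_mat (2 * r) (2 * r)" "R \<in> carrier_mat (2 * s) (2 * s)"
    using Q R by (auto simp: S1_set_def sp_carrier)
  have d: "dim_row Q div 2 = r" "dim_row R div 2 = s" using c by auto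
  have refl: "similar_mat B B" if "B \<in> S1_set k" for B k
    using that similar_mat_refl[OF sp_carrier] by (auto simp: S1_set_def)
  have "r = s" if "similar_mat Q R"
    using similar_mat_carrier[OF that, of "2 * r"] c by auto
  \<comment> \<open>A class contains its representative, so equal classes place \<open>Q\<close> in
    the set of matrices of the size of \<open>R\<close>.\<close>
  moreover have "r = s" if e: "S1_class Q = S1_class R"
  proof -
    have "Q \<in> S1_class Q" using Q refl[OF Q] by (auto simp: S1_class_def S1_rel_def d)
    then have "Q \<in> S1_set s" unfolding e by (auto simp: S1_class_def S1_rel_def d)
    then show ?thesis using c sp_carrier[of Q s] by (auto simp: S1_set_def)
  qed
  moreover have "S1_class Q = S1_class R \<longleftrightarrow> similar_mat Q R" if "r = s"
    unfolding S1_class_def d that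
    by (rule quotient_class_eq_iff[OF S1_rel_def refl])
      (use Q R that in \<open>auto intro: similar_mat_sym similar_mat_trans\<close>)
  ultimately show ?thesis by blast
qed

lemma S1_eq: "S1 r = S1_class ` S1_set r"
proof -
  have "S1_class Q = S1_rel r `` {Q}" if "Q \<in> S1_set r" for Q
    using that sp_carrier[of Q r] by (auto simp: S1_class_def S1_set_def)
  then show ?thesis by (auto simp: S1_def quotient_def image_iff)
qed

text \<open>Similarity up to sign is an equivalence relation because negation is an involution that
  preserves similarity; as before, the two sizes are compared first.\<close>

lemma S0_class_eq_iff:
  assumes Q: "Q \<in> S0_set r" and R: "R \<in> S0_set s"
  shows "S0_class Q = S0_class R \<longleftrightarrow> similar_mat Q R \<or> similar_mat Q (- R)"
proof -
  let ?P = "\<lambda>A B :: real mat. similar_mat A B \<or> similar_mat A (- B)"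
  have c: "Q \<in> carrier_mat (2 * r) (2 * r)" "R \<in> carrier_mat (2 * s) (2 * s)"
    using Q R by (auto simp: S0_set_def sp_carrier)
  have d: "dim_row Q div 2 = r" "dim_row R div 2 = s" using c by auto
  have refl: "similar_mat B B" if "B \<in> S0_set k" for B k
    using that similar_mat_refl[OF sp_carrier] by (auto simp: S0_set_def)
  have mm: "- (- B) = B" for B :: "real mat" by (intro eq_matI) auto
  have sym: "?P B A" if "?P A B" for A B
    using that similar_mat_sym[of A B] similar_mat_sym[OF similar_mat_uminus[of A "- B"]] mm[of B]
      by auto
  have trans: "?P A C" if "?P A B" "?P B C" for A B C
    using that similar_mat_trans[of A B C] similar_mat_trans[of A B "- C"]
      similar_mat_trans[OF _ similar_mat_uminus[of B C], of A]
      similar_mat_trans[OF _ similar_mat_uminus[of B "- C"], of A] mm[of C] by auto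
  have "r = s" if "?P Q R"
    using that similar_mat_carrier[of Q R "2 * r"] similar_mat_carrier[of Q "- R" "2 * r"] c by auto
  moreover have "r = s" if e: "S0_class Q = S0_class R"
  proof -
    have "Q \<in> S0_class Q" using Q refl[OF Q] by (auto simp: S0_class_def S0_rel_def d)
    then have "Q \<in> S0_set s" unfolding e by (auto simp: S0_class_def S0_rel_def d)
    then show ?thesis using c sp_carrier[of Q s] by (auto simp: S0_set_def)
  qed
  moreover have "S0_class Q = S0_class R \<longleftrightarrow> ?P Q R" if "r = s"
    unfolding S0_class_def d that
    by (rule quotient_class_eq_iff[OF S0_rel_def]) (use Q R that refl sym trans in blast)+
  ultimately show ?thesis by blast
qed

lemma S0_eq: "S0 r = S0_class ` S0_set r"
proof -
  have "S0_class Q = S0_rel r `` {Q}" if "Q \<in> S0_set r" for Q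
    using that sp_carrier[of Q r] by (auto simp: S0_class_def S0_set_def)
  then show ?thesis by (auto simp: S0_def quotient_def image_iff)
qed

lemma jtype_lower_jordan_eq_iff:
  assumes "0 \<notin> set ns" "0 \<notin> set ms"
  shows "jtype (lower_jordan ns b) = jtype (lower_jordan ms c) \<longleftrightarrow> mset ns = mset ms"
proof -
  have "mset ns = mset ms \<Longrightarrow> sum_list ns = sum_list ms" by (metis sum_mset_sum_list)
  then show ?thesis
    using jtype_eq_iff[OF assms(1), of b] jtype_lower_jordan[OF assms(2), of c] by metis
qed

text \<open>The sizes do not depend on the eigenvalue, so one list realises the type for every
  \<open>b\<close> simultaneously.\<close>

lemma jordan_type_realization:
  assumes "\<tau> \<in> types m"
  obtains ns where "0 \<notin> set ns" "sum_list ns = m" "mset ns = parts \<tau>"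
    "\<And>b. jtype (lower_jordan ns b) = \<tau>"
proof -
  obtain ns where ns: "mset ns = parts \<tau>" using ex_mset by blast
  have z: "0 \<notin> set ns" using zero_notin_parts[OF assms] by (metis ns set_mset_mset)
  have s: "sum_list ns = m" using sum_mset_parts[OF assms] by (metis ns sum_mset_sum_list)
  have "jtype (lower_jordan ns b) = \<tau>" for b using jtype_eq_iff[OF z, of b \<tau>] ns s assms by simp
  then show thesis using that z s ns by blast
qed

lemma zero_form_parametrization:
  assumes n: "n \<ge> 2"
  shows "(\<lambda>(ns, r, Q). (jtype (lower_jordan ns 0), S0_class Q)) ` {(ns, r, Q). zero_form n ns r Q} =
    (\<Union>k\<in>{1..n - 1}. types_s (2 * k - 1) \<times> S0 (n - k))" (is "?L = ?R")
proof
  show "?L \<subseteq> ?R"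
  proof (clarify)
    fix ns r Q assume f: "zero_form n ns r Q"
    then have ns: "0 \<notin> set ns" "\<exists>!a. odd a \<and> odd (count (mset ns) a)" "Q \<in> sp r" "normalized_spec Q"
      "sum_list ns + 2 * r + 1 = 2 * n" unfolding zero_form_def by blast+
    have Q: "Q \<in> S0_set r" using ns(3,4) by (simp add: S0_set_def)
    \<comment> \<open>The normalised spectrum is non-empty, so \<open>Q\<close> is non-empty; this
      is why \<open>k = n - r\<close> stops at \<open>n - 1\<close>. The lower bound for
      \<open>k\<close> comes from the odd, hence positive, size of the nilpotent part.\<close>
    have "r \<noteq> 0"
    proof
      assume "r = 0"
      then have "spec Q = {}" using spec_empty sp_carrier[OF ns(3)] by simp
      then show False using ns(4) by (simp add: normalized_spec_def)
    qed
    have o: "odd (sum_list ns)" using arg_cong[OF ns(5), of even] by auto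
    define k where "k = n - r"
    have k: "k \<in> {1..n - 1}" "sum_list ns = 2 * k - 1" "r = n - k"
      using ns(5) \<open>r \<noteq> 0\<close> o by (auto simp: k_def)
    have "jtype (lower_jordan ns 0) \<in> types_s (2 * k - 1)"
      using types_s_iff[OF jtype_lower_jordan(1)[OF ns(1)] o, of 0] ns(2) jtype_lower_jordan(2)[OF
        ns(1), of 0] k(2) by simp
    moreover have "S0_class Q \<in> S0 (n - k)" using Q unfolding S0_eq k(3) by blast
    ultimately show "(jtype (lower_jordan ns 0), S0_class Q) \<in> ?R" using k(1) by blast
  qed
  show "?R \<subseteq> ?L"
  proof
    fix p assume "p \<in> ?R"
    then obtain k \<tau> Q where k: "k \<in> {1..n - 1}" "\<tau> \<in> types_s (2 * k - 1)" "Q \<in> S0_set (n - k)"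
      "p = (\<tau>, S0_class Q)"
      unfolding S0_eq by blast
    have \<tau>: "\<tau> \<in> types (2 * k - 1)" using k(2) types_s_subset by blast
    obtain ns where ns: "0 \<notin> set ns" "sum_list ns = 2 * k - 1" "mset ns = parts \<tau>"
      "\<And>b. jtype (lower_jordan ns b) = \<tau>"
      using jordan_type_realization[OF \<tau>] by metis
    have "odd (2 * k - 1)" using k(1) by simp
    then have "\<exists>!a. odd a \<and> odd (count (mset ns) a)" using types_s_iff[OF \<tau>] k(2) ns(3) by simp
    moreover have "sum_list ns + 2 * (n - k) + 1 = 2 * n" using k(1) ns(2) by auto
    ultimately have "zero_form n ns (n - k) Q"
      using ns(1) k(3) unfolding zero_form_def S0_set_def by blast
    then show "p \<in> ?L" using ns(4) k(4) by (intro image_eqI[of _ _ "(ns, n - k, Q)"]) auto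
  qed
qed

text \<open>The part at 1 has size \<open>n - r\<close>, which serves as the index of
  \<open>Sigma_set\<close>; a non-empty part at -1 makes it at least 2.\<close>

lemma pair_form_types:
  assumes f: "pair_form n ms ns r Q" and "ns \<noteq> []"
  shows "n - r \<ge> 2"
    "(jtype (lower_jordan ns (- 1)), jtype (lower_jordan ms 1)) \<in> Sigma_set (n - r) 1"
proof -
  have ms: "0 \<notin> set ms" "0 \<notin> set ns" "grows (mset ns) (mset ms)" "sum_list ns + r + 1 = n"
    using f unfolding pair_form_def by auto
  have "sum_list ns \<noteq> 0" using ms(2) assms(2) by (cases ns) auto
  then show n: "n - r \<ge> 2" using ms(4) by linarith
  have t: "jtype (lower_jordan ns (- 1)) \<in> types (n - r - 1)"
    "jtype (lower_jordan ms 1) \<in> types (n - r)"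
    using jtype_lower_jordan(1)[OF ms(2), of "- 1"] jtype_lower_jordan(1)[OF ms(1), of 1] ms(4)
      grows_sum_list[OF ms(3)]
    by auto
  show "(jtype (lower_jordan ns (- 1)), jtype (lower_jordan ms 1)) \<in> Sigma_set (n - r) 1"
    unfolding Sigma_set_iff[OF n t] jtype_lower_jordan(2)[OF ms(1)] jtype_lower_jordan(2)[OF
      ms(2)] by (rule ms(3))
qed

text \<open>Covers two forms: \<open>k = n\<close> leaves \<open>Q\<close> empty and gives form (3),
  \<open>k < n\<close> gives form (4).\<close>

lemma Sigma_set_realization:
  assumes k: "k \<ge> 2" and S: "(\<tau>, \<sigma>) \<in> Sigma_set k 1" and Q: "Q \<in> sp (n - k)" "1 \<notin> spec Q"
    and n: "k \<le> n"
  obtains ms ns where "pair_form n ms ns (n - k) Q" "ns \<noteq> []" "jtype (lower_jordan ns (- 1)) = \<tau>"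
    "jtype (lower_jordan ms 1) = \<sigma>"
proof -
  have t: "\<tau> \<in> types (k - 1)" "\<sigma> \<in> types k" using S by (auto simp: Sigma_set_def)
  obtain ns where ns: "0 \<notin> set ns" "sum_list ns = k - 1" "mset ns = parts \<tau>"
    "\<And>b. jtype (lower_jordan ns b) = \<tau>"
    using jordan_type_realization[OF t(1)] by metis
  obtain ms where ms: "0 \<notin> set ms" "sum_list ms = k" "mset ms = parts \<sigma>"
    "\<And>b. jtype (lower_jordan ms b) = \<sigma>"
    using jordan_type_realization[OF t(2)] by metis
  have "grows (mset ns) (mset ms)" using Sigma_set_iff[OF k t] S unfolding ns(3) ms(3) by blast
  then have "pair_form n ms ns (n - k) Q" using ns(1,2) ms(1) Q k n by (auto simp: pair_form_def)
  moreover have "ns \<noteq> []" using ns(2) k by auto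
  ultimately show thesis using that ns(4) ms(4) by blast
qed

theorem corollary5p27:
  fixes n :: nat
  assumes "n \<ge> 2"
  shows
    "{iso_class (almost_abelian A) | A. A \<in> carrier_mat (2 * n - 1) (2 * n - 1)
        \<and> \<not> nilpotent_mat A \<and> (\<exists>\<omega>. symplectic_structure (almost_abelian A) \<omega>)}
      = {iso_class (almost_abelian M) | M M0 Q. form1 n M M0 Q}
      \<union> {iso_class (almost_abelian M) | M M1 Q. form2 n M M1 Q}
      \<union> {iso_class (almost_abelian M) | M M1 N1. form3 n M M1 N1}
      \<union> {iso_class (almost_abelian M) | M M1 N1 Q. form4 n M M1 N1 Q}
    \<and> (\<exists>f. bij_betw f {iso_class (almost_abelian M) | M M0 Q. form1 n M M0 Q}
             (\<Union>k\<in>{1..n - 1}. types_s (2 * k - 1) \<times> S0 (n - k))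
         \<and> (\<forall>M M0 Q. form1 n M M0 Q \<longrightarrow>
              f (iso_class (almost_abelian M)) = (jtype M0, S0_class Q)))
    \<and> (\<exists>f. bij_betw f {iso_class (almost_abelian M) | M M1 Q. form2 n M M1 Q} (S1 (n - 1))
         \<and> (\<forall>M M1 Q. form2 n M M1 Q \<longrightarrow>
              f (iso_class (almost_abelian M)) = S1_class Q))
    \<and> (\<exists>f. bij_betw f {iso_class (almost_abelian M) | M M1 N1. form3 n M M1 N1}
             (Sigma_set n 1)
         \<and> (\<forall>M M1 N1. form3 n M M1 N1 \<longrightarrow>
              f (iso_class (almost_abelian M)) = (jtype N1, jtype M1)))
    \<and> (\<exists>f. bij_betw f {iso_class (almost_abelian M) | M M1 N1 Q. form4 n M M1 N1 Q}
             (\<Union>k\<in>{2..n - 1}. Sigma_set k 1 \<times> S1 (n - k))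
         \<and> (\<forall>M M1 N1 Q. form4 n M M1 N1 Q \<longrightarrow>
              f (iso_class (almost_abelian M)) = ((jtype N1, jtype M1), S1_class Q)))"
    (is "?S = ?X1 \<union> ?X2 \<union> ?X3 \<union> ?X4 \<and> ?B1 \<and> ?B2 \<and> ?B3 \<and> ?B4")
proof -
  let ?c = "\<lambda>M. iso_class (almost_abelian M)" and ?O = "0\<^sub>m 0 0 :: real mat"
  have n1: "n \<ge> 1" using assms by simp
  note f1 = form1_iff[OF n1] and f2 = form2_iff[OF n1] and f3 = form3_iff[OF assms]
  \<comment> \<open>Each set of classes is rewritten over a single tuple of parameters; the same
    tuples index the bijections obtained from \<open>bij_betw_classes\<close> below.\<close>
  have X1: "?X1 = {?c (zero_sum (fst x) (snd (snd x))) | x. zero_form n (fst x) (fst (snd x))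
    (snd (snd x))}"
    unfolding f1 by fastforce
  have X2: "?X2 = {?c (pair_sum [1] [] (snd x)) | x. pair_form n [1] [] (fst x) (snd x)}"
    unfolding f2 by fastforce
  have X3: "?X3 = {?c (pair_sum (fst x) (snd x) ?O) | x. pair_form n (fst x) (snd x) 0 ?O}"
    unfolding f3 by fastforce
  have X4: "?X4 = {?c (pair_sum (fst x) (fst (snd x)) (snd (snd (snd x)))) | x.
      pair_form n (fst x) (fst (snd x)) (fst (snd (snd x))) (snd (snd (snd x))) \<and> fst (snd x) \<noteq> []
        \<and> fst (snd (snd x)) \<ge> 1}"
    unfolding form4_iff by fastforce
  have zero_in: "?c (zero_sum ns Q) \<in> ?X1" if "zero_form n ns r Q" for ns r Q
    unfolding f1 using that by blast
  have pair_in: "?c (pair_sum ms ns Q) \<in> ?X2 \<union> ?X3 \<union> ?X4" if f: "pair_form n ms ns r Q"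
    for ms ns r Q
  proof -
    consider "ns = []" | "ns \<noteq> []" "r = 0" | "ns \<noteq> []" "r \<ge> 1" by linarith
    then show ?thesis
    proof cases
      case 1
      then have "ms = [1]" using f pair_form_Nil by blast
      then show ?thesis using f 1 unfolding f2 by blast
    next
      case 2
      have "Q = ?O" using f 2(2) sp_zero(2) by (simp add: pair_form_def)
      then show ?thesis using f 2 unfolding f3 by blast
    next
      case 3
      then show ?thesis using f unfolding form4_iff by blast
    qed
  qed
  have "?S \<subseteq> ?X1 \<union> ?X2 \<union> ?X3 \<union> ?X4"
  proof (rule subsetI)
    fix x assume "x \<in> ?S"
    then obtain A \<omega> where x: "x = ?c A" and A: "A \<in> carrier_mat (2 * n - 1) (2 * n - 1)"
      "\<not> nilpotent_mat A" "symplectic_structure (almost_abelian A) \<omega>" by blast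
    have eq: "?c A = ?c M" if "M \<in> carrier_mat (2 * n - 1) (2 * n - 1)"
      "lie_iso (almost_abelian A) (almost_abelian M)" for M
      using iso_class_eq_iff[OF real_lie_algebra_almost_abelian[OF A(1)]
        real_lie_algebra_almost_abelian[OF that(1)]] that(2)
      by blast
    have "?c A \<in> ?X1 \<union> (?X2 \<union> ?X3 \<union> ?X4)"
    proof (rule symplectic_cases[OF A(1) n1 A(2,3)], goal_cases)
      case h: (1 ns r Q)
      show "?c A \<in> ?X1 \<union> (?X2 \<union> ?X3 \<union> ?X4)"
        unfolding eq[OF zero_sum_carrier[OF h(1)] h(2)] by (rule UnI1[OF zero_in[OF h(1)]])
    next
      case h: (2 ms ns r Q)
      show "?c A \<in> ?X1 \<union> (?X2 \<union> ?X3 \<union> ?X4)"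
        unfolding eq[OF pair_sum_carrier[OF h(1)] h(2)] by (rule UnI2[OF pair_in[OF h(1)]])
    qed
    then show "x \<in> ?X1 \<union> ?X2 \<union> ?X3 \<union> ?X4" unfolding x by (simp only: Un_assoc)
  qed
  moreover have "?X1 \<union> ?X2 \<union> ?X3 \<union> ?X4 \<subseteq> ?S"
  proof -
    have zero: "?c (zero_sum ns Q) \<in> ?S" if f: "zero_form n ns r Q" for ns r Q
    proof -
      obtain \<omega> where "symplectic_structure (almost_abelian (zero_sum ns Q)) \<omega>"
        by (rule symplectic_zero_sum[OF f])
      then show ?thesis
        by (intro CollectI exI[of _ "zero_sum ns Q"] conjI refl zero_sum_carrier[OF f]
          zero_sum_not_nilpotent[OF f]) (rule exI)
    qed
    have pair: "?c (pair_sum ms ns Q) \<in> ?S" if f: "pair_form n ms ns r Q" for ms ns r Q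
    proof -
      obtain \<omega> where "symplectic_structure (almost_abelian (pair_sum ms ns Q)) \<omega>"
        by (rule symplectic_pair_sum[OF f])
      then show ?thesis
        by (intro CollectI exI[of _ "pair_sum ms ns Q"] conjI refl pair_sum_carrier[OF f]
          pair_sum_not_nilpotent[OF f]) (rule exI)
    qed
    have "?X1 \<subseteq> ?S" unfolding X1 by (rule subsetI) (elim CollectE exE conjE, simp only:, rule zero)
    moreover have "?X2 \<subseteq> ?S" unfolding X2
      by (rule subsetI) (elim CollectE exE conjE, simp only:, rule pair)
    moreover have "?X3 \<subseteq> ?S" unfolding X3
      by (rule subsetI) (elim CollectE exE conjE, simp only:, rule pair)
    moreover have "?X4 \<subseteq> ?S" unfolding X4
      by (rule subsetI) (elim CollectE exE conjE, simp only:, rule pair)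
    ultimately show ?thesis by (simp only: Un_least)
  qed
  ultimately have "?S = ?X1 \<union> ?X2 \<union> ?X3 \<union> ?X4" by (rule equalityI)
  moreover have ?B1
  proof -
    let ?F = "\<lambda>(ns, r, Q). zero_form n ns r Q"
      and ?g = "\<lambda>(ns, r, Q). (jtype (lower_jordan ns 0), S0_class Q)"
    let ?d = "\<lambda>(ns, r :: nat, Q). ?c (zero_sum ns Q)"
    have "\<exists>f. bij_betw f {?d x | x. ?F x} (\<Union>k\<in>{1..n - 1}. types_s (2 * k - 1) \<times> S0 (n - k)) \<and>
      (\<forall>x. ?F x \<longrightarrow> f (?d x) = ?g x)"
    proof (rule bij_betw_classes)
      fix x y assume "?F x" "?F y"
      then obtain ns r Q ms s R where x: "x = (ns, r, Q)" "y = (ms, s, R)" "zero_form n ns r Q"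
        "zero_form n ms s R" by auto
      have "0 \<notin> set ns" "0 \<notin> set ms" "Q \<in> S0_set r" "R \<in> S0_set s"
        using x(3,4) by (auto simp: zero_form_def S0_set_def)
      then show "?d x = ?d y \<longleftrightarrow> ?g x = ?g y"
        unfolding x(1,2) using iso_class_zero_sum_iff[OF x(3,4)]
          by (simp add: jtype_lower_jordan_eq_iff S0_class_eq_iff)
    qed (use zero_form_parametrization[OF assms] in simp)
    moreover have "{?d x | x. ?F x} = ?X1" unfolding X1 by (auto; force)
    ultimately obtain f
      where f: "bij_betw f ?X1 ((\<Union>k\<in>{1..n - 1}. types_s (2 * k - 1) \<times> S0 (n - k)))"
      "\<forall>x. ?F x \<longrightarrow> f (?d x) = ?g x"
      by (elim exE conjE) (simp only:)
    then show ?B1 unfolding f1 by (intro exI[of _ f]) auto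
  qed
  moreover have ?B2
  proof -
    let ?F = "\<lambda>(r, Q). pair_form n [1] [] r Q" and ?g = "\<lambda>(r :: nat, Q). S1_class Q"
    let ?d = "\<lambda>(r :: nat, Q). ?c (pair_sum [1] [] Q)"
    \<comment> \<open>Without blocks at -1 the size equation fixes \<open>r = n - 1\<close>, so
      \<open>Q\<close> is the only free parameter.\<close>
    have F: "?F (r, Q) \<longleftrightarrow> r = n - 1 \<and> Q \<in> S1_set (n - 1)" for r Q
      using n1 by (auto simp: pair_form_def S1_set_def grows_def)
    have "\<exists>f. bij_betw f {?d x | x. ?F x} (S1 (n - 1)) \<and> (\<forall>x. ?F x \<longrightarrow> f (?d x) = ?g x)"
    proof (rule bij_betw_classes)
      fix x y assume "?F x" "?F y"
      then obtain r Q s R where x: "x = (r, Q)" "y = (s, R)" "pair_form n [1] [] r Q"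
        "pair_form n [1] [] s R" by auto
      have "Q \<in> S1_set r" "R \<in> S1_set s" using x(3,4) by (auto simp: pair_form_def S1_set_def)
      then show "?d x = ?d y \<longleftrightarrow> ?g x = ?g y"
        unfolding x(1,2) using iso_class_pair_sum_iff[OF x(3,4)] by (simp add: S1_class_eq_iff)
    next
      have "{x. ?F x} = Pair (n - 1) ` S1_set (n - 1)" using F by auto
      then show "?g ` {x. ?F x} = S1 (n - 1)" unfolding S1_eq by (simp add: image_image)
    qed
    moreover have "{?d x | x. ?F x} = ?X2" unfolding X2 by (auto; force)
    ultimately obtain f where f: "bij_betw f ?X2 ((S1 (n - 1)))" "\<forall>x. ?F x \<longrightarrow> f (?d x) = ?g x"
      by (elim exE conjE) (simp only:)
    then show ?B2 unfolding f2 by (intro exI[of _ f]) auto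
  qed
  moreover have ?B3
  proof -
    let ?F = "\<lambda>(ms, ns). pair_form n ms ns 0 ?O"
      and ?g = "\<lambda>(ms, ns). (jtype (lower_jordan ns (- 1)), jtype (lower_jordan ms 1))"
    let ?d = "\<lambda>(ms, ns). ?c (pair_sum ms ns ?O)"
    have "\<exists>f. bij_betw f {?d x | x. ?F x} (Sigma_set n 1) \<and> (\<forall>x. ?F x \<longrightarrow> f (?d x) = ?g x)"
    proof (rule bij_betw_classes)
      fix x y assume "?F x" "?F y"
      then obtain ms ns ms' ns' where x: "x = (ms, ns)" "y = (ms', ns')" "pair_form n ms ns 0 ?O"
        "pair_form n ms' ns' 0 ?O"
        by auto
      have "0 \<notin> set ns" "0 \<notin> set ms" "0 \<notin> set ns'" "0 \<notin> set ms'" using x(3,4)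
        by (auto simp: pair_form_def)
      moreover have "similar_mat ?O ?O" by (rule similar_mat_refl[of _ 0]) simp
      ultimately show "?d x = ?d y \<longleftrightarrow> ?g x = ?g y"
        unfolding x(1,2) using iso_class_pair_sum_iff[OF x(3,4)]
          by (auto simp: jtype_lower_jordan_eq_iff)
    next
      show "?g ` {x. ?F x} = Sigma_set n 1"
      proof (intro equalityI subsetI)
        fix p assume "p \<in> ?g ` {x. ?F x}"
        then obtain ms ns where p: "pair_form n ms ns 0 ?O"
          "p = (jtype (lower_jordan ns (- 1)), jtype (lower_jordan ms 1))" by auto
        \<comment> \<open>The total size of \<open>ns\<close> is \<open>n - 1\<close>, which is
          positive since \<open>n \<ge> 2\<close>.\<close>
        have "ns \<noteq> []" using p(1) assms by (auto simp: pair_form_def)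
        from pair_form_types(2)[OF p(1) this] show "p \<in> Sigma_set n 1" using p(2) by simp
      next
        fix p assume p: "p \<in> Sigma_set n 1"
        obtain \<tau> \<sigma> where \<tau>: "p = (\<tau>, \<sigma>)" by (cases p) auto
        \<comment> \<open>Form (3) is the realisation with \<open>k = n\<close>, where the
          Hamiltonian summand is the empty matrix with empty spectrum.\<close>
        have O: "?O \<in> sp (n - n)" "1 \<notin> spec ?O" using sp_zero(1) spec_empty[of ?O] by auto
        obtain ms ns where "pair_form n ms ns (n - n) ?O" "jtype (lower_jordan ns (- 1)) = \<tau>"
          "jtype (lower_jordan ms 1) = \<sigma>"
          using Sigma_set_realization[OF assms p[unfolded \<tau>] O order_refl] by metis
        then show "p \<in> ?g ` {x. ?F x}" unfolding \<tau> by (intro image_eqI[of _ _ "(ms, ns)"]) auto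
      qed
    qed
    moreover have "{?d x | x. ?F x} = ?X3" unfolding X3 by (auto; force)
    ultimately obtain f where f: "bij_betw f ?X3 ((Sigma_set n 1))" "\<forall>x. ?F x \<longrightarrow> f (?d x) = ?g x"
      by (elim exE conjE) (simp only:)
    then show ?B3 unfolding f3 by (intro exI[of _ f]) auto
  qed
  moreover have ?B4
  proof -
    let ?F = "\<lambda>(ms, ns, r, Q). pair_form n ms ns r Q \<and> ns \<noteq> [] \<and> r \<ge> 1"
    let ?g = "\<lambda>(ms, ns, r :: nat, Q). ((jtype (lower_jordan ns (- 1)), jtype (lower_jordan ms 1)),
      S1_class Q)"
    let ?d = "\<lambda>(ms, ns, r :: nat, Q). ?c (pair_sum ms ns Q)"
    let ?T = "\<Union>k\<in>{2..n - 1}. Sigma_set k 1 \<times> S1 (n - k)"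
    have "\<exists>f. bij_betw f {?d x | x. ?F x} ?T \<and> (\<forall>x. ?F x \<longrightarrow> f (?d x) = ?g x)"
    proof (rule bij_betw_classes)
      fix x y assume "?F x" "?F y"
      then obtain ms ns r Q ms' ns' s R where x: "x = (ms, ns, r, Q)" "y = (ms', ns', s, R)"
        "pair_form n ms ns r Q" "pair_form n ms' ns' s R" by auto
      have "0 \<notin> set ns" "0 \<notin> set ms" "0 \<notin> set ns'" "0 \<notin> set ms'" "Q \<in> S1_set r" "R \<in> S1_set s"
        using x(3,4) by (auto simp: pair_form_def S1_set_def)
      then show "?d x = ?d y \<longleftrightarrow> ?g x = ?g y"
        unfolding x(1,2) using iso_class_pair_sum_iff[OF x(3,4)]
          by (auto simp: jtype_lower_jordan_eq_iff S1_class_eq_iff)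
    next
      show "?g ` {x. ?F x} = ?T"
      proof (intro equalityI subsetI)
        fix p assume "p \<in> ?g ` {x. ?F x}"
        then obtain ms ns r Q where p: "pair_form n ms ns r Q" "ns \<noteq> []" "r \<ge> 1"
          "p = ((jtype (lower_jordan ns (- 1)), jtype (lower_jordan ms 1)), S1_class Q)" by auto
        \<comment> \<open>The index \<open>k\<close> is \<open>n - r\<close>; the bound
          \<open>k \<ge> 2\<close> expresses a non-empty part at -1, and
          \<open>k \<le> n - 1\<close> expresses \<open>r \<ge> 1\<close>.\<close>
        have k: "n - r \<in> {2..n - 1}" "n - (n - r) = r" using pair_form_types(1)[OF p(1,2)] p(3)
          by auto
        have "S1_class Q \<in> S1 (n - (n - r))" using p(1) unfolding k(2) S1_eq
          by (auto simp: pair_form_def S1_set_def)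
        then show "p \<in> ?T" using k(1) pair_form_types(2)[OF p(1,2)] unfolding p(4) by blast
      next
        fix p assume "p \<in> ?T"
        then obtain k \<tau> \<sigma> Q where p: "k \<in> {2..n - 1}" "(\<tau>, \<sigma>) \<in> Sigma_set k 1" "Q \<in> S1_set (n - k)"
          "p = ((\<tau>, \<sigma>), S1_class Q)" unfolding S1_eq by auto
        have k: "k \<ge> 2" "k \<le> n" "n - k \<ge> 1" using p(1) by auto
        have Q: "Q \<in> sp (n - k)" "1 \<notin> spec Q" using p(3) by (auto simp: S1_set_def)
        obtain ms ns where "pair_form n ms ns (n - k) Q" "ns \<noteq> []"
          "jtype (lower_jordan ns (- 1)) = \<tau>"
          "jtype (lower_jordan ms 1) = \<sigma>"
          using Sigma_set_realization[OF k(1) p(2) Q k(2)] by metis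
        then show "p \<in> ?g ` {x. ?F x}"
          unfolding p(4) using k(3) by (intro image_eqI[of _ _ "(ms, ns, n - k, Q)"]) auto
      qed
    qed
    moreover have "{?d x | x. ?F x} = ?X4" unfolding X4 by (auto; force)
    ultimately obtain f where f: "bij_betw f ?X4 (?T)" "\<forall>x. ?F x \<longrightarrow> f (?d x) = ?g x"
      by (elim exE conjE) (simp only:)
    then show ?B4 unfolding form4_iff by (intro exI[of _ f]) auto
  qed
  ultimately show ?thesis by blast
qed

end
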